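(* Let $\Omega_1\subseteq\mathbb{R}^n$ and $\Omega_2\subseteq\mathbb{R}^m$ be open, let $f\in\mathcal{G}[\Omega_1,\Omega_2]$ be a c-bounded generalized map with representative $(f_\varepsilon)_\varepsilon$, and let $u\in\mathcal{G}(\Omega_2)$ with representative $(u_\varepsilon)_\varepsilon$. Define the pullback $f^*u\in\mathcal{G}(\Omega_1)$ by $$f^*u:=(u_\varepsilon(f_\varepsilon(x)))_\varepsilon+\mathcal{N}(\Omega_1).$$ Then $f^*u$ satisfies the microlocal inclusion relation $$\operatorname{WF}(f^*u)\subseteq f^*\operatorname{WF}(u)\ \cup\ \bigl(U^f(\operatorname{WF}(u))\times S^{n-1}\bigr)\ \cup\ \Bigl(\bigl(K^f(u)\cap (S^f)^c\bigr)\times S^{n-1}\Bigr).$$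
   Context: **Colombeau algebra.** For open $\Omega\subseteq\mathbb{R}^n$, $\mathcal{E}_M(\Omega)$ is the set of nets $(u_\varepsilon)_{\varepsilon\in]0,1]}$ in $C^\infty(\Omega)$ such that for every compact $K\subset\Omega$ and $\alpha\in\mathbb{N}_0^n$ there is $p\in\mathbb{R}$ with $\sup_K|\partial^\alpha u_\varepsilon|=O(\varepsilon^{-p})$ as $\varepsilon\to0$. $\mathcal{N}(\Omega)$ is the ideal of those moderate nets with $\sup_K|u_\varepsilon|=O(\varepsilon^q)$ for all compact $K$ and all $q\in\mathbb{R}$. $\mathcal{G}(\Omega)=\mathcal{E}_M(\Omega)/\mathcal{N}(\Omega)$ is the (special) Colombeau algebra. $\widetilde{\mathbb{R}}$ is the ring of generalized numbers, obtained by replacing nets of smooth functions by nets of real numbers. The support of an element of $\mathcal{G}(\Omega)$ is the complement of the largest open set on which it vanishes (as an element of $\mathcal{G}$ of that set); $\mathcal{G}_c(\Omega)$ denotes the compactly supported elements. **C-bounded maps.** $\mathcal{G}[\Omega_1,\Omega_2]$ is the set of $f\in\mathcal{G}(\Omega_1)^m$ having a representative $(f_\varepsilon)_\varepsilon$ with $f_\varepsilon\in C^\infty(\Omega_1,\Omega_2)$ such that for every compact $K\subset\Omega_1$ there is a compact $K'\subset\Omega_2$ with $f_\varepsilon(K)\subseteq K'$ for all $\varepsilon\in]0,1]$ (such representatives are used for $f$). **Wave front set.** An element of $\mathcal{G}(\mathbb{R}^n)$ is rapidly decreasing in the directions $\Gamma\subseteq S^{n-1}$ if it has a representative $(v_\varepsilon)$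 for which there is $N\in\mathbb{N}_0$ such that for all $p\in\mathbb{N}_0$, $\sup_{\lambda>0,\,\xi_1\in\Gamma}(1+\lambda^2)^{p/2}|v_\varepsilon(\lambda\xi_1)|=O(\varepsilon^{-N})$ as $\varepsilon\to 0$. For $v\in\mathcal{G}_c(\Omega)$, $\mathcal{F}(v)\in\mathcal{G}(\mathbb{R}^n)$ is the class of $\int_\Omega v_\varepsilon(x)e^{-i\langle x,\cdot\rangle}\,dx$, where $(v_\varepsilon)$ is a representative with supports in a joint compact set. $\Sigma(v)\subseteq S^{n-1}$ is the complement of the set of points having an open neighborhood $\Gamma\subseteq S^{n-1}$ such that $\mathcal{F}(v)$ is rapidly decreasing in the directions $\Gamma$. For $u\in\mathcal{G}(\Omega)$, $\Sigma_{x_0}(u)=\bigcap_{\varphi\in C_c^\infty(\Omega),\,\varphi(x_0)\neq0}\Sigma(\varphi u)$ and $\operatorname{WF}(u)=\{(x,\xi)\in\Omega\times S^{n-1}:\xi\in\Sigma_x(u)\}$. **Generalized graph.** Let $\mathcal{T}$ be the set of maps $\tau:]0,1]\to]0,1]$ with $\lim_{\varepsilon\to0}\tau(\varepsilon)=0$. A point $\lambda$ is a cluster point of a net $(\lambda_\varepsilon)_{\varepsilon\in]0,1]}$ iff $\lambda=\lim_{\varepsilon\to0}\lambda_{\tau(\varepsilon)}$ for some $\tau\in\mathcal{T}$. $\operatorname{Graph}(f)$ is the set of $(x,y)\in\Omega_1\times\Omega_2$ for which there are a net $(x_\varepsilon)_\varepsilon$ in $\Omega_1$ with $x_\varepsilon\to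 x$ and $\tau\in\mathcal{T}$ such that $y$ is a cluster point of $(f_{\tau(\varepsilon)}(x_\varepsilon))_\varepsilon$. Put $\operatorname{Graph}(f)_x=\{y:(x,y)\in\operatorname{Graph}(f)\}$. $\pi_1$ is the projection $\Omega_1\times\Omega_2\to\Omega_1$. **Slow scale.** A net $(\lambda_\varepsilon)_\varepsilon$ in $\mathbb{R}$ is of slow scale if there is $\varepsilon'\in]0,1]$ such that for every $t\ge0$ there is $C_t>0$ with $|\lambda_\varepsilon|^t\le C_t\varepsilon^{-1}$ for all $\varepsilon\in]0,\varepsilon']$. **The set $D^f$.** $D^f\subseteq\Omega_1\times S^{m-1}$ is the (open) set of all $(x,\eta)$ for which there are a neighborhood $X\times V\subseteq \Omega_1\times S^{m-1}$ of $(x,\eta)$, a positive net $(\sigma_\varepsilon)_\varepsilon$ of slow scale, $\alpha,\beta\in]0,\infty[$ and $\varepsilon'\in]0,1]$ such that for all $\varepsilon<\varepsilon'$ $$\inf_{(x,\eta)\in X\times V}|\sigma_\varepsilon\,{}^T\!df_\varepsilon(x)\eta|\ge\alpha,\qquad \sup_{(x,\eta)\in X\times V^\perp}|\sigma_\varepsilon\,{}^T\!df_\varepsilon(x)\eta|\le\beta,$$ where $V^\perp=\{\eta\in S^{m-1}:\exists\eta_0\in V,\ \langle\eta,\eta_0\rangle=0\}$ and ${}^T\!df_\varepsilon(x)$ is the transposed Jacobian. **The sets in the theorem.** For a closed set $\Gamma\subseteq\Omega_2\times S^{m-1}$ put $\Gamma_y=\{\eta:(y,\eta)\in\Gamma\}$.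 - Wave front unfavorable support: $U^f(\Gamma)=\{x\in\Omega_1:\exists (y,\eta)\in\Gamma \text{ with } (x,y)\in\operatorname{Graph}(f),\ (x,\eta)\notin D^f\}$. - Pullback of $\Gamma$: on $D^f$ let $M_\varepsilon(x,\eta)=\frac{{}^T\!df_\varepsilon(x)\eta}{|{}^T\!df_\varepsilon(x)\eta|}$ (near each point of $D^f$ defined for small $\varepsilon$), and for $(x,\eta)\in D^f$ let $\operatorname{Graph}(M)_{x,\eta}$ be the set of $\xi\in S^{n-1}$ that are cluster points of $(M_{\tau(\varepsilon)}(x_\varepsilon,\eta_\varepsilon))_\varepsilon$ for some $\tau\in\mathcal{T}$ and some net $(x_\varepsilon,\eta_\varepsilon)$ in $D^f$ converging to $(x,\eta)$; for $(x,\eta)\notin D^f$ it is empty. If $D^f\neq\emptyset$, then $(f^*\Gamma)_x=\bigcup_{\eta\in\widetilde\Gamma_x}\operatorname{Graph}(M)_{x,\eta}$ with $\widetilde\Gamma_x=\bigcup_{y\in\operatorname{Graph}(f)_x}\Gamma_y$; if $D^f=\emptyset$, then $(f^*\Gamma)_x=S^{n-1}$ for all $x\in\Omega_1$. $f^*\Gamma$ is identified with $\{(x,\xi)\in\Omega_1\times S^{n-1}:\xi\in(f^*\Gamma)_x\}$. - $S^f$ is the set of $x_0\in\Omega_1$ at which $f$ is slow scaled in all derivatives, i.e. there is a neighborhood $X_0$ of $x_0$ such that for every $\alpha\in\mathbb{N}_0^n$ there are a slow scale net $(r_{\alpha,\varepsilon})_\varepsilon$ and a constant $C_\alpha$ with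 $\sup_{x\in X_0}|\partial^\alpha f_\varepsilon(x)|\le C_\alpha r_{\alpha,\varepsilon}$ for small $\varepsilon$; $(S^f)^c=\Omega_1\setminus S^f$. - $K^f(u)=\bigcap_{k\in\widetilde{\mathbb{R}}}\pi_1\bigl(\operatorname{Graph}(f)\cap(\Omega_1\times\operatorname{supp}(u-k))\bigr)$. *)

theory Defs
  imports "HOL-Analysis.Analysis" "HOL-Library.Landau_Symbols"
begin

text \<open>
  Conventions. A net indexed by \<open>]0,1]\<close> is a function on \<^typ>\<open>real\<close> of which only the values at
  \<open>\<epsilon> \<in> {0<..1}\<close> matter, and a function on an open set \<open>\<Omega>\<close> is a total function of which only the
  values on \<open>\<Omega>\<close> matter. "As \<open>\<epsilon> \<rightarrow> 0\<close>" and "for small \<open>\<epsilon>\<close>" are expressed by the filter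
  \<^term>\<open>at_right (0::real)\<close>. Generalized functions are complex valued (their Fourier
  transforms have to be); the generalized map \<open>f\<close> takes values in \<open>real^'m\<close>, and generalized
  constants are real.
\<close>

definition partial_deriv ::
    "'n::finite \<Rightarrow> (real^'n \<Rightarrow> 'b::real_normed_vector) \<Rightarrow> real^'n \<Rightarrow> 'b" where
  "partial_deriv i g x = frechet_derivative g (at x) (axis i 1)"

text \<open>
  A multi-index \<open>\<alpha>\<close> is given as the list of the coordinates in which one differentiates; by the
  symmetry of mixed partial derivatives of smooth functions, quantifying over lists is the same as
  quantifying over multi-indices.
\<close>

primrec iter_partial ::
    "'n::finite list \<Rightarrow> (real^'n \<Rightarrow> 'b::real_normed_vector) \<Rightarrow> real^'n \<Rightarrow> 'b" where
  "iter_partial [] g = g"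
| "iter_partial (i # \<alpha>) g = partial_deriv i (iter_partial \<alpha> g)"

definition smooth_on :: "(real^'n::finite) set \<Rightarrow> (real^'n \<Rightarrow> 'b::real_normed_vector) \<Rightarrow> bool" where
  "smooth_on \<Omega> g \<longleftrightarrow> (\<forall>\<alpha>. \<forall>x\<in>\<Omega>. iter_partial \<alpha> g differentiable (at x))"

definition test_functions :: "(real^'n::finite) set \<Rightarrow> (real^'n \<Rightarrow> complex) set" where
  "test_functions \<Omega> =
     {\<phi>. smooth_on \<Omega> \<phi> \<and> (\<exists>K. compact K \<and> K \<subseteq> \<Omega> \<and> (\<forall>x\<in>\<Omega> - K. \<phi> x = 0))}"

text \<open>
  The estimate \<open>sup\<^sub>A |g\<^sub>\<epsilon>| = O(h(\<epsilon>))\<close> as \<open>\<epsilon> \<rightarrow> 0\<close>, stated pointwise because the real \<^term>\<open>Sup\<close> has no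
  useful value on empty or unbounded sets.
\<close>

definition sup_bigo :: "'a set \<Rightarrow> (real \<Rightarrow> 'a \<Rightarrow> 'b::real_normed_vector) \<Rightarrow> (real \<Rightarrow> real) \<Rightarrow> bool" where
  "sup_bigo A g h \<longleftrightarrow> (\<exists>C. \<forall>\<^sub>F \<epsilon> in at_right 0. \<forall>x\<in>A. norm (g \<epsilon> x) \<le> C * h \<epsilon>)"

definition moderate_nets ::
    "(real^'n::finite) set \<Rightarrow> (real \<Rightarrow> real^'n \<Rightarrow> 'b::real_normed_vector) set" where
  "moderate_nets \<Omega> =
     {u. (\<forall>\<epsilon>\<in>{0<..1}. smooth_on \<Omega> (u \<epsilon>)) \<and>
         (\<forall>K \<alpha>. compact K \<and> K \<subseteq> \<Omega> \<longrightarrow>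
            (\<exists>p::real. sup_bigo K (\<lambda>\<epsilon>. iter_partial \<alpha> (u \<epsilon>)) (\<lambda>\<epsilon>. \<epsilon> powr (- p))))}"

definition null_nets ::
    "(real^'n::finite) set \<Rightarrow> (real \<Rightarrow> real^'n \<Rightarrow> 'b::real_normed_vector) set" where
  "null_nets \<Omega> =
     {u \<in> moderate_nets \<Omega>. \<forall>K (q::real). compact K \<and> K \<subseteq> \<Omega> \<longrightarrow> sup_bigo K u (\<lambda>\<epsilon>. \<epsilon> powr q)}"

definition colombeau_rel ::
    "(real^'n::finite) set \<Rightarrow>
     ((real \<Rightarrow> real^'n \<Rightarrow> 'b::real_normed_vector) \<times> (real \<Rightarrow> real^'n \<Rightarrow> 'b)) set" where
  "colombeau_rel \<Omega> =
     {(u, v). u \<in> moderate_nets \<Omega> \<and> v \<in> moderate_nets \<Omega> \<and> (\<lambda>\<epsilon> x. u \<epsilon> x - v \<epsilon> x) \<in> null_nets \<Omega>}"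

text \<open>
  For vector valued nets this quotient is the corresponding power of the scalar one, since
  moderateness and negligibility may be tested componentwise.
\<close>

definition colombeau ::
    "(real^'n::finite) set \<Rightarrow> (real \<Rightarrow> real^'n \<Rightarrow> 'b::real_normed_vector) set set" where
  "colombeau \<Omega> = moderate_nets \<Omega> // colombeau_rel \<Omega>"

definition gclass ::
    "(real^'n::finite) set \<Rightarrow> (real \<Rightarrow> real^'n \<Rightarrow> 'b::real_normed_vector) \<Rightarrow>
     (real \<Rightarrow> real^'n \<Rightarrow> 'b) set" where
  "gclass \<Omega> u = colombeau_rel \<Omega> `` {u}"

text \<open>
  Operations on classes are lifted as unions over representatives; they do not depend on the
  representatives, so each union is a single class.
\<close>

definition grestrict ::
    "(real^'n::finite) set \<Rightarrow> (real \<Rightarrow> real^'n \<Rightarrow> complex) set \<Rightarrow>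
     (real \<Rightarrow> real^'n \<Rightarrow> complex) set" where
  "grestrict V U = (\<Union>u\<in>U. gclass V u)"

definition gsupp ::
    "(real^'n::finite) set \<Rightarrow> (real \<Rightarrow> real^'n \<Rightarrow> complex) set \<Rightarrow> (real^'n) set" where
  "gsupp \<Omega> U = \<Omega> - \<Union>{V. open V \<and> V \<subseteq> \<Omega> \<and> grestrict V U = gclass V (\<lambda>_ _. 0)}"

definition gmult ::
    "(real^'n::finite) set \<Rightarrow> (real^'n \<Rightarrow> complex) \<Rightarrow> (real \<Rightarrow> real^'n \<Rightarrow> complex) set \<Rightarrow>
     (real \<Rightarrow> real^'n \<Rightarrow> complex) set" where
  "gmult \<Omega> \<phi> U = (\<Union>u\<in>U. gclass \<Omega> (\<lambda>\<epsilon> x. \<phi> x * u \<epsilon> x))"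

definition moderate_numbers :: "(real \<Rightarrow> real) set" where
  "moderate_numbers = {k. \<exists>p::real. k \<in> O[at_right 0](\<lambda>\<epsilon>. \<epsilon> powr (- p))}"

definition null_numbers :: "(real \<Rightarrow> real) set" where
  "null_numbers = {k. \<forall>q::real. k \<in> O[at_right 0](\<lambda>\<epsilon>. \<epsilon> powr q)}"

definition gen_reals :: "(real \<Rightarrow> real) set set" where
  "gen_reals =
     moderate_numbers //
       {(k, l). k \<in> moderate_numbers \<and> l \<in> moderate_numbers \<and> (\<lambda>\<epsilon>. k \<epsilon> - l \<epsilon>) \<in> null_numbers}"

definition gdiff_const ::
    "(real^'n::finite) set \<Rightarrow> (real \<Rightarrow> real^'n \<Rightarrow> complex) set \<Rightarrow> (real \<Rightarrow> real) set \<Rightarrow>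
     (real \<Rightarrow> real^'n \<Rightarrow> complex) set" where
  "gdiff_const \<Omega> U \<kappa> = (\<Union>u\<in>U. \<Union>k\<in>\<kappa>. gclass \<Omega> (\<lambda>\<epsilon> x. u \<epsilon> x - complex_of_real (k \<epsilon>)))"

definition cbounded_rep ::
    "(real^'n::finite) set \<Rightarrow> (real^'m::finite) set \<Rightarrow> (real \<Rightarrow> real^'n \<Rightarrow> real^'m) \<Rightarrow> bool" where
  "cbounded_rep \<Omega>1 \<Omega>2 f \<longleftrightarrow>
     (\<forall>\<epsilon>\<in>{0<..1}. smooth_on \<Omega>1 (f \<epsilon>) \<and> f \<epsilon> ` \<Omega>1 \<subseteq> \<Omega>2) \<and>
     (\<forall>K. compact K \<and> K \<subseteq> \<Omega>1 \<longrightarrow>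
        (\<exists>K'. compact K' \<and> K' \<subseteq> \<Omega>2 \<and> (\<forall>\<epsilon>\<in>{0<..1}. f \<epsilon> ` K \<subseteq> K')))"

definition cbounded_maps ::
    "(real^'n::finite) set \<Rightarrow> (real^'m::finite) set \<Rightarrow> (real \<Rightarrow> real^'n \<Rightarrow> real^'m) set set" where
  "cbounded_maps \<Omega>1 \<Omega>2 = {F \<in> colombeau \<Omega>1. \<exists>f\<in>F. cbounded_rep \<Omega>1 \<Omega>2 f}"

definition gpullback ::
    "(real^'n::finite) set \<Rightarrow> (real \<Rightarrow> real^'n \<Rightarrow> real^'m::finite) \<Rightarrow>
     (real \<Rightarrow> real^'m \<Rightarrow> complex) \<Rightarrow> (real \<Rightarrow> real^'n \<Rightarrow> complex) set" where
  "gpullback \<Omega>1 f u = gclass \<Omega>1 (\<lambda>\<epsilon> x. u \<epsilon> (f \<epsilon> x))"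

text \<open>
  The Fourier transforms of the representatives of \<open>V\<close> whose supports lie in a joint compact set.
  Rapid decrease of the transform of \<open>V\<close> is tested on these nets and not on arbitrary members of
  their class modulo \<open>null_nets UNIV\<close>. That class only sees compact sets of frequencies: a
  representative may be cut off smoothly at \<open>|\<xi>| = log (1/\<epsilon>)\<close> without leaving its class, so that
  with arbitrary representatives every transform would be rapidly decreasing in all directions
  and every wave front set would be empty.
\<close>

definition fourier_nets ::
    "(real^'n::finite) set \<Rightarrow> (real \<Rightarrow> real^'n \<Rightarrow> complex) set \<Rightarrow>
     (real \<Rightarrow> real^'n \<Rightarrow> complex) set" where
  "fourier_nets \<Omega> V =
     {(\<lambda>\<epsilon> \<xi>. LINT x:\<Omega>|lborel. v \<epsilon> x * exp (- (\<i> * complex_of_real (x \<bullet> \<xi>)))) | v.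
        v \<in> V \<and> (\<exists>K. compact K \<and> K \<subseteq> \<Omega> \<and> (\<forall>\<epsilon>\<in>{0<..1}. \<forall>x\<in>\<Omega> - K. v \<epsilon> x = 0))}"

definition rapidly_decreasing ::
    "(real^'n::finite) set \<Rightarrow> (real \<Rightarrow> real^'n \<Rightarrow> complex) set \<Rightarrow> bool" where
  "rapidly_decreasing \<Gamma> W \<longleftrightarrow>
     (\<exists>w\<in>W. \<exists>N::nat. \<forall>p::nat.
        sup_bigo ({0<..} \<times> \<Gamma>)
          (\<lambda>\<epsilon> (r, \<xi>). (1 + r\<^sup>2) powr (real p / 2) *\<^sub>R w \<epsilon> (r *\<^sub>R \<xi>))
          (\<lambda>\<epsilon>. \<epsilon> powr (- real N)))"

definition irregular_directions ::
    "(real^'n::finite) set \<Rightarrow> (real \<Rightarrow> real^'n \<Rightarrow> complex) set \<Rightarrow> (real^'n) set" where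
  "irregular_directions \<Omega> V =
     {\<xi> \<in> sphere 0 1. \<not> (\<exists>\<Gamma>. openin (top_of_set (sphere 0 1)) \<Gamma> \<and> \<xi> \<in> \<Gamma> \<and>
                          rapidly_decreasing \<Gamma> (fourier_nets \<Omega> V))}"

definition irregular_directions_at ::
    "(real^'n::finite) set \<Rightarrow> (real \<Rightarrow> real^'n \<Rightarrow> complex) set \<Rightarrow> real^'n \<Rightarrow> (real^'n) set" where
  "irregular_directions_at \<Omega> U x0 =
     (\<Inter>\<phi>\<in>{\<phi> \<in> test_functions \<Omega>. \<phi> x0 \<noteq> 0}. irregular_directions \<Omega> (gmult \<Omega> \<phi> U))"

definition WF ::
    "(real^'n::finite) set \<Rightarrow> (real \<Rightarrow> real^'n \<Rightarrow> complex) set \<Rightarrow> ((real^'n) \<times> (real^'n)) set" where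
  "WF \<Omega> U = {(x, \<xi>). x \<in> \<Omega> \<and> \<xi> \<in> sphere 0 1 \<and> \<xi> \<in> irregular_directions_at \<Omega> U x}"

definition reparam :: "(real \<Rightarrow> real) set" where
  "reparam = {\<tau>. (\<forall>\<epsilon>\<in>{0<..1}. \<tau> \<epsilon> \<in> {0<..1}) \<and> (\<tau> \<longlongrightarrow> 0) (at_right 0)}"

definition cluster_point :: "(real \<Rightarrow> 'a::topological_space) \<Rightarrow> 'a \<Rightarrow> bool" where
  "cluster_point l a \<longleftrightarrow> (\<exists>\<tau>\<in>reparam. ((\<lambda>\<epsilon>. l (\<tau> \<epsilon>)) \<longlongrightarrow> a) (at_right 0))"

definition ggraph ::
    "(real^'n::finite) set \<Rightarrow> (real^'m::finite) set \<Rightarrow> (real \<Rightarrow> real^'n \<Rightarrow> real^'m) \<Rightarrow>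
     ((real^'n) \<times> (real^'m)) set" where
  "ggraph \<Omega>1 \<Omega>2 f =
     {(x, y). x \<in> \<Omega>1 \<and> y \<in> \<Omega>2 \<and>
        (\<exists>z. \<exists>\<tau>\<in>reparam. (\<forall>\<epsilon>\<in>{0<..1}. z \<epsilon> \<in> \<Omega>1) \<and> (z \<longlongrightarrow> x) (at_right 0) \<and>
           cluster_point (\<lambda>\<epsilon>. f (\<tau> \<epsilon>) (z \<epsilon>)) y)}"

definition slow_scale :: "(real \<Rightarrow> real) \<Rightarrow> bool" where
  "slow_scale s \<longleftrightarrow>
     (\<exists>\<epsilon>'\<in>{0<..1}. \<forall>t\<ge>0. \<exists>C>0. \<forall>\<epsilon>\<in>{0<..\<epsilon>'}. \<bar>s \<epsilon>\<bar> powr t \<le> C * inverse \<epsilon>)"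

definition transp_diff ::
    "(real \<Rightarrow> real^'n::finite \<Rightarrow> real^'m::finite) \<Rightarrow> real \<Rightarrow> real^'n \<Rightarrow> real^'m \<Rightarrow> real^'n" where
  "transp_diff f \<epsilon> x \<eta> = transpose (jacobian (f \<epsilon>) (at x)) *v \<eta>"

definition sphere_perp :: "(real^'m::finite) set \<Rightarrow> (real^'m) set" where
  "sphere_perp V = {\<eta> \<in> sphere 0 1. \<exists>\<eta>0\<in>V. \<eta> \<bullet> \<eta>0 = 0}"

definition D_set ::
    "(real^'n::finite) set \<Rightarrow> (real \<Rightarrow> real^'n \<Rightarrow> real^'m::finite) \<Rightarrow> ((real^'n) \<times> (real^'m)) set" where
  "D_set \<Omega>1 f =
     {(x0, \<eta>0). \<exists>X V. open X \<and> X \<subseteq> \<Omega>1 \<and> x0 \<in> X \<and>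
        openin (top_of_set (sphere 0 1)) V \<and> \<eta>0 \<in> V \<and>
        (\<exists>\<sigma>. (\<forall>\<epsilon>\<in>{0<..1}. 0 < \<sigma> \<epsilon>) \<and> slow_scale \<sigma> \<and>
           (\<exists>\<alpha>>0. \<exists>\<beta>>0. \<exists>\<epsilon>'\<in>{0<..1}. \<forall>\<epsilon>\<in>{0<..<\<epsilon>'}.
              (\<forall>x\<in>X. \<forall>\<eta>\<in>V. \<alpha> \<le> norm (\<sigma> \<epsilon> *\<^sub>R transp_diff f \<epsilon> x \<eta>)) \<and>
              (\<forall>x\<in>X. \<forall>\<eta>\<in>sphere_perp V. norm (\<sigma> \<epsilon> *\<^sub>R transp_diff f \<epsilon> x \<eta>) \<le> \<beta>)))}"

definition unfavorable_support ::
    "(real^'n::finite) set \<Rightarrow> (real^'m::finite) set \<Rightarrow> (real \<Rightarrow> real^'n \<Rightarrow> real^'m) \<Rightarrow>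
     ((real^'m) \<times> (real^'m)) set \<Rightarrow> (real^'n) set" where
  "unfavorable_support \<Omega>1 \<Omega>2 f \<Gamma> =
     {x \<in> \<Omega>1. \<exists>(y, \<eta>)\<in>\<Gamma>. (x, y) \<in> ggraph \<Omega>1 \<Omega>2 f \<and> (x, \<eta>) \<notin> D_set \<Omega>1 f}"

text \<open>
  \<open>sgn w\<close> is \<open>w / |w|\<close>; its value \<open>0\<close> at \<open>w = 0\<close> is irrelevant below, because a net
  in \<open>D_set\<close> that converges in \<open>D_set\<close> leads to nonzero \<open>w\<close> for small parameters.
\<close>

definition M_net ::
    "(real \<Rightarrow> real^'n::finite \<Rightarrow> real^'m::finite) \<Rightarrow> real \<Rightarrow> (real^'n) \<times> (real^'m) \<Rightarrow> real^'n" where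
  "M_net f \<epsilon> = (\<lambda>(x, \<eta>). sgn (transp_diff f \<epsilon> x \<eta>))"

definition M_graph_at ::
    "(real^'n::finite) set \<Rightarrow> (real \<Rightarrow> real^'n \<Rightarrow> real^'m::finite) \<Rightarrow> real^'n \<Rightarrow> real^'m \<Rightarrow>
     (real^'n) set" where
  "M_graph_at \<Omega>1 f x \<eta> =
     {\<xi> \<in> sphere 0 1. (x, \<eta>) \<in> D_set \<Omega>1 f \<and>
        (\<exists>z. \<exists>\<tau>\<in>reparam. (\<forall>\<epsilon>\<in>{0<..1}. z \<epsilon> \<in> D_set \<Omega>1 f) \<and>
           (z \<longlongrightarrow> (x, \<eta>)) (at_right 0) \<and>
           cluster_point (\<lambda>\<epsilon>. M_net f (\<tau> \<epsilon>) (z \<epsilon>)) \<xi>)}"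

definition wf_pullback_at ::
    "(real^'n::finite) set \<Rightarrow> (real^'m::finite) set \<Rightarrow> (real \<Rightarrow> real^'n \<Rightarrow> real^'m) \<Rightarrow>
     ((real^'m) \<times> (real^'m)) set \<Rightarrow> real^'n \<Rightarrow> (real^'n) set" where
  "wf_pullback_at \<Omega>1 \<Omega>2 f \<Gamma> x =
     (if D_set \<Omega>1 f = {} then sphere 0 1
      else (\<Union>\<eta>\<in>(\<Union>y\<in>ggraph \<Omega>1 \<Omega>2 f `` {x}. \<Gamma> `` {y}). M_graph_at \<Omega>1 f x \<eta>))"

definition wf_pullback ::
    "(real^'n::finite) set \<Rightarrow> (real^'m::finite) set \<Rightarrow> (real \<Rightarrow> real^'n \<Rightarrow> real^'m) \<Rightarrow>
     ((real^'m) \<times> (real^'m)) set \<Rightarrow> ((real^'n) \<times> (real^'n)) set" where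
  "wf_pullback \<Omega>1 \<Omega>2 f \<Gamma> = (SIGMA x:\<Omega>1. wf_pullback_at \<Omega>1 \<Omega>2 f \<Gamma> x)"

definition slow_scaled_points ::
    "(real^'n::finite) set \<Rightarrow> (real \<Rightarrow> real^'n \<Rightarrow> real^'m::finite) \<Rightarrow> (real^'n) set" where
  "slow_scaled_points \<Omega>1 f =
     {x0. \<exists>X0. open X0 \<and> X0 \<subseteq> \<Omega>1 \<and> x0 \<in> X0 \<and>
        (\<forall>\<alpha>. \<exists>r C. slow_scale r \<and>
           (\<forall>\<^sub>F \<epsilon> in at_right 0. \<forall>x\<in>X0. norm (iter_partial \<alpha> (f \<epsilon>) x) \<le> C * r \<epsilon>))}"

definition K_set ::
    "(real^'n::finite) set \<Rightarrow> (real^'m::finite) set \<Rightarrow> (real \<Rightarrow> real^'n \<Rightarrow> real^'m) \<Rightarrow>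
     (real \<Rightarrow> real^'m \<Rightarrow> complex) set \<Rightarrow> (real^'n) set" where
  "K_set \<Omega>1 \<Omega>2 f U =
     (\<Inter>\<kappa>\<in>gen_reals. fst ` (ggraph \<Omega>1 \<Omega>2 f \<inter> (\<Omega>1 \<times> gsupp \<Omega>2 (gdiff_const \<Omega>2 U \<kappa>))))"

end

theory Submission
  imports Defs "HOL-Probability.Characteristic_Functions" "HOL-Probability.Sinc_Integral"
begin

text \<open>
  The inclusion is proved by contraposition: if \<open>(x, \<xi>)\<close> lies outside the right-hand side, then some
  cutoff of \<open>f\<^sup>*u\<close> near \<open>x\<close> has a Fourier transform that decreases rapidly near \<open>\<xi>\<close>. The values
  \<open>f\<^sub>\<epsilon>(x')\<close> for \<open>x'\<close> near \<open>x\<close> and small \<open>\<epsilon>\<close> are governed by the fibre of the generalized graph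
  over \<open>x\<close>: c-boundedness makes this fibre compact, and every open set containing it contains
  \<open>f\<^sub>\<epsilon>(X)\<close> for some neighbourhood \<open>X\<close> of \<open>x\<close> and all small \<open>\<epsilon>\<close> (\<open>compact_ggraph_fibre\<close>,
  \<open>ggraph_neighbourhood\<close>).

  If \<open>x\<close> is not in \<open>K\<^sup>f(u)\<close>, then \<open>u - k\<close> vanishes near the whole fibre for one generalized
  constant \<open>k\<close>. Then \<open>f\<^sup>*u = k\<close> near \<open>x\<close>, and the transform of \<open>\<phi> k\<close> is a moderate number times
  the transform of a test function (\<open>pullback_regular_const\<close>).

  Otherwise \<open>f\<close> is slow scaled in all derivatives near \<open>x\<close>. For every \<open>y\<close> in the fibre there are a
  cutoff \<open>v\<close> of \<open>u\<close> near \<open>y\<close> and a set \<open>V\<close> of unit covectors such that the transform of \<open>v\<close>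
  decreases rapidly outside the cone over \<open>V\<close>, while for \<open>\<eta>\<close> in that cone the phase
  \<open>f\<^sub>\<epsilon>(x) \<bullet> \<eta> - x \<bullet> \<lambda>\<xi>\<close> has a gradient of size at least \<open>|\<eta>| + \<lambda>\<close> up to a slow scale factor. Indeed, a direction
  \<open>\<eta>\<close> with \<open>(y, \<eta>)\<close> in the wave front set of \<open>u\<close> satisfies \<open>(x, \<eta>) \<in> D\<^sup>f\<close> and the normalized
  codifferential of \<open>f\<close> stays away from \<open>\<xi>\<close> near \<open>(x, \<eta>)\<close> (\<open>nonstationary_at_D_set\<close>); any other
  direction is regular for \<open>u\<close>; and the sphere is compact (\<open>microlocal_cutoff\<close>).

  Fourier inversion writes the transform of \<open>a \<cdot> (v \<circ> f)\<close> at \<open>\<lambda>\<xi>\<close> as a superposition over \<open>\<eta>\<close> of the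
  transform of \<open>v\<close> times the oscillatory integral \<open>J(\<eta>, \<lambda>\<xi>)\<close> of \<open>a\<close> with the phase above. Over \<open>V\<close>,
  nonstationary phase gives \<open>J = O((1 + |\<eta>| + \<lambda>)\<^sup>-\<^sup>p)\<close>; elsewhere \<open>J = O((1 + \<lambda>)\<^sup>-\<^sup>p)\<close> at the cost of a
  power of \<open>|\<eta>|\<close>, which the decay of the transform of \<open>v\<close> absorbs. The constants are slow scale nets
  that depend on \<open>p\<close>, but each of them is \<open>O(1/\<epsilon>)\<close>. This is why the resulting exponent of \<open>1/\<epsilon>\<close> is
  independent of \<open>p\<close>, as rapid decrease demands (\<open>rapid_pullback\<close>). Finitely many cutoffs \<open>v\<close> suffice
  for the compact fibre, and weights that sum to one combine them into \<open>\<phi> \<cdot> (u \<circ> f)\<close>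
  (\<open>pullback_regular_slow\<close>).

  All derivative estimates (moderate, slow scale, uniform in covariables, or mere smoothness) are
  instances of one notion, \<open>symbol\<close>, which is closed under the operations of calculus.
\<close>

abbreviation for_small :: "(real \<Rightarrow> bool) \<Rightarrow> bool" (binder "\<forall>\<^sub>0" 10) where
  "for_small P \<equiv> eventually P (at_right 0)"

section \<open>Families of functions with weighted derivative bounds\<close>

lemma iter_partial_append: "iter_partial (\<alpha> @ \<beta>) g = iter_partial \<alpha> (iter_partial \<beta> g)"
  by (induction \<alpha>) auto

lemma partial_deriv_eq: "(g has_derivative D) (at x) \<Longrightarrow> partial_deriv i g x = D (axis i 1)"
  by (simp add: partial_deriv_def frechet_derivative_at[symmetric])

lemma has_derivative_cong_open:
  assumes "open \<Omega>" "x \<in> \<Omega>" "\<And>y. y \<in> \<Omega> \<Longrightarrow> g y = h y"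
  shows "(g has_derivative D) (at x) \<longleftrightarrow> (h has_derivative D) (at x)"
  using has_derivative_transform_within_open[of g D x UNIV \<Omega> h]
    has_derivative_transform_within_open[of h D x UNIV \<Omega> g] assms by auto

lemma differentiable_cong_open:
  assumes "open \<Omega>" "x \<in> \<Omega>" "\<And>y. y \<in> \<Omega> \<Longrightarrow> g y = h y"
  shows "g differentiable (at x) \<longleftrightarrow> h differentiable (at x)"
  unfolding differentiable_def using has_derivative_cong_open[OF assms] by simp

lemma partial_deriv_cong_open:
  assumes "open \<Omega>" "x \<in> \<Omega>" "\<And>y. y \<in> \<Omega> \<Longrightarrow> g y = h y"
  shows "partial_deriv i g x = partial_deriv i h x"
  unfolding partial_deriv_def frechet_derivative_def
  using has_derivative_cong_open[OF assms] by simp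

lemma iter_partial_cong_open:
  assumes "open \<Omega>" "x \<in> \<Omega>" "\<And>y. y \<in> \<Omega> \<Longrightarrow> g y = h y"
  shows "iter_partial \<alpha> g x = iter_partial \<alpha> h x"
  using assms(2)
proof (induction \<alpha> arbitrary: x)
  case Nil
  then show ?case using assms by simp
next
  case (Cons i \<alpha>)
  then show ?case
    using partial_deriv_cong_open[OF assms(1) Cons.prems, of "iter_partial \<alpha> g" "iter_partial \<alpha> h"]
    by simp
qed

lemma continuous_on_of_differentiable:
  "(\<And>x. x \<in> X \<Longrightarrow> g differentiable (at x)) \<Longrightarrow> continuous_on X g"
  by (simp add: continuous_at_imp_continuous_on differentiable_imp_continuous_within)

lemma smooth_on_subset: "smooth_on \<Omega> g \<Longrightarrow> \<Omega>' \<subseteq> \<Omega> \<Longrightarrow> smooth_on \<Omega>' g"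
  unfolding smooth_on_def by blast

lemma smooth_on_differentiable: "smooth_on \<Omega> g \<Longrightarrow> x \<in> \<Omega> \<Longrightarrow> g differentiable (at x)"
  unfolding smooth_on_def by (drule spec[of _ "[]"]) simp

lemma smooth_on_iter_partial: "smooth_on \<Omega> g \<Longrightarrow> smooth_on \<Omega> (iter_partial \<beta> g)"
  unfolding smooth_on_def iter_partial_append[symmetric] by blast

lemma smooth_on_continuous_on: "smooth_on \<Omega> g \<Longrightarrow> continuous_on \<Omega> g"
  by (intro continuous_on_of_differentiable smooth_on_differentiable)

lemma partial_deriv_const [simp]: "partial_deriv i (\<lambda>_. c) = (\<lambda>_. 0)"
  by (rule ext, rule partial_deriv_eq[where D="\<lambda>_. 0", simplified]) simp

lemma partial_deriv_ident: "partial_deriv i (\<lambda>x. x) x = axis i 1"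
  using partial_deriv_eq[OF has_derivative_ident] .

lemma iter_partial_zero: "iter_partial \<alpha> (\<lambda>_. 0) = (\<lambda>_. 0)"
  by (induction \<alpha>) simp_all

text \<open>
  The classes of admissible bounds: the three closure conditions are what the product and chain rules
  consume.
\<close>

definition weights :: "('p \<Rightarrow> real) set \<Rightarrow> bool" where
  "weights B \<longleftrightarrow> (\<forall>w\<in>B. \<forall>\<theta>. 0 \<le> w \<theta>) \<and> (\<forall>c\<ge>0. (\<lambda>_. c) \<in> B) \<and>
     (\<forall>v\<in>B. \<forall>w\<in>B. (\<lambda>\<theta>. v \<theta> + w \<theta>) \<in> B \<and> (\<lambda>\<theta>. v \<theta> * w \<theta>) \<in> B)"

lemma weights_nonneg: "weights B \<Longrightarrow> w \<in> B \<Longrightarrow> 0 \<le> w \<theta>"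
  and weights_const: "weights B \<Longrightarrow> 0 \<le> c \<Longrightarrow> (\<lambda>_. c) \<in> B"
  and weights_add: "weights B \<Longrightarrow> v \<in> B \<Longrightarrow> w \<in> B \<Longrightarrow> (\<lambda>\<theta>. v \<theta> + w \<theta>) \<in> B"
  and weights_mult: "weights B \<Longrightarrow> v \<in> B \<Longrightarrow> w \<in> B \<Longrightarrow> (\<lambda>\<theta>. v \<theta> * w \<theta>) \<in> B"
  unfolding weights_def by simp_all

text \<open>
  The parameter \<open>\<theta>\<close> tends along \<open>F\<close>; it is \<open>\<epsilon>\<close> alone, or \<open>\<epsilon>\<close> together with covariables. Derivatives
  exist on \<open>\<Omega>\<close> and are bounded on \<open>X\<close> only: moderate nets need bounds on compact sets \<open>X\<close>, and
  \<open>X = {}\<close> expresses smoothness without bounds.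
\<close>

definition symbol_upto ::
    "nat \<Rightarrow> (real^'n::finite) set \<Rightarrow> (real^'n) set \<Rightarrow> 'p filter \<Rightarrow> ('p \<Rightarrow> real) set \<Rightarrow>
     ('p \<Rightarrow> real^'n \<Rightarrow> 'b::real_normed_vector) \<Rightarrow> bool" where
  "symbol_upto k \<Omega> X F B g \<longleftrightarrow> (\<forall>\<alpha>. length \<alpha> \<le> k \<longrightarrow>
     (\<forall>\<^sub>F \<theta> in F. \<forall>x\<in>\<Omega>. iter_partial \<alpha> (g \<theta>) differentiable (at x)) \<and>
     (\<exists>w\<in>B. \<forall>\<^sub>F \<theta> in F. \<forall>x\<in>X. norm (iter_partial \<alpha> (g \<theta>) x) \<le> w \<theta>))"

definition symbol ::
    "(real^'n::finite) set \<Rightarrow> (real^'n) set \<Rightarrow> 'p filter \<Rightarrow> ('p \<Rightarrow> real) set \<Rightarrow>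
     ('p \<Rightarrow> real^'n \<Rightarrow> 'b::real_normed_vector) \<Rightarrow> bool" where
  "symbol \<Omega> X F B g \<longleftrightarrow> (\<forall>\<alpha>.
     (\<forall>\<^sub>F \<theta> in F. \<forall>x\<in>\<Omega>. iter_partial \<alpha> (g \<theta>) differentiable (at x)) \<and>
     (\<exists>w\<in>B. \<forall>\<^sub>F \<theta> in F. \<forall>x\<in>X. norm (iter_partial \<alpha> (g \<theta>) x) \<le> w \<theta>))"

lemma symbol_iff_upto: "symbol \<Omega> X F B g \<longleftrightarrow> (\<forall>k. symbol_upto k \<Omega> X F B g)"
  unfolding symbol_def symbol_upto_def by blast

lemma symbol_upto_0:
  "symbol_upto 0 \<Omega> X F B g \<longleftrightarrow> (\<forall>\<^sub>F \<theta> in F. \<forall>x\<in>\<Omega>. g \<theta> differentiable (at x)) \<and>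
     (\<exists>w\<in>B. \<forall>\<^sub>F \<theta> in F. \<forall>x\<in>X. norm (g \<theta> x) \<le> w \<theta>)"
  unfolding symbol_upto_def by simp

text \<open>
  The derivative that is split off is the one taken first. Inductions on the order therefore only use the
  first-order product and chain rules, and no formula for higher derivatives of products or compositions.
\<close>

lemma symbol_upto_Suc:
  "symbol_upto (Suc k) \<Omega> X F B g \<longleftrightarrow> symbol_upto 0 \<Omega> X F B g \<and>
     (\<forall>i. symbol_upto k \<Omega> X F B (\<lambda>\<theta>. partial_deriv i (g \<theta>)))" (is "?L \<longleftrightarrow> ?R")
proof
  assume L: ?L
  show ?R
    unfolding symbol_upto_def
  proof (intro conjI allI impI, goal_cases)
    case (1 \<alpha>) then show ?case using L[unfolded symbol_upto_def, rule_format, of \<alpha>] by simp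
  next
    case (2 \<alpha>) then show ?case using L[unfolded symbol_upto_def, rule_format, of \<alpha>] by simp
  next
    case (3 i \<alpha>) then show ?case
      using L[unfolded symbol_upto_def, rule_format, of "\<alpha> @ [i]"] by (simp add: iter_partial_append)
  next
    case (4 i \<alpha>) then show ?case
      using L[unfolded symbol_upto_def, rule_format, of "\<alpha> @ [i]"] by (simp add: iter_partial_append)
  qed
next
  assume R: ?R
  show ?L unfolding symbol_upto_def
  proof (intro allI impI)
    fix \<alpha> :: "'a list" assume len: "length \<alpha> \<le> Suc k"
    show "(\<forall>\<^sub>F \<theta> in F. \<forall>x\<in>\<Omega>. iter_partial \<alpha> (g \<theta>) differentiable (at x)) \<and>
     (\<exists>w\<in>B. \<forall>\<^sub>F \<theta> in F. \<forall>x\<in>X. norm (iter_partial \<alpha> (g \<theta>) x) \<le> w \<theta>)"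
    proof (cases \<alpha> rule: rev_cases)
      case Nil then show ?thesis using R unfolding symbol_upto_0 by simp
    next
      case (snoc \<beta> i)
      then show ?thesis using R len unfolding symbol_upto_def by (simp add: iter_partial_append)
    qed
  qed
qed

lemma symbol_upto_mono: "symbol_upto k \<Omega> X F B g \<Longrightarrow> l \<le> k \<Longrightarrow> symbol_upto l \<Omega> X F B g"
  unfolding symbol_upto_def by (meson order_trans)

lemma symbol_partial_deriv: "symbol \<Omega> X F B g \<Longrightarrow> symbol \<Omega> X F B (\<lambda>\<theta>. partial_deriv i (g \<theta>))"
  unfolding symbol_iff_upto using symbol_upto_Suc by blast

lemma symbol_mono:
  "symbol \<Omega> X F B g \<Longrightarrow> \<Omega>' \<subseteq> \<Omega> \<Longrightarrow> X' \<subseteq> X \<Longrightarrow> symbol \<Omega>' X' F B g"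
  unfolding symbol_def
proof (intro allI conjI, goal_cases)
  case (1 \<alpha>)
  then have "\<forall>\<^sub>F \<theta> in F. \<forall>x\<in>\<Omega>. iter_partial \<alpha> (g \<theta>) differentiable (at x)" by blast
  then show ?case by eventually_elim (use 1 in blast)
next
  case (2 \<alpha>)
  then obtain w where "w \<in> B" and w: "\<forall>\<^sub>F \<theta> in F. \<forall>x\<in>X. norm (iter_partial \<alpha> (g \<theta>) x) \<le> w \<theta>" by blast
  from w have "\<forall>\<^sub>F \<theta> in F. \<forall>x\<in>X'. norm (iter_partial \<alpha> (g \<theta>) x) \<le> w \<theta>"
    by eventually_elim (use 2 in blast)
  with \<open>w \<in> B\<close> show ?case by blast
qed

lemma symbol_bound:
  assumes "symbol \<Omega> X F B g"
  obtains w where "w \<in> B" "\<forall>\<^sub>F \<theta> in F. \<forall>x\<in>X. norm (g \<theta> x) \<le> w \<theta>"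
  using assms[unfolded symbol_def, rule_format, of "[]"] by auto

lemma symbol_differentiable:
  assumes "symbol \<Omega> X F B g"
  shows "\<forall>\<^sub>F \<theta> in F. \<forall>x\<in>\<Omega>. g \<theta> differentiable (at x)"
  using assms[unfolded symbol_def, rule_format, of "[]"] by auto

lemma symbol_upto_cong:
  assumes "open \<Omega>" "X \<subseteq> \<Omega>" "\<forall>\<^sub>F \<theta> in F. \<forall>x\<in>\<Omega>. g \<theta> x = h \<theta> x" "symbol_upto k \<Omega> X F B g"
  shows "symbol_upto k \<Omega> X F B h"
  unfolding symbol_upto_def
proof (intro allI impI conjI)
  fix \<alpha> :: "'a list" assume "length \<alpha> \<le> k"
  then have 1: "\<forall>\<^sub>F \<theta> in F. \<forall>x\<in>\<Omega>. iter_partial \<alpha> (g \<theta>) differentiable (at x)"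
    and "\<exists>w\<in>B. \<forall>\<^sub>F \<theta> in F. \<forall>x\<in>X. norm (iter_partial \<alpha> (g \<theta>) x) \<le> w \<theta>"
    using assms(4) unfolding symbol_upto_def by blast+
  then obtain w where w: "w \<in> B" "\<forall>\<^sub>F \<theta> in F. \<forall>x\<in>X. norm (iter_partial \<alpha> (g \<theta>) x) \<le> w \<theta>" by blast
  have eq: "\<forall>\<^sub>F \<theta> in F. \<forall>x\<in>\<Omega>. iter_partial \<alpha> (g \<theta>) x = iter_partial \<alpha> (h \<theta>) x"
    using assms(3) by eventually_elim (auto intro!: iter_partial_cong_open[OF assms(1)])
  show "\<forall>\<^sub>F \<theta> in F. \<forall>x\<in>\<Omega>. iter_partial \<alpha> (h \<theta>) differentiable (at x)"
    using eq 1
  proof eventually_elim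
    case (elim \<theta>)
    then show ?case
      using differentiable_cong_open[OF assms(1), of _ "iter_partial \<alpha> (g \<theta>)" "iter_partial \<alpha> (h \<theta>)"]
      by auto
  qed
  show "\<exists>w\<in>B. \<forall>\<^sub>F \<theta> in F. \<forall>x\<in>X. norm (iter_partial \<alpha> (h \<theta>) x) \<le> w \<theta>"
    using eq w(2) by (intro bexI[OF _ w(1)], eventually_elim) (use assms(2) in fastforce)
qed

lemma symbol_upto_SucI:
  assumes "open \<Omega>" "X \<subseteq> \<Omega>" "symbol_upto 0 \<Omega> X F B g"
    and "\<And>i. \<forall>\<^sub>F \<theta> in F. \<forall>x\<in>\<Omega>. partial_deriv i (g \<theta>) x = h i \<theta> x"
    and "\<And>i. symbol_upto k \<Omega> X F B (h i)"
  shows "symbol_upto (Suc k) \<Omega> X F B g"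
  unfolding symbol_upto_Suc
proof (intro conjI allI)
  fix i
  have "\<forall>\<^sub>F \<theta> in F. \<forall>x\<in>\<Omega>. h i \<theta> x = partial_deriv i (g \<theta>) x"
    using assms(4)[of i] by eventually_elim auto
  from symbol_upto_cong[OF assms(1,2) this assms(5)]
  show "symbol_upto k \<Omega> X F B (\<lambda>\<theta>. partial_deriv i (g \<theta>))" .
qed (use assms in blast)

lemma symbol_upto_0_bounded_linear:
  fixes T :: "'b::real_normed_vector \<Rightarrow> 'c::real_normed_vector"
  assumes "weights B" "bounded_linear T" "symbol_upto 0 \<Omega> X F B g"
  shows "symbol_upto 0 \<Omega> X F B (\<lambda>\<theta> x. T (g \<theta> x))"
proof -
  obtain w where w: "w \<in> B" "\<forall>\<^sub>F \<theta> in F. \<forall>x\<in>X. norm (g \<theta> x) \<le> w \<theta>" and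
    d: "\<forall>\<^sub>F \<theta> in F. \<forall>x\<in>\<Omega>. g \<theta> differentiable (at x)"
    using assms(3) unfolding symbol_upto_0 by blast
  obtain K where K: "K \<ge> 0" "\<And>x. norm (T x) \<le> norm x * K"
    using bounded_linear.nonneg_bounded[OF assms(2)] by blast
  have wB: "(\<lambda>\<theta>. w \<theta> * K) \<in> B"
    by (rule weights_mult[OF assms(1) w(1) weights_const[OF assms(1) K(1)]])
  show ?thesis unfolding symbol_upto_0
  proof
    show "\<forall>\<^sub>F \<theta> in F. \<forall>x\<in>\<Omega>. (\<lambda>x. T (g \<theta> x)) differentiable (at x)"
      using d
    proof eventually_elim
      case (elim \<theta>)
      show ?case
      proof
        fix x assume "x \<in> \<Omega>"
        then have "(g \<theta> has_derivative frechet_derivative (g \<theta>) (at x)) (at x)"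
          using elim frechet_derivative_works by blast
        from bounded_linear.has_derivative[OF assms(2) this]
        show "(\<lambda>x. T (g \<theta> x)) differentiable (at x)" by (rule differentiableI)
      qed
    qed
    show "\<exists>w\<in>B. \<forall>\<^sub>F \<theta> in F. \<forall>x\<in>X. norm (T (g \<theta> x)) \<le> w \<theta>"
    proof (rule bexI[OF _ wB])
      show "\<forall>\<^sub>F \<theta> in F. \<forall>x\<in>X. norm (T (g \<theta> x)) \<le> w \<theta> * K"
        using w(2)
      proof eventually_elim
        case (elim \<theta>)
        show ?case
        proof
          fix x assume "x \<in> X"
          then have "norm (g \<theta> x) * K \<le> w \<theta> * K" using elim K(1) by (intro mult_right_mono) auto
          then show "norm (T (g \<theta> x)) \<le> w \<theta> * K" using K(2)[of "g \<theta> x"] by linarith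
        qed
      qed
    qed
  qed
qed

lemma symbol_upto_bounded_linear:
  fixes T :: "'b::real_normed_vector \<Rightarrow> 'c::real_normed_vector"
  assumes "weights B" "open \<Omega>" "X \<subseteq> \<Omega>" "bounded_linear T" "symbol_upto k \<Omega> X F B g"
  shows "symbol_upto k \<Omega> X F B (\<lambda>\<theta> x. T (g \<theta> x))"
  using assms(5)
proof (induction k arbitrary: g)
  case 0
  then show ?case by (rule symbol_upto_0_bounded_linear[OF assms(1,4)])
next
  case (Suc k)
  show ?case
  proof (rule symbol_upto_SucI[OF assms(2,3), where h="\<lambda>i \<theta> x. T (partial_deriv i (g \<theta>) x)"])
    show "symbol_upto 0 \<Omega> X F B (\<lambda>\<theta> x. T (g \<theta> x))"
      using symbol_upto_0_bounded_linear[OF assms(1,4)] Suc.prems symbol_upto_Suc by blast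
    fix i
    show "symbol_upto k \<Omega> X F B (\<lambda>\<theta> x. T (partial_deriv i (g \<theta>) x))"
      using Suc by (auto simp: symbol_upto_Suc)
    have "\<forall>\<^sub>F \<theta> in F. \<forall>x\<in>\<Omega>. g \<theta> differentiable (at x)"
      using Suc.prems unfolding symbol_upto_Suc symbol_upto_0 by blast
    then show "\<forall>\<^sub>F \<theta> in F. \<forall>x\<in>\<Omega>. partial_deriv i (\<lambda>x. T (g \<theta> x)) x = T (partial_deriv i (g \<theta>) x)"
    proof eventually_elim
      case (elim \<theta>)
      show ?case
      proof
        fix x assume "x \<in> \<Omega>"
        then have "(g \<theta> has_derivative frechet_derivative (g \<theta>) (at x)) (at x)"
          using elim frechet_derivative_works by blast
        from partial_deriv_eq[OF bounded_linear.has_derivative[OF assms(4) this]]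
        show "partial_deriv i (\<lambda>x. T (g \<theta> x)) x = T (partial_deriv i (g \<theta>) x)"
          by (simp add: partial_deriv_def)
      qed
    qed
  qed
qed

section \<open>Closure properties of symbols\<close>

lemma symbol_upto_0I:
  assumes "\<forall>\<^sub>F \<theta> in F. \<forall>x\<in>\<Omega>. g \<theta> differentiable (at x)"
    and "w \<in> B" "\<forall>\<^sub>F \<theta> in F. \<forall>x\<in>X. norm (g \<theta> x) \<le> w \<theta>"
  shows "symbol_upto 0 \<Omega> X F B g"
  unfolding symbol_upto_0 using assms by blast

lemma symbol_upto_0E:
  assumes "symbol_upto k \<Omega> X F B g"
  obtains w where "w \<in> B" "\<forall>\<^sub>F \<theta> in F. \<forall>x\<in>X. norm (g \<theta> x) \<le> w \<theta>"
    and "\<forall>\<^sub>F \<theta> in F. \<forall>x\<in>\<Omega>. g \<theta> differentiable (at x)"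
  using symbol_upto_mono[OF assms, of 0] unfolding symbol_upto_0 by blast

lemma has_frechet_derivative: "g differentiable (at x) \<Longrightarrow> (g has_derivative frechet_derivative g (at x)) (at x)"
  using frechet_derivative_works by blast

lemma partial_deriv_add:
  assumes "g differentiable (at x)" "h differentiable (at x)"
  shows "partial_deriv i (\<lambda>x. g x + h x) x = partial_deriv i g x + partial_deriv i h x"
  using partial_deriv_eq[OF has_derivative_add[OF assms[THEN has_frechet_derivative]]]
  by (simp add: partial_deriv_def)

lemma partial_deriv_bilinear:
  assumes "bounded_bilinear pr" "g differentiable (at x)" "h differentiable (at x)"
  shows "partial_deriv i (\<lambda>x. pr (g x) (h x)) x = pr (g x) (partial_deriv i h x) + pr (partial_deriv i g x) (h x)"
  using partial_deriv_eq[OF bounded_bilinear.FDERIV[OF assms(1) assms(2,3)[THEN has_frechet_derivative]]]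
  by (simp add: partial_deriv_def)

lemma partial_deriv_compose:
  fixes g :: "real^'m::finite \<Rightarrow> 'b::real_normed_vector" and f :: "real^'n::finite \<Rightarrow> real^'m"
  assumes "g differentiable (at (f x))" "f differentiable (at x)"
  shows "partial_deriv i (\<lambda>x. g (f x)) x = (\<Sum>j\<in>UNIV. (partial_deriv i f x $ j) *\<^sub>R partial_deriv j g (f x))"
proof -
  note d = assms[THEN has_frechet_derivative]
  interpret L: linear "frechet_derivative g (at (f x))"
    using d(1) has_derivative_linear by blast
  have "partial_deriv i (\<lambda>x. g (f x)) x = frechet_derivative g (at (f x)) (partial_deriv i f x)"
    using partial_deriv_eq[OF has_derivative_compose[OF d(2,1)]] by (simp add: partial_deriv_def)
  also have "\<dots> = frechet_derivative g (at (f x)) (\<Sum>j\<in>UNIV. (partial_deriv i f x $ j) *\<^sub>R axis j 1)"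
    using basis_expansion[of "partial_deriv i f x"] by (simp add: scalar_mult_eq_scaleR)
  also have "\<dots> = (\<Sum>j\<in>UNIV. (partial_deriv i f x $ j) *\<^sub>R partial_deriv j g (f x))"
    by (simp add: L.sum L.scaleR partial_deriv_def)
  finally show ?thesis .
qed

lemma partial_deriv_inverse:
  fixes g :: "real^'n::finite \<Rightarrow> 'b::real_normed_field"
  assumes "g differentiable (at x)" "g x \<noteq> 0"
  shows "partial_deriv i (\<lambda>x. inverse (g x)) x = - (inverse (g x) * (partial_deriv i g x * inverse (g x)))"
  using partial_deriv_eq[OF Deriv.has_derivative_inverse[OF assms(2) has_frechet_derivative[OF assms(1)]]]
  by (simp add: partial_deriv_def mult.assoc)

lemma partial_deriv_exp:
  fixes g :: "real^'n::finite \<Rightarrow> complex"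
  assumes "g differentiable (at x)"
  shows "partial_deriv i (\<lambda>x. exp (g x)) x = partial_deriv i g x * exp (g x)"
  using partial_deriv_eq[OF has_derivative_compose[OF has_frechet_derivative[OF assms] DERIV_exp[unfolded has_field_derivative_def]]]
  by (simp add: partial_deriv_def mult.commute)

lemma symbol_upto_add:
  fixes g h :: "'p \<Rightarrow> real^'n::finite \<Rightarrow> 'b::real_normed_vector"
  assumes "weights B" "open \<Omega>" "X \<subseteq> \<Omega>" "symbol_upto k \<Omega> X F B g" "symbol_upto k \<Omega> X F B h"
  shows "symbol_upto k \<Omega> X F B (\<lambda>\<theta> x. g \<theta> x + h \<theta> x)"
  using assms(4,5)
proof (induction k arbitrary: g h)
  have zero: "symbol_upto 0 \<Omega> X F B (\<lambda>\<theta> x. g \<theta> x + h \<theta> x)"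
    if asm: "symbol_upto k \<Omega> X F B g" "symbol_upto k \<Omega> X F B h" for k and g h :: "'p \<Rightarrow> real^'n \<Rightarrow> 'b"
  proof -
    obtain w1 w2 where w: "w1 \<in> B" "w2 \<in> B" "\<forall>\<^sub>F \<theta> in F. \<forall>x\<in>X. norm (g \<theta> x) \<le> w1 \<theta>"
       "\<forall>\<^sub>F \<theta> in F. \<forall>x\<in>X. norm (h \<theta> x) \<le> w2 \<theta>" "\<forall>\<^sub>F \<theta> in F. \<forall>x\<in>\<Omega>. g \<theta> differentiable (at x)"
       "\<forall>\<^sub>F \<theta> in F. \<forall>x\<in>\<Omega>. h \<theta> differentiable (at x)"
      using asm by (elim symbol_upto_0E) blast
    show ?thesis
    proof (rule symbol_upto_0I[where w="\<lambda>\<theta>. w1 \<theta> + w2 \<theta>"])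
      show "\<forall>\<^sub>F \<theta> in F. \<forall>x\<in>\<Omega>. (\<lambda>x. g \<theta> x + h \<theta> x) differentiable (at x)"
        using w(5,6) by eventually_elim simp
      show "\<forall>\<^sub>F \<theta> in F. \<forall>x\<in>X. norm (g \<theta> x + h \<theta> x) \<le> w1 \<theta> + w2 \<theta>"
        using w(3,4) by eventually_elim (auto intro!: norm_triangle_mono)
    qed (rule weights_add[OF assms(1) w(1,2)])
  qed
  {
    case 0
    then show ?case by (rule zero)
  next
    case (Suc k)
    obtain "\<forall>\<^sub>F \<theta> in F. \<forall>x\<in>\<Omega>. g \<theta> differentiable (at x)" "\<forall>\<^sub>F \<theta> in F. \<forall>x\<in>\<Omega>. h \<theta> differentiable (at x)"
      using Suc.prems by (elim symbol_upto_0E) blast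
    then have "\<forall>\<^sub>F \<theta> in F. \<forall>x\<in>\<Omega>. partial_deriv i (\<lambda>x. g \<theta> x + h \<theta> x) x = partial_deriv i (g \<theta>) x + partial_deriv i (h \<theta>) x" for i
      by eventually_elim (simp add: partial_deriv_add)
    moreover have "symbol_upto k \<Omega> X F B (\<lambda>\<theta> x. partial_deriv i (g \<theta>) x + partial_deriv i (h \<theta>) x)" for i
      using Suc.prems by (intro Suc.IH) (simp_all add: symbol_upto_Suc)
    ultimately show ?case by (rule symbol_upto_SucI[OF assms(2,3) zero[OF Suc.prems]])
  }
qed

lemma symbol_upto_bilinear:
  fixes g :: "'p \<Rightarrow> real^'n::finite \<Rightarrow> 'b::real_normed_vector"
    and h :: "'p \<Rightarrow> real^'n \<Rightarrow> 'c::real_normed_vector"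
    and pr :: "'b \<Rightarrow> 'c \<Rightarrow> 'd::real_normed_vector"
  assumes "weights B" "open \<Omega>" "X \<subseteq> \<Omega>" "bounded_bilinear pr"
    "symbol_upto k \<Omega> X F B g" "symbol_upto k \<Omega> X F B h"
  shows "symbol_upto k \<Omega> X F B (\<lambda>\<theta> x. pr (g \<theta> x) (h \<theta> x))"
  using assms(5,6)
proof (induction k arbitrary: g h)
  have zero: "symbol_upto 0 \<Omega> X F B (\<lambda>\<theta> x. pr (g \<theta> x) (h \<theta> x))"
    if asm: "symbol_upto k \<Omega> X F B g" "symbol_upto k \<Omega> X F B h" for k and g :: "'p \<Rightarrow> real^'n \<Rightarrow> 'b" and h :: "'p \<Rightarrow> real^'n \<Rightarrow> 'c"
  proof -
    obtain w1 w2 where w: "w1 \<in> B" "w2 \<in> B" "\<forall>\<^sub>F \<theta> in F. \<forall>x\<in>X. norm (g \<theta> x) \<le> w1 \<theta>"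
       "\<forall>\<^sub>F \<theta> in F. \<forall>x\<in>X. norm (h \<theta> x) \<le> w2 \<theta>" "\<forall>\<^sub>F \<theta> in F. \<forall>x\<in>\<Omega>. g \<theta> differentiable (at x)"
       "\<forall>\<^sub>F \<theta> in F. \<forall>x\<in>\<Omega>. h \<theta> differentiable (at x)"
      using asm by (elim symbol_upto_0E) blast
    obtain K where K: "K \<ge> 0" "\<And>a b. norm (pr a b) \<le> norm a * norm b * K"
      using bounded_bilinear.nonneg_bounded[OF assms(4)] by blast
    show ?thesis
    proof (rule symbol_upto_0I[where w="\<lambda>\<theta>. (w1 \<theta> * w2 \<theta>) * K"])
      show "\<forall>\<^sub>F \<theta> in F. \<forall>x\<in>\<Omega>. (\<lambda>x. pr (g \<theta> x) (h \<theta> x)) differentiable (at x)"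
        using w(5,6)
      proof eventually_elim
        case (elim \<theta>)
        show ?case
        proof
          fix x assume x: "x \<in> \<Omega>"
          have "g \<theta> differentiable (at x)" "h \<theta> differentiable (at x)" using elim x by auto
          from bounded_bilinear.FDERIV[OF assms(4) this[THEN has_frechet_derivative]]
          show "(\<lambda>x. pr (g \<theta> x) (h \<theta> x)) differentiable (at x)" by (rule differentiableI)
        qed
      qed
      show "\<forall>\<^sub>F \<theta> in F. \<forall>x\<in>X. norm (pr (g \<theta> x) (h \<theta> x)) \<le> w1 \<theta> * w2 \<theta> * K"
        using w(3,4)
      proof eventually_elim
        case (elim \<theta>)
        show ?case
        proof
          fix x assume x: "x \<in> X"
          then have "norm (g \<theta> x) * norm (h \<theta> x) * K \<le> w1 \<theta> * w2 \<theta> * K"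
            using elim K(1) weights_nonneg[OF assms(1) w(1)] by (intro mult_right_mono mult_mono) auto
          with K(2)[of "g \<theta> x" "h \<theta> x"] show "norm (pr (g \<theta> x) (h \<theta> x)) \<le> w1 \<theta> * w2 \<theta> * K" by linarith
        qed
      qed
      show "(\<lambda>\<theta>. (w1 \<theta> * w2 \<theta>) * K) \<in> B"
        by (rule weights_mult[OF assms(1) weights_mult[OF assms(1) w(1,2)] weights_const[OF assms(1) K(1)]])
    qed
  qed
  {
    case 0
    then show ?case by (rule zero)
  next
    case (Suc k)
    obtain "\<forall>\<^sub>F \<theta> in F. \<forall>x\<in>\<Omega>. g \<theta> differentiable (at x)" "\<forall>\<^sub>F \<theta> in F. \<forall>x\<in>\<Omega>. h \<theta> differentiable (at x)"
      using Suc.prems by (elim symbol_upto_0E) blast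
    then have 1: "\<forall>\<^sub>F \<theta> in F. \<forall>x\<in>\<Omega>. partial_deriv i (\<lambda>x. pr (g \<theta> x) (h \<theta> x)) x =
        pr (g \<theta> x) (partial_deriv i (h \<theta>) x) + pr (partial_deriv i (g \<theta>) x) (h \<theta> x)" for i
      by eventually_elim (simp add: partial_deriv_bilinear[OF assms(4)])
    have "symbol_upto k \<Omega> X F B g" "symbol_upto k \<Omega> X F B h"
      using Suc.prems by (auto elim!: symbol_upto_mono)
    then have "symbol_upto k \<Omega> X F B (\<lambda>\<theta> x. pr (g \<theta> x) (partial_deriv i (h \<theta>) x) + pr (partial_deriv i (g \<theta>) x) (h \<theta> x))" for i
      using Suc.prems
      by (intro symbol_upto_add[OF assms(1-3)] Suc.IH) (simp_all add: symbol_upto_Suc)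
    from symbol_upto_SucI[OF assms(2,3) zero[OF Suc.prems] 1 this] show ?case .
  }
qed

lemma symbol_upto_const:
  fixes c :: "'p \<Rightarrow> 'b::real_normed_vector" and X :: "(real^'n::finite) set"
  assumes "weights B" "w \<in> B" "\<forall>\<^sub>F \<theta> in F. norm (c \<theta>) \<le> w \<theta>"
  shows "symbol_upto k \<Omega> X F B (\<lambda>\<theta> _. c \<theta>)"
  unfolding symbol_upto_def
proof (intro allI impI)
  fix \<alpha> :: "'n list"
  show "(\<forall>\<^sub>F \<theta> in F. \<forall>x\<in>\<Omega>. iter_partial \<alpha> (\<lambda>_. c \<theta>) differentiable at x) \<and>
         (\<exists>w\<in>B. \<forall>\<^sub>F \<theta> in F. \<forall>x\<in>X. norm (iter_partial \<alpha> (\<lambda>_. c \<theta>) x) \<le> w \<theta>)"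
  proof (cases \<alpha> rule: rev_cases)
    case Nil
    then show ?thesis using assms by auto
  next
    case (snoc \<beta> i)
    then have "iter_partial \<alpha> (\<lambda>_. c \<theta>) = (\<lambda>_. 0)" for \<theta>
      by (simp add: iter_partial_append iter_partial_zero)
    then show ?thesis using assms(2) weights_nonneg[OF assms(1,2)] by (auto intro!: bexI[of _ w])
  qed
qed

lemma symbol_upto_sum:
  assumes "weights B" "open \<Omega>" "X \<subseteq> \<Omega>" "finite J" "\<And>j. j \<in> J \<Longrightarrow> symbol_upto k \<Omega> X F B (g j)"
  shows "symbol_upto k \<Omega> X F B (\<lambda>\<theta> x. \<Sum>j\<in>J. g j \<theta> x)"
  using assms(4,5)
proof (induction J rule: finite_induct)
  case empty
  show ?case
    using symbol_upto_const[OF assms(1) weights_const[OF assms(1), of 0], where F=F and c="\<lambda>_. 0"] by simp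
next
  case (insert j J)
  then show ?case using symbol_upto_add[OF assms(1-3), of k F "g j" "\<lambda>\<theta> x. \<Sum>j\<in>J. g j \<theta> x"] by simp
qed

text \<open>
  The first derivatives of a composition are sums of products of the inner first derivatives with
  \<^emph>\<open>other\<close> compositions, namely those of the outer first derivatives. Hence the induction runs over
  all outer families simultaneously.
\<close>

lemma symbol_upto_compose:
  fixes g :: "'p \<Rightarrow> real^'m::finite \<Rightarrow> 'b::real_normed_vector" and f :: "'p \<Rightarrow> real^'n::finite \<Rightarrow> real^'m"
  assumes "weights B" "open \<Omega>" "X \<subseteq> \<Omega>" "symbol_upto k \<Omega>' Y F B g" "symbol_upto k \<Omega> X F B f"
    and maps: "\<forall>\<^sub>F \<theta> in F. f \<theta> ` \<Omega> \<subseteq> \<Omega>' \<and> f \<theta> ` X \<subseteq> Y"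
  shows "symbol_upto k \<Omega> X F B (\<lambda>\<theta> x. g \<theta> (f \<theta> x))"
  using assms(4,5)
proof (induction k arbitrary: g)
  have zero: "symbol_upto 0 \<Omega> X F B (\<lambda>\<theta> x. g \<theta> (f \<theta> x))"
    if asm: "symbol_upto k \<Omega>' Y F B g" "symbol_upto k \<Omega> X F B f" for k and g :: "'p \<Rightarrow> real^'m \<Rightarrow> 'b"
  proof -
    obtain w where w: "w \<in> B" "\<forall>\<^sub>F \<theta> in F. \<forall>x\<in>Y. norm (g \<theta> x) \<le> w \<theta>"
       "\<forall>\<^sub>F \<theta> in F. \<forall>x\<in>\<Omega>'. g \<theta> differentiable (at x)"
       "\<forall>\<^sub>F \<theta> in F. \<forall>x\<in>\<Omega>. f \<theta> differentiable (at x)"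
      using asm by (elim symbol_upto_0E) blast
    show ?thesis
    proof (rule symbol_upto_0I)
      show "\<forall>\<^sub>F \<theta> in F. \<forall>x\<in>\<Omega>. (\<lambda>x. g \<theta> (f \<theta> x)) differentiable (at x)"
        using w(3,4) maps
      proof eventually_elim
        case (elim \<theta>)
        show ?case
        proof
          fix x assume x: "x \<in> \<Omega>"
          have "g \<theta> differentiable (at (f \<theta> x))" "f \<theta> differentiable (at x)" using elim x by auto
          then show "(\<lambda>x. g \<theta> (f \<theta> x)) differentiable (at x)"
            using differentiable_chain_at[of "f \<theta>" x "g \<theta>"] by (simp add: o_def)
        qed
      qed
      show "\<forall>\<^sub>F \<theta> in F. \<forall>x\<in>X. norm (g \<theta> (f \<theta> x)) \<le> w \<theta>"
        using w(2) maps by eventually_elim auto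
    qed (rule w(1))
  qed
  {
    case 0
    then show ?case by (rule zero)
  next
    case (Suc k)
    obtain "\<forall>\<^sub>F \<theta> in F. \<forall>x\<in>\<Omega>'. g \<theta> differentiable (at x)" "\<forall>\<^sub>F \<theta> in F. \<forall>x\<in>\<Omega>. f \<theta> differentiable (at x)"
      using Suc.prems by (elim symbol_upto_0E) blast
    then have 1: "\<forall>\<^sub>F \<theta> in F. \<forall>x\<in>\<Omega>. partial_deriv i (\<lambda>x. g \<theta> (f \<theta> x)) x =
        (\<Sum>j\<in>UNIV. (partial_deriv i (f \<theta>) x $ j) *\<^sub>R partial_deriv j (g \<theta>) (f \<theta> x))" for i
      using maps
    proof eventually_elim
      case (elim \<theta>)
      then show ?case by (auto intro!: partial_deriv_compose)
    qed
    have "symbol_upto k \<Omega> X F B (\<lambda>\<theta> x. \<Sum>j\<in>UNIV. (partial_deriv i (f \<theta>) x $ j) *\<^sub>R partial_deriv j (g \<theta>) (f \<theta> x))" for i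
      using Suc.prems symbol_upto_mono[of "Suc k" \<Omega> X F B f k]
      by (intro symbol_upto_sum[OF assms(1-3)] symbol_upto_bilinear[OF assms(1-3) bounded_bilinear_scaleR]
          symbol_upto_bounded_linear[OF assms(1-3) bounded_linear_vec_nth] Suc.IH)
        (simp_all add: symbol_upto_Suc)
    from symbol_upto_SucI[OF assms(2,3) zero[OF Suc.prems] 1 this] show ?case .
  }
qed

text \<open>
  The first derivatives of \<open>1/g\<close> are polynomial in \<open>1/g\<close> and the derivatives of \<open>g\<close>, so the induction
  feeds on its own conclusion; the bound \<open>w\<close> of order zero implies the bounds of all orders.
\<close>

lemma symbol_upto_inverse:
  fixes g :: "'p \<Rightarrow> real^'n::finite \<Rightarrow> 'b::real_normed_field"
  assumes "weights B" "open \<Omega>" "X \<subseteq> \<Omega>" "symbol_upto k \<Omega> X F B g"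
    and nz: "\<forall>\<^sub>F \<theta> in F. \<forall>x\<in>\<Omega>. g \<theta> x \<noteq> 0"
    and w: "w \<in> B" "\<forall>\<^sub>F \<theta> in F. \<forall>x\<in>X. norm (inverse (g \<theta> x)) \<le> w \<theta>"
  shows "symbol_upto k \<Omega> X F B (\<lambda>\<theta> x. inverse (g \<theta> x))"
  using assms(4)
proof (induction k)
  have zero: "symbol_upto 0 \<Omega> X F B (\<lambda>\<theta> x. inverse (g \<theta> x))"
  proof (rule symbol_upto_0I[OF _ w])
    have "\<forall>\<^sub>F \<theta> in F. \<forall>x\<in>\<Omega>. g \<theta> differentiable (at x)"
      using assms(4) by (elim symbol_upto_0E)
    then show "\<forall>\<^sub>F \<theta> in F. \<forall>x\<in>\<Omega>. (\<lambda>x. inverse (g \<theta> x)) differentiable (at x)"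
      using nz by eventually_elim (auto intro!: differentiable_inverse)
  qed
  {
    case 0
    then show ?case using zero by simp
  next
    case (Suc k)
    have "\<forall>\<^sub>F \<theta> in F. \<forall>x\<in>\<Omega>. g \<theta> differentiable (at x)"
      using assms(4) by (elim symbol_upto_0E)
    then have 1: "\<forall>\<^sub>F \<theta> in F. \<forall>x\<in>\<Omega>. partial_deriv i (\<lambda>x. inverse (g \<theta> x)) x =
        - (inverse (g \<theta> x) * (partial_deriv i (g \<theta>) x * inverse (g \<theta> x)))" for i
      using nz
    proof eventually_elim
      case (elim \<theta>)
      then show ?case by (auto simp: partial_deriv_inverse)
    qed
    have I: "symbol_upto k \<Omega> X F B (\<lambda>\<theta> x. inverse (g \<theta> x))"
      using Suc symbol_upto_mono[of "Suc k" \<Omega> X F B g k] by simp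
    have "symbol_upto k \<Omega> X F B (\<lambda>\<theta> x. - (inverse (g \<theta> x) * (partial_deriv i (g \<theta>) x * inverse (g \<theta> x))))" for i
      using Suc.prems
      by (intro symbol_upto_bounded_linear[OF assms(1-3) bounded_linear_minus[OF bounded_linear_ident]]
        symbol_upto_bilinear[OF assms(1-3) bounded_bilinear_mult] I) (simp_all add: symbol_upto_Suc)
    from symbol_upto_SucI[OF assms(2,3) zero 1 this] show ?case .
  }
qed

text \<open>
  As for the reciprocal, the exponential reproduces itself under differentiation, and a bound of order
  zero is enough. For imaginary \<open>g\<close> this bound is 1, whatever the size of \<open>g\<close>.
\<close>

lemma symbol_upto_exp:
  fixes g :: "'p \<Rightarrow> real^'n::finite \<Rightarrow> complex"
  assumes "weights B" "open \<Omega>" "X \<subseteq> \<Omega>" "symbol_upto k \<Omega> X F B g"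
    and w: "w \<in> B" "\<forall>\<^sub>F \<theta> in F. \<forall>x\<in>X. norm (exp (g \<theta> x)) \<le> w \<theta>"
  shows "symbol_upto k \<Omega> X F B (\<lambda>\<theta> x. exp (g \<theta> x))"
  using assms(4)
proof (induction k)
  have d: "\<forall>\<^sub>F \<theta> in F. \<forall>x\<in>\<Omega>. g \<theta> differentiable (at x)"
    using assms(4) by (elim symbol_upto_0E)
  have zero: "symbol_upto 0 \<Omega> X F B (\<lambda>\<theta> x. exp (g \<theta> x))"
  proof (rule symbol_upto_0I[OF _ w])
    show "\<forall>\<^sub>F \<theta> in F. \<forall>x\<in>\<Omega>. (\<lambda>x. exp (g \<theta> x)) differentiable (at x)"
      using d
    proof eventually_elim
      case (elim \<theta>)
      then show ?case
        using has_derivative_compose[OF has_frechet_derivative DERIV_exp[unfolded has_field_derivative_def]]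
          differentiableI by blast
    qed
  qed
  {
    case 0
    then show ?case using zero by simp
  next
    case (Suc k)
    from d have 1: "\<forall>\<^sub>F \<theta> in F. \<forall>x\<in>\<Omega>. partial_deriv i (\<lambda>x. exp (g \<theta> x)) x =
        partial_deriv i (g \<theta>) x * exp (g \<theta> x)" for i
      by eventually_elim (auto simp: partial_deriv_exp)
    have "symbol_upto k \<Omega> X F B (\<lambda>\<theta> x. partial_deriv i (g \<theta>) x * exp (g \<theta> x))" for i
      using Suc symbol_upto_mono[of "Suc k" \<Omega> X F B g k]
      by (intro symbol_upto_bilinear[OF assms(1-3) bounded_bilinear_mult]) (simp_all add: symbol_upto_Suc)
    from symbol_upto_SucI[OF assms(2,3) zero 1 this] show ?case .
  }
qed

lemma symbol_add:
  assumes "weights B" "open \<Omega>" "X \<subseteq> \<Omega>" "symbol \<Omega> X F B g" "symbol \<Omega> X F B h"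
  shows "symbol \<Omega> X F B (\<lambda>\<theta> x. g \<theta> x + h \<theta> x)"
  using assms symbol_upto_add unfolding symbol_iff_upto by blast

lemma symbol_bilinear:
  assumes "weights B" "open \<Omega>" "X \<subseteq> \<Omega>" "bounded_bilinear pr" "symbol \<Omega> X F B g" "symbol \<Omega> X F B h"
  shows "symbol \<Omega> X F B (\<lambda>\<theta> x. pr (g \<theta> x) (h \<theta> x))"
  using symbol_upto_bilinear[OF assms(1-4)] assms(5,6) unfolding symbol_iff_upto by blast

lemmas symbol_mult = symbol_bilinear[OF _ _ _ bounded_bilinear_mult]

lemma symbol_bounded_linear:
  assumes "weights B" "open \<Omega>" "X \<subseteq> \<Omega>" "bounded_linear T" "symbol \<Omega> X F B g"
  shows "symbol \<Omega> X F B (\<lambda>\<theta> x. T (g \<theta> x))"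
  using symbol_upto_bounded_linear[OF assms(1-4)] assms(5) unfolding symbol_iff_upto by blast

lemma symbol_const:
  assumes "weights B" "w \<in> B" "\<forall>\<^sub>F \<theta> in F. norm (c \<theta>) \<le> w \<theta>"
  shows "symbol \<Omega> X F B (\<lambda>\<theta> _. c \<theta>)"
  using symbol_upto_const[OF assms] unfolding symbol_iff_upto by blast

lemma symbol_sum:
  assumes "weights B" "open \<Omega>" "X \<subseteq> \<Omega>" "finite J" "\<And>j. j \<in> J \<Longrightarrow> symbol \<Omega> X F B (g j)"
  shows "symbol \<Omega> X F B (\<lambda>\<theta> x. \<Sum>j\<in>J. g j \<theta> x)"
  using symbol_upto_sum[OF assms(1-4), where g=g] assms(5) unfolding symbol_iff_upto by blast

lemma symbol_compose:
  fixes g :: "'p \<Rightarrow> real^'m::finite \<Rightarrow> 'b::real_normed_vector" and f :: "'p \<Rightarrow> real^'n::finite \<Rightarrow> real^'m"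
  assumes "weights B" "open \<Omega>" "X \<subseteq> \<Omega>" "symbol \<Omega>' Y F B g" "symbol \<Omega> X F B f"
    and "\<forall>\<^sub>F \<theta> in F. f \<theta> ` \<Omega> \<subseteq> \<Omega>' \<and> f \<theta> ` X \<subseteq> Y"
  shows "symbol \<Omega> X F B (\<lambda>\<theta> x. g \<theta> (f \<theta> x))"
  using symbol_upto_compose[OF assms(1-3) _ _ assms(6)] assms(4,5) unfolding symbol_iff_upto by blast

lemma symbol_inverse:
  fixes g :: "'p \<Rightarrow> real^'n::finite \<Rightarrow> 'b::real_normed_field"
  assumes "weights B" "open \<Omega>" "X \<subseteq> \<Omega>" "symbol \<Omega> X F B g"
    and "\<forall>\<^sub>F \<theta> in F. \<forall>x\<in>\<Omega>. g \<theta> x \<noteq> 0" "w \<in> B" "\<forall>\<^sub>F \<theta> in F. \<forall>x\<in>X. norm (inverse (g \<theta> x)) \<le> w \<theta>"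
  shows "symbol \<Omega> X F B (\<lambda>\<theta> x. inverse (g \<theta> x))"
  using symbol_upto_inverse[OF assms(1-3) _ assms(5-)] assms(4) unfolding symbol_iff_upto by blast

lemma symbol_exp:
  fixes g :: "'p \<Rightarrow> real^'n::finite \<Rightarrow> complex"
  assumes "weights B" "open \<Omega>" "X \<subseteq> \<Omega>" "symbol \<Omega> X F B g"
    and "w \<in> B" "\<forall>\<^sub>F \<theta> in F. \<forall>x\<in>X. norm (exp (g \<theta> x)) \<le> w \<theta>"
  shows "symbol \<Omega> X F B (\<lambda>\<theta> x. exp (g \<theta> x))"
  using symbol_upto_exp[OF assms(1-3) _ assms(5-)] assms(4) unfolding symbol_iff_upto by blast

lemma symbol_reparam:
  fixes \<Omega> :: "(real^'n::finite) set"
  assumes "symbol \<Omega> X F B g" "filterlim \<pi> F F'" "\<And>w. w \<in> B \<Longrightarrow> (\<lambda>\<theta>. w (\<pi> \<theta>)) \<in> B'"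
  shows "symbol \<Omega> X F' B' (\<lambda>\<theta>. g (\<pi> \<theta>))"
  unfolding symbol_def
proof (intro allI conjI)
  fix \<alpha> :: "'n list"
  obtain w where 1: "\<forall>\<^sub>F \<theta> in F. \<forall>x\<in>\<Omega>. iter_partial \<alpha> (g \<theta>) differentiable (at x)"
    and w: "w \<in> B" "\<forall>\<^sub>F \<theta> in F. \<forall>x\<in>X. norm (iter_partial \<alpha> (g \<theta>) x) \<le> w \<theta>"
    using assms(1) unfolding symbol_def by blast
  show "\<forall>\<^sub>F \<theta> in F'. \<forall>x\<in>\<Omega>. iter_partial \<alpha> (g (\<pi> \<theta>)) differentiable (at x)"
    using filterlim_iff[THEN iffD1, OF assms(2), rule_format, OF 1] .
  show "\<exists>w\<in>B'. \<forall>\<^sub>F \<theta> in F'. \<forall>x\<in>X. norm (iter_partial \<alpha> (g (\<pi> \<theta>)) x) \<le> w \<theta>"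
    using filterlim_iff[THEN iffD1, OF assms(2), rule_format, OF w(2)] assms(3)[OF w(1)]
    by (rule bexI)
qed

text \<open>
  With \<open>X = {}\<close> and a one-point parameter set, the closure properties of symbols become those of
  smooth functions.
\<close>

definition const_weights :: "('p \<Rightarrow> real) set" where
  "const_weights = {(\<lambda>_. c) |c. 0 \<le> c}"

lemma weights_const_weights: "weights (const_weights :: ('p \<Rightarrow> real) set)"
  unfolding weights_def const_weights_def
proof (intro conjI ballI allI impI)
  fix v w :: "'p \<Rightarrow> real" assume "v \<in> {\<lambda>_. c |c. 0 \<le> c}" "w \<in> {\<lambda>_. c |c. 0 \<le> c}"
  then obtain c d where "v = (\<lambda>_. c)" "w = (\<lambda>_. d)" "c \<ge> 0" "d \<ge> 0" by blast
  moreover from this have "0 \<le> c + d" "0 \<le> c * d" by simp_all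
  ultimately show "(\<lambda>\<theta>. v \<theta> + w \<theta>) \<in> {\<lambda>_. c |c. 0 \<le> c}" "(\<lambda>\<theta>. v \<theta> * w \<theta>) \<in> {\<lambda>_. c |c. 0 \<le> c}"
    by blast+
qed auto

lemma smooth_on_iff_symbol:
  "smooth_on \<Omega> g \<longleftrightarrow> symbol \<Omega> {} (principal (UNIV :: unit set)) const_weights (\<lambda>_. g)"
  unfolding smooth_on_def symbol_def const_weights_def by (auto simp: eventually_principal)

lemma smooth_on_add:
  "open \<Omega> \<Longrightarrow> smooth_on \<Omega> g \<Longrightarrow> smooth_on \<Omega> h \<Longrightarrow> smooth_on \<Omega> (\<lambda>x. g x + h x)"
  unfolding smooth_on_iff_symbol using symbol_add[OF weights_const_weights] by fastforce

lemma smooth_on_bounded_linear: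
  "open \<Omega> \<Longrightarrow> bounded_linear T \<Longrightarrow> smooth_on \<Omega> g \<Longrightarrow> smooth_on \<Omega> (\<lambda>x. T (g x))"
  unfolding smooth_on_iff_symbol by (rule symbol_bounded_linear[OF weights_const_weights]) auto

lemma smooth_on_mult:
  fixes g h :: "real^'n::finite \<Rightarrow> 'b::real_normed_algebra"
  shows "open \<Omega> \<Longrightarrow> smooth_on \<Omega> g \<Longrightarrow> smooth_on \<Omega> h \<Longrightarrow> smooth_on \<Omega> (\<lambda>x. g x * h x)"
  unfolding smooth_on_iff_symbol by (rule symbol_mult[OF weights_const_weights]) auto

lemma smooth_on_const: "smooth_on \<Omega> (\<lambda>_. c)"
  unfolding smooth_on_iff_symbol
  by (rule symbol_const[OF weights_const_weights, where w="\<lambda>_. norm c"]) (auto simp: const_weights_def)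

lemma smooth_on_sum:
  "open \<Omega> \<Longrightarrow> finite J \<Longrightarrow> (\<And>j. j \<in> J \<Longrightarrow> smooth_on \<Omega> (g j)) \<Longrightarrow> smooth_on \<Omega> (\<lambda>x. \<Sum>j\<in>J. g j x)"
  unfolding smooth_on_iff_symbol by (rule symbol_sum[OF weights_const_weights]) auto

lemma smooth_on_prod:
  fixes g :: "'j \<Rightarrow> real^'n::finite \<Rightarrow> 'b::{real_normed_algebra,comm_ring_1}"
  shows "open \<Omega> \<Longrightarrow> finite J \<Longrightarrow> (\<And>j. j \<in> J \<Longrightarrow> smooth_on \<Omega> (g j)) \<Longrightarrow> smooth_on \<Omega> (\<lambda>x. \<Prod>j\<in>J. g j x)"
  by (rotate_tac 1, induction J rule: finite_induct) (auto intro: smooth_on_const smooth_on_mult)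

lemma smooth_on_compose:
  fixes g :: "real^'m::finite \<Rightarrow> 'b::real_normed_vector" and f :: "real^'n::finite \<Rightarrow> real^'m"
  shows "open \<Omega> \<Longrightarrow> smooth_on \<Omega>' g \<Longrightarrow> smooth_on \<Omega> f \<Longrightarrow> f ` \<Omega> \<subseteq> \<Omega>' \<Longrightarrow> smooth_on \<Omega> (\<lambda>x. g (f x))"
  unfolding smooth_on_iff_symbol by (rule symbol_compose[OF weights_const_weights]) auto

section \<open>Integration by parts and nonstationary phase\<close>

lemma has_derivative_zero_outside:
  assumes "compact K" "\<And>x. x \<notin> K \<Longrightarrow> g x = 0" "x \<notin> K"
  shows "(g has_derivative (\<lambda>_. 0)) (at x)"
proof -
  have "open (- K)" using assms(1) compact_imp_closed by blast
  then show ?thesis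
    using has_derivative_cong_open[of "-K" x g "\<lambda>_. 0" "\<lambda>_. 0"] assms by auto
qed

lemma integral_translation:
  fixes g :: "'a::euclidean_space \<Rightarrow> 'b::{banach,second_countable_topology}"
  assumes [measurable]: "g \<in> borel_measurable borel"
  shows "(LINT x|lborel. g (c + x)) = (LINT x|lborel. g x)"
proof -
  have "(LINT x|lborel. g x) = (LINT x|distr lborel borel ((+) c). g x)"
    by (simp add: lborel_distr_plus)
  also have "\<dots> = (LINT x|lborel. g (c + x))" by (subst integral_distr) auto
  finally show ?thesis by simp
qed

text \<open>
  By translation invariance every difference quotient of \<open>g\<close> has integral zero. The quotients are bounded
  by a constant on a fixed ball, so that dominated convergence passes this to the derivative.
\<close>

lemma integral_partial_deriv_eq_0:
  fixes g :: "real^'n::finite \<Rightarrow> complex"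
  assumes diff: "\<And>x. g differentiable (at x)" and cont: "continuous_on UNIV (partial_deriv i g)"
    and K: "compact K" "\<And>x. x \<notin> K \<Longrightarrow> g x = 0"
  shows "(LINT x|lborel. partial_deriv i g x) = 0"
proof -
  define e :: "real^'n" where "e = axis i 1"
  have e: "norm e = 1" by (simp add: e_def)
  have g_cont: "continuous_on UNIV g"
    using diff by (simp add: continuous_on_of_differentiable)
  have [measurable]: "g \<in> borel_measurable borel" using g_cont by (rule borel_measurable_continuous_onI)
  have supp: "partial_deriv i g x = 0" if "x \<notin> K" for x
    using partial_deriv_eq[OF has_derivative_zero_outside[OF K that]] .
  obtain M where M: "M \<ge> 0" "\<And>x. norm (partial_deriv i g x) \<le> M"
  proof -
    have "bounded (partial_deriv i g ` K)"
      using compact_continuous_image[OF continuous_on_subset[OF cont] K(1)] compact_imp_bounded by blast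
    then obtain M where "\<forall>x\<in>K. norm (partial_deriv i g x) \<le> M"
      unfolding bounded_iff by blast
    then have "norm (partial_deriv i g x) \<le> max M 0" for x
      using supp[of x] by (cases "x \<in> K") auto
    then show thesis using that[of "max M 0"] by simp
  qed
  have line: "((\<lambda>t. g (x + t *\<^sub>R e)) has_vector_derivative partial_deriv i g (x + t *\<^sub>R e)) (at t)" for x t
  proof -
    have 1: "((\<lambda>t. x + t *\<^sub>R e) has_derivative (\<lambda>t. t *\<^sub>R e)) (at t)"
      by (auto intro!: derivative_eq_intros)
    have D: "(g has_derivative frechet_derivative g (at (x + t *\<^sub>R e))) (at (x + t *\<^sub>R e))"
      using has_frechet_derivative[OF diff] .
    then interpret L: linear "frechet_derivative g (at (x + t *\<^sub>R e))"
      by (rule has_derivative_linear)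
    show ?thesis
      using has_derivative_compose[OF 1 D]
      by (simp add: has_vector_derivative_def partial_deriv_def L.scaleR flip: e_def)
  qed
  define h where "h n = 1 / real (Suc n)" for n
  have h: "0 < h n" "h n \<le> 1" for n by (auto simp: h_def)
  have h0: "h \<longlonglongrightarrow> 0" unfolding h_def using LIMSEQ_inverse_real_of_nat by (simp add: inverse_eq_divide)
  define s where "s n x = (1 / h n) *\<^sub>R (g (h n *\<^sub>R e + x) - g x)" for n x
  obtain R where R: "\<And>x. x \<in> K \<Longrightarrow> norm x \<le> R"
    using compact_imp_bounded[OF K(1)] unfolding bounded_iff by blast
  have bound: "norm (s n x) \<le> indicator (cball 0 (R + 1)) x *\<^sub>R M" for n x
  proof (cases "x \<in> cball 0 (R + 1)")
    case True
    have "norm (g (x + h n *\<^sub>R e) - g (x + 0 *\<^sub>R e)) \<le> M * norm (h n - 0)"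
    proof (rule differentiable_bound[where S="{0..h n}" and f'="\<lambda>t s. s *\<^sub>R partial_deriv i g (x + t *\<^sub>R e)"])
      fix t assume "t \<in> {0..h n}"
      show "((\<lambda>t. g (x + t *\<^sub>R e)) has_derivative (\<lambda>s. s *\<^sub>R partial_deriv i g (x + t *\<^sub>R e))) (at t within {0..h n})"
        using line[of x t] has_derivative_at_withinI unfolding has_vector_derivative_def by blast
      show "onorm (\<lambda>s. s *\<^sub>R partial_deriv i g (x + t *\<^sub>R e)) \<le> M"
        by (rule onorm_bound) (use M in \<open>auto intro!: mult_left_mono simp: mult.commute[of M]\<close>)
    qed (use h[of n] in auto)
    then have "norm (s n x) \<le> (1 / h n) * (M * h n)"
      using h[of n] unfolding s_def by (simp add: add.commute pos_divide_le_eq)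
    then show ?thesis using True h(1)[of n] by simp
  next
    case False
    then have n: "norm x > R + 1" by simp
    have "norm (h n *\<^sub>R e) \<le> 1" using h[of n] e by simp
    then have "norm (h n *\<^sub>R e + x) > R"
      using n norm_triangle_ineq4[of "h n *\<^sub>R e + x" "h n *\<^sub>R e"] by simp
    then have "g (h n *\<^sub>R e + x) = 0" "g x = 0" using K(2) R n by fastforce+
    then show ?thesis using False by (simp add: s_def)
  qed
  have lim: "(\<lambda>n. s n x) \<longlonglongrightarrow> partial_deriv i g x" for x
  proof -
    have "((\<lambda>t. (1 / t) *\<^sub>R (g (x + t *\<^sub>R e) - g x)) \<longlongrightarrow> partial_deriv i g x) (at 0)"
    proof (rule Lim_null[THEN iffD2], rule tendsto_norm_zero_cancel)
      have "((\<lambda>t. norm (g (x + t *\<^sub>R e) - g x - t *\<^sub>R partial_deriv i g x) / norm t) \<longlongrightarrow> 0) (at 0)"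
        using line[of x 0] unfolding has_vector_derivative_def has_derivative_at by simp
      moreover have "\<forall>\<^sub>F t in at 0. norm (g (x + t *\<^sub>R e) - g x - t *\<^sub>R partial_deriv i g x) / norm t =
          norm ((1 / t) *\<^sub>R (g (x + t *\<^sub>R e) - g x) - partial_deriv i g x)"
        using eventually_at_ball'[OF zero_less_one, of 0 UNIV]
      proof eventually_elim
        case (elim t)
        then have "(1 / t) *\<^sub>R (g (x + t *\<^sub>R e) - g x) - partial_deriv i g x =
            (1 / t) *\<^sub>R (g (x + t *\<^sub>R e) - g x - t *\<^sub>R partial_deriv i g x)"
          by (simp add: scaleR_diff_right)
        then show ?case by simp
      qed
      ultimately show "((\<lambda>t. norm ((1 / t) *\<^sub>R (g (x + t *\<^sub>R e) - g x) - partial_deriv i g x)) \<longlongrightarrow> 0) (at 0)"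
        using tendsto_cong by fast
    qed
    moreover have "filterlim h (at 0) sequentially"
      using h0 h(1) by (intro filterlim_atI) (auto intro!: always_eventually simp: less_le)
    ultimately have "(\<lambda>n. (1 / h n) *\<^sub>R (g (x + h n *\<^sub>R e) - g x)) \<longlonglongrightarrow> partial_deriv i g x"
      by (rule filterlim_compose)
    then show ?thesis by (simp add: s_def add.commute)
  qed
  have "(\<lambda>n. LINT x|lborel. s n x) \<longlonglongrightarrow> (LINT x|lborel. partial_deriv i g x)"
  proof (rule integral_dominated_convergence[where w="\<lambda>x. indicator (cball 0 (R + 1)) x *\<^sub>R M"])
    show "partial_deriv i g \<in> borel_measurable lborel"
      using borel_measurable_continuous_onI[OF cont] by simp
    show "s n \<in> borel_measurable lborel" for n unfolding s_def by measurable
    show "integrable lborel (\<lambda>x::real^'n. indicator (cball 0 (R + 1)) x *\<^sub>R M)"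
      by (intro integrableI_bounded_set_indicator[where B=M]) (use emeasure_bounded_finite[of "cball (0::real^'n) (R + 1)"] in \<open>auto simp: M(1)\<close>)
  qed (use bound lim in auto)
  moreover have "(LINT x|lborel. s n x) = 0" for n
  proof -
    obtain B where B: "\<forall>x\<in>K. norm (g x) \<le> B"
      using compact_imp_bounded[OF compact_continuous_image[OF continuous_on_subset[OF g_cont] K(1)]]
      unfolding bounded_iff by blast
    have int: "integrable lborel g"
      by (rule integrableI_bounded_set[where A=K and B=B])
        (use K B emeasure_bounded_finite[OF compact_imp_bounded[OF K(1)]] in \<open>auto simp: compact_imp_closed\<close>)
    have "integrable lborel (\<lambda>x. g (h n *\<^sub>R e + x))"
      using integrable_distr_eq[of "(+) (h n *\<^sub>R e)" lborel borel g] int by (simp add: lborel_distr_plus)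
    then show ?thesis
      unfolding s_def using int by (simp add: integral_translation)
  qed
  ultimately have "(\<lambda>n::nat. 0) \<longlonglongrightarrow> (LINT x|lborel. partial_deriv i g x)" by simp
  then show ?thesis using LIMSEQ_unique tendsto_const by blast
qed

lemma extend_differentiable:
  fixes g :: "real^'n::finite \<Rightarrow> 'b::real_normed_vector"
  assumes "open X" "compact K" "K \<subseteq> X" "\<And>x. x \<in> X - K \<Longrightarrow> g x = 0" "\<And>x. x \<in> X \<Longrightarrow> g differentiable (at x)"
  shows "(\<lambda>x. indicator X x *\<^sub>R g x) differentiable (at x)" (is ?A)
    and "partial_deriv i (\<lambda>x. indicator X x *\<^sub>R g x) x = indicator X x *\<^sub>R partial_deriv i g x" (is ?B)
proof -
  let ?E = "\<lambda>x. indicator X x *\<^sub>R g x"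
  have "?A \<and> ?B"
  proof (cases "x \<in> X")
    case True
    have eq: "?E y = g y" if "y \<in> X" for y using that by simp
    show ?thesis
      using differentiable_cong_open[OF assms(1) True eq] partial_deriv_cong_open[OF assms(1) True eq] assms(5) True
      by simp
  next
    case False
    then have "x \<notin> K" using assms(3) by auto
    have "(?E has_derivative (\<lambda>_. 0)) (at x)"
      by (rule has_derivative_zero_outside[OF assms(2) _ \<open>x \<notin> K\<close>]) (use assms(4) in \<open>auto simp: indicator_def\<close>)
    then show ?thesis using False partial_deriv_eq[of ?E "\<lambda>_. 0" x] differentiableI by auto
  qed
  then show ?A ?B by auto
qed

lemma partial_deriv_zero_outside:
  assumes "open X" "compact K" "\<And>x. x \<in> X - K \<Longrightarrow> g x = 0" "x \<in> X - K"
  shows "partial_deriv i g x = 0"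
proof -
  have "open (X - K)" using assms by (simp add: open_Diff compact_imp_closed)
  then show ?thesis using partial_deriv_cong_open[of "X - K" x g "\<lambda>_. 0" i] assms(3,4) by simp
qed

lemma set_integral_partial_deriv_eq_0:
  fixes g :: "real^'n::finite \<Rightarrow> complex"
  assumes X: "open X" "compact K" "K \<subseteq> X" and g0: "\<And>x. x \<in> X - K \<Longrightarrow> g x = 0"
    and "\<And>x. x \<in> X \<Longrightarrow> g differentiable (at x)" "\<And>x. x \<in> X \<Longrightarrow> partial_deriv i g differentiable (at x)"
  shows "(LINT x:X|lborel. partial_deriv i g x) = 0"
proof -
  let ?E = "\<lambda>x. indicator X x *\<^sub>R g x"
  have p0: "partial_deriv i g x = 0" if "x \<in> X - K" for x
    using partial_deriv_zero_outside[OF X(1,2) g0 that] by simp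
  have E': "partial_deriv i ?E = (\<lambda>x. indicator X x *\<^sub>R partial_deriv i g x)"
    by (rule ext, rule extend_differentiable(2)[OF X g0 assms(5)])
  have "(LINT x|lborel. partial_deriv i ?E x) = 0"
  proof (rule integral_partial_deriv_eq_0[OF _ _ X(2)])
    show "?E differentiable (at x)" for x by (rule extend_differentiable(1)[OF X g0 assms(5)])
    show "continuous_on UNIV (partial_deriv i ?E)"
      unfolding E' using extend_differentiable(1)[OF X p0 assms(6)]
      by (simp add: continuous_on_of_differentiable)
    show "?E x = 0" if "x \<notin> K" for x using g0 that by (auto simp: indicator_def)
  qed
  then show ?thesis unfolding set_lebesgue_integral_def E' .
qed

lemma set_integrable_compact_support:
  fixes g :: "'a::euclidean_space \<Rightarrow> 'b::{banach,second_countable_topology}"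
  assumes "open X" "compact K" "K \<subseteq> X" "\<And>x. x \<in> X - K \<Longrightarrow> g x = 0" "continuous_on X g"
  shows "set_integrable lborel X g"
proof -
  have "set_integrable lborel K g"
    unfolding set_integrable_def
    by (rule borel_integrable_compact[OF assms(2) continuous_on_subset[OF assms(5,3)]])
  moreover have "(\<lambda>x. indicator K x *\<^sub>R g x) = (\<lambda>x. indicator X x *\<^sub>R g x)"
    using assms(3,4) by (auto simp: indicator_def fun_eq_iff)
  ultimately show ?thesis unfolding set_integrable_def by simp
qed

lemma norm_set_integral_le:
  fixes g :: "'a::euclidean_space \<Rightarrow> 'b::{banach,second_countable_topology}"
  assumes "open X" "compact K" "K \<subseteq> X" "\<And>x. x \<in> X - K \<Longrightarrow> g x = 0" "continuous_on X g"
    and "\<And>x. x \<in> K \<Longrightarrow> norm (g x) \<le> c" "0 \<le> c"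
  shows "norm (LINT x:X|lborel. g x) \<le> measure lborel K * c"
proof -
  have K: "K \<in> sets lborel" "emeasure lborel K < \<infinity>"
    using assms(2) emeasure_bounded_finite[OF compact_imp_bounded[OF assms(2)]] by (auto simp: compact_imp_closed)
  have "norm (LINT x:X|lborel. g x) \<le> (LINT x|lborel. norm (indicator X x *\<^sub>R g x))"
    unfolding set_lebesgue_integral_def by (rule integral_norm_bound)
  also have "\<dots> \<le> (LINT x|lborel. indicator K x *\<^sub>R c)"
  proof (rule integral_mono)
    show "integrable lborel (\<lambda>x. norm (indicator X x *\<^sub>R g x))"
      using set_integrable_compact_support[OF assms(1-5)] unfolding set_integrable_def by (rule integrable_norm)
    show "integrable lborel (\<lambda>x. indicator K x *\<^sub>R c)"
      using K by (intro integrableI_bounded_set_indicator[where B=c]) (auto simp: assms(7))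
    show "norm (indicator X x *\<^sub>R g x) \<le> indicator K x *\<^sub>R c" for x
      using assms(3,4,6) by (auto simp: indicator_def)
  qed
  also have "\<dots> = measure lborel K * c"
    using K by simp
  finally show ?thesis .
qed

lemma symbol_order_one:
  assumes "symbol X Y F B g"
  shows "\<forall>\<^sub>F \<theta> in F. \<forall>x\<in>X. g \<theta> differentiable (at x) \<and> partial_deriv i (g \<theta>) differentiable (at x)"
  using symbol_differentiable[OF assms] symbol_differentiable[OF symbol_partial_deriv[OF assms, of i]]
  by eventually_elim auto

text \<open>
  The principle of nonstationary phase. If the vector field \<open>a\<close> differentiates the phase \<open>\<psi>\<close> to
  \<open>\<omega>\<close>, then \<open>\<i> \<omega> g exp(\<i>\<psi>)\<close> equals \<open>div(a g exp(\<i>\<psi>)) - div(a g) exp(\<i>\<psi>)\<close>, and the first divergence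
  integrates to zero. Each such step gains a factor \<open>\<omega>\<close> and replaces the amplitude \<open>g\<close> by \<open>div(a g)\<close>,
  which is a symbol with the same support. The phase is a symbol on \<open>{}\<close> only, because it grows with the
  covariables.
\<close>

lemma nonstationary_phase:
  fixes g :: "'p \<Rightarrow> real^'n::finite \<Rightarrow> complex" and a :: "'n \<Rightarrow> 'p \<Rightarrow> real^'n \<Rightarrow> real"
    and \<psi> :: "'p \<Rightarrow> real^'n \<Rightarrow> real" and \<omega> :: "'p \<Rightarrow> real"
  assumes B: "weights B" and X: "open X" "compact K" "K \<subseteq> X"
    and g: "symbol X X F B g" "\<forall>\<^sub>F \<theta> in F. \<forall>x\<in>X-K. g \<theta> x = 0"
    and a: "\<And>j. symbol X X F B (a j)" and \<psi>: "symbol X {} F B \<psi>"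
    and eq: "\<forall>\<^sub>F \<theta> in F. \<forall>x\<in>X. (\<Sum>j\<in>UNIV. a j \<theta> x * partial_deriv j (\<psi> \<theta>) x) = \<omega> \<theta>"
    and \<omega>: "\<forall>\<^sub>F \<theta> in F. 0 \<le> \<omega> \<theta>"
  shows "\<exists>w\<in>B. \<forall>\<^sub>F \<theta> in F. \<omega> \<theta> ^ p * norm (LINT x:X|lborel. g \<theta> x * exp (\<i> * of_real (\<psi> \<theta> x))) \<le> w \<theta>"
  using g
proof (induction p arbitrary: g)
  case 0
  obtain w where w: "w \<in> B" "\<forall>\<^sub>F \<theta> in F. \<forall>x\<in>X. norm (g \<theta> x) \<le> w \<theta>"
    using symbol_bound[OF 0(1)] .
  have "(\<lambda>\<theta>. measure lborel K * w \<theta>) \<in> B"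
    using weights_mult[OF B weights_const[OF B] w(1)] by simp
  moreover have "\<forall>\<^sub>F \<theta> in F. \<omega> \<theta> ^ 0 * norm (LINT x:X|lborel. g \<theta> x * exp (\<i> * of_real (\<psi> \<theta> x))) \<le> measure lborel K * w \<theta>"
    using w(2) 0(2) symbol_differentiable[OF 0(1)] symbol_differentiable[OF \<psi>]
  proof eventually_elim
    case (elim \<theta>)
    have c: "continuous_on X (g \<theta>)" "continuous_on X (\<psi> \<theta>)"
      using elim(3,4) by (auto intro!: continuous_on_of_differentiable)
    show ?case
      unfolding power_0 mult_1
      by (rule norm_set_integral_le[OF X])
        (use elim X weights_nonneg[OF B w(1)] in \<open>auto simp: norm_mult intro!: continuous_intros c\<close>)
  qed
  ultimately show ?case
    by (intro bexI[where x="\<lambda>\<theta>. measure lborel K * w \<theta>"])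
next
  case (Suc p)
  define T where "T \<theta> x = (\<Sum>j\<in>UNIV. partial_deriv j (\<lambda>x. a j \<theta> x *\<^sub>R g \<theta> x) x)" for \<theta> x
  define E where "E \<theta> x = exp (\<i> * of_real (\<psi> \<theta> x))" for \<theta> x
  note XX = X(1) subset_refl
  have ag: "symbol X X F B (\<lambda>\<theta> x. a j \<theta> x *\<^sub>R g \<theta> x)" for j
    by (rule symbol_bilinear[OF B XX bounded_bilinear_scaleR a Suc.prems(1)])
  have T_symbol: "symbol X X F B T"
    unfolding T_def by (rule symbol_sum[OF B XX]) (auto intro: symbol_partial_deriv[OF ag])
  have T0: "\<forall>\<^sub>F \<theta> in F. \<forall>x\<in>X-K. T \<theta> x = 0"
    using Suc.prems(2)
  proof eventually_elim
    case (elim \<theta>)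
    have "partial_deriv j (\<lambda>x. a j \<theta> x *\<^sub>R g \<theta> x) x = 0" if "x \<in> X - K" for x j
      by (rule partial_deriv_zero_outside[OF X(1,2) _ that]) (use elim in auto)
    then show ?case by (simp add: T_def)
  qed
  obtain w where w: "w \<in> B" "\<forall>\<^sub>F \<theta> in F. \<omega> \<theta> ^ p * norm (LINT x:X|lborel. T \<theta> x * E \<theta> x) \<le> w \<theta>"
    using Suc.IH[OF T_symbol T0] unfolding E_def by blast
  have i\<psi>: "symbol X {} F B (\<lambda>\<theta> x. \<i> * of_real (\<psi> \<theta> x))"
    by (rule symbol_bounded_linear[OF B X(1) _ _ \<psi>])
      (auto intro: bounded_linear_compose[OF bounded_linear_mult_right bounded_linear_of_real, unfolded o_def])
  \<comment> \<open>The order-zero bound on the empty set is vacuous, so any weight serves.\<close>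
  have E: "symbol X {} F B E"
    unfolding E_def by (rule symbol_exp[OF B X(1) _ i\<psi>, where w="\<lambda>_. 0"]) (auto intro: weights_const[OF B])
  have agE: "symbol X {} F B (\<lambda>\<theta> x. (a j \<theta> x *\<^sub>R g \<theta> x) * E \<theta> x)" for j
    by (rule symbol_mult[OF B X(1)]) (use symbol_mono[OF ag[of j], of X "{}"] E in auto)
  have agE1: "\<forall>\<^sub>F \<theta> in F. \<forall>j. \<forall>x\<in>X. (\<lambda>x. (a j \<theta> x *\<^sub>R g \<theta> x) * E \<theta> x) differentiable (at x) \<and>
      partial_deriv j (\<lambda>x. (a j \<theta> x *\<^sub>R g \<theta> x) * E \<theta> x) differentiable (at x)"
    using symbol_order_one[OF agE] by (simp add: eventually_all_finite)
  have ag1: "\<forall>\<^sub>F \<theta> in F. \<forall>j. \<forall>x\<in>X. (\<lambda>x. a j \<theta> x *\<^sub>R g \<theta> x) differentiable (at x)"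
    using symbol_differentiable[OF ag] by (simp add: eventually_all_finite)
  have id: "\<forall>\<^sub>F \<theta> in F. \<omega> \<theta> * norm (LINT x:X|lborel. g \<theta> x * E \<theta> x) = norm (LINT x:X|lborel. T \<theta> x * E \<theta> x)"
    using eq \<omega> agE1 ag1 Suc.prems(2) symbol_differentiable[OF E] symbol_differentiable[OF \<psi>]
      symbol_differentiable[OF T_symbol] T0 symbol_differentiable[OF Suc.prems(1)] symbol_differentiable[OF i\<psi>]
  proof eventually_elim
    case (elim \<theta>)
    have dE: "partial_deriv j (E \<theta>) x = \<i> * of_real (partial_deriv j (\<psi> \<theta>) x) * E \<theta> x" if "x \<in> X" for j x
    proof -
      have bl: "bounded_linear (\<lambda>t::real. \<i> * of_real t)"
        by (rule bounded_linear_compose[OF bounded_linear_mult_right bounded_linear_of_real, unfolded o_def])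
      have "partial_deriv j (\<lambda>x. \<i> * of_real (\<psi> \<theta> x)) x = \<i> * of_real (partial_deriv j (\<psi> \<theta>) x)"
        using partial_deriv_eq[OF bounded_linear.has_derivative[OF bl has_frechet_derivative], of "\<psi> \<theta>" x j] elim(7) that
        by (simp add: partial_deriv_def)
      then show ?thesis
        unfolding E_def using partial_deriv_exp[of "\<lambda>x. \<i> * of_real (\<psi> \<theta> x)" x j] elim(11) that by simp
    qed
    have sum: "(\<Sum>j\<in>UNIV. partial_deriv j (\<lambda>x. (a j \<theta> x *\<^sub>R g \<theta> x) * E \<theta> x) x) =
        T \<theta> x * E \<theta> x + \<i> * of_real (\<omega> \<theta>) * (g \<theta> x * E \<theta> x)" if x: "x \<in> X" for x
    proof -
      have "partial_deriv j (\<lambda>x. (a j \<theta> x *\<^sub>R g \<theta> x) * E \<theta> x) x =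
          partial_deriv j (\<lambda>x. a j \<theta> x *\<^sub>R g \<theta> x) x * E \<theta> x +
          (a j \<theta> x *\<^sub>R g \<theta> x) * (\<i> * of_real (partial_deriv j (\<psi> \<theta>) x) * E \<theta> x)" for j
        using partial_deriv_bilinear[OF bounded_bilinear_mult, of "\<lambda>x. a j \<theta> x *\<^sub>R g \<theta> x" x "E \<theta>" j] elim(4,6) x dE
        by simp
      then have "(\<Sum>j\<in>UNIV. partial_deriv j (\<lambda>x. (a j \<theta> x *\<^sub>R g \<theta> x) * E \<theta> x) x) =
          T \<theta> x * E \<theta> x + (\<Sum>j\<in>UNIV. (a j \<theta> x *\<^sub>R g \<theta> x) * (\<i> * of_real (partial_deriv j (\<psi> \<theta>) x) * E \<theta> x))"
        by (simp add: sum.distrib T_def sum_distrib_right)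
      also have "(\<Sum>j\<in>UNIV. (a j \<theta> x *\<^sub>R g \<theta> x) * (\<i> * of_real (partial_deriv j (\<psi> \<theta>) x) * E \<theta> x)) =
          \<i> * of_real (\<Sum>j\<in>UNIV. a j \<theta> x * partial_deriv j (\<psi> \<theta>) x) * (g \<theta> x * E \<theta> x)"
        by (simp add: sum_distrib_left sum_distrib_right scaleR_conv_of_real mult_ac)
      finally show ?thesis using elim(1) x by simp
    qed
    have cont: "continuous_on X (g \<theta>)" "continuous_on X (T \<theta>)" "continuous_on X (E \<theta>)"
      using elim(6,8,10) by (auto intro!: continuous_on_of_differentiable)
    have i1: "set_integrable lborel X (\<lambda>x. T \<theta> x * E \<theta> x)" and i2: "set_integrable lborel X (\<lambda>x. g \<theta> x * E \<theta> x)"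
      by (rule set_integrable_compact_support[OF X], use elim in \<open>auto intro!: continuous_intros cont\<close>)+
    have z: "(LINT x:X|lborel. partial_deriv j (\<lambda>x. (a j \<theta> x *\<^sub>R g \<theta> x) * E \<theta> x) x) = 0" for j
      by (rule set_integral_partial_deriv_eq_0[OF X]) (use elim(3,5) in auto)
    have pint: "set_integrable lborel X (partial_deriv j (\<lambda>x. (a j \<theta> x *\<^sub>R g \<theta> x) * E \<theta> x))" for j
    proof (rule set_integrable_compact_support[OF X])
      show "partial_deriv j (\<lambda>x. (a j \<theta> x *\<^sub>R g \<theta> x) * E \<theta> x) x = 0" if "x \<in> X - K" for x
        by (rule partial_deriv_zero_outside[OF X(1,2) _ that]) (use elim(5) in auto)
      show "continuous_on X (partial_deriv j (\<lambda>x. (a j \<theta> x *\<^sub>R g \<theta> x) * E \<theta> x))"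
        using elim(3) by (auto intro!: continuous_on_of_differentiable)
    qed
    have "0 = (\<Sum>j\<in>UNIV. LINT x:X|lborel. partial_deriv j (\<lambda>x. (a j \<theta> x *\<^sub>R g \<theta> x) * E \<theta> x) x)"
      using z by simp
    also have "\<dots> = (LINT x:X|lborel. (\<Sum>j\<in>UNIV. partial_deriv j (\<lambda>x. (a j \<theta> x *\<^sub>R g \<theta> x) * E \<theta> x) x))"
      using pint unfolding set_lebesgue_integral_def set_integrable_def scaleR_sum_right
      by (subst Bochner_Integration.integral_sum) auto
    also have "\<dots> = (LINT x:X|lborel. T \<theta> x * E \<theta> x + \<i> * of_real (\<omega> \<theta>) * (g \<theta> x * E \<theta> x))"
      by (rule set_lebesgue_integral_cong) (use sum X in auto)
    also have "\<dots> = (LINT x:X|lborel. T \<theta> x * E \<theta> x) + \<i> * of_real (\<omega> \<theta>) * (LINT x:X|lborel. g \<theta> x * E \<theta> x)"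
      using i1 i2 by (subst set_integral_add) auto
    finally have "(LINT x:X|lborel. T \<theta> x * E \<theta> x) = - (\<i> * of_real (\<omega> \<theta>) * (LINT x:X|lborel. g \<theta> x * E \<theta> x))"
      by (simp add: eq_neg_iff_add_eq_0)
    then show ?case using elim(2) by (simp add: norm_mult)
  qed
  have "\<forall>\<^sub>F \<theta> in F. \<omega> \<theta> ^ Suc p * norm (LINT x:X|lborel. g \<theta> x * E \<theta> x) \<le> w \<theta>"
    using id w(2)
  proof eventually_elim
    case (elim \<theta>)
    have "\<omega> \<theta> ^ Suc p * norm (LINT x:X|lborel. g \<theta> x * E \<theta> x) = \<omega> \<theta> ^ p * (\<omega> \<theta> * norm (LINT x:X|lborel. g \<theta> x * E \<theta> x))"
      by simp
    then show ?case using elim by presburger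
  qed
  then show ?case using w(1) unfolding E_def by blast
qed

section \<open>Fourier inversion\<close>

lemma
  fixes f :: "'a::euclidean_space \<Rightarrow> real \<Rightarrow> 'b::{real_normed_field,banach,second_countable_topology}"
  assumes f: "\<And>b. b \<in> Basis \<Longrightarrow> integrable lborel (f b)"
  shows integrable_prod_Basis: "integrable lborel (\<lambda>x::'a. \<Prod>b\<in>Basis. f b (x \<bullet> b))"
    and integral_prod_Basis: "(LINT x|lborel. (\<Prod>b\<in>Basis. f b ((x::'a) \<bullet> b))) = (\<Prod>b\<in>Basis. (LINT t|lborel. f b t))"
proof -
  interpret product_sigma_finite "\<lambda>_::'a. lborel :: real measure" by standard
  have [measurable]: "f b \<in> borel_measurable borel" if "b \<in> Basis" for b
    using borel_measurable_integrable[OF f[OF that]] by simp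
  have m: "(\<lambda>x::'a. \<Prod>b\<in>Basis. f b (x \<bullet> b)) \<in> borel_measurable borel" by measurable
  have m2: "(\<lambda>g. \<Sum>b\<in>Basis. g b *\<^sub>R b) \<in> measurable (\<Pi>\<^sub>M b\<in>(Basis::'a set). lborel) (borel :: 'a measure)"
    by measurable
  have eq: "(\<Prod>b\<in>Basis. f b ((\<Sum>c\<in>Basis. g c *\<^sub>R c) \<bullet> b)) = (\<Prod>b\<in>Basis. f b (g b))" for g :: "'a \<Rightarrow> real"
    by (intro prod.cong refl arg_cong2[where f=f]) simp
  show "integrable lborel (\<lambda>x::'a. \<Prod>b\<in>Basis. f b (x \<bullet> b))"
    unfolding lborel_eq[where 'a='a] integrable_distr_eq[OF m2 m] eq
    by (rule product_integrable_prod) (use f in auto)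
  show "(LINT x|lborel. (\<Prod>b\<in>Basis. f b ((x::'a) \<bullet> b))) = (\<Prod>b\<in>Basis. (LINT t|lborel. f b t))"
    unfolding lborel_eq[where 'a='a] integral_distr[OF m2 m] eq
    by (rule product_integral_prod) (use f in auto)
qed

definition gauss :: "'a::euclidean_space \<Rightarrow> real" where
  "gauss x = exp (- (x \<bullet> x) / 2)"

text \<open>
  The characteristic function of the standard normal distribution, without its normalization.
\<close>

lemma gauss_real_transform:
  "integrable lborel (\<lambda>s. of_real (exp (- (s\<^sup>2) / 2)) * iexp (t * s))"
  "(LINT s|lborel. of_real (exp (- (s\<^sup>2) / 2)) * iexp (t * s)) = sqrt (2 * pi) * of_real (exp (- (t\<^sup>2) / 2))"
proof -
  have eq: "std_normal_density s *\<^sub>R iexp (t * s) = (1 / sqrt (2 * pi)) * (of_real (exp (- (s\<^sup>2) / 2)) * iexp (t * s))" for s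
    by (simp add: std_normal_density_def scaleR_conv_of_real)
  have int: "integrable lborel (\<lambda>s. std_normal_density s *\<^sub>R iexp (t * s))"
    by (rule Bochner_Integration.integrable_bound[where f=std_normal_density]) auto
  then have int2: "integrable lborel (\<lambda>s. of_real (1 / sqrt (2 * pi)) * (of_real (exp (- (s\<^sup>2) / 2)) * iexp (t * s)) :: complex)"
    unfolding eq .
  have "integrable lborel (\<lambda>s. of_real (sqrt (2 * pi)) * (of_real (1 / sqrt (2 * pi)) * (of_real (exp (- (s\<^sup>2) / 2)) * iexp (t * s))) :: complex)"
    by (rule integrable_mult_right[OF int2])
  also have "(\<lambda>s. of_real (sqrt (2 * pi)) * (of_real (1 / sqrt (2 * pi)) * (of_real (exp (- (s\<^sup>2) / 2)) * iexp (t * s))) :: complex)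
     = (\<lambda>s. of_real (exp (- (s\<^sup>2) / 2)) * iexp (t * s))"
    by (rule ext) (simp add: field_simps flip: of_real_mult)
  finally show int3: "integrable lborel (\<lambda>s. of_real (exp (- (s\<^sup>2) / 2)) * iexp (t * s))" .
  have "of_real (exp (- (t\<^sup>2) / 2)) = (LINT s|lborel. std_normal_density s *\<^sub>R iexp (t * s))"
    using fun_cong[OF char_std_normal_distribution, of t]
    by (simp add: char_def integral_density)
  also have "\<dots> = of_real (1 / sqrt (2 * pi)) * (LINT s|lborel. of_real (exp (- (s\<^sup>2) / 2)) * iexp (t * s))"
    unfolding eq using int3 by simp
  finally have *: "(of_real (exp (- (t\<^sup>2) / 2)) :: complex) = of_real (1 / sqrt (2 * pi)) * (LINT s|lborel. of_real (exp (- (s\<^sup>2) / 2)) * iexp (t * s))" .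
  have "sqrt (2 * pi) * of_real (exp (- (t\<^sup>2) / 2)) = of_real (sqrt (2 * pi)) * (of_real (1 / sqrt (2 * pi)) * (LINT s|lborel. of_real (exp (- (s\<^sup>2) / 2)) * iexp (t * s)))"
    using * by simp
  then show "(LINT s|lborel. of_real (exp (- (s\<^sup>2) / 2)) * iexp (t * s)) = sqrt (2 * pi) * of_real (exp (- (t\<^sup>2) / 2))"
    by (simp flip: of_real_mult mult.assoc)
qed

definition gauss_const :: "'a::euclidean_space itself \<Rightarrow> real" where
  "gauss_const _ = sqrt (2 * pi) ^ DIM('a)"

lemma gauss_const_pos: "0 < gauss_const TYPE('a::euclidean_space)"
  by (simp add: gauss_const_def)

lemma
  fixes x :: "'a::euclidean_space"
  shows gauss_transform_integrable: "integrable lborel (\<lambda>t. of_real (gauss t) * iexp (t \<bullet> x))"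
    and gauss_transform: "(LINT t|lborel. of_real (gauss t) * iexp (t \<bullet> x)) = of_real (gauss_const TYPE('a) * gauss x)"
proof -
  have eq: "of_real (gauss t) * iexp (t \<bullet> x) = (\<Prod>b\<in>Basis. of_real (exp (- ((t \<bullet> b)\<^sup>2) / 2)) * iexp ((x \<bullet> b) * (t \<bullet> b)))" for t :: 'a
  proof -
    have 1: "- (t \<bullet> t) / 2 = (\<Sum>b\<in>Basis. - ((t \<bullet> b)\<^sup>2) / 2)"
      by (subst euclidean_inner) (simp add: power2_eq_square sum_negf sum_divide_distrib)
    have 2: "\<i> * of_real (t \<bullet> x) = (\<Sum>b\<in>Basis. \<i> * of_real ((x \<bullet> b) * (t \<bullet> b)))"
      by (subst euclidean_inner) (simp add: sum_distrib_left mult_ac)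
    show ?thesis
      unfolding gauss_def 1 2 by (simp add: exp_sum prod.distrib del: of_real_mult)
  qed
  note I = gauss_real_transform
  show "integrable lborel (\<lambda>t. of_real (gauss t) * iexp (t \<bullet> x))"
    unfolding eq using integrable_prod_Basis[where f="\<lambda>b s. of_real (exp (- (s\<^sup>2) / 2)) * iexp ((x \<bullet> b) * s)"] I(1) by blast
  have "(LINT t|lborel. of_real (gauss t) * iexp (t \<bullet> x)) = (\<Prod>b\<in>Basis. of_real (sqrt (2 * pi)) * of_real (exp (- ((x \<bullet> b)\<^sup>2) / 2)))"
    unfolding eq using integral_prod_Basis[where f="\<lambda>b s. of_real (exp (- (s\<^sup>2) / 2)) * iexp ((x \<bullet> b) * s)"] I by simp
  also have "\<dots> = of_real (gauss_const TYPE('a)) * (\<Prod>b\<in>Basis. of_real (exp (- ((x \<bullet> b)\<^sup>2) / 2)))"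
    by (simp add: prod.distrib gauss_const_def)
  also have "(\<Prod>b\<in>Basis. of_real (exp (- ((x \<bullet> b)\<^sup>2) / 2))) = (of_real (gauss x) :: complex)"
  proof -
    have 1: "- (x \<bullet> x) / 2 = (\<Sum>b\<in>Basis. - ((x \<bullet> b)\<^sup>2) / 2)"
      by (subst euclidean_inner) (simp add: power2_eq_square sum_negf sum_divide_distrib)
    show ?thesis unfolding gauss_def 1 by (simp add: exp_sum)
  qed
  finally show "(LINT t|lborel. of_real (gauss t) * iexp (t \<bullet> x)) = of_real (gauss_const TYPE('a) * gauss x)"
    by simp
qed

lemma gauss_integrable: "integrable lborel (gauss :: 'a::euclidean_space \<Rightarrow> real)"
  using integrable_norm[OF gauss_transform_integrable[of "0::'a"]] by (simp add: gauss_def[abs_def])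

lemma gauss_integral: "(LINT t|lborel. gauss (t::'a::euclidean_space)) = gauss_const TYPE('a)"
proof -
  have "of_real (LINT t|lborel. gauss (t::'a)) = (of_real (gauss_const TYPE('a)) :: complex)"
    using gauss_transform[of "0::'a"] by (simp add: gauss_def)
  then show ?thesis using of_real_eq_iff by blast
qed

lemma gauss_measurable [measurable]: "gauss \<in> borel_measurable borel"
  unfolding gauss_def by measurable

lemma gauss_pos: "0 < gauss x" and gauss_le_1: "gauss x \<le> 1"
  by (simp_all add: gauss_def)

lemma
  fixes g :: "'a::euclidean_space \<Rightarrow> 'b::{banach,second_countable_topology}"
  assumes [measurable]: "g \<in> borel_measurable borel" and c: "c > 0"
  shows integral_affine: "(LINT x|lborel. g x) = c ^ DIM('a) *\<^sub>R (LINT x|lborel. g (y + c *\<^sub>R x))"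
    and integrable_affine_iff: "integrable lborel (\<lambda>x. g (y + c *\<^sub>R x)) \<longleftrightarrow> integrable lborel g"
proof -
  have eq: "lborel = density (distr lborel borel (\<lambda>x::'a. y + c *\<^sub>R x)) (\<lambda>_. ennreal (c ^ DIM('a)))"
    using lborel_affine[of c y] c by simp
  have "(LINT x|lborel. g x) = (LINT x|density (distr lborel borel (\<lambda>x::'a. y + c *\<^sub>R x)) (\<lambda>_. ennreal (c ^ DIM('a))). g x)"
    using eq by simp
  also have "\<dots> = c ^ DIM('a) *\<^sub>R (LINT x|lborel. g (y + c *\<^sub>R x))"
    using c by (subst integral_density) (auto simp: integral_distr)
  finally show "(LINT x|lborel. g x) = c ^ DIM('a) *\<^sub>R (LINT x|lborel. g (y + c *\<^sub>R x))" .
  have "integrable lborel g \<longleftrightarrow> integrable (density (distr lborel borel (\<lambda>x::'a. y + c *\<^sub>R x)) (\<lambda>_. ennreal (c ^ DIM('a)))) g"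
    using eq by simp
  also have "\<dots> \<longleftrightarrow> integrable lborel (\<lambda>x. g (y + c *\<^sub>R x))"
    using c integrable_scaleR_right[of "inverse (c ^ DIM('a))" lborel "\<lambda>x. c ^ DIM('a) *\<^sub>R g (y + c *\<^sub>R x)"]
    by (subst integrable_density) (auto simp: integrable_distr_eq)
  finally show "integrable lborel (\<lambda>x. g (y + c *\<^sub>R x)) \<longleftrightarrow> integrable lborel g" by simp
qed

definition fourier :: "('a::euclidean_space \<Rightarrow> complex) \<Rightarrow> 'a \<Rightarrow> complex" where
  "fourier g \<xi> = (LINT x|lborel. g x * exp (- (\<i> * of_real (x \<bullet> \<xi>))))"

text \<open>
  A product majorant is the form in which Tonelli's theorem is applied below.
\<close>

lemma integrable_lborel_product:
  fixes f :: "'a::euclidean_space \<Rightarrow> 'b::euclidean_space \<Rightarrow> complex" and v :: "'a \<Rightarrow> real" and w :: "'b \<Rightarrow> real"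
  assumes [measurable]: "case_prod f \<in> borel_measurable (borel \<Otimes>\<^sub>M borel)"
    and v: "integrable lborel v" and w: "integrable lborel w"
    and le: "\<And>x y. norm (f x y) \<le> v x * w y"
  shows "integrable (lborel \<Otimes>\<^sub>M lborel) (case_prod f)"
proof (rule lborel_pair.Fubini_integrable)
  show "case_prod f \<in> borel_measurable (lborel \<Otimes>\<^sub>M lborel)" by measurable
  have [measurable]: "w \<in> borel_measurable borel" "v \<in> borel_measurable borel"
    using borel_measurable_integrable[OF w] borel_measurable_integrable[OF v] by simp_all
  have fx [measurable]: "f x \<in> borel_measurable borel" for x
  proof -
    have "(\<lambda>y. case_prod f (x, y)) \<in> borel_measurable borel" by measurable
    then show ?thesis by simp
  qed
  have i: "integrable lborel (f x)" for x
  proof (rule Bochner_Integration.integrable_bound)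
    show "integrable lborel (\<lambda>y. v x * w y)" using w by simp
    show "AE y in lborel. norm (f x y) \<le> norm (v x * w y)"
    proof (rule AE_I2)
      fix y show "norm (f x y) \<le> norm (v x * w y)"
        using le[of x y] abs_ge_self[of "v x * w y"] unfolding real_norm_def by linarith
    qed
  qed simp
  then show "AE x in lborel. integrable lborel (\<lambda>y. case_prod f (x, y))" by simp
  show "integrable lborel (\<lambda>x. LINT y|lborel. norm (case_prod f (x, y)))"
  proof (rule Bochner_Integration.integrable_bound)
    show "integrable lborel (\<lambda>x. v x * (LINT y|lborel. w y))" using v by simp
    show "(\<lambda>x. LINT y|lborel. norm (case_prod f (x, y))) \<in> borel_measurable lborel" by measurable
    show "AE x in lborel. norm (LINT y|lborel. norm (case_prod f (x, y))) \<le> norm (v x * (LINT y|lborel. w y))"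
    proof (rule AE_I2)
      fix x
      have "(LINT y|lborel. norm (f x y)) \<le> (LINT y|lborel. v x * w y)"
        using i w le by (intro integral_mono) auto
      moreover have "0 \<le> (LINT y|lborel. norm (f x y))" by simp
      ultimately show "norm (LINT y|lborel. norm (case_prod f (x, y))) \<le> norm (v x * (LINT y|lborel. w y))"
        using abs_ge_self[of "v x * (LINT y|lborel. w y)"] by simp
    qed
  qed
qed

text \<open>
  Damping the inversion integral by \<open>gauss (h \<eta>)\<close> makes Fubini's theorem applicable and turns it into
  the average of \<open>v\<close> against a Gaussian of width \<open>h\<close> centred at \<open>y\<close>. As \<open>h\<close> tends to 0, the average tends
  to \<open>v y\<close>, and the damped integral to the undamped one because the transform is integrable.
\<close>

theorem fourier_inversion:
  fixes v :: "'a::euclidean_space \<Rightarrow> complex"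
  assumes cont: "continuous_on UNIV v" and bd: "\<And>x. norm (v x) \<le> C"
    and v: "integrable lborel v" and ft: "integrable lborel (fourier v)"
  shows "(LINT \<eta>|lborel. fourier v \<eta> * iexp (y \<bullet> \<eta>)) = of_real ((gauss_const TYPE('a))\<^sup>2) * v y"
proof -
  define h where "h n = 1 / real (Suc n)" for n
  have h: "0 < h n" for n by (auto simp: h_def)
  have h0: "h \<longlonglongrightarrow> 0" unfolding h_def using LIMSEQ_inverse_real_of_nat by (simp add: inverse_eq_divide)
  have [measurable]: "v \<in> borel_measurable borel" using cont by (rule borel_measurable_continuous_onI)
  have [measurable]: "fourier v \<in> borel_measurable borel" using borel_measurable_integrable[OF ft] by simp
  let ?c = "gauss_const TYPE('a)"
  define A where "A n = (LINT \<eta>|lborel. fourier v \<eta> * iexp (y \<bullet> \<eta>) * of_real (gauss (h n *\<^sub>R \<eta>)))" for n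
  have A_lim: "A \<longlonglongrightarrow> (LINT \<eta>|lborel. fourier v \<eta> * iexp (y \<bullet> \<eta>))"
    unfolding A_def
  proof (rule integral_dominated_convergence[where w="\<lambda>\<eta>. norm (fourier v \<eta>)"])
    show "AE \<eta> in lborel. (\<lambda>n. fourier v \<eta> * iexp (y \<bullet> \<eta>) * of_real (gauss (h n *\<^sub>R \<eta>))) \<longlonglongrightarrow> fourier v \<eta> * iexp (y \<bullet> \<eta>)"
    proof (rule AE_I2)
      fix \<eta> :: 'a
      have "(\<lambda>n. fourier v \<eta> * iexp (y \<bullet> \<eta>) * of_real (gauss (h n *\<^sub>R \<eta>))) \<longlonglongrightarrow> fourier v \<eta> * iexp (y \<bullet> \<eta>) * of_real (gauss (0 *\<^sub>R \<eta>))"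
        unfolding gauss_def by (intro tendsto_intros h0) auto
      then show "(\<lambda>n. fourier v \<eta> * iexp (y \<bullet> \<eta>) * of_real (gauss (h n *\<^sub>R \<eta>))) \<longlonglongrightarrow> fourier v \<eta> * iexp (y \<bullet> \<eta>)"
        by (simp add: gauss_def)
    qed
    show "AE \<eta> in lborel. norm (fourier v \<eta> * iexp (y \<bullet> \<eta>) * of_real (gauss (h n *\<^sub>R \<eta>))) \<le> norm (fourier v \<eta>)" for n
      by (auto simp: norm_mult abs_of_pos gauss_pos intro!: mult_left_le gauss_le_1)
  qed (use ft in \<open>simp_all add: integrable_norm\<close>)
  have A_eq: "A n = of_real ?c * (LINT t|lborel. v (y + h n *\<^sub>R t) * of_real (gauss t))" for n
  proof -
    define d where "d = h n"
    have d: "d > 0" using h d_def by simp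
    have gi: "integrable lborel (\<lambda>\<eta>::'a. gauss (d *\<^sub>R \<eta>))"
      using integrable_affine_iff[of "gauss :: 'a \<Rightarrow> real" d 0] gauss_integrable[where 'a='a] d by simp
    define G where "G x \<eta> = v x * exp (- (\<i> * of_real (x \<bullet> \<eta>))) * (iexp (y \<bullet> \<eta>) * of_real (gauss (d *\<^sub>R \<eta>)))" for x \<eta>
    have G: "integrable (lborel \<Otimes>\<^sub>M lborel) (case_prod G)"
    proof (rule integrable_lborel_product[OF _ integrable_norm[OF v] gi])
      show "case_prod G \<in> borel_measurable (borel \<Otimes>\<^sub>M borel)" unfolding G_def by measurable
      show "norm (G x \<eta>) \<le> norm (v x) * gauss (d *\<^sub>R \<eta>)" for x \<eta>
        using gauss_pos[of "d *\<^sub>R \<eta>"] by (simp add: G_def norm_mult)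
    qed
    have "A n = (LINT \<eta>|lborel. LINT x|lborel. G x \<eta>)"
      unfolding A_def d_def[symmetric]
    proof (rule Bochner_Integration.integral_cong[OF refl])
      fix \<eta> :: 'a
      have "fourier v \<eta> * (iexp (y \<bullet> \<eta>) * of_real (gauss (d *\<^sub>R \<eta>))) = (LINT x|lborel. G x \<eta>)"
        unfolding fourier_def G_def by (rule integral_mult_left_zero[symmetric])
      then show "fourier v \<eta> * iexp (y \<bullet> \<eta>) * of_real (gauss (d *\<^sub>R \<eta>)) = (LINT x|lborel. G x \<eta>)"
        by (simp only: mult.assoc)
    qed
    also have "\<dots> = (LINT x|lborel. LINT \<eta>|lborel. G x \<eta>)"
      by (rule lborel_pair.Fubini_integral[OF G])
    also have "\<dots> = (LINT x|lborel. v x * (of_real (1 / d ^ DIM('a)) * of_real (?c * gauss ((1/d) *\<^sub>R (y - x)))))"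
    proof (rule Bochner_Integration.integral_cong[OF refl])
      fix x :: 'a
      have "(LINT \<eta>|lborel. G x \<eta>) = v x * (LINT \<eta>|lborel. of_real (gauss (d *\<^sub>R \<eta>)) * iexp ((d *\<^sub>R \<eta>) \<bullet> ((1/d) *\<^sub>R (y - x))))"
      proof (subst integral_mult_right_zero[symmetric], rule Bochner_Integration.integral_cong[OF refl])
        fix \<eta> :: 'a
        have "exp (- (\<i> * of_real (x \<bullet> \<eta>))) * iexp (y \<bullet> \<eta>) = iexp ((d *\<^sub>R \<eta>) \<bullet> ((1/d) *\<^sub>R (y - x)))"
          using d by (simp add: exp_add[symmetric] inner_diff_right inner_commute algebra_simps)
        then show "G x \<eta> = v x * (of_real (gauss (d *\<^sub>R \<eta>)) * iexp ((d *\<^sub>R \<eta>) \<bullet> ((1/d) *\<^sub>R (y - x))))"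
          unfolding G_def by (simp only: mult_ac)
      qed
      also have "(LINT \<eta>|lborel. of_real (gauss (d *\<^sub>R \<eta>)) * iexp ((d *\<^sub>R \<eta>) \<bullet> ((1/d) *\<^sub>R (y - x)))) =
          (1 / d ^ DIM('a)) *\<^sub>R (LINT t|lborel. of_real (gauss t) * iexp (t \<bullet> ((1/d) *\<^sub>R (y - x))))"
        using integral_affine[of "\<lambda>t. of_real (gauss t) * iexp (t \<bullet> ((1/d) *\<^sub>R (y - x)))" d 0] d by simp
      finally show "(LINT \<eta>|lborel. G x \<eta>) = v x * (of_real (1 / d ^ DIM('a)) * of_real (?c * gauss ((1/d) *\<^sub>R (y - x))))"
        unfolding gauss_transform by (simp add: scaleR_conv_of_real)
    qed
    also have "\<dots> = d ^ DIM('a) *\<^sub>R (LINT t|lborel. v (y + d *\<^sub>R t) * (of_real (1 / d ^ DIM('a)) * of_real (?c * gauss ((1/d) *\<^sub>R (y - (y + d *\<^sub>R t))))))"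
      by (rule integral_affine) (use d in simp_all)
    also have "\<dots> = (LINT t|lborel. of_real (d ^ DIM('a)) * (v (y + d *\<^sub>R t) * (of_real (1 / d ^ DIM('a)) * of_real (?c * gauss ((1/d) *\<^sub>R (y - (y + d *\<^sub>R t)))))))"
      by (simp add: scaleR_conv_of_real del: of_real_power of_real_divide of_real_mult)
    also have "\<dots> = (LINT t|lborel. of_real ?c * (v (y + d *\<^sub>R t) * of_real (gauss t)))"
      using d by (intro Bochner_Integration.integral_cong refl) (simp add: gauss_def)
    finally show ?thesis by (simp add: d_def)
  qed
  have lim: "(\<lambda>n. LINT t|lborel. v (y + h n *\<^sub>R t) * of_real (gauss t)) \<longlonglongrightarrow> (LINT t|lborel. v y * of_real (gauss (t::'a)))"
  proof (rule integral_dominated_convergence[where w="\<lambda>t. C * gauss t"])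
    show "AE t in lborel. (\<lambda>n. v (y + h n *\<^sub>R t) * of_real (gauss t)) \<longlonglongrightarrow> v y * of_real (gauss t)"
    proof (rule AE_I2)
      fix t :: 'a
      have "(\<lambda>n. y + h n *\<^sub>R t) \<longlonglongrightarrow> y + 0 *\<^sub>R t" by (intro tendsto_intros h0)
      moreover have "isCont v y" using cont by (simp add: continuous_on_eq_continuous_at)
      ultimately have "(\<lambda>n. v (y + h n *\<^sub>R t)) \<longlonglongrightarrow> v y" using isCont_tendsto_compose by fastforce
      then show "(\<lambda>n. v (y + h n *\<^sub>R t) * of_real (gauss t)) \<longlonglongrightarrow> v y * of_real (gauss t)"
        by (intro tendsto_intros)
    qed
    show "AE t in lborel. norm (v (y + h n *\<^sub>R t) * of_real (gauss t)) \<le> C * gauss t" for n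
      by (auto simp: norm_mult abs_of_pos gauss_pos intro!: mult_right_mono bd less_imp_le)
  qed (use gauss_integrable[where 'a='a] in \<open>simp_all\<close>)
  from A_lim tendsto_mult_left[OF lim, of "of_real ?c"]
  have "(LINT \<eta>|lborel. fourier v \<eta> * iexp (y \<bullet> \<eta>)) = of_real ?c * (LINT t|lborel. v y * of_real (gauss (t::'a)))"
    unfolding A_eq[symmetric] by (rule LIMSEQ_unique)
  then show ?thesis
    using gauss_integral[where 'a='a] by (simp add: power2_eq_square)
qed

text \<open>
  An explicit integrable function on \<open>\<real>\<^sup>m\<close>: being a product of one-variable functions, it is integrable by
  Fubini, and it dominates a power of \<open>1/(1 + |\<eta>|)\<close>.
\<close>

definition decay_weight :: "'a::euclidean_space \<Rightarrow> real" where
  "decay_weight \<eta> = (\<Prod>b\<in>Basis. inverse (1 + (\<eta> \<bullet> b)\<^sup>2))"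

lemma decay_weight_integrable: "integrable lborel (decay_weight :: 'a::euclidean_space \<Rightarrow> real)"
proof -
  have "integrable lborel (\<lambda>x::real. inverse (1 + x\<^sup>2))"
    using integrable_inverse_1_plus_square by (simp add: set_integrable_def)
  then show ?thesis
    unfolding decay_weight_def using integrable_prod_Basis[where f="\<lambda>_ s. inverse (1 + s\<^sup>2)"] by blast
qed

lemma decay_weight_pos: "0 < decay_weight \<eta>"
  unfolding decay_weight_def by (intro prod_pos) (simp add: add_pos_nonneg)

lemma inverse_power_le_decay_weight:
  fixes \<eta> :: "'a::euclidean_space"
  shows "inverse ((1 + norm \<eta>) ^ (2 * DIM('a))) \<le> decay_weight \<eta>"
proof -
  have "inverse ((1 + norm \<eta>) ^ (2 * DIM('a))) = (\<Prod>b\<in>(Basis :: 'a set). inverse ((1 + norm \<eta>)\<^sup>2))"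
    by (simp add: power_mult power_inverse)
  also have "\<dots> \<le> decay_weight \<eta>"
    unfolding decay_weight_def
  proof (rule prod_mono, safe)
    fix b :: 'a assume "b \<in> Basis"
    then have "(\<eta> \<bullet> b)\<^sup>2 \<le> (norm \<eta>)\<^sup>2" by (metis Basis_le_norm abs_ge_zero power2_abs power_mono)
    then have "1 + (\<eta> \<bullet> b)\<^sup>2 \<le> (1 + norm \<eta>)\<^sup>2" by (simp add: power2_sum add_increasing2)
    then show "inverse ((1 + norm \<eta>)\<^sup>2) \<le> inverse (1 + (\<eta> \<bullet> b)\<^sup>2)"
      by (intro le_imp_inverse_le) (auto intro: add_pos_nonneg)
  qed simp
  finally show ?thesis .
qed

section \<open>Slow scale weights and rapid decrease\<close>

text \<open>
  Slow scale nets with their constants, so that they form a class of weights.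
\<close>

definition slow_weights :: "(real \<Rightarrow> real) set" where
  "slow_weights = {r. (\<forall>\<epsilon>. 0 \<le> r \<epsilon>) \<and> (\<forall>t::nat. \<exists>C. \<forall>\<^sub>0\<epsilon>. r \<epsilon> ^ t \<le> C * inverse \<epsilon>)}"

lemma slow_weights_add_mult:
  assumes "r \<in> slow_weights" "s \<in> slow_weights"
  shows "(\<lambda>\<epsilon>. r \<epsilon> + s \<epsilon>) \<in> slow_weights" "(\<lambda>\<epsilon>. r \<epsilon> * s \<epsilon>) \<in> slow_weights"
proof -
  have nn: "0 \<le> r \<epsilon>" "0 \<le> s \<epsilon>" for \<epsilon> using assms unfolding slow_weights_def by auto
  have "\<exists>C. \<forall>\<^sub>0\<epsilon>. (r \<epsilon> + s \<epsilon>) ^ t \<le> C * inverse \<epsilon>" for t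
  proof -
    obtain C D where C: "\<forall>\<^sub>0\<epsilon>. r \<epsilon> ^ t \<le> C * inverse \<epsilon>" and D: "\<forall>\<^sub>0\<epsilon>. s \<epsilon> ^ t \<le> D * inverse \<epsilon>"
      using assms unfolding slow_weights_def by blast
    have "\<forall>\<^sub>0\<epsilon>. (r \<epsilon> + s \<epsilon>) ^ t \<le> (2 ^ t * (C + D)) * inverse \<epsilon>"
      using C D
    proof eventually_elim
      case (elim \<epsilon>)
      have "(r \<epsilon> + s \<epsilon>) ^ t \<le> (2 * max (r \<epsilon>) (s \<epsilon>)) ^ t"
        using nn[of \<epsilon>] by (intro power_mono) auto
      also have "\<dots> \<le> 2 ^ t * (r \<epsilon> ^ t + s \<epsilon> ^ t)"
        using nn[of \<epsilon>] by (auto simp: power_mult_distrib max_def)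
      also have "\<dots> \<le> 2 ^ t * (C * inverse \<epsilon> + D * inverse \<epsilon>)"
        using elim by (intro mult_left_mono add_mono) auto
      finally show ?case by (simp add: algebra_simps)
    qed
    then show ?thesis by blast
  qed
  then show "(\<lambda>\<epsilon>. r \<epsilon> + s \<epsilon>) \<in> slow_weights" using nn unfolding slow_weights_def by simp
  have "\<exists>C. \<forall>\<^sub>0\<epsilon>. (r \<epsilon> * s \<epsilon>) ^ t \<le> C * inverse \<epsilon>" for t
  proof -
    obtain C D where C: "\<forall>\<^sub>0\<epsilon>. r \<epsilon> ^ (2 * t) \<le> C * inverse \<epsilon>"
        and D: "\<forall>\<^sub>0\<epsilon>. s \<epsilon> ^ (2 * t) \<le> D * inverse \<epsilon>"
      using assms unfolding slow_weights_def by blast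
    have "\<forall>\<^sub>0\<epsilon>. (r \<epsilon> * s \<epsilon>) ^ t \<le> (C + D) * inverse \<epsilon>"
      using C D
    proof eventually_elim
      case (elim \<epsilon>)
      have "2 * (r \<epsilon> ^ t * s \<epsilon> ^ t) \<le> (r \<epsilon> ^ t)\<^sup>2 + (s \<epsilon> ^ t)\<^sup>2"
        using sum_squares_bound[of "r \<epsilon> ^ t" "s \<epsilon> ^ t"] by simp
      also have "\<dots> \<le> C * inverse \<epsilon> + D * inverse \<epsilon>"
        using elim by (simp add: power_mult mult.commute flip: power_mult)
      finally have "2 * (r \<epsilon> * s \<epsilon>) ^ t \<le> (C + D) * inverse \<epsilon>"
        by (simp add: algebra_simps)
      moreover have "0 \<le> (r \<epsilon> * s \<epsilon>) ^ t" using nn[of \<epsilon>] by simp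
      ultimately show ?case by linarith
    qed
    then show ?thesis by blast
  qed
  then show "(\<lambda>\<epsilon>. r \<epsilon> * s \<epsilon>) \<in> slow_weights" using nn unfolding slow_weights_def by simp
qed

lemma eventually_in_unit: "\<forall>\<^sub>F \<epsilon>::real in at_right 0. 0 < \<epsilon> \<and> \<epsilon> < 1"
  using eventually_at_right_real[of 0 "1::real"] by simp

lemma slow_weights_const: "0 \<le> c \<Longrightarrow> (\<lambda>_. c) \<in> slow_weights"
proof -
  assume c: "0 \<le> c"
  have "\<forall>\<^sub>F \<epsilon>::real in at_right 0. c ^ t \<le> c ^ t * inverse \<epsilon>" for t
    using eventually_in_unit
  proof eventually_elim
    case (elim \<epsilon>)
    then have "1 \<le> inverse \<epsilon>" by (simp add: one_le_inverse)
    then show ?case using mult_left_mono[of 1 "inverse \<epsilon>" "c ^ t"] c by simp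
  qed
  then show ?thesis using c unfolding slow_weights_def by blast
qed

lemma weights_slow_weights: "weights slow_weights"
  unfolding weights_def
  by (intro conjI ballI allI impI slow_weights_const slow_weights_add_mult)
    (auto simp: slow_weights_def)

lemma slow_weights_bound:
  assumes "r \<in> slow_weights"
  obtains C where "0 \<le> C" "\<forall>\<^sub>0\<epsilon>. r \<epsilon> \<le> C * inverse \<epsilon>"
proof -
  obtain C where C: "\<forall>\<^sub>0\<epsilon>. r \<epsilon> ^ 1 \<le> C * inverse \<epsilon>"
    using assms unfolding slow_weights_def by blast
  have "\<forall>\<^sub>0\<epsilon>. r \<epsilon> \<le> max C 0 * inverse \<epsilon>"
    using C eventually_in_unit
  proof eventually_elim
    case (elim \<epsilon>)
    then have "C * inverse \<epsilon> \<le> max C 0 * inverse \<epsilon>" by (intro mult_right_mono) auto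
    then show ?case using elim(1) unfolding power_one_right by linarith
  qed
  then show thesis using that[of "max C 0"] by simp
qed

lemma slow_scale_imp_slow_weights:
  assumes "slow_scale s"
  shows "(\<lambda>\<epsilon>. \<bar>s \<epsilon>\<bar>) \<in> slow_weights"
  unfolding slow_weights_def
proof (intro CollectI conjI allI)
  fix t :: nat
  obtain \<epsilon>' where e: "\<epsilon>' \<in> {0<..1}" "\<forall>t\<ge>0. \<exists>C>0. \<forall>\<epsilon>\<in>{0<..\<epsilon>'}. \<bar>s \<epsilon>\<bar> powr t \<le> C * inverse \<epsilon>"
    using assms unfolding slow_scale_def by blast
  then obtain C where C: "C > 0" "\<forall>\<epsilon>\<in>{0<..\<epsilon>'}. \<bar>s \<epsilon>\<bar> powr real t \<le> C * inverse \<epsilon>"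
    using of_nat_0_le_iff by blast
  have "\<forall>\<^sub>0\<epsilon>. \<epsilon> \<in> {0<..<\<epsilon>'}"
    using e(1) eventually_at_right_real[of 0 \<epsilon>'] by simp
  then have "\<forall>\<^sub>0\<epsilon>. \<bar>s \<epsilon>\<bar> ^ t \<le> (C + 1) * inverse \<epsilon>"
    using eventually_in_unit
  proof eventually_elim
    case (elim \<epsilon>)
    have i: "1 \<le> inverse \<epsilon>" using elim by (simp add: one_le_inverse)
    have m: "C * inverse \<epsilon> \<le> (C + 1) * inverse \<epsilon>" "1 \<le> (C + 1) * inverse \<epsilon>"
      using i C(1) elim mult_mono[of 1 "C + 1" 1 "inverse \<epsilon>"] by (simp_all add: distrib_right)
    show ?case
    proof (cases "s \<epsilon> = 0")
      case True
      then have "\<bar>s \<epsilon>\<bar> ^ t \<le> 1" by (simp add: power_0_left)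
      then show ?thesis using m by linarith
    next
      case False
      then have "\<bar>s \<epsilon>\<bar> powr real t = \<bar>s \<epsilon>\<bar> ^ t" by (intro powr_realpow) simp
      moreover have "\<bar>s \<epsilon>\<bar> powr real t \<le> C * inverse \<epsilon>" using C(2) elim by simp
      ultimately show ?thesis using m(1) by linarith
    qed
  qed
  then show "\<exists>C. \<forall>\<^sub>0\<epsilon>. \<bar>s \<epsilon>\<bar> ^ t \<le> C * inverse \<epsilon>" by blast
qed simp

text \<open>
  Convergence of \<open>\<epsilon>\<close> to 0, uniformly in a second parameter \<open>q \<in> P\<close>. With it, symbol estimates become
  uniform in covariables.
\<close>

definition param_filter :: "'q set \<Rightarrow> (real \<times> 'q) filter" where
  "param_filter P = inf (filtercomap fst (at_right 0)) (principal (UNIV \<times> P))"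

lemma eventually_param_filter:
  "eventually Q (param_filter P) \<longleftrightarrow> (\<forall>\<^sub>0\<epsilon>. \<forall>q\<in>P. Q (\<epsilon>, q))" (is "?L \<longleftrightarrow> ?R")
proof
  assume ?L
  then obtain R where R: "eventually R (at_right 0)" "\<And>\<theta>. R (fst \<theta>) \<Longrightarrow> \<theta> \<in> UNIV \<times> P \<longrightarrow> Q \<theta>"
    unfolding param_filter_def eventually_inf_principal eventually_filtercomap by blast
  show ?R using R(1) by eventually_elim (use R(2) in force)
next
  assume ?R
  then show ?L
    unfolding param_filter_def eventually_inf_principal eventually_filtercomap
    by (intro exI[of _ "\<lambda>\<epsilon>. \<forall>q\<in>P. Q (\<epsilon>, q)"]) auto
qed

lemma filterlim_fst_param_filter: "filterlim fst (at_right 0) (param_filter P)"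
  unfolding filterlim_iff eventually_param_filter by simp

text \<open>
  Slow scale in \<open>\<epsilon>\<close> and of polynomial growth in \<open>h q\<close>. For \<open>h q = 1\<close> these are the bounds that are
  uniform in \<open>q\<close>.
\<close>

definition param_weights :: "('q \<Rightarrow> real) \<Rightarrow> (real \<times> 'q \<Rightarrow> real) set" where
  "param_weights h = {w. (\<forall>\<theta>. 0 \<le> w \<theta>) \<and>
     (\<exists>r\<in>slow_weights. \<exists>k::nat. \<forall>\<epsilon> q. w (\<epsilon>, q) \<le> r \<epsilon> * h q ^ k)}"

lemma param_weightsI:
  assumes "r \<in> slow_weights" "\<And>\<theta>. 0 \<le> w \<theta>" "\<And>\<epsilon> q. w (\<epsilon>, q) \<le> r \<epsilon> * h q ^ k"
  shows "w \<in> param_weights h"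
  unfolding param_weights_def using assms by blast

lemma weights_param_weights:
  fixes h :: "'q \<Rightarrow> real"
  assumes h: "\<And>q. 1 \<le> h q"
  shows "weights (param_weights h)"
  unfolding weights_def
proof (intro conjI ballI allI impI)
  show "0 \<le> w \<theta>" if "w \<in> param_weights h" for w \<theta>
    using that unfolding param_weights_def by blast
  show "(\<lambda>_. c) \<in> param_weights h" if "0 \<le> c" for c
    by (rule param_weightsI[OF slow_weights_const[OF that], where k=0]) (use that in auto)
  fix v w assume "v \<in> param_weights h" "w \<in> param_weights h"
  then obtain r s k l where v: "\<forall>\<theta>. 0 \<le> v \<theta>" "r \<in> slow_weights" "\<forall>\<epsilon> q. v (\<epsilon>, q) \<le> r \<epsilon> * h q ^ k"
    and w: "\<forall>\<theta>. 0 \<le> w \<theta>" "s \<in> slow_weights" "\<forall>\<epsilon> q. w (\<epsilon>, q) \<le> s \<epsilon> * h q ^ l"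
    unfolding param_weights_def by blast
  have nn: "0 \<le> r \<epsilon>" "0 \<le> s \<epsilon>" for \<epsilon>
    using v(2) w(2) weights_nonneg[OF weights_slow_weights] by blast+
  show "(\<lambda>\<theta>. v \<theta> + w \<theta>) \<in> param_weights h"
  proof (rule param_weightsI[OF slow_weights_add_mult(1)[OF v(2) w(2)], where k="k + l"])
    fix \<epsilon> q
    have "v (\<epsilon>, q) + w (\<epsilon>, q) \<le> r \<epsilon> * h q ^ k + s \<epsilon> * h q ^ l" using v(3) w(3) add_mono by blast
    also have "\<dots> \<le> r \<epsilon> * h q ^ (k + l) + s \<epsilon> * h q ^ (k + l)"
      using nn h[of q] by (intro add_mono mult_left_mono power_increasing) auto
    finally show "v (\<epsilon>, q) + w (\<epsilon>, q) \<le> (r \<epsilon> + s \<epsilon>) * h q ^ (k + l)" by (simp add: algebra_simps)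
  qed (use v w in auto)
  show "(\<lambda>\<theta>. v \<theta> * w \<theta>) \<in> param_weights h"
  proof (rule param_weightsI[OF slow_weights_add_mult(2)[OF v(2) w(2)], where k="k + l"])
    fix \<epsilon> q
    have "v (\<epsilon>, q) * w (\<epsilon>, q) \<le> (r \<epsilon> * h q ^ k) * (s \<epsilon> * h q ^ l)"
      using v w nn h[of q] by (intro mult_mono) auto
    then show "v (\<epsilon>, q) * w (\<epsilon>, q) \<le> (r \<epsilon> * s \<epsilon>) * h q ^ (k + l)" by (simp add: power_add mult_ac)
  qed (use v w in auto)
qed

lemma slow_weights_lift: "r \<in> slow_weights \<Longrightarrow> (\<lambda>\<theta>. r (fst \<theta>)) \<in> param_weights h"
  by (rule param_weightsI[where r=r and k=0]) (auto simp: slow_weights_def)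

lemma symbol_lift:
  "symbol \<Omega> X (at_right 0) slow_weights g \<Longrightarrow> symbol \<Omega> X (param_filter P) (param_weights h) (\<lambda>\<theta>. g (fst \<theta>))"
  by (rule symbol_reparam[OF _ filterlim_fst_param_filter slow_weights_lift])

lemma symbol_of_smooth:
  assumes "weights B" "\<forall>\<^sub>F \<theta> in F. smooth_on \<Omega> (g \<theta>)"
  shows "symbol \<Omega> {} F B g"
  unfolding symbol_def
proof (intro allI conjI)
  fix \<alpha>
  show "\<forall>\<^sub>F \<theta> in F. \<forall>x\<in>\<Omega>. iter_partial \<alpha> (g \<theta>) differentiable at x"
    using assms(2) by eventually_elim (auto simp: smooth_on_def)
  show "\<exists>w\<in>B. \<forall>\<^sub>F \<theta> in F. \<forall>x\<in>{}. norm (iter_partial \<alpha> (g \<theta>) x) \<le> w \<theta>"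
    using weights_const[OF assms(1), of 0] by auto
qed

lemma smooth_on_inner: "smooth_on \<Omega> (\<lambda>x. x \<bullet> (c::real^'n::finite))"
proof -
  have d: "((\<lambda>x. x \<bullet> c) has_derivative (\<lambda>h. h \<bullet> c)) (at x)" for x :: "real^'n"
    by (rule bounded_linear_imp_has_derivative[OF bounded_linear_inner_left])
  have p: "partial_deriv i (\<lambda>x. x \<bullet> c) = (\<lambda>_. axis i 1 \<bullet> c)" for i
    using partial_deriv_eq[OF d] by blast
  have "iter_partial \<alpha> (\<lambda>x. x \<bullet> c) differentiable (at x)" for \<alpha> x
  proof (cases \<alpha> rule: rev_cases)
    case Nil
    then show ?thesis using d differentiableI by auto
  next
    case (snoc \<beta> i)
    then show ?thesis
      using smooth_on_const[of "UNIV :: (real^'n) set" "axis i 1 \<bullet> c :: real"] unfolding smooth_on_def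
      by (simp add: p iter_partial_append)
  qed
  then show ?thesis unfolding smooth_on_def by blast
qed

lemma partial_deriv_inner: "partial_deriv i (\<lambda>x. x \<bullet> c) x = c $ i"
  using partial_deriv_eq[OF bounded_linear_imp_has_derivative[OF bounded_linear_inner_left]]
  by (simp add: inner_axis' )

text \<open>
  Nonstationary phase for the linear phase \<open>-x \<bullet> \<xi>\<close>, with the constant vector field \<open>- sgn \<xi>\<close>.
\<close>

lemma fourier_decay:
  fixes g :: "'p \<Rightarrow> real^'n::finite \<Rightarrow> complex" and \<xi> :: "'p \<Rightarrow> real^'n"
  assumes B: "weights B" and X: "open X" "compact K" "K \<subseteq> X"
    and g: "symbol X X F B g" "\<forall>\<^sub>F \<theta> in F. \<forall>x\<in>X-K. g \<theta> x = 0"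
  shows "\<exists>w\<in>B. \<forall>\<^sub>F \<theta> in F. norm (\<xi> \<theta>) ^ p *
     norm (LINT x:X|lborel. g \<theta> x * exp (- (\<i> * of_real (x \<bullet> \<xi> \<theta>)))) \<le> w \<theta>"
proof -
  have sm: "smooth_on X (\<lambda>x. x \<bullet> - \<xi> \<theta>)" for \<theta> by (rule smooth_on_inner)
  have pd: "partial_deriv j (\<lambda>x. x \<bullet> - \<xi> \<theta>) x = - (\<xi> \<theta> $ j)" for j \<theta> x
    using partial_deriv_inner[of j "- \<xi> \<theta>" x] by simp
  have "\<exists>w\<in>B. \<forall>\<^sub>F \<theta> in F. norm (\<xi> \<theta>) ^ p *
     norm (LINT x:X|lborel. g \<theta> x * exp (\<i> * of_real (x \<bullet> - \<xi> \<theta>))) \<le> w \<theta>"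
  proof (rule nonstationary_phase[OF B X g, where a="\<lambda>j \<theta> _. - (sgn (\<xi> \<theta>) $ j)"])
    show "symbol X X F B (\<lambda>\<theta> _. - (sgn (\<xi> \<theta>) $ j))" for j
    proof (rule symbol_const[OF B weights_const[OF B]])
      show "\<forall>\<^sub>F \<theta> in F. norm (- (sgn (\<xi> \<theta>) $ j)) \<le> 1"
      proof (intro always_eventually allI)
        fix \<theta>
        have "norm (sgn (\<xi> \<theta>) $ j) \<le> norm (sgn (\<xi> \<theta>))" by (rule Finite_Cartesian_Product.norm_nth_le)
        also have "\<dots> \<le> 1" by (simp add: norm_sgn)
        finally show "norm (- (sgn (\<xi> \<theta>) $ j)) \<le> 1" by simp
      qed
    qed simp
    show "symbol X {} F B (\<lambda>\<theta> x. x \<bullet> - \<xi> \<theta>)"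
      by (rule symbol_of_smooth[OF B]) (use sm in simp)
    show "\<forall>\<^sub>F \<theta> in F. \<forall>x\<in>X. (\<Sum>j\<in>UNIV. - (sgn (\<xi> \<theta>) $ j) * partial_deriv j (\<lambda>x. x \<bullet> - \<xi> \<theta>) x) = norm (\<xi> \<theta>)"
    proof (intro always_eventually allI ballI)
      fix \<theta> x
      have "(\<Sum>j\<in>UNIV. - (sgn (\<xi> \<theta>) $ j) * partial_deriv j (\<lambda>x. x \<bullet> - \<xi> \<theta>) x) = sgn (\<xi> \<theta>) \<bullet> \<xi> \<theta>"
        unfolding pd by (simp add: inner_vec_def)
      also have "\<dots> = norm (\<xi> \<theta>)"
        by (cases "\<xi> \<theta> = 0") (simp_all add: sgn_div_norm power2_norm_eq_inner[symmetric] power2_eq_square)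
      finally show "(\<Sum>j\<in>UNIV. - (sgn (\<xi> \<theta>) $ j) * partial_deriv j (\<lambda>x. x \<bullet> - \<xi> \<theta>) x) = norm (\<xi> \<theta>)" .
    qed
  qed simp
  then show ?thesis by simp
qed

lemma symbol_test_function:
  fixes v :: "real^'n::finite \<Rightarrow> 'b::real_normed_vector"
  assumes B: "weights B" and v: "smooth_on UNIV v" and K: "compact K" "\<And>x. x \<notin> K \<Longrightarrow> v x = 0"
  shows "symbol UNIV UNIV F B (\<lambda>_. v)"
  unfolding symbol_def
proof (intro allI conjI)
  fix \<alpha> :: "'n list"
  show "\<forall>\<^sub>F \<theta> in F. \<forall>x\<in>UNIV. iter_partial \<alpha> v differentiable (at x)"
    using v unfolding smooth_on_def by simp
  have cont: "continuous_on K (iter_partial \<alpha> v)"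
    using smooth_on_continuous_on[OF smooth_on_iter_partial[OF v]] continuous_on_subset by blast
  obtain b where b: "\<forall>x\<in>K. norm (iter_partial \<alpha> v x) \<le> b"
    using compact_imp_bounded[OF compact_continuous_image[OF cont K(1)]] unfolding bounded_iff by blast
  have z: "iter_partial \<alpha> v x = 0" if "x \<notin> K" for x
  proof -
    have "open (- K)" using K(1) compact_imp_closed by blast
    then show ?thesis using iter_partial_cong_open[of "-K" x v "\<lambda>_. 0" \<alpha>] K(2) that by (simp add: iter_partial_zero)
  qed
  have "norm (iter_partial \<alpha> v x) \<le> max b 0" for x
    using b z[of x] by (cases "x \<in> K") auto
  then show "\<exists>w\<in>B. \<forall>\<^sub>F \<theta> in F. \<forall>x\<in>UNIV. norm (iter_partial \<alpha> v x) \<le> w \<theta>"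
    using weights_const[OF B, of "max b 0"] by (intro bexI[of _ "\<lambda>_. max b 0"]) auto
qed

lemma fourier_measurable [measurable]:
  assumes [measurable]: "v \<in> borel_measurable borel"
  shows "fourier v \<in> borel_measurable borel"
  unfolding fourier_def by measurable

lemma fourier_integrable:
  fixes v :: "real^'n::finite \<Rightarrow> complex"
  assumes v: "smooth_on UNIV v" and K: "compact K" "\<And>x. x \<notin> K \<Longrightarrow> v x = 0"
  shows "integrable lborel (fourier v)"
proof -
  let ?q = "2 * DIM(real^'n)"
  have *: "\<exists>c\<ge>0. \<forall>\<xi>. norm \<xi> ^ p * norm (fourier v \<xi>) \<le> c" for p
    using fourier_decay[OF weights_const_weights open_UNIV K(1) subset_UNIV, of "principal UNIV" "\<lambda>_. v" "\<lambda>\<xi>. \<xi>" p]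
      symbol_test_function[OF weights_const_weights v K] K(2)
    unfolding const_weights_def by (auto simp: eventually_principal set_lebesgue_integral_def fourier_def)
  obtain c where c: "\<And>\<xi>. norm \<xi> ^ 0 * norm (fourier v \<xi>) \<le> c" "c \<ge> 0" using *[of 0] by blast
  obtain d where d: "\<And>\<xi>. norm \<xi> ^ ?q * norm (fourier v \<xi>) \<le> d" "d \<ge> 0" using *[of ?q] by blast
  have "norm (fourier v \<xi>) \<le> 2 ^ ?q * (c + d) * decay_weight \<xi>" for \<xi>
  proof -
    have "(1 + norm \<xi>) ^ ?q \<le> (2 * max 1 (norm \<xi>)) ^ ?q" by (intro power_mono) auto
    also have "\<dots> \<le> 2 ^ ?q * (1 + norm \<xi> ^ ?q)"
      by (auto simp: power_mult_distrib max_def)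
    finally have "(1 + norm \<xi>) ^ ?q * norm (fourier v \<xi>) \<le> 2 ^ ?q * (1 + norm \<xi> ^ ?q) * norm (fourier v \<xi>)"
      by (intro mult_right_mono) auto
    also have "\<dots> = 2 ^ ?q * (norm (fourier v \<xi>) + norm \<xi> ^ ?q * norm (fourier v \<xi>))"
      by (simp add: algebra_simps)
    also have "\<dots> \<le> 2 ^ ?q * (c + d)" using c(1)[of \<xi>] d(1)[of \<xi>] by (intro mult_left_mono add_mono) auto
    finally have 1: "(1 + norm \<xi>) ^ ?q * norm (fourier v \<xi>) \<le> 2 ^ ?q * (c + d)" .
    have pos: "0 < (1 + norm \<xi>) ^ ?q" by (intro zero_less_power add_pos_nonneg) auto
    have "norm (fourier v \<xi>) = inverse ((1 + norm \<xi>) ^ ?q) * ((1 + norm \<xi>) ^ ?q * norm (fourier v \<xi>))"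
      using pos by (metis left_inverse less_irrefl mult.assoc mult_1)
    also have "\<dots> \<le> decay_weight \<xi> * (2 ^ ?q * (c + d))"
      by (intro mult_mono 1 inverse_power_le_decay_weight) (use less_imp_le[OF decay_weight_pos] in auto)
    finally show ?thesis by (simp add: mult_ac)
  qed
  moreover have "0 < decay_weight \<xi>" for \<xi> :: "real^'n" by (rule decay_weight_pos)
  moreover have "v \<in> borel_measurable borel"
    using smooth_on_continuous_on[OF v] by (rule borel_measurable_continuous_onI)
  ultimately show ?thesis
    by (intro Bochner_Integration.integrable_bound[where g="fourier v" and f="\<lambda>\<xi>. 2 ^ ?q * (c + d) * decay_weight \<xi>"])
      (use c d in \<open>auto intro!: integrable_mult_right decay_weight_integrable AE_I2 simp: abs_of_pos abs_mult\<close>)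
qed

lemma smooth_fourier_inversion:
  fixes v :: "real^'n::finite \<Rightarrow> complex"
  assumes v: "smooth_on UNIV v" and K: "compact K" "\<And>x. x \<notin> K \<Longrightarrow> v x = 0"
  shows "(LINT \<eta>|lborel. fourier v \<eta> * iexp (y \<bullet> \<eta>)) = of_real ((gauss_const TYPE(real^'n))\<^sup>2) * v y"
proof -
  obtain w where w: "w \<in> const_weights" "\<forall>\<^sub>F \<theta> in principal (UNIV :: unit set). \<forall>x\<in>UNIV. norm (v x) \<le> w \<theta>"
    using symbol_bound[OF symbol_test_function[OF weights_const_weights v K]] .
  have cont: "continuous_on UNIV v" using smooth_on_continuous_on[OF v] .
  have "set_integrable lborel UNIV v"
    by (rule set_integrable_compact_support[OF open_UNIV K(1)]) (use K cont in auto)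
  then have "integrable lborel v" by (simp add: set_integrable_def)
  then show ?thesis
    using fourier_inversion[OF cont _ _ fourier_integrable[OF v K], of "w ()"] w(2)
    by (auto simp: eventually_principal)
qed

text \<open>
  Powers of \<open>1 + r\<close> multiply without loss; up to constants they are those of \<open>(1 + r\<^sup>2)\<^sup>1\<^sup>/\<^sup>2\<close>. The order of
  the quantifiers in the next definition matters: the exponent \<open>N\<close> has to serve for all \<open>p\<close>.
\<close>

definition rapid_bound ::
    "nat \<Rightarrow> nat \<Rightarrow> (real^'n::finite) set \<Rightarrow> (real \<Rightarrow> real^'n \<Rightarrow> complex) \<Rightarrow> bool" where
  "rapid_bound N p \<Gamma> w \<longleftrightarrow> (\<exists>C. \<forall>\<^sub>0\<epsilon>. \<forall>r>0. \<forall>\<xi>\<in>\<Gamma>.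
     (1 + r) ^ p * norm (w \<epsilon> (r *\<^sub>R \<xi>)) \<le> C * inverse \<epsilon> ^ N)"

definition rapid :: "(real^'n::finite) set \<Rightarrow> (real \<Rightarrow> real^'n \<Rightarrow> complex) \<Rightarrow> bool" where
  "rapid \<Gamma> w \<longleftrightarrow> (\<exists>N. \<forall>p. rapid_bound N p \<Gamma> w)"

lemma rapidI: "(\<And>p. rapid_bound N p \<Gamma> w) \<Longrightarrow> rapid \<Gamma> w"
  unfolding rapid_def by blast

lemma powr_minus_real: "0 < \<epsilon> \<Longrightarrow> \<epsilon> powr (- real N) = inverse \<epsilon> ^ N" for \<epsilon> :: real
  by (simp add: powr_minus powr_realpow power_inverse)

lemma rapidly_decreasing_iff_rapid: "rapidly_decreasing \<Gamma> W \<longleftrightarrow> (\<exists>w\<in>W. rapid \<Gamma> w)"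
proof -
  note powr = powr_minus_real
  have upper: "(1 + r) ^ p \<le> 2 ^ p * (1 + r\<^sup>2) powr (real p / 2)"
    and lower: "(1 + r\<^sup>2) powr (real p / 2) \<le> (1 + r) ^ p" if "0 < r" for r :: real and p :: nat
  proof -
    have eq: "(1 + r\<^sup>2) powr (real p / 2) = sqrt (1 + r\<^sup>2) ^ p"
    proof -
      have x: "0 < 1 + r\<^sup>2" by (intro add_pos_nonneg) auto
      have "sqrt (1 + r\<^sup>2) ^ p = sqrt (1 + r\<^sup>2) powr real p"
        using x by (intro powr_realpow[symmetric]) simp
      also have "\<dots> = ((1 + r\<^sup>2) powr (1 / 2)) powr real p"
        using powr_half_sqrt[of "1 + r\<^sup>2"] x by (simp only: less_imp_le)
      also have "\<dots> = (1 + r\<^sup>2) powr (real p / 2)" by (simp only: powr_powr) simp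
      finally show ?thesis by simp
    qed
    have "1 + r \<le> 2 * sqrt (1 + r\<^sup>2)"
    proof -
      have "1 \<le> sqrt (1 + r\<^sup>2)" "r \<le> sqrt (1 + r\<^sup>2)" by (simp_all add: real_le_rsqrt)
      then show ?thesis by linarith
    qed
    then show "(1 + r) ^ p \<le> 2 ^ p * (1 + r\<^sup>2) powr (real p / 2)"
      unfolding eq power_mult_distrib[symmetric] using that by (intro power_mono) auto
    have "sqrt (1 + r\<^sup>2) \<le> 1 + r"
      using that by (intro real_le_lsqrt) (auto simp: power2_sum)
    then show "(1 + r\<^sup>2) powr (real p / 2) \<le> (1 + r) ^ p"
      unfolding eq by (intro power_mono) auto
  qed
  have "(\<exists>C. \<forall>\<^sub>0\<epsilon>. \<forall>x\<in>{0<..} \<times> \<Gamma>. norm (case x of (r, \<xi>) \<Rightarrow> (1 + r\<^sup>2) powr (real p / 2) *\<^sub>R w \<epsilon> (r *\<^sub>R \<xi>)) \<le> C * \<epsilon> powr - real N)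
     \<longleftrightarrow> rapid_bound N p \<Gamma> w" (is "?L \<longleftrightarrow> ?R")
    for w :: "real \<Rightarrow> real^'a \<Rightarrow> complex" and p N
  proof
    assume ?L
    then obtain C where C: "\<forall>\<^sub>0\<epsilon>. \<forall>x\<in>{0<..} \<times> \<Gamma>. norm (case x of (r, \<xi>) \<Rightarrow> (1 + r\<^sup>2) powr (real p / 2) *\<^sub>R w \<epsilon> (r *\<^sub>R \<xi>)) \<le> C * \<epsilon> powr - real N"
      by blast
    have "\<forall>\<^sub>0\<epsilon>. \<forall>r>0. \<forall>\<xi>\<in>\<Gamma>. (1 + r) ^ p * norm (w \<epsilon> (r *\<^sub>R \<xi>)) \<le> (2 ^ p * C) * inverse \<epsilon> ^ N"
      using C eventually_in_unit
    proof eventually_elim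
      case (elim \<epsilon>)
      show ?case
      proof (intro allI impI ballI)
        fix r :: real and \<xi> assume r: "r > 0" "\<xi> \<in> \<Gamma>"
        have 1: "(1 + r\<^sup>2) powr (real p / 2) * norm (w \<epsilon> (r *\<^sub>R \<xi>)) \<le> C * inverse \<epsilon> ^ N"
          using elim(1)[rule_format, of "(r, \<xi>)"] r elim(2) by (simp add: powr)
        have "(1 + r) ^ p * norm (w \<epsilon> (r *\<^sub>R \<xi>)) \<le> (2 ^ p * (1 + r\<^sup>2) powr (real p / 2)) * norm (w \<epsilon> (r *\<^sub>R \<xi>))"
          by (intro mult_right_mono upper[OF r(1)]) simp
        also have "\<dots> \<le> 2 ^ p * (C * inverse \<epsilon> ^ N)"
          unfolding mult.assoc by (intro mult_left_mono 1) simp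
        finally show "(1 + r) ^ p * norm (w \<epsilon> (r *\<^sub>R \<xi>)) \<le> (2 ^ p * C) * inverse \<epsilon> ^ N" by (simp add: mult.assoc)
      qed
    qed
    then show ?R unfolding rapid_bound_def by blast
  next
    assume ?R
    then obtain C where C: "\<forall>\<^sub>0\<epsilon>. \<forall>r>0. \<forall>\<xi>\<in>\<Gamma>. (1 + r) ^ p * norm (w \<epsilon> (r *\<^sub>R \<xi>)) \<le> C * inverse \<epsilon> ^ N"
      unfolding rapid_bound_def by blast
    have "\<forall>\<^sub>0\<epsilon>. \<forall>x\<in>{0<..} \<times> \<Gamma>. norm (case x of (r, \<xi>) \<Rightarrow> (1 + r\<^sup>2) powr (real p / 2) *\<^sub>R w \<epsilon> (r *\<^sub>R \<xi>)) \<le> C * \<epsilon> powr - real N"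
      using C eventually_in_unit
    proof eventually_elim
      case (elim \<epsilon>)
      show ?case
      proof
        fix q :: "real \<times> (real^'a)" assume "q \<in> {0<..} \<times> \<Gamma>"
        then obtain r \<xi> where q: "q = (r, \<xi>)" and r: "r \<in> {0<..}" "\<xi> \<in> \<Gamma>" by blast
        have "(1 + r\<^sup>2) powr (real p / 2) * norm (w \<epsilon> (r *\<^sub>R \<xi>)) \<le> (1 + r) ^ p * norm (w \<epsilon> (r *\<^sub>R \<xi>))"
          using lower r by (intro mult_right_mono) auto
        also have "\<dots> \<le> C * inverse \<epsilon> ^ N" using elim(1) r by simp
        finally show "norm (case q of (r, \<xi>) \<Rightarrow> (1 + r\<^sup>2) powr (real p / 2) *\<^sub>R w \<epsilon> (r *\<^sub>R \<xi>)) \<le> C * \<epsilon> powr - real N"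
          using elim(2) by (simp add: powr q)
      qed
    qed
    then show ?L by blast
  qed
  then show ?thesis unfolding rapidly_decreasing_def rapid_def sup_bigo_def by simp
qed

section \<open>Oscillatory integrals with a slow scale phase\<close>

lemma one_plus_power_le: "0 \<le> s \<Longrightarrow> (1 + s) ^ p \<le> 2 ^ p * (1 + s ^ p)" for s :: real
proof -
  assume s: "0 \<le> s"
  have "(1 + s) ^ p \<le> (2 * max 1 s) ^ p" using s by (intro power_mono) auto
  also have "\<dots> \<le> 2 ^ p * (1 + s ^ p)" using s by (auto simp: power_mult_distrib max_def)
  finally show ?thesis .
qed

text \<open>
  The repeated integrations by parts bound the powers of \<open>\<omega>\<close>; integrability near \<open>\<omega> = 0\<close> and products of
  estimates call for \<open>1 + \<omega>\<close>.
\<close>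

lemma decay_one_plus:
  assumes B: "weights B" and "\<And>p. \<exists>w\<in>B. \<forall>\<^sub>F \<theta> in F. \<omega> \<theta> ^ p * c \<theta> \<le> w \<theta>"
    and pos: "\<forall>\<^sub>F \<theta> in F. 0 \<le> \<omega> \<theta> \<and> 0 \<le> c \<theta>"
  shows "\<exists>w\<in>B. \<forall>\<^sub>F \<theta> in F. (1 + \<omega> \<theta>) ^ p * c \<theta> \<le> w \<theta>"
proof -
  obtain v w where v: "v \<in> B" "\<forall>\<^sub>F \<theta> in F. \<omega> \<theta> ^ 0 * c \<theta> \<le> v \<theta>" and w: "w \<in> B" "\<forall>\<^sub>F \<theta> in F. \<omega> \<theta> ^ p * c \<theta> \<le> w \<theta>"
    using assms(2)[of 0] assms(2)[of p] by blast
  have "(\<lambda>\<theta>. 2 ^ p * (v \<theta> + w \<theta>)) \<in> B"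
    by (rule weights_mult[OF B weights_const[OF B] weights_add[OF B v(1) w(1)]]) simp
  moreover have "\<forall>\<^sub>F \<theta> in F. (1 + \<omega> \<theta>) ^ p * c \<theta> \<le> 2 ^ p * (v \<theta> + w \<theta>)"
    using v(2) w(2) pos
  proof eventually_elim
    case (elim \<theta>)
    have "(1 + \<omega> \<theta>) ^ p * c \<theta> \<le> (2 ^ p * (1 + \<omega> \<theta> ^ p)) * c \<theta>"
      using elim by (intro mult_right_mono one_plus_power_le) auto
    also have "\<dots> = 2 ^ p * (\<omega> \<theta> ^ 0 * c \<theta> + \<omega> \<theta> ^ p * c \<theta>)" by (simp add: algebra_simps)
    also have "\<dots> \<le> 2 ^ p * (v \<theta> + w \<theta>)" using elim by (intro mult_left_mono add_mono) auto
    finally show ?case .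
  qed
  ultimately show ?thesis by (intro bexI[where x="\<lambda>\<theta>. 2 ^ p * (v \<theta> + w \<theta>)"])
qed

text \<open>
  Fourier transform at \<open>\<zeta>\<close> of \<open>a\<close> times the pullback of the plane wave with covector \<open>\<eta>\<close>.
\<close>

definition osc :: "(real^'n::finite) set \<Rightarrow> (real \<Rightarrow> real^'n \<Rightarrow> complex) \<Rightarrow> (real \<Rightarrow> real^'n \<Rightarrow> real^'m::finite) \<Rightarrow>
    real \<Rightarrow> real^'m \<Rightarrow> real^'n \<Rightarrow> complex" where
  "osc X a f \<epsilon> \<eta> \<zeta> = (LINT x:X|lborel. a \<epsilon> x * iexp (f \<epsilon> x \<bullet> \<eta>) * exp (- (\<i> * of_real (x \<bullet> \<zeta>))))"

lemma bounded_linear_i_times: "bounded_linear (\<lambda>t::real. \<i> * complex_of_real t)"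
  by (rule bounded_linear_compose[OF bounded_linear_mult_right bounded_linear_of_real, unfolded o_def])

text \<open>
  For arbitrary \<open>\<eta>\<close>, the plane wave \<open>exp (\<i> f \<bullet> \<eta>)\<close> is taken as part of the amplitude. Its derivatives
  grow polynomially in \<open>|\<eta>|\<close>, so decay in \<open>\<zeta>\<close> costs a power of \<open>1 + |\<eta>|\<close>, but no power of \<open>1/\<epsilon>\<close> beyond
  slow scale.
\<close>

lemma osc_decay_covariable:
  fixes f :: "real \<Rightarrow> real^'n::finite \<Rightarrow> real^'m::finite"
  assumes X: "open X" "compact K" "K \<subseteq> X"
    and f: "symbol X X (at_right 0) slow_weights f"
    and a: "symbol X X (at_right 0) slow_weights a" "\<forall>\<^sub>0\<epsilon>. \<forall>x\<in>X-K. a \<epsilon> x = 0"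
  shows "\<exists>r\<in>slow_weights. \<exists>k. \<forall>\<^sub>0\<epsilon>. \<forall>\<eta> \<zeta>.
    (1 + norm \<zeta>) ^ p * norm (osc X a f \<epsilon> \<eta> \<zeta>) \<le> r \<epsilon> * (1 + norm \<eta>) ^ k"
proof -
  define h where "h = (\<lambda>(\<eta> :: real^'m, \<zeta> :: real^'n). 1 + norm \<eta>)"
  define F where "F = param_filter (UNIV :: ((real^'m) \<times> (real^'n)) set)"
  define B where "B = param_weights h"
  have B: "weights B" unfolding B_def by (rule weights_param_weights) (auto simp: h_def)
  note XX = X(1) subset_refl
  have f': "symbol X X F B (\<lambda>\<theta>. f (fst \<theta>))" and a': "symbol X X F B (\<lambda>\<theta>. a (fst \<theta>))"
    unfolding F_def B_def by (rule symbol_lift[OF f], rule symbol_lift[OF a(1)])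
  have "(\<lambda>\<theta>. 1 + norm (fst (snd \<theta>))) \<in> B"
    unfolding B_def by (rule param_weightsI[OF slow_weights_const[of 1], where k=1]) (auto simp: h_def)
  then have \<eta>: "symbol X X F B (\<lambda>\<theta> _. fst (snd \<theta>))"
    by (rule symbol_const[OF B]) simp
  have "symbol X X F B (\<lambda>\<theta> x. iexp (f (fst \<theta>) x \<bullet> fst (snd \<theta>)))"
    by (rule symbol_exp[OF B XX symbol_bounded_linear[OF B XX bounded_linear_i_times
        symbol_bilinear[OF B XX bounded_bilinear_inner f' \<eta>]] weights_const[OF B, of 1]]) auto
  from symbol_mult[OF B XX a' this]
  have g: "symbol X X F B (\<lambda>\<theta> x. a (fst \<theta>) x * iexp (f (fst \<theta>) x \<bullet> fst (snd \<theta>)))" .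
  have z: "\<forall>\<^sub>F \<theta> in F. \<forall>x\<in>X-K. a (fst \<theta>) x * iexp (f (fst \<theta>) x \<bullet> fst (snd \<theta>)) = 0"
    unfolding F_def eventually_param_filter using a(2) by eventually_elim auto
  have "\<exists>w\<in>B. \<forall>\<^sub>F \<theta> in F. (1 + norm (snd (snd \<theta>))) ^ p * norm (osc X a f (fst \<theta>) (fst (snd \<theta>)) (snd (snd \<theta>))) \<le> w \<theta>"
    unfolding osc_def by (rule decay_one_plus[OF B fourier_decay[OF B X g z]]) simp
  then obtain w where w: "w \<in> B" "\<forall>\<^sub>F \<theta> in F. (1 + norm (snd (snd \<theta>))) ^ p * norm (osc X a f (fst \<theta>) (fst (snd \<theta>)) (snd (snd \<theta>))) \<le> w \<theta>"
    by blast
  obtain r k where rk: "r \<in> slow_weights" "\<And>\<epsilon> q. w (\<epsilon>, q) \<le> r \<epsilon> * h q ^ k"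
    using w(1) unfolding B_def param_weights_def by blast
  have "\<forall>\<^sub>0\<epsilon>. \<forall>\<eta> \<zeta>. (1 + norm \<zeta>) ^ p * norm (osc X a f \<epsilon> \<eta> \<zeta>) \<le> r \<epsilon> * (1 + norm \<eta>) ^ k"
    using w(2) unfolding F_def eventually_param_filter
  proof eventually_elim
    case (elim \<epsilon>)
    show ?case
    proof (intro allI)
      fix \<eta> \<zeta>
      show "(1 + norm \<zeta>) ^ p * norm (osc X a f \<epsilon> \<eta> \<zeta>) \<le> r \<epsilon> * (1 + norm \<eta>) ^ k"
        using elim[rule_format, of "(\<eta>, \<zeta>)"] rk(2)[of \<epsilon> "(\<eta>, \<zeta>)"] by (simp add: h_def)
    qed
  qed
  then show ?thesis using rk(1) by blast
qed

definition codifferential :: "(real^'n::finite \<Rightarrow> real^'m::finite) \<Rightarrow> real^'n \<Rightarrow> real^'m \<Rightarrow> real^'n" where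
  "codifferential g x \<eta> = (\<chi> j. partial_deriv j g x \<bullet> \<eta>)"

lemma partial_deriv_diff:
  assumes "g differentiable (at x)" "h differentiable (at x)"
  shows "partial_deriv i (\<lambda>x. g x - h x) x = partial_deriv i g x - partial_deriv i h x"
  using partial_deriv_eq[OF has_derivative_diff[OF assms[THEN has_frechet_derivative]]]
  by (simp add: partial_deriv_def)

lemma partial_deriv_inner_left:
  assumes "g differentiable (at x)"
  shows "partial_deriv i (\<lambda>x. g x \<bullet> c) x = partial_deriv i g x \<bullet> c"
  using partial_deriv_eq[OF bounded_linear.has_derivative[OF bounded_linear_inner_left has_frechet_derivative[OF assms]]]
  by (simp add: partial_deriv_def)

text \<open>
  Here both terms belong to the phase. The lower bound \<open>1/\<rho>\<close> for its gradient, normalized by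
  \<open>\<omega> = |\<eta>| + \<kappa>\<close>, is assumed for convex weights \<open>s\<close> and \<open>t\<close>, which stand for \<open>|\<eta>|/\<omega>\<close> and \<open>\<kappa>/\<omega>\<close>. If \<open>b\<close> is
  the normalized gradient, then the vector field \<open>b/|b|\<^sup>2\<close> differentiates the phase to \<open>\<omega>\<close> and is bounded
  with all derivatives by slow scale nets.
\<close>

lemma osc_decay_joint:
  fixes f :: "real \<Rightarrow> real^'n::finite \<Rightarrow> real^'m::finite"
  assumes X: "open X" "compact K" "K \<subseteq> X"
    and f: "symbol X X (at_right 0) slow_weights f"
    and a: "symbol X X (at_right 0) slow_weights a" "\<forall>\<^sub>0\<epsilon>. \<forall>x\<in>X-K. a \<epsilon> x = 0"
    and \<rho>: "\<rho> \<in> slow_weights"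
      "\<forall>\<^sub>0\<epsilon>. \<forall>x\<in>X. \<forall>\<eta>\<in>V. \<forall>\<xi>\<in>\<Gamma>. \<forall>s\<ge>0. \<forall>t\<ge>0. s + t = 1 \<longrightarrow>
         1 \<le> \<rho> \<epsilon> * norm (s *\<^sub>R codifferential (f \<epsilon>) x \<eta> - t *\<^sub>R \<xi>)"
    and \<Gamma>: "\<Gamma> \<subseteq> sphere 0 1"
  shows "\<exists>r\<in>slow_weights. \<forall>\<^sub>0\<epsilon>. \<forall>\<eta>. \<eta> \<noteq> 0 \<longrightarrow> sgn \<eta> \<in> V \<longrightarrow> (\<forall>\<kappa>>0. \<forall>\<xi>\<in>\<Gamma>.
    (1 + (norm \<eta> + \<kappa>)) ^ p * norm (osc X a f \<epsilon> \<eta> (\<kappa> *\<^sub>R \<xi>)) \<le> r \<epsilon>)"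
proof -
  define P where "P = {(\<eta> :: real^'m, \<zeta> :: real^'n). \<eta> \<noteq> 0 \<and> sgn \<eta> \<in> V \<and> (\<exists>\<kappa>>0. \<exists>\<xi>\<in>\<Gamma>. \<zeta> = \<kappa> *\<^sub>R \<xi>)}"
  define F where "F = param_filter P"
  define B where "B = (param_weights (\<lambda>_. 1) :: (real \<times> (real^'m) \<times> (real^'n) \<Rightarrow> real) set)"
  have B: "weights B" unfolding B_def by (rule weights_param_weights) simp
  note XX = X(1) subset_refl
  have f': "symbol X X F B (\<lambda>\<theta>. f (fst \<theta>))" and a': "symbol X X F B (\<lambda>\<theta>. a (fst \<theta>))"
    unfolding F_def B_def by (rule symbol_lift[OF f], rule symbol_lift[OF a(1)])
  define \<omega> where "\<omega> \<theta> = norm (fst (snd \<theta>)) + norm (snd (snd \<theta>))" for \<theta> :: "real \<times> (real^'m) \<times> (real^'n)"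
  have \<omega>_nn: "0 \<le> \<omega> \<theta>" for \<theta> by (simp add: \<omega>_def)
  have le1: "norm ((1 / \<omega> \<theta>) *\<^sub>R fst (snd \<theta>)) \<le> 1" "norm ((1 / \<omega> \<theta>) *\<^sub>R snd (snd \<theta>)) \<le> 1" for \<theta>
  proof -
    have *: "norm ((1 / \<omega> \<theta>) *\<^sub>R w) \<le> 1" if "norm w \<le> \<omega> \<theta>" for w :: "'c::real_normed_vector"
      using that \<omega>_nn[of \<theta>] by (cases "\<omega> \<theta> = 0") (auto simp: divide_le_eq_1)
    show "norm ((1 / \<omega> \<theta>) *\<^sub>R fst (snd \<theta>)) \<le> 1" "norm ((1 / \<omega> \<theta>) *\<^sub>R snd (snd \<theta>)) \<le> 1"
      by (rule *, simp add: \<omega>_def)+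
  qed
  define b where "b j \<theta> x = partial_deriv j (f (fst \<theta>)) x \<bullet> ((1 / \<omega> \<theta>) *\<^sub>R fst (snd \<theta>)) + - (((1 / \<omega> \<theta>) *\<^sub>R snd (snd \<theta>)) $ j)"
    for j and \<theta> :: "real \<times> (real^'m) \<times> (real^'n)" and x
  have b: "symbol X X F B (b j)" for j
  proof -
    have c1: "symbol X X F B (\<lambda>\<theta> _. (1 / \<omega> \<theta>) *\<^sub>R fst (snd \<theta>))"
      by (rule symbol_const[OF B weights_const[OF B, of 1]]) (use le1 in auto)
    have le: "norm (- (((1 / \<omega> \<theta>) *\<^sub>R snd (snd \<theta>)) $ j)) \<le> 1" for \<theta>
      using le1(2)[of \<theta>] Finite_Cartesian_Product.norm_nth_le[of "(1 / \<omega> \<theta>) *\<^sub>R snd (snd \<theta>)" j]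
      unfolding norm_minus_cancel by linarith
    have c2: "symbol X X F B (\<lambda>\<theta> _. - (((1 / \<omega> \<theta>) *\<^sub>R snd (snd \<theta>)) $ j))"
      by (rule symbol_const[OF B weights_const[OF B, of 1]]) (use le in auto)
    have "symbol X X F B (\<lambda>\<theta> x. partial_deriv j (f (fst \<theta>)) x \<bullet> ((1 / \<omega> \<theta>) *\<^sub>R fst (snd \<theta>)))"
      by (rule symbol_bilinear[OF B XX bounded_bilinear_inner symbol_partial_deriv[OF f'] c1])
    from symbol_add[OF B XX this c2] show ?thesis unfolding b_def .
  qed
  define H where "H \<theta> x = (\<Sum>j\<in>UNIV. b j \<theta> x * b j \<theta> x)" for \<theta> x
  have H: "symbol X X F B H"
    unfolding H_def by (rule symbol_sum[OF B XX]) (auto intro: symbol_mult[OF B XX b b])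
  have \<omega>_pos: "\<forall>\<^sub>F \<theta> in F. 0 < \<omega> \<theta>"
    unfolding F_def eventually_param_filter by (auto simp: P_def \<omega>_def intro!: always_eventually add_pos_nonneg)
  have H_low: "\<forall>\<^sub>F \<theta> in F. \<forall>x\<in>X. 1 \<le> (\<rho> (fst \<theta>))\<^sup>2 * H \<theta> x"
    unfolding F_def eventually_param_filter using \<rho>(2)
  proof eventually_elim
    case (elim \<epsilon>)
    show ?case
    proof safe
      fix \<eta> :: "real^'m" and \<zeta> x assume q: "(\<eta>, \<zeta>) \<in> P" and x: "x \<in> X"
      then obtain \<kappa> \<xi> where l: "\<kappa> > 0" "\<xi> \<in> \<Gamma>" "\<zeta> = \<kappa> *\<^sub>R \<xi>" "\<eta> \<noteq> 0" "sgn \<eta> \<in> V" by (auto simp: P_def)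
      have n\<zeta>: "norm \<zeta> = \<kappa>" using l \<Gamma> by auto
      define s t where "s = norm \<eta> / \<omega> (\<epsilon>, \<eta>, \<zeta>)" and "t = norm \<zeta> / \<omega> (\<epsilon>, \<eta>, \<zeta>)"
      have w: "\<omega> (\<epsilon>, \<eta>, \<zeta>) > 0" using l by (auto simp: \<omega>_def intro!: add_pos_nonneg)
      have st: "s \<ge> 0" "t \<ge> 0" "s + t = 1"
        using w by (auto simp: s_def t_def \<omega>_def add_divide_distrib[symmetric])
      have "(s *\<^sub>R codifferential (f \<epsilon>) x (sgn \<eta>) - t *\<^sub>R \<xi>) $ j = b j (\<epsilon>, \<eta>, \<zeta>) x" for j
        using l n\<zeta> w by (simp add: s_def t_def b_def codifferential_def sgn_div_norm)
      then have "(norm (s *\<^sub>R codifferential (f \<epsilon>) x (sgn \<eta>) - t *\<^sub>R \<xi>))\<^sup>2 = H (\<epsilon>, \<eta>, \<zeta>) x"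
        unfolding power2_norm_eq_inner inner_vec_def H_def by simp
      moreover have "1 \<le> \<rho> \<epsilon> * norm (s *\<^sub>R codifferential (f \<epsilon>) x (sgn \<eta>) - t *\<^sub>R \<xi>)"
        using elim x l st by blast
      then have "1 \<le> (\<rho> \<epsilon> * norm (s *\<^sub>R codifferential (f \<epsilon>) x (sgn \<eta>) - t *\<^sub>R \<xi>))\<^sup>2"
        by (simp add: one_le_power)
      ultimately show "1 \<le> (\<rho> (fst (\<epsilon>, \<eta>, \<zeta>)))\<^sup>2 * H (\<epsilon>, \<eta>, \<zeta>) x"
        by (simp add: power_mult_distrib)
    qed
  qed
  have \<rho>2: "(\<lambda>\<theta>. (\<rho> (fst \<theta>))\<^sup>2) \<in> B"
    unfolding B_def power2_eq_square
    by (rule slow_weights_lift[OF slow_weights_add_mult(2)[OF \<rho>(1) \<rho>(1)]])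
  have Hpos: "\<forall>\<^sub>F \<theta> in F. \<forall>x\<in>X. 0 < H \<theta> x \<and> inverse (H \<theta> x) \<le> (\<rho> (fst \<theta>))\<^sup>2"
    using H_low
  proof eventually_elim
    case (elim \<theta>)
    show ?case
    proof
      fix x assume "x \<in> X"
      then have 1: "1 \<le> (\<rho> (fst \<theta>))\<^sup>2 * H \<theta> x" using elim by blast
      have "0 \<le> H \<theta> x" unfolding H_def by (intro sum_nonneg) simp
      then have p: "0 < H \<theta> x" using 1 by (cases "H \<theta> x = 0") auto
      then show "0 < H \<theta> x \<and> inverse (H \<theta> x) \<le> (\<rho> (fst \<theta>))\<^sup>2"
        using 1 by (simp add: field_simps)
    qed
  qed
  have iH: "symbol X X F B (\<lambda>\<theta> x. inverse (H \<theta> x))"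
  proof (rule symbol_inverse[OF B XX H _ \<rho>2])
    show "\<forall>\<^sub>F \<theta> in F. \<forall>x\<in>X. H \<theta> x \<noteq> 0" using Hpos by eventually_elim force
    show "\<forall>\<^sub>F \<theta> in F. \<forall>x\<in>X. norm (inverse (H \<theta> x)) \<le> (\<rho> (fst \<theta>))\<^sup>2"
      using Hpos by eventually_elim (auto simp: abs_of_pos)
  qed
  define c where "c j \<theta> x = b j \<theta> x * inverse (H \<theta> x)" for j \<theta> x
  have c: "symbol X X F B (c j)" for j
    unfolding c_def by (rule symbol_mult[OF B XX b iH])
  define \<psi> where "\<psi> \<theta> x = f (fst \<theta>) x \<bullet> fst (snd \<theta>) - x \<bullet> snd (snd \<theta>)" for \<theta> :: "real \<times> (real^'m) \<times> (real^'n)" and x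
  have df: "\<forall>\<^sub>F \<theta> in F. \<forall>x\<in>X. f (fst \<theta>) differentiable (at x)"
    by (rule symbol_differentiable[OF f'])
  have \<psi>_deriv: "\<forall>\<^sub>F \<theta> in F. \<forall>j. \<forall>x\<in>X. partial_deriv j (\<psi> \<theta>) x = \<omega> \<theta> * b j \<theta> x"
    using df \<omega>_pos
  proof eventually_elim
    case (elim \<theta>)
    show ?case
    proof (intro allI ballI)
      fix j x assume x: "x \<in> X"
      have d: "(\<lambda>x. f (fst \<theta>) x \<bullet> fst (snd \<theta>)) differentiable (at x)" "(\<lambda>x. x \<bullet> snd (snd \<theta>)) differentiable (at x)"
        using elim(1) x by (auto intro!: differentiable_inner)
      have "partial_deriv j (\<psi> \<theta>) x = partial_deriv j (f (fst \<theta>)) x \<bullet> fst (snd \<theta>) - snd (snd \<theta>) $ j"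
        unfolding \<psi>_def using partial_deriv_diff[OF d] partial_deriv_inner_left[of "f (fst \<theta>)" x j "fst (snd \<theta>)"]
          partial_deriv_inner[of j "snd (snd \<theta>)" x] elim(1) x by simp
      then show "partial_deriv j (\<psi> \<theta>) x = \<omega> \<theta> * b j \<theta> x"
        using elim(2) by (simp add: b_def algebra_simps)
    qed
  qed
  have \<psi>: "symbol X {} F B \<psi>"
  proof -
    have f1: "symbol X {} F B (\<lambda>\<theta>. f (fst \<theta>))" by (rule symbol_mono[OF f']) auto
    have e: "symbol X {} F B (\<lambda>\<theta> _. fst (snd \<theta>))"
      by (rule symbol_of_smooth[OF B]) (simp add: smooth_on_const)
    have x: "symbol X {} F B (\<lambda>\<theta> x. x \<bullet> snd (snd \<theta>))"
      by (rule symbol_of_smooth[OF B]) (simp add: smooth_on_inner)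
    note E = X(1) empty_subsetI[of X]
    have "symbol X {} F B (\<lambda>\<theta> x. f (fst \<theta>) x \<bullet> fst (snd \<theta>))"
      by (rule symbol_bilinear[OF B E bounded_bilinear_inner f1 e])
    from symbol_add[OF B E this symbol_bounded_linear[OF B E bounded_linear_minus[OF bounded_linear_ident] x]]
    show ?thesis unfolding \<psi>_def diff_conv_add_uminus .
  qed
  have z: "\<forall>\<^sub>F \<theta> in F. \<forall>x\<in>X-K. a (fst \<theta>) x = 0"
    unfolding F_def eventually_param_filter using a(2) by eventually_elim auto
  have eq: "\<forall>\<^sub>F \<theta> in F. \<forall>x\<in>X. (\<Sum>j\<in>UNIV. c j \<theta> x * partial_deriv j (\<psi> \<theta>) x) = \<omega> \<theta>"
    using \<psi>_deriv Hpos
  proof eventually_elim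
    case (elim \<theta>)
    show ?case
    proof
      fix x assume x: "x \<in> X"
      have "(\<Sum>j\<in>UNIV. c j \<theta> x * partial_deriv j (\<psi> \<theta>) x) = (\<Sum>j\<in>UNIV. (b j \<theta> x * b j \<theta> x) * (\<omega> \<theta> * inverse (H \<theta> x)))"
        using elim(1) x by (intro sum.cong) (auto simp: c_def)
      also have "\<dots> = H \<theta> x * (\<omega> \<theta> * inverse (H \<theta> x))" by (simp only: H_def sum_distrib_right)
      finally show "(\<Sum>j\<in>UNIV. c j \<theta> x * partial_deriv j (\<psi> \<theta>) x) = \<omega> \<theta>" using elim(2) x by force
    qed
  qed
  have "\<exists>w\<in>B. \<forall>\<^sub>F \<theta> in F. (1 + \<omega> \<theta>) ^ p * norm (LINT x:X|lborel. a (fst \<theta>) x * exp (\<i> * of_real (\<psi> \<theta> x))) \<le> w \<theta>"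
    by (rule decay_one_plus[OF B nonstationary_phase[OF B X a' z c \<psi> eq]]) (use \<omega>_nn in auto)
  then obtain w where w: "w \<in> B" "\<forall>\<^sub>F \<theta> in F. (1 + \<omega> \<theta>) ^ p * norm (LINT x:X|lborel. a (fst \<theta>) x * exp (\<i> * of_real (\<psi> \<theta> x))) \<le> w \<theta>"
    by blast
  obtain r k where rk: "r \<in> slow_weights" "\<And>\<epsilon> q. w (\<epsilon>, q) \<le> r \<epsilon> * 1 ^ k"
    using w(1) unfolding B_def param_weights_def by blast
  have osc_eq: "(LINT x:X|lborel. a \<epsilon> x * exp (\<i> * of_real (\<psi> (\<epsilon>, \<eta>, \<zeta>) x))) = osc X a f \<epsilon> \<eta> \<zeta>" for \<epsilon> \<eta> \<zeta>
    unfolding osc_def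
  proof (rule arg_cong[where f="\<lambda>h. set_lebesgue_integral lborel X h"], rule ext)
    fix x
    have "exp (\<i> * of_real (\<psi> (\<epsilon>, \<eta>, \<zeta>) x)) = iexp (f \<epsilon> x \<bullet> \<eta>) * exp (- (\<i> * of_real (x \<bullet> \<zeta>)))"
      unfolding exp_add[symmetric] by (simp add: \<psi>_def algebra_simps)
    then show "a \<epsilon> x * exp (\<i> * of_real (\<psi> (\<epsilon>, \<eta>, \<zeta>) x)) = a \<epsilon> x * iexp (f \<epsilon> x \<bullet> \<eta>) * exp (- (\<i> * of_real (x \<bullet> \<zeta>)))"
      by simp
  qed
  have "\<forall>\<^sub>0\<epsilon>. \<forall>\<eta>. \<eta> \<noteq> 0 \<longrightarrow> sgn \<eta> \<in> V \<longrightarrow> (\<forall>\<kappa>>0. \<forall>\<xi>\<in>\<Gamma>.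
    (1 + (norm \<eta> + \<kappa>)) ^ p * norm (osc X a f \<epsilon> \<eta> (\<kappa> *\<^sub>R \<xi>)) \<le> r \<epsilon>)"
    using w(2) unfolding F_def eventually_param_filter
  proof eventually_elim
    case (elim \<epsilon>)
    show ?case
    proof (intro allI impI ballI)
      fix \<eta> \<kappa> \<xi> assume h: "\<eta> \<noteq> 0" "sgn \<eta> \<in> V" "(0::real) < \<kappa>" "\<xi> \<in> \<Gamma>"
      then have "(\<eta>, \<kappa> *\<^sub>R \<xi>) \<in> P" by (auto simp: P_def)
      moreover have "norm (\<kappa> *\<^sub>R \<xi>) = \<kappa>" using h \<Gamma> by auto
      ultimately show "(1 + (norm \<eta> + \<kappa>)) ^ p * norm (osc X a f \<epsilon> \<eta> (\<kappa> *\<^sub>R \<xi>)) \<le> r \<epsilon>"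
        using elim[rule_format, of "(\<eta>, \<kappa> *\<^sub>R \<xi>)"] rk(2)[of \<epsilon> "(\<eta>, \<kappa> *\<^sub>R \<xi>)"] by (simp add: osc_eq \<omega>_def)
    qed
  qed
  then show ?thesis using rk(1) by blast
qed

section \<open>Microlocal estimate for the pullback\<close>

text \<open>
  Insert the inversion formula for \<open>v\<close> at \<open>f x\<close> and exchange the integrals.
\<close>

lemma fourier_superposition:
  fixes a :: "real^'n::finite \<Rightarrow> complex" and f :: "real^'n \<Rightarrow> real^'m::finite"
  assumes X: "open X" "compact K" "K \<subseteq> X" "\<And>x. x \<in> X - K \<Longrightarrow> a x = 0"
    and a: "continuous_on X a" and f: "continuous_on X f"
    and v: "integrable lborel V" "\<And>y. (LINT \<eta>|lborel. V \<eta> * iexp (y \<bullet> \<eta>)) = c * v y"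
  shows "c * (LINT x:X|lborel. a x * v (f x) * exp (- (\<i> * of_real (x \<bullet> \<zeta>)))) =
     (LINT \<eta>|lborel. V \<eta> * (LINT x:X|lborel. a x * iexp (f x \<bullet> \<eta>) * exp (- (\<i> * of_real (x \<bullet> \<zeta>)))))"
proof -
  have Xs [measurable]: "X \<in> sets borel" using X(1) by simp
  define a' where "a' x = indicator X x *\<^sub>R a x" for x
  define f' where "f' x = indicator X x *\<^sub>R f x" for x
  have [measurable]: "a' \<in> borel_measurable borel" "f' \<in> borel_measurable borel"
    unfolding a'_def f'_def using borel_measurable_continuous_on_indicator[OF Xs a] borel_measurable_continuous_on_indicator[OF Xs f]
    by simp_all
  have [measurable]: "V \<in> borel_measurable borel" using borel_measurable_integrable[OF v(1)] by simp
  have ai: "integrable lborel a'"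
    using set_integrable_compact_support[OF X a] unfolding a'_def set_integrable_def .
  define G where "G x \<eta> = a' x * iexp (f' x \<bullet> \<eta>) * exp (- (\<i> * of_real (x \<bullet> \<zeta>))) * V \<eta>" for x \<eta>
  have G: "integrable (lborel \<Otimes>\<^sub>M lborel) (case_prod G)"
  proof (rule integrable_lborel_product[OF _ integrable_norm[OF ai] integrable_norm[OF v(1)]])
    show "case_prod G \<in> borel_measurable (borel \<Otimes>\<^sub>M borel)" unfolding G_def by measurable
    show "norm (G x \<eta>) \<le> norm (a' x) * norm (V \<eta>)" for x \<eta>
      by (simp add: G_def norm_mult)
  qed
  have "(LINT \<eta>|lborel. V \<eta> * (LINT x:X|lborel. a x * iexp (f x \<bullet> \<eta>) * exp (- (\<i> * of_real (x \<bullet> \<zeta>))))) =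
      (LINT \<eta>|lborel. (LINT x|lborel. G x \<eta>))"
  proof (rule Bochner_Integration.integral_cong[OF refl])
    fix \<eta>
    have "(LINT x|lborel. G x \<eta>) = (LINT x|lborel. V \<eta> * (indicator X x *\<^sub>R (a x * iexp (f x \<bullet> \<eta>) * exp (- (\<i> * of_real (x \<bullet> \<zeta>))))))"
      by (rule Bochner_Integration.integral_cong[OF refl]) (simp add: G_def a'_def f'_def indicator_def)
    then show "V \<eta> * (LINT x:X|lborel. a x * iexp (f x \<bullet> \<eta>) * exp (- (\<i> * of_real (x \<bullet> \<zeta>)))) = (LINT x|lborel. G x \<eta>)"
      unfolding set_lebesgue_integral_def by (simp only: integral_mult_right_zero)
  qed
  also have "\<dots> = (LINT x|lborel. (LINT \<eta>|lborel. G x \<eta>))"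
    by (rule lborel_pair.Fubini_integral[OF G])
  also have "\<dots> = (LINT x|lborel. c * (indicator X x *\<^sub>R (a x * v (f x) * exp (- (\<i> * of_real (x \<bullet> \<zeta>))))))"
  proof (rule Bochner_Integration.integral_cong[OF refl])
    fix x
    have "(LINT \<eta>|lborel. G x \<eta>) = (LINT \<eta>|lborel. (a' x * exp (- (\<i> * of_real (x \<bullet> \<zeta>)))) * (V \<eta> * iexp (f' x \<bullet> \<eta>)))"
      by (rule Bochner_Integration.integral_cong[OF refl]) (simp only: G_def mult_ac)
    also have "\<dots> = (a' x * exp (- (\<i> * of_real (x \<bullet> \<zeta>)))) * (c * v (f' x))"
      by (simp only: integral_mult_right_zero v(2))
    also have "\<dots> = c * (indicator X x *\<^sub>R (a x * v (f x) * exp (- (\<i> * of_real (x \<bullet> \<zeta>)))))"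
      by (simp add: a'_def f'_def indicator_def)
    finally show "(LINT \<eta>|lborel. G x \<eta>) = c * (indicator X x *\<^sub>R (a x * v (f x) * exp (- (\<i> * of_real (x \<bullet> \<zeta>)))))" .
  qed
  finally show ?thesis
    unfolding set_lebesgue_integral_def by (simp only: integral_mult_right_zero)
qed

lemma fourier_norm_le:
  fixes v :: "real^'m::finite \<Rightarrow> complex"
  assumes v: "continuous_on UNIV v" and L: "compact L" "\<And>y. y \<notin> L \<Longrightarrow> v y = 0"
    and le: "\<And>y. norm (v y) \<le> c"
  shows "norm (fourier v \<eta>) \<le> measure lborel L * c"
proof -
  have "norm (LINT x:UNIV|lborel. v x * exp (- (\<i> * of_real (x \<bullet> \<eta>)))) \<le> measure lborel L * c"
    by (rule norm_set_integral_le[OF open_UNIV L(1)])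
      (use L(2) le in \<open>auto intro!: continuous_intros v order_trans[OF norm_ge_zero le] simp: norm_mult\<close>)
  then show ?thesis by (simp add: fourier_def set_lebesgue_integral_def)
qed

text \<open>
  The core of the microlocal estimate. The transform of \<open>a \<cdot> (v \<circ> f)\<close> is a superposition over \<open>\<eta>\<close> of
  \<open>fourier v \<eta>\<close> times an oscillatory integral. For \<open>\<eta>\<close> in the cone over \<open>V\<close> the second factor decays
  in \<open>|\<eta>| + \<kappa>\<close> and the first is moderate; for all other \<open>\<eta>\<close> the first factor decays in \<open>|\<eta>|\<close>, as
  fast as is needed to pay for the growth of the second.
\<close>

theorem rapid_pullback:
  fixes f :: "real \<Rightarrow> real^'n::finite \<Rightarrow> real^'m::finite" and a :: "real \<Rightarrow> real^'n \<Rightarrow> complex"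
    and v :: "real \<Rightarrow> real^'m \<Rightarrow> complex"
  assumes X: "open X" "compact K" "K \<subseteq> X"
    and f: "symbol X X (at_right 0) slow_weights f"
    and a: "symbol X X (at_right 0) slow_weights a" "\<forall>\<^sub>0\<epsilon>. \<forall>x\<in>X-K. a \<epsilon> x = 0"
    and v: "\<forall>\<^sub>0\<epsilon>. smooth_on UNIV (v \<epsilon>)" "compact L" "\<forall>\<^sub>0\<epsilon>. \<forall>y. y \<notin> L \<longrightarrow> v \<epsilon> y = 0"
      "\<forall>\<^sub>0\<epsilon>. \<forall>y. norm (v \<epsilon> y) \<le> C\<^sub>0 * inverse \<epsilon> ^ N\<^sub>0"
    and decay: "rapid (sphere 0 1 - V) (\<lambda>\<epsilon>. fourier (v \<epsilon>))"
    and \<rho>: "\<rho> \<in> slow_weights"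
      "\<forall>\<^sub>0\<epsilon>. \<forall>x\<in>X. \<forall>\<eta>\<in>V. \<forall>\<xi>\<in>\<Gamma>. \<forall>s\<ge>0. \<forall>t\<ge>0. s + t = 1 \<longrightarrow>
         1 \<le> \<rho> \<epsilon> * norm (s *\<^sub>R codifferential (f \<epsilon>) x \<eta> - t *\<^sub>R \<xi>)"
    and \<Gamma>: "\<Gamma> \<subseteq> sphere 0 1"
  shows "rapid \<Gamma> (\<lambda>\<epsilon> \<zeta>. LINT x:X|lborel. a \<epsilon> x * v \<epsilon> (f \<epsilon> x) * exp (- (\<i> * of_real (x \<bullet> \<zeta>))))"
proof -
  let ?q = "2 * DIM(real^'m)"
  let ?g = "(gauss_const TYPE(real^'m))\<^sup>2"
  have g: "?g > 0" using gauss_const_pos[where 'a="real^'m"] by simp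
  obtain N\<^sub>1 where N1: "\<And>p. rapid_bound N\<^sub>1 p (sphere 0 1 - V) (\<lambda>\<epsilon>. fourier (v \<epsilon>))"
    using decay unfolding rapid_def by blast
  define C\<^sub>2 where "C\<^sub>2 = measure lborel L * max C\<^sub>0 0"
  have C2: "0 \<le> C\<^sub>2" by (simp add: C\<^sub>2_def)
  have v_fourier: "\<forall>\<^sub>0\<epsilon>. \<forall>\<eta>. norm (fourier (v \<epsilon>) \<eta>) \<le> C\<^sub>2 * inverse \<epsilon> ^ N\<^sub>0"
    using v(1,3,4) eventually_in_unit
  proof eventually_elim
    case (elim \<epsilon>)
    have "C\<^sub>0 * inverse \<epsilon> ^ N\<^sub>0 \<le> max C\<^sub>0 0 * inverse \<epsilon> ^ N\<^sub>0" using elim(4) by (intro mult_right_mono) auto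
    then have "norm (v \<epsilon> y) \<le> max C\<^sub>0 0 * inverse \<epsilon> ^ N\<^sub>0" for y using elim(3) order_trans by blast
    then show ?case
      using fourier_norm_le[OF smooth_on_continuous_on[OF elim(1)] v(2), of "max C\<^sub>0 0 * inverse \<epsilon> ^ N\<^sub>0"] elim(2)
      by (simp add: C\<^sub>2_def mult.assoc)
  qed
  \<comment> \<open>\<open>N\<^sub>0\<close> and \<open>N\<^sub>1\<close> bound \<open>fourier v\<close> in the two regions. The additional power absorbs the slow
    scale nets, which depend on \<open>p\<close> while \<open>N\<close> does not.\<close>
  define N where "N = N\<^sub>0 + N\<^sub>1 + 1"
  define J where "J = osc X a f"
  show ?thesis
  proof (rule rapidI[where N=N])
    fix p :: nat
    obtain r\<^sub>1 k where r1: "r\<^sub>1 \<in> slow_weights" "\<forall>\<^sub>0\<epsilon>. \<forall>\<eta> \<zeta>. (1 + norm \<zeta>) ^ p * norm (J \<epsilon> \<eta> \<zeta>) \<le> r\<^sub>1 \<epsilon> * (1 + norm \<eta>) ^ k"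
      using osc_decay_covariable[OF X f a, of p] unfolding J_def by blast
    obtain r\<^sub>2 where r2: "r\<^sub>2 \<in> slow_weights" "\<forall>\<^sub>0\<epsilon>. \<forall>\<eta>. \<eta> \<noteq> 0 \<longrightarrow> sgn \<eta> \<in> V \<longrightarrow> (\<forall>\<kappa>>0. \<forall>\<xi>\<in>\<Gamma>.
        (1 + (norm \<eta> + \<kappa>)) ^ (p + ?q) * norm (J \<epsilon> \<eta> (\<kappa> *\<^sub>R \<xi>)) \<le> r\<^sub>2 \<epsilon>)"
      using osc_decay_joint[OF X f a \<rho> \<Gamma>, of "p + ?q"] unfolding J_def by blast
    obtain A\<^sub>1 where A1: "0 \<le> A\<^sub>1" "\<forall>\<^sub>0\<epsilon>. r\<^sub>1 \<epsilon> \<le> A\<^sub>1 * inverse \<epsilon>" using slow_weights_bound[OF r1(1)] .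
    obtain A\<^sub>2 where A2: "0 \<le> A\<^sub>2" "\<forall>\<^sub>0\<epsilon>. r\<^sub>2 \<epsilon> \<le> A\<^sub>2 * inverse \<epsilon>" using slow_weights_bound[OF r2(1)] .
    obtain C\<^sub>1 where C1: "\<forall>\<^sub>0\<epsilon>. \<forall>r>0. \<forall>\<xi>\<in>sphere 0 1 - V.
        (1 + r) ^ (k + ?q) * norm (fourier (v \<epsilon>) (r *\<^sub>R \<xi>)) \<le> C\<^sub>1 * inverse \<epsilon> ^ N\<^sub>1"
      using N1[of "k + ?q"] unfolding rapid_bound_def by blast
    define A where "A = (A\<^sub>1 + A\<^sub>2) * (max C\<^sub>1 0 + C\<^sub>2)"
    have pointwise: "\<forall>\<^sub>0\<epsilon>. \<forall>\<eta>. \<forall>\<kappa>>0. \<forall>\<xi>\<in>\<Gamma>. (1 + \<kappa>) ^ p * norm (fourier (v \<epsilon>) \<eta> * J \<epsilon> \<eta> (\<kappa> *\<^sub>R \<xi>)) \<le> A * inverse \<epsilon> ^ N * decay_weight \<eta>"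
      using r1(2) r2(2) A1(2) A2(2) C1 v_fourier eventually_in_unit
    proof eventually_elim
      case (elim \<epsilon>)
      note E = elim
      define i where "i = inverse \<epsilon>"
      have i: "1 \<le> i" using E(7) by (simp add: i_def one_le_inverse)
      have mono: "i ^ l \<le> i ^ l'" if "l \<le> l'" for l l' using that i by (rule power_increasing)
      have r_nn: "0 \<le> r\<^sub>1 \<epsilon>" "0 \<le> r\<^sub>2 \<epsilon>"
        using r1(1) r2(1) weights_nonneg[OF weights_slow_weights] by blast+
      show ?case
      proof (intro allI impI ballI)
        fix \<eta> :: "real^'m" and \<kappa> :: real and \<xi> assume l: "0 < \<kappa>" "\<xi> \<in> \<Gamma>"
        then have n: "norm (\<kappa> *\<^sub>R \<xi>) = \<kappa>" using \<Gamma> by auto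
        \<comment> \<open>The factor \<open>D\<close> is traded for the integrable weight \<open>decay_weight\<close> at the end.\<close>
        define D where "D = (1 + norm \<eta>) ^ ?q"
        have D: "0 < D" unfolding D_def by (intro zero_less_power add_pos_nonneg) auto
        have D1: "D = 1" if "\<eta> = 0" using that by (simp add: D_def)
        let ?F = "norm (fourier (v \<epsilon>) \<eta>)" and ?J = "norm (J \<epsilon> \<eta> (\<kappa> *\<^sub>R \<xi>))"
        have "(1 + \<kappa>) ^ p * (?F * ?J) * D \<le> A * i ^ N"
        proof (cases "\<eta> \<noteq> 0 \<and> sgn \<eta> \<in> V")
          case True
          have "(1 + \<kappa>) ^ p * ?J * D \<le> (1 + (norm \<eta> + \<kappa>)) ^ p * ?J * (1 + (norm \<eta> + \<kappa>)) ^ ?q"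
            unfolding D_def using l by (intro mult_mono power_mono mult_nonneg_nonneg) auto
          also have "\<dots> = (1 + (norm \<eta> + \<kappa>)) ^ (p + ?q) * ?J" by (simp add: power_add)
          also have "\<dots> \<le> A\<^sub>2 * i" using E(2,4) True l by (fastforce simp: i_def)
          finally have 1: "(1 + \<kappa>) ^ p * ?J * D \<le> A\<^sub>2 * i" .
          have "(1 + \<kappa>) ^ p * (?F * ?J) * D = ?F * ((1 + \<kappa>) ^ p * ?J * D)" by simp
          also have "\<dots> \<le> (C\<^sub>2 * i ^ N\<^sub>0) * (A\<^sub>2 * i)"
          proof (rule mult_mono[OF _ 1])
            show "?F \<le> C\<^sub>2 * i ^ N\<^sub>0" using E(6) by (simp add: i_def)
            show "0 \<le> C\<^sub>2 * i ^ N\<^sub>0" using C2 i by simp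
            show "0 \<le> (1 + \<kappa>) ^ p * ?J * D" using l D by simp
          qed
          also have "\<dots> = (A\<^sub>2 * C\<^sub>2) * i ^ (N\<^sub>0 + 1)" by simp
          also have "\<dots> \<le> A * i ^ N"
            unfolding A_def using A1(1) A2(1) C2 i by (intro mult_mono mono) (auto simp: N_def intro!: mult_mono)
          finally show ?thesis .
        next
          case False
          have 1: "(1 + \<kappa>) ^ p * ?J \<le> (A\<^sub>1 * i) * (1 + norm \<eta>) ^ k"
          proof -
            have "(1 + \<kappa>) ^ p * ?J \<le> r\<^sub>1 \<epsilon> * (1 + norm \<eta>) ^ k" using E(1) n by metis
            also have "\<dots> \<le> (A\<^sub>1 * i) * (1 + norm \<eta>) ^ k" using E(3) by (intro mult_right_mono) (auto simp: i_def)
            finally show ?thesis .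
          qed
          have 2: "?F * ((1 + norm \<eta>) ^ k * D) \<le> (max C\<^sub>1 0 + C\<^sub>2) * i ^ (N\<^sub>0 + N\<^sub>1)"
          proof (cases "\<eta> = 0")
            case True
            have "?F \<le> C\<^sub>2 * i ^ N\<^sub>0" using E(6) by (simp add: i_def)
            also have "\<dots> \<le> (max C\<^sub>1 0 + C\<^sub>2) * i ^ (N\<^sub>0 + N\<^sub>1)" using C2 i by (intro mult_mono mono) auto
            finally show ?thesis using True D1 by simp
          next
            case nz: False
            then have "sgn \<eta> \<in> sphere 0 1 - V" using False by (simp add: norm_sgn)
            then have "(1 + norm \<eta>) ^ (k + ?q) * norm (fourier (v \<epsilon>) (norm \<eta> *\<^sub>R sgn \<eta>)) \<le> C\<^sub>1 * inverse \<epsilon> ^ N\<^sub>1"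
              using E(5) nz by (meson zero_less_norm_iff)
            moreover have "norm \<eta> *\<^sub>R sgn \<eta> = \<eta>" using nz by (simp add: sgn_div_norm)
            ultimately have "?F * ((1 + norm \<eta>) ^ k * D) \<le> C\<^sub>1 * i ^ N\<^sub>1"
              by (simp add: D_def power_add i_def mult_ac)
            also have "\<dots> \<le> (max C\<^sub>1 0 + C\<^sub>2) * i ^ (N\<^sub>0 + N\<^sub>1)" using C2 i by (intro mult_mono mono) auto
            finally show ?thesis .
          qed
          have "(1 + \<kappa>) ^ p * (?F * ?J) * D = ((1 + \<kappa>) ^ p * ?J) * (?F * D)" by simp
          also have "\<dots> \<le> ((A\<^sub>1 * i) * (1 + norm \<eta>) ^ k) * (?F * D)"
            using D by (intro mult_right_mono 1) auto
          also have "\<dots> = (A\<^sub>1 * i) * (?F * ((1 + norm \<eta>) ^ k * D))" by simp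
          also have "\<dots> \<le> (A\<^sub>1 * i) * ((max C\<^sub>1 0 + C\<^sub>2) * i ^ (N\<^sub>0 + N\<^sub>1))"
            using A1(1) i by (intro mult_left_mono 2) auto
          also have "\<dots> = (A\<^sub>1 * (max C\<^sub>1 0 + C\<^sub>2)) * i ^ N" by (simp add: N_def)
          also have "\<dots> \<le> A * i ^ N"
            unfolding A_def using A1(1) A2(1) C2 i by (intro mult_right_mono) auto
          finally show ?thesis .
        qed
        then have "(1 + \<kappa>) ^ p * (?F * ?J) \<le> A * i ^ N * inverse D"
          using D by (simp add: field_simps)
        also have "\<dots> \<le> A * i ^ N * decay_weight \<eta>"
          unfolding D_def A_def using A1(1) A2(1) C2 i by (intro mult_left_mono inverse_power_le_decay_weight) auto
        finally show "(1 + \<kappa>) ^ p * norm (fourier (v \<epsilon>) \<eta> * J \<epsilon> \<eta> (\<kappa> *\<^sub>R \<xi>)) \<le> A * inverse \<epsilon> ^ N * decay_weight \<eta>"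
          by (simp add: norm_mult i_def)
      qed
    qed
    define W where "W = (LINT \<eta>|lborel. decay_weight (\<eta> :: real^'m))"
    have "\<forall>\<^sub>0\<epsilon>. \<forall>r>0. \<forall>\<xi>\<in>\<Gamma>. (1 + r) ^ p *
       norm (LINT x:X|lborel. a \<epsilon> x * v \<epsilon> (f \<epsilon> x) * exp (- (\<i> * of_real (x \<bullet> r *\<^sub>R \<xi>)))) \<le> (A * W / ?g) * inverse \<epsilon> ^ N"
      using pointwise a(2) symbol_differentiable[OF a(1)] symbol_differentiable[OF f] v(1,3)
    proof eventually_elim
      case (elim \<epsilon>)
      note E = elim
      have cont: "continuous_on X (a \<epsilon>)" "continuous_on X (f \<epsilon>)"
        using E(3,4) by (auto intro!: continuous_on_of_differentiable)
      have vz: "v \<epsilon> y = 0" if "y \<notin> L" for y using E(6) that by blast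
      show ?case
      proof (intro allI impI ballI)
        fix \<kappa> :: real and \<xi> assume l: "0 < \<kappa>" "\<xi> \<in> \<Gamma>"
        let ?I = "LINT x:X|lborel. a \<epsilon> x * v \<epsilon> (f \<epsilon> x) * exp (- (\<i> * of_real (x \<bullet> \<kappa> *\<^sub>R \<xi>)))"
        let ?h = "\<lambda>\<eta>. fourier (v \<epsilon>) \<eta> * J \<epsilon> \<eta> (\<kappa> *\<^sub>R \<xi>)"
        have eq: "of_real ?g * ?I = (LINT \<eta>|lborel. ?h \<eta>)"
          unfolding J_def osc_def
          by (rule fourier_superposition[OF X _ cont fourier_integrable[OF E(5) v(2) vz] smooth_fourier_inversion[OF E(5) v(2) vz]])
            (use E(2) in auto)
        have "(1 + \<kappa>) ^ p * norm (LINT \<eta>|lborel. ?h \<eta>) \<le> A * inverse \<epsilon> ^ N * W"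
        proof (cases "integrable lborel ?h")
          case True
          have "(1 + \<kappa>) ^ p * norm (LINT \<eta>|lborel. ?h \<eta>) \<le> (1 + \<kappa>) ^ p * (LINT \<eta>|lborel. norm (?h \<eta>))"
            using l by (intro mult_left_mono integral_norm_bound) auto
          also have "\<dots> = (LINT \<eta>|lborel. (1 + \<kappa>) ^ p * norm (?h \<eta>))" by simp
          also have "\<dots> \<le> (LINT \<eta>|lborel. A * inverse \<epsilon> ^ N * decay_weight (\<eta> :: real^'m))"
          proof (rule Bochner_Integration.integral_mono)
            show "integrable lborel (\<lambda>\<eta>. (1 + \<kappa>) ^ p * norm (?h \<eta>))"
              by (rule integrable_mult_right[OF integrable_norm[OF True]])
            show "integrable lborel (\<lambda>\<eta>::real^'m. A * inverse \<epsilon> ^ N * decay_weight \<eta>)"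
              by (rule integrable_mult_right[OF decay_weight_integrable])
            show "(1 + \<kappa>) ^ p * norm (?h \<eta>) \<le> A * inverse \<epsilon> ^ N * decay_weight \<eta>" for \<eta>
              using E(1) l by blast
          qed
          also have "\<dots> = A * inverse \<epsilon> ^ N * W" by (simp add: W_def)
          finally show ?thesis .
        next
          case False
          have "0 \<le> (1 + \<kappa>) ^ p * norm (?h 0)" using l by simp
          also have "\<dots> \<le> A * inverse \<epsilon> ^ N * decay_weight (0 :: real^'m)" using E(1) l by blast
          finally have "0 \<le> A * inverse \<epsilon> ^ N" using decay_weight_pos[of "0 :: real^'m"] by (simp add: zero_le_mult_iff)
          moreover have "0 \<le> W"
            unfolding W_def by (intro Bochner_Integration.integral_nonneg less_imp_le[OF decay_weight_pos])
          ultimately have "0 \<le> A * inverse \<epsilon> ^ N * W" by (rule mult_nonneg_nonneg)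
          then show ?thesis using False by (simp add: not_integrable_integral_eq)
        qed
        moreover have "norm (LINT \<eta>|lborel. ?h \<eta>) = ?g * norm ?I"
          unfolding eq[symmetric] norm_mult norm_of_real abs_of_pos[OF g] by (rule refl)
        ultimately have "((1 + \<kappa>) ^ p * norm ?I) * ?g \<le> A * inverse \<epsilon> ^ N * W" by (simp add: mult_ac)
        then have "(1 + \<kappa>) ^ p * norm ?I \<le> A * inverse \<epsilon> ^ N * W / ?g"
          using g by (simp add: pos_le_divide_eq)
        then show "(1 + \<kappa>) ^ p * norm ?I \<le> (A * W / ?g) * inverse \<epsilon> ^ N" by (simp add: mult_ac)
      qed
    qed
    then show "rapid_bound N p \<Gamma> (\<lambda>\<epsilon> \<zeta>. LINT x:X|lborel. a \<epsilon> x * v \<epsilon> (f \<epsilon> x) * exp (- (\<i> * of_real (x \<bullet> \<zeta>))))"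
      unfolding rapid_bound_def by blast
  qed
qed

section \<open>Test functions and moderate nets\<close>

text \<open>
  The functions \<open>t\<^sup>-\<^sup>k exp (-1/t)\<close>, extended by zero; their derivatives are combinations of functions of the
  same kind, which yields smoothness by induction.
\<close>

definition flat :: "nat \<Rightarrow> real \<Rightarrow> real" where
  "flat k t = (if 0 < t then inverse t ^ k / exp (inverse t) else 0)"

lemma DERIV_flat: "(flat k has_field_derivative (flat (k + 2) t - real k * flat (k + 1) t)) (at t)"
proof (cases t "0 :: real" rule: linorder_cases)
  case less
  have "(flat k has_field_derivative 0) (at t) \<longleftrightarrow> ((\<lambda>_. 0) has_field_derivative 0) (at t)"
    using less by (intro DERIV_cong_ev refl eventually_mono[OF order_tendstoD(2)[OF tendsto_ident_at less]])
      (auto simp: flat_def eventually_nhds intro!: exI[of _ "{..<0}"])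
  then show ?thesis using less by (simp add: flat_def)
next
  case greater
  have d: "((\<lambda>t. inverse t ^ k / exp (inverse t)) has_field_derivative (flat (k + 2) t - real k * flat (k + 1) t)) (at t)"
  proof -
    have "((\<lambda>t. inverse t ^ k * exp (- inverse t)) has_field_derivative
        (real k * (- (inverse t ^ Suc (Suc 0)) * inverse t ^ (k - Suc 0)) * exp (- inverse t) +
         exp (- inverse t) * inverse t ^ Suc (Suc 0) * inverse t ^ k)) (at t)"
      using greater by (auto intro!: derivative_eq_intros simp: power2_eq_square)
    moreover have "real k * (- (inverse t ^ Suc (Suc 0)) * inverse t ^ (k - Suc 0)) * exp (- inverse t) +
         exp (- inverse t) * inverse t ^ Suc (Suc 0) * inverse t ^ k = flat (k + 2) t - real k * flat (k + 1) t"
      using greater by (cases k) (simp_all add: flat_def exp_minus divide_inverse mult_ac)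
    ultimately show ?thesis by (simp add: exp_minus divide_inverse)
  qed
  have "\<forall>\<^sub>F s in nhds t. flat k s = inverse s ^ k / exp (inverse s)"
    unfolding eventually_nhds using greater by (intro exI[of _ "{0<..}"]) (auto simp: flat_def)
  then show ?thesis using DERIV_cong_ev[OF refl _ refl, of "flat k" _ t] d by simp
next
  case equal
  have "((\<lambda>s. flat k s / s) \<longlongrightarrow> 0) (at_left 0)"
  proof (rule tendsto_eventually)
    show "\<forall>\<^sub>F s in at_left (0::real). flat k s / s = 0"
      using eventually_at_left_real[of "-1" "0::real"] by (auto elim!: eventually_mono simp: flat_def)
  qed
  moreover have "((\<lambda>s. flat k s / s) \<longlongrightarrow> 0) (at_right 0)"
  proof -
    have "((\<lambda>s::real. inverse s ^ (k + 1) / exp (inverse s)) \<longlongrightarrow> 0) (at_right 0)"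
      by (rule filterlim_compose[OF tendsto_power_div_exp_0 filterlim_inverse_at_top_right])
    moreover have "\<forall>\<^sub>F s in at_right (0::real). inverse s ^ (k + 1) / exp (inverse s) = flat k s / s"
      using eventually_in_unit by eventually_elim (simp add: flat_def divide_inverse mult_ac)
    ultimately show ?thesis using tendsto_cong by fast
  qed
  ultimately have "((\<lambda>s. flat k s / s) \<longlongrightarrow> 0) (at 0)" by (rule filterlim_split_at)
  then show ?thesis using equal by (simp add: has_field_derivative_iff flat_def)
qed

lemma smooth_on_flat_compose:
  fixes q :: "real^'n::finite \<Rightarrow> real"
  assumes "smooth_on UNIV q"
  shows "smooth_on UNIV (\<lambda>x. flat k (q x))"
proof -
  let ?S = "\<lambda>l g. symbol_upto l UNIV {} (principal (UNIV :: unit set)) const_weights (\<lambda>_. g :: real^'n \<Rightarrow> real)"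
  have q: "?S l q" for l
    using assms unfolding smooth_on_iff_symbol symbol_iff_upto by blast
  note W = weights_const_weights open_UNIV empty_subsetI
  have d: "((\<lambda>x. flat k (q x)) has_derivative (\<lambda>h. frechet_derivative q (at x) h * (flat (k + 2) (q x) - real k * flat (k + 1) (q x)))) (at x)" for k x
    by (rule DERIV_compose_FDERIV[OF DERIV_flat has_frechet_derivative[OF smooth_on_differentiable[OF assms UNIV_I]]])
  have p: "partial_deriv i (\<lambda>x. flat k (q x)) x = partial_deriv i q x * (flat (k + 2) (q x) + - real k * flat (k + 1) (q x))" for i k x
    using partial_deriv_eq[OF d] by (simp add: partial_deriv_def)
  have z: "?S 0 (\<lambda>x. flat k (q x))" for k
    by (rule symbol_upto_0I[where w="\<lambda>_. 0"]) (use d in \<open>auto simp: const_weights_def intro!: differentiableI\<close>)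
  have "?S l (\<lambda>x. flat k (q x))" for l
  proof (induction l arbitrary: k)
    case 0
    show ?case by (rule z)
  next
    case (Suc l)
    show ?case
    proof (rule symbol_upto_SucI[OF W(2,3) z])
      show "\<forall>\<^sub>F \<theta> in principal (UNIV :: unit set). \<forall>x\<in>UNIV. partial_deriv i (\<lambda>x. flat k (q x)) x =
          partial_deriv i q x * (flat (k + 2) (q x) + - real k * flat (k + 1) (q x))" for i
        using p by simp
      have c: "?S l (\<lambda>_. - real k)"
        by (rule symbol_upto_const[OF W(1), where w="\<lambda>_. real k"]) (auto simp: const_weights_def)
      show "?S l (\<lambda>x. partial_deriv i q x * (flat (k + 2) (q x) + - real k * flat (k + 1) (q x)))" for i
        using q[of "Suc l"] Suc.IH c unfolding symbol_upto_Suc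
        by (intro symbol_upto_bilinear[OF W bounded_bilinear_mult] symbol_upto_add[OF W]) auto
    qed
  qed
  then show ?thesis unfolding smooth_on_iff_symbol symbol_iff_upto by blast
qed

text \<open>
  The bump is \<open>flat 0\<close> of the polynomial \<open>d\<^sup>2 - |x - x0|\<^sup>2\<close>.
\<close>

lemma bump_exists:
  fixes x0 :: "real^'n::finite"
  assumes "open X" "x0 \<in> X"
  obtains \<phi> :: "real^'n \<Rightarrow> complex" and K where "smooth_on UNIV \<phi>" "compact K" "K \<subseteq> X"
    "\<And>x. x \<notin> K \<Longrightarrow> \<phi> x = 0" "\<phi> x0 \<noteq> 0"
proof -
  obtain d where d: "d > 0" "cball x0 d \<subseteq> X" using assms open_contains_cball by blast
  define q where "q x = d\<^sup>2 + (- 1) * (\<Sum>j\<in>UNIV. ((x \<bullet> axis j 1) + (- (x0 \<bullet> axis j 1))) * ((x \<bullet> axis j 1) + (- (x0 \<bullet> axis j 1))))" for x :: "real^'n"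
  have q: "q x = d\<^sup>2 - (norm (x - x0))\<^sup>2" for x
  proof -
    have ax: "z \<bullet> axis j 1 = z $ j" for z :: "real^'n" and j by (simp add: inner_axis)
    show ?thesis unfolding q_def ax power2_norm_eq_inner by (simp add: inner_vec_def algebra_simps sum_subtractf sum.distrib)
  qed
  have "smooth_on UNIV q"
    unfolding q_def
    by (intro smooth_on_add smooth_on_mult smooth_on_sum smooth_on_const smooth_on_inner open_UNIV finite)
  from smooth_on_bounded_linear[OF open_UNIV bounded_linear_of_real smooth_on_flat_compose[OF this]]
  have "smooth_on UNIV (\<lambda>x. complex_of_real (flat 0 (q x)))" .
  moreover have "complex_of_real (flat 0 (q x)) = 0" if "x \<notin> cball x0 d" for x
  proof -
    have "d \<le> norm (x - x0)" using that by (simp add: dist_norm norm_minus_commute)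
    then have "d\<^sup>2 \<le> (norm (x - x0))\<^sup>2" using d(1) by (intro power_mono) auto
    then show ?thesis by (simp add: flat_def q)
  qed
  moreover have "complex_of_real (flat 0 (q x0)) \<noteq> 0" using d(1) by (simp add: flat_def q)
  ultimately show thesis using that[OF _ compact_cball d(2)] by blast
qed

definition extend_zero :: "'a set \<Rightarrow> ('a \<Rightarrow> 'b::zero) \<Rightarrow> 'a \<Rightarrow> 'b" where
  "extend_zero \<Omega> g x = (if x \<in> \<Omega> then g x else 0)"

lemma iter_partial_extend_zero:
  assumes "open \<Omega>" "compact K" "K \<subseteq> \<Omega>" "\<And>x. x \<in> \<Omega> - K \<Longrightarrow> g x = 0"
  shows "x \<in> \<Omega> \<Longrightarrow> iter_partial \<alpha> (extend_zero \<Omega> g) x = iter_partial \<alpha> g x"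
    and "x \<notin> K \<Longrightarrow> iter_partial \<alpha> (extend_zero \<Omega> g) x = 0"
proof -
  show "iter_partial \<alpha> (extend_zero \<Omega> g) x = iter_partial \<alpha> g x" if "x \<in> \<Omega>"
    by (rule iter_partial_cong_open[OF assms(1) that]) (simp add: extend_zero_def)
  assume x: "x \<notin> K"
  have "open (- K)" using assms(2) compact_imp_closed by blast
  from iter_partial_cong_open[OF this, of x "extend_zero \<Omega> g" "\<lambda>_. 0" \<alpha>] x assms(4)
  show "iter_partial \<alpha> (extend_zero \<Omega> g) x = 0"
    by (auto simp: extend_zero_def iter_partial_zero)
qed

lemma smooth_on_extend_zero:
  assumes "open \<Omega>" "compact K" "K \<subseteq> \<Omega>" "\<And>x. x \<in> \<Omega> - K \<Longrightarrow> g x = 0" "smooth_on \<Omega> g"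
  shows "smooth_on UNIV (extend_zero \<Omega> g)"
  unfolding smooth_on_def
proof (intro allI ballI)
  fix \<alpha> x
  show "iter_partial \<alpha> (extend_zero \<Omega> g) differentiable at x"
  proof (cases "x \<in> \<Omega>")
    case True
    have "iter_partial \<alpha> (extend_zero \<Omega> g) y = iter_partial \<alpha> g y" if "y \<in> \<Omega>" for y
      by (rule iter_partial_extend_zero(1)[OF assms(1-3) _ that]) (use assms(4) in auto)
    then show ?thesis
      using differentiable_cong_open[OF assms(1) True, of "iter_partial \<alpha> (extend_zero \<Omega> g)" "iter_partial \<alpha> g"]
        assms(5) True unfolding smooth_on_def by blast
  next
    case False
    then have x: "x \<in> - K" using assms(3) by blast
    have "open (- K)" using assms(2) compact_imp_closed by blast
    moreover have "iter_partial \<alpha> (extend_zero \<Omega> g) y = 0" if "y \<in> - K" for y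
      by (rule iter_partial_extend_zero(2)[OF assms(1-3)]) (use assms(4) that in auto)
    ultimately show ?thesis
      using differentiable_cong_open[OF _ x, of "iter_partial \<alpha> (extend_zero \<Omega> g)" "\<lambda>_. 0"] by auto
  qed
qed

definition moderate_weights :: "(real \<Rightarrow> real) set" where
  "moderate_weights = {w. (\<forall>\<epsilon>. 0 \<le> w \<epsilon>) \<and> (\<exists>C. \<exists>N::nat. \<forall>\<^sub>0\<epsilon>. w \<epsilon> \<le> C * inverse \<epsilon> ^ N)}"

lemma moderate_weightsE:
  assumes "w \<in> moderate_weights"
  obtains C N where "0 \<le> C" "\<forall>\<^sub>0\<epsilon>. w \<epsilon> \<le> C * inverse \<epsilon> ^ N"
proof -
  obtain C N where C: "\<forall>\<^sub>0\<epsilon>. w \<epsilon> \<le> C * inverse \<epsilon> ^ N"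
    using assms unfolding moderate_weights_def by blast
  have "\<forall>\<^sub>0\<epsilon>. w \<epsilon> \<le> max C 0 * inverse \<epsilon> ^ N"
    using C eventually_in_unit
  proof eventually_elim
    case (elim \<epsilon>)
    then have "C * inverse \<epsilon> ^ N \<le> max C 0 * inverse \<epsilon> ^ N" by (intro mult_right_mono) auto
    then show ?case using elim(1) by linarith
  qed
  then show thesis using that[of "max C 0"] by simp
qed

lemma weights_moderate_weights: "weights moderate_weights"
  unfolding weights_def
proof (intro conjI ballI allI impI)
  show "0 \<le> w \<epsilon>" if "w \<in> moderate_weights" for w \<epsilon> using that unfolding moderate_weights_def by blast
  show "(\<lambda>_. c) \<in> moderate_weights" if "0 \<le> c" for c
    unfolding moderate_weights_def
    by (intro CollectI conjI allI that exI[where x=c] exI[where x="0::nat"]) simp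
  fix v w assume vw: "v \<in> moderate_weights" "w \<in> moderate_weights"
  obtain C M where v: "0 \<le> C" "\<forall>\<^sub>0\<epsilon>. v \<epsilon> \<le> C * inverse \<epsilon> ^ M" using moderate_weightsE[OF vw(1)] .
  obtain D N where w: "0 \<le> D" "\<forall>\<^sub>0\<epsilon>. w \<epsilon> \<le> D * inverse \<epsilon> ^ N" using moderate_weightsE[OF vw(2)] .
  have nn: "0 \<le> v \<epsilon>" "0 \<le> w \<epsilon>" for \<epsilon> using vw unfolding moderate_weights_def by auto
  have "\<forall>\<^sub>0\<epsilon>. v \<epsilon> + w \<epsilon> \<le> (C + D) * inverse \<epsilon> ^ (M + N)"
    using v(2) w(2) eventually_in_unit
  proof eventually_elim
    case (elim \<epsilon>)
    then have i: "1 \<le> inverse \<epsilon>" by (simp add: one_le_inverse)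
    have "v \<epsilon> + w \<epsilon> \<le> C * inverse \<epsilon> ^ M + D * inverse \<epsilon> ^ N" using elim by simp
    also have "\<dots> \<le> C * inverse \<epsilon> ^ (M + N) + D * inverse \<epsilon> ^ (M + N)"
      using v(1) w(1) i by (intro add_mono mult_left_mono power_increasing) auto
    finally show ?case by (simp add: algebra_simps)
  qed
  then show "(\<lambda>\<theta>. v \<theta> + w \<theta>) \<in> moderate_weights" using nn unfolding moderate_weights_def by auto
  have "\<forall>\<^sub>0\<epsilon>. v \<epsilon> * w \<epsilon> \<le> (C * D) * inverse \<epsilon> ^ (M + N)"
    using v(2) w(2) eventually_in_unit
  proof eventually_elim
    case (elim \<epsilon>)
    have "v \<epsilon> * w \<epsilon> \<le> (C * inverse \<epsilon> ^ M) * (D * inverse \<epsilon> ^ N)"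
      using elim nn v w by (intro mult_mono) auto
    then show ?case by (simp add: power_add mult_ac)
  qed
  then show "(\<lambda>\<theta>. v \<theta> * w \<theta>) \<in> moderate_weights" using nn unfolding moderate_weights_def by auto
qed

text \<open>
  The real exponents and signed constants of the definition of moderateness against the natural exponents
  and nonnegative bounds of \<open>moderate_weights\<close>.
\<close>

lemma bigo_moderate:
  "(\<exists>p::real. \<exists>C. \<forall>\<^sub>0\<epsilon>. Q \<epsilon> (C * \<epsilon> powr (- p))) \<longleftrightarrow> (\<exists>w\<in>moderate_weights. \<forall>\<^sub>0\<epsilon>. Q \<epsilon> (w \<epsilon>))"
  (is "?L \<longleftrightarrow> ?R")
  if mono: "\<And>\<epsilon> a b. a \<le> b \<Longrightarrow> Q \<epsilon> a \<Longrightarrow> Q \<epsilon> b"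
proof
  assume ?L
  then obtain p C where C: "\<forall>\<^sub>0\<epsilon>. Q \<epsilon> (C * \<epsilon> powr (- p))" by blast
  obtain N :: nat where N: "p \<le> real N" using real_arch_simple by blast
  let ?w = "\<lambda>\<epsilon>::real. max C 0 * \<bar>inverse \<epsilon>\<bar> ^ N"
  have "\<forall>\<^sub>0\<epsilon>. ?w \<epsilon> \<le> max C 0 * inverse \<epsilon> ^ N"
    using eventually_in_unit by eventually_elim simp
  then have "?w \<in> moderate_weights" unfolding moderate_weights_def by auto
  moreover have "\<forall>\<^sub>0\<epsilon>. Q \<epsilon> (?w \<epsilon>)"
    using C eventually_in_unit
  proof eventually_elim
    case (elim \<epsilon>)
    have "C * \<epsilon> powr (- p) \<le> max C 0 * \<epsilon> powr (- p)" by (intro mult_right_mono) auto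
    also have "\<dots> \<le> max C 0 * \<epsilon> powr (- real N)"
      using elim N by (intro mult_left_mono powr_mono') auto
    also have "\<dots> = ?w \<epsilon>" using elim by (simp add: powr_minus_real)
    finally show ?case using mono elim(1) by blast
  qed
  ultimately show ?R by (intro bexI[where x="?w"])
next
  assume ?R
  then obtain w where w: "w \<in> moderate_weights" "\<forall>\<^sub>0\<epsilon>. Q \<epsilon> (w \<epsilon>)" by blast
  obtain C N where C: "\<forall>\<^sub>0\<epsilon>. w \<epsilon> \<le> C * inverse \<epsilon> ^ N" using moderate_weightsE[OF w(1)] by blast
  have "\<forall>\<^sub>0\<epsilon>. Q \<epsilon> (C * \<epsilon> powr (- real N))"
    using C w(2) eventually_in_unit
  proof eventually_elim
    case (elim \<epsilon>)
    then show ?case using mono by (metis powr_minus_real)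
  qed
  then show ?L by blast
qed

lemma moderate_nets_iff_symbol:
  "u \<in> moderate_nets \<Omega> \<longleftrightarrow> (\<forall>\<epsilon>\<in>{0<..1}. smooth_on \<Omega> (u \<epsilon>)) \<and>
     (\<forall>K. compact K \<and> K \<subseteq> \<Omega> \<longrightarrow> symbol \<Omega> K (at_right 0) moderate_weights u)"
proof -
  have *: "(\<exists>p::real. sup_bigo K (\<lambda>\<epsilon>. iter_partial \<alpha> (u \<epsilon>)) (\<lambda>\<epsilon>. \<epsilon> powr (- p))) \<longleftrightarrow>
      (\<exists>w\<in>moderate_weights. \<forall>\<^sub>0\<epsilon>. \<forall>x\<in>K. norm (iter_partial \<alpha> (u \<epsilon>) x) \<le> w \<epsilon>)" for K \<alpha>
    unfolding sup_bigo_def by (rule bigo_moderate) (blast intro: order_trans)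
  have ev: "\<forall>\<^sub>0\<epsilon>. smooth_on \<Omega> (u \<epsilon>)" if "\<forall>\<epsilon>\<in>{0<..1}. smooth_on \<Omega> (u \<epsilon>)"
    using eventually_in_unit by eventually_elim (use that in auto)
  have "\<forall>\<^sub>0\<epsilon>. \<forall>x\<in>\<Omega>. iter_partial \<alpha> (u \<epsilon>) differentiable (at x)" if "\<forall>\<epsilon>\<in>{0<..1}. smooth_on \<Omega> (u \<epsilon>)" for \<alpha>
    using ev[OF that] by eventually_elim (auto simp: smooth_on_def)
  then have s: "symbol \<Omega> K (at_right 0) moderate_weights u \<longleftrightarrow>
      (\<forall>\<alpha>. \<exists>w\<in>moderate_weights. \<forall>\<^sub>0\<epsilon>. \<forall>x\<in>K. norm (iter_partial \<alpha> (u \<epsilon>) x) \<le> w \<epsilon>)"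
    if "\<forall>\<epsilon>\<in>{0<..1}. smooth_on \<Omega> (u \<epsilon>)" for K
    unfolding symbol_def using that by simp
  show ?thesis
  proof (cases "\<forall>\<epsilon>\<in>{0<..1}. smooth_on \<Omega> (u \<epsilon>)")
    case True
    show ?thesis unfolding moderate_nets_def * s[OF True] mem_Collect_eq by metis
  next
    case False
    show ?thesis unfolding moderate_nets_def mem_Collect_eq by (simp only: False simp_thms)
  qed
qed

lemma moderate_smooth: "u \<in> moderate_nets \<Omega> \<Longrightarrow> \<epsilon> \<in> {0<..1} \<Longrightarrow> smooth_on \<Omega> (u \<epsilon>)"
  and moderate_symbol: "u \<in> moderate_nets \<Omega> \<Longrightarrow> compact K \<Longrightarrow> K \<subseteq> \<Omega> \<Longrightarrow> symbol \<Omega> K (at_right 0) moderate_weights u"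
  unfolding moderate_nets_iff_symbol by blast+

lemma moderate_subset: "u \<in> moderate_nets \<Omega> \<Longrightarrow> V \<subseteq> \<Omega> \<Longrightarrow> u \<in> moderate_nets V"
  unfolding moderate_nets_def by (blast intro: smooth_on_subset order_trans)

lemma moderate_add:
  assumes "open \<Omega>" "u \<in> moderate_nets \<Omega>" "v \<in> moderate_nets \<Omega>"
  shows "(\<lambda>\<epsilon> x. u \<epsilon> x + v \<epsilon> x) \<in> moderate_nets \<Omega>"
  unfolding moderate_nets_iff_symbol
  using moderate_smooth[OF assms(2)] moderate_smooth[OF assms(3)] moderate_symbol[OF assms(2)] moderate_symbol[OF assms(3)]
  by (intro conjI ballI allI impI smooth_on_add[OF assms(1)] symbol_add[OF weights_moderate_weights assms(1)]) simp_all

lemma moderate_bounded_linear: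
  assumes "open \<Omega>" "bounded_linear T" "u \<in> moderate_nets \<Omega>"
  shows "(\<lambda>\<epsilon> x. T (u \<epsilon> x)) \<in> moderate_nets \<Omega>"
  unfolding moderate_nets_iff_symbol
  using moderate_smooth[OF assms(3)] moderate_symbol[OF assms(3)]
  by (intro conjI ballI allI impI smooth_on_bounded_linear[OF assms(1,2)]
      symbol_bounded_linear[OF weights_moderate_weights assms(1) _ assms(2)]) simp_all

lemma moderate_diff:
  assumes "open \<Omega>" "u \<in> moderate_nets \<Omega>" "v \<in> moderate_nets \<Omega>"
  shows "(\<lambda>\<epsilon> x. u \<epsilon> x - v \<epsilon> x) \<in> moderate_nets \<Omega>"
  using moderate_add[OF assms(1,2) moderate_bounded_linear[OF assms(1) bounded_linear_minus[OF bounded_linear_ident] assms(3)]]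
  by simp

lemma moderate_mult:
  fixes u v :: "real \<Rightarrow> real^'n::finite \<Rightarrow> complex"
  assumes "open \<Omega>" "u \<in> moderate_nets \<Omega>" "v \<in> moderate_nets \<Omega>"
  shows "(\<lambda>\<epsilon> x. u \<epsilon> x * v \<epsilon> x) \<in> moderate_nets \<Omega>"
  unfolding moderate_nets_iff_symbol
  using moderate_smooth[OF assms(2)] moderate_smooth[OF assms(3)] moderate_symbol[OF assms(2)] moderate_symbol[OF assms(3)]
  by (intro conjI ballI allI impI smooth_on_mult[OF assms(1)] symbol_mult[OF weights_moderate_weights assms(1)]) simp_all

lemma moderate_smooth_function:
  fixes g :: "real^'n::finite \<Rightarrow> 'b::real_normed_vector"
  assumes "smooth_on \<Omega> g"
  shows "(\<lambda>_. g) \<in> moderate_nets \<Omega>"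
  unfolding moderate_nets_iff_symbol symbol_def
proof (intro conjI ballI allI impI)
  fix K and \<alpha> :: "'n list" assume K: "compact K \<and> K \<subseteq> \<Omega>"
  show "\<forall>\<^sub>F \<theta> in at_right 0. \<forall>x\<in>\<Omega>. iter_partial \<alpha> g differentiable (at x)"
    using assms by (simp add: smooth_on_def)
  have "continuous_on K (iter_partial \<alpha> g)"
    using smooth_on_continuous_on[OF smooth_on_iter_partial[OF assms]] K continuous_on_subset by blast
  then obtain b where b: "\<forall>x\<in>K. norm (iter_partial \<alpha> g x) \<le> b"
    using compact_imp_bounded[OF compact_continuous_image[OF _ conjunct1[OF K]]] by (fastforce simp: bounded_iff)
  show "\<exists>w\<in>moderate_weights. \<forall>\<^sub>F \<theta> in at_right 0. \<forall>x\<in>K. norm (iter_partial \<alpha> g x) \<le> w \<theta>"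
    using b weights_const[OF weights_moderate_weights, of "max b 0"]
    by (intro bexI[of _ "\<lambda>_. max b 0"]) auto
qed (use assms in auto)

lemma cbounded_rep_compact:
  assumes "cbounded_rep \<Omega>1 \<Omega>2 f" "compact K" "K \<subseteq> \<Omega>1"
  obtains K' where "compact K'" "K' \<subseteq> \<Omega>2" "\<And>\<epsilon> x. \<epsilon> \<in> {0<..1} \<Longrightarrow> x \<in> K \<Longrightarrow> f \<epsilon> x \<in> K'"
proof -
  have "\<exists>K'. compact K' \<and> K' \<subseteq> \<Omega>2 \<and> (\<forall>\<epsilon>\<in>{0<..1}. f \<epsilon> ` K \<subseteq> K')"
    using assms unfolding cbounded_rep_def by simp
  then obtain K' where "compact K'" "K' \<subseteq> \<Omega>2" "\<forall>\<epsilon>\<in>{0<..1}. f \<epsilon> ` K \<subseteq> K'"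
    by (elim exE conjE)
  then show thesis by (intro that[of K']) (simp_all add: image_subset_iff)
qed

lemma cbounded_rep_maps: "cbounded_rep \<Omega>1 \<Omega>2 f \<Longrightarrow> \<epsilon> \<in> {0<..1} \<Longrightarrow> x \<in> \<Omega>1 \<Longrightarrow> f \<epsilon> x \<in> \<Omega>2"
  unfolding cbounded_rep_def image_subset_iff by simp

text \<open>
  C-boundedness confines \<open>f\<^sub>\<epsilon>(K)\<close> to one compact set, on which \<open>u\<close> has moderate bounds.
\<close>

lemma moderate_compose:
  fixes u :: "real \<Rightarrow> real^'m::finite \<Rightarrow> 'b::real_normed_vector" and f :: "real \<Rightarrow> real^'n::finite \<Rightarrow> real^'m"
  assumes "open \<Omega>1" "u \<in> moderate_nets \<Omega>2" "f \<in> moderate_nets \<Omega>1" "cbounded_rep \<Omega>1 \<Omega>2 f"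
  shows "(\<lambda>\<epsilon> x. u \<epsilon> (f \<epsilon> x)) \<in> moderate_nets \<Omega>1"
  unfolding moderate_nets_iff_symbol
proof (intro conjI ballI allI impI)
  fix \<epsilon> :: real assume e: "\<epsilon> \<in> {0<..1}"
  show "smooth_on \<Omega>1 (\<lambda>x. u \<epsilon> (f \<epsilon> x))"
    by (rule smooth_on_compose[OF assms(1) moderate_smooth[OF assms(2) e] moderate_smooth[OF assms(3) e]])
      (simp add: image_subset_iff cbounded_rep_maps[OF assms(4) e])
next
  fix K assume K: "compact K \<and> K \<subseteq> \<Omega>1"
  obtain K' where K': "compact K'" "K' \<subseteq> \<Omega>2" "\<And>\<epsilon> x. \<epsilon> \<in> {0<..1} \<Longrightarrow> x \<in> K \<Longrightarrow> f \<epsilon> x \<in> K'"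
    using cbounded_rep_compact[OF assms(4) conjunct1[OF K] conjunct2[OF K]] by metis
  have "\<forall>\<^sub>0\<epsilon>. f \<epsilon> ` \<Omega>1 \<subseteq> \<Omega>2 \<and> f \<epsilon> ` K \<subseteq> K'"
    using eventually_in_unit
  proof eventually_elim
    case (elim \<epsilon>)
    then have "\<epsilon> \<in> {0<..1}" by simp
    then show ?case using K'(3) cbounded_rep_maps[OF assms(4)] by (simp add: image_subset_iff)
  qed
  then show "symbol \<Omega>1 K (at_right 0) moderate_weights (\<lambda>\<epsilon> x. u \<epsilon> (f \<epsilon> x))"
    using K K' by (intro symbol_compose[OF weights_moderate_weights assms(1) _ moderate_symbol[OF assms(2)] moderate_symbol[OF assms(3)]]) auto
qed

section \<open>Independence of representatives\<close>

lemma null_nets_iff: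
  "u \<in> null_nets \<Omega> \<longleftrightarrow> u \<in> moderate_nets \<Omega> \<and> (\<forall>K. compact K \<longrightarrow> K \<subseteq> \<Omega> \<longrightarrow>
     (\<forall>N::nat. \<exists>C\<ge>0. \<forall>\<^sub>0\<epsilon>. \<forall>x\<in>K. norm (u \<epsilon> x) \<le> C * \<epsilon> ^ N))"
proof -
  have "(\<forall>q::real. sup_bigo K u (\<lambda>\<epsilon>. \<epsilon> powr q)) \<longleftrightarrow>
    (\<forall>N::nat. \<exists>C\<ge>0. \<forall>\<^sub>0\<epsilon>. \<forall>x\<in>K. norm (u \<epsilon> x) \<le> C * \<epsilon> ^ N)" (is "?L \<longleftrightarrow> ?R") for K
  proof
    assume L: ?L
    show ?R
    proof
      fix N :: nat
      obtain C where C: "\<forall>\<^sub>0\<epsilon>. \<forall>x\<in>K. norm (u \<epsilon> x) \<le> C * \<epsilon> powr real N"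
        using L[rule_format, of "real N"] unfolding sup_bigo_def by blast
      have "\<forall>\<^sub>0\<epsilon>. \<forall>x\<in>K. norm (u \<epsilon> x) \<le> max C 0 * \<epsilon> ^ N"
        using C eventually_in_unit
      proof eventually_elim
        case (elim \<epsilon>)
        then have "C * \<epsilon> powr real N \<le> max C 0 * \<epsilon> ^ N"
          by (simp add: powr_realpow mult_right_mono)
        then show ?case using elim(1) order_trans by blast
      qed
      then show "\<exists>C\<ge>0. \<forall>\<^sub>0\<epsilon>. \<forall>x\<in>K. norm (u \<epsilon> x) \<le> C * \<epsilon> ^ N"
        by (intro exI[of _ "max C 0"]) simp
    qed
  next
    assume R: ?R
    show ?L
    proof
      fix q :: real
      obtain N :: nat where N: "q \<le> real N" using real_arch_simple by blast
      obtain C where C: "C \<ge> 0" "\<forall>\<^sub>0\<epsilon>. \<forall>x\<in>K. norm (u \<epsilon> x) \<le> C * \<epsilon> ^ N"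
        using R by blast
      have "\<forall>\<^sub>0\<epsilon>. \<forall>x\<in>K. norm (u \<epsilon> x) \<le> C * \<epsilon> powr q"
        using C(2) eventually_in_unit
      proof eventually_elim
        case (elim \<epsilon>)
        have "\<epsilon> ^ N = \<epsilon> powr real N" using elim(2) by (simp add: powr_realpow)
        also have "\<dots> \<le> \<epsilon> powr q" using elim(2) N by (intro powr_mono') auto
        finally have "C * \<epsilon> ^ N \<le> C * \<epsilon> powr q" by (intro mult_left_mono C(1))
        then show ?case using elim(1) order_trans by blast
      qed
      then show "sup_bigo K u (\<lambda>\<epsilon>. \<epsilon> powr q)" unfolding sup_bigo_def by blast
    qed
  qed
  note * = this
  have "u \<in> null_nets \<Omega> \<longleftrightarrow> u \<in> moderate_nets \<Omega> \<and>
      (\<forall>K. compact K \<longrightarrow> K \<subseteq> \<Omega> \<longrightarrow> (\<forall>q::real. sup_bigo K u (\<lambda>\<epsilon>. \<epsilon> powr q)))"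
    unfolding null_nets_def by auto
  then show ?thesis unfolding * .
qed

lemma null_moderate: "u \<in> null_nets \<Omega> \<Longrightarrow> u \<in> moderate_nets \<Omega>"
  unfolding null_nets_def by blast

lemma null_bound:
  assumes "u \<in> null_nets \<Omega>" "compact K" "K \<subseteq> \<Omega>"
  obtains C where "C \<ge> 0" "\<forall>\<^sub>0\<epsilon>. \<forall>x\<in>K. norm (u \<epsilon> x) \<le> C * \<epsilon> ^ N"
  using assms unfolding null_nets_iff by blast

lemma null_add:
  assumes "open \<Omega>" "u \<in> null_nets \<Omega>" "v \<in> null_nets \<Omega>"
  shows "(\<lambda>\<epsilon> x. u \<epsilon> x + v \<epsilon> x) \<in> null_nets \<Omega>"
  unfolding null_nets_iff
proof (intro conjI allI impI)
  show "(\<lambda>\<epsilon> x. u \<epsilon> x + v \<epsilon> x) \<in> moderate_nets \<Omega>"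
    by (rule moderate_add[OF assms(1) assms(2,3)[THEN null_moderate]])
  fix K and N :: nat assume K: "compact K" "K \<subseteq> \<Omega>"
  obtain C where C: "C \<ge> 0" "\<forall>\<^sub>0\<epsilon>. \<forall>x\<in>K. norm (u \<epsilon> x) \<le> C * \<epsilon> ^ N" using null_bound[OF assms(2) K] .
  obtain D where D: "D \<ge> 0" "\<forall>\<^sub>0\<epsilon>. \<forall>x\<in>K. norm (v \<epsilon> x) \<le> D * \<epsilon> ^ N" using null_bound[OF assms(3) K] .
  have "\<forall>\<^sub>0\<epsilon>. \<forall>x\<in>K. norm (u \<epsilon> x + v \<epsilon> x) \<le> (C + D) * \<epsilon> ^ N"
    using C(2) D(2)
  proof eventually_elim
    case (elim \<epsilon>)
    then show ?case unfolding distrib_right using norm_triangle_mono by blast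
  qed
  then show "\<exists>C\<ge>0. \<forall>\<^sub>0\<epsilon>. \<forall>x\<in>K. norm (u \<epsilon> x + v \<epsilon> x) \<le> C * \<epsilon> ^ N"
    using C D by (intro exI[of _ "C + D"]) simp
qed

lemma null_minus:
  assumes "open \<Omega>" "u \<in> null_nets \<Omega>"
  shows "(\<lambda>\<epsilon> x. - u \<epsilon> x) \<in> null_nets \<Omega>"
  using assms moderate_bounded_linear[OF assms(1) bounded_linear_minus[OF bounded_linear_ident] null_moderate[OF assms(2)]]
  unfolding null_nets_iff norm_minus_cancel by simp

lemma null_mult:
  fixes \<phi> :: "real^'n::finite \<Rightarrow> complex"
  assumes "open \<Omega>" "smooth_on \<Omega> \<phi>" "u \<in> null_nets \<Omega>"
  shows "(\<lambda>\<epsilon> x. \<phi> x * u \<epsilon> x) \<in> null_nets \<Omega>"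
  unfolding null_nets_iff
proof (intro conjI allI impI)
  show "(\<lambda>\<epsilon> x. \<phi> x * u \<epsilon> x) \<in> moderate_nets \<Omega>"
    by (rule moderate_mult[OF assms(1) moderate_smooth_function[OF assms(2)] null_moderate[OF assms(3)]])
  fix K and N :: nat assume K: "compact K" "K \<subseteq> \<Omega>"
  obtain C where C: "C \<ge> 0" "\<forall>\<^sub>0\<epsilon>. \<forall>x\<in>K. norm (u \<epsilon> x) \<le> C * \<epsilon> ^ N" using null_bound[OF assms(3) K] .
  have "continuous_on K \<phi>" using smooth_on_continuous_on[OF assms(2)] K(2) continuous_on_subset by blast
  then obtain b where b: "\<forall>x\<in>K. norm (\<phi> x) \<le> b"
    using compact_imp_bounded[OF compact_continuous_image[OF _ K(1)]] by (fastforce simp: bounded_iff)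
  have "\<forall>\<^sub>0\<epsilon>. \<forall>x\<in>K. norm (\<phi> x * u \<epsilon> x) \<le> (max b 0 * C) * \<epsilon> ^ N"
    using C(2)
  proof eventually_elim
    case (elim \<epsilon>)
    show ?case
    proof
      fix x assume x: "x \<in> K"
      have "norm (\<phi> x) * norm (u \<epsilon> x) \<le> max b 0 * (C * \<epsilon> ^ N)"
        using x b elim by (intro mult_mono) force+
      then show "norm (\<phi> x * u \<epsilon> x) \<le> (max b 0 * C) * \<epsilon> ^ N" by (simp add: norm_mult mult.assoc)
    qed
  qed
  then show "\<exists>C\<ge>0. \<forall>\<^sub>0\<epsilon>. \<forall>x\<in>K. norm (\<phi> x * u \<epsilon> x) \<le> C * \<epsilon> ^ N"
    using C(1) by (intro exI[of _ "max b 0 * C"]) simp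
qed

lemma null_zero: "(\<lambda>_ _. 0) \<in> null_nets \<Omega>"
  unfolding null_nets_iff using moderate_smooth_function[OF smooth_on_const[of \<Omega> 0]]
  by (auto intro!: exI[of _ 0])

lemma gclass_self: "u \<in> moderate_nets \<Omega> \<Longrightarrow> u \<in> gclass \<Omega> u"
  unfolding gclass_def colombeau_rel_def using null_zero by simp

lemma gclass_colombeau: "u \<in> moderate_nets \<Omega> \<Longrightarrow> gclass \<Omega> u \<in> colombeau \<Omega>"
  unfolding gclass_def colombeau_def by (rule quotientI)

lemma gclassD:
  assumes "v \<in> gclass \<Omega> u"
  shows "u \<in> moderate_nets \<Omega>" "v \<in> moderate_nets \<Omega>" "(\<lambda>\<epsilon> x. u \<epsilon> x - v \<epsilon> x) \<in> null_nets \<Omega>"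
  using assms unfolding gclass_def colombeau_rel_def by auto

lemma colombeau_moderate:
  assumes "U \<in> colombeau \<Omega>" "u \<in> U"
  shows "u \<in> moderate_nets \<Omega>"
  using assms unfolding colombeau_def colombeau_rel_def by (auto elim!: quotientE)

lemma colombeau_diff_null:
  assumes "open \<Omega>" "U \<in> colombeau \<Omega>" "u \<in> U" "v \<in> U"
  shows "(\<lambda>\<epsilon> x. u \<epsilon> x - v \<epsilon> x) \<in> null_nets \<Omega>"
proof -
  obtain w where "U = gclass \<Omega> w"
    using assms(2) unfolding colombeau_def gclass_def by (auto elim!: quotientE)
  then have "(\<lambda>\<epsilon> x. w \<epsilon> x - u \<epsilon> x) \<in> null_nets \<Omega>" "(\<lambda>\<epsilon> x. w \<epsilon> x - v \<epsilon> x) \<in> null_nets \<Omega>"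
    using gclassD(3) assms(3,4) by blast+
  from null_add[OF assms(1) null_minus[OF assms(1) this(1)] this(2)] show ?thesis by simp
qed

lemma fourier_extend_zero:
  "fourier (extend_zero \<Omega> g) \<xi> = (LINT x:\<Omega>|lborel. g x * exp (- (\<i> * complex_of_real (x \<bullet> \<xi>))))"
  unfolding fourier_def set_lebesgue_integral_def
  by (rule Bochner_Integration.integral_cong[OF refl]) (simp add: extend_zero_def indicator_def)

lemma symbol_extend_zero:
  fixes w :: "real \<Rightarrow> real^'n::finite \<Rightarrow> complex"
  assumes "open \<Omega>" "w \<in> moderate_nets \<Omega>" "compact K" "K \<subseteq> \<Omega>" "\<forall>\<epsilon>\<in>{0<..1}. \<forall>x\<in>\<Omega>-K. w \<epsilon> x = 0"
  shows "symbol UNIV UNIV (at_right 0) moderate_weights (\<lambda>\<epsilon>. extend_zero \<Omega> (w \<epsilon>))"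
  unfolding symbol_def
proof (intro allI conjI)
  fix \<alpha> :: "'n list"
  show "\<forall>\<^sub>0\<epsilon>. \<forall>x\<in>UNIV. iter_partial \<alpha> (extend_zero \<Omega> (w \<epsilon>)) differentiable at x"
    using eventually_in_unit
  proof eventually_elim
    case (elim \<epsilon>)
    then have e: "\<epsilon> \<in> {0<..1}" by simp
    have "smooth_on UNIV (extend_zero \<Omega> (w \<epsilon>))"
      by (rule smooth_on_extend_zero[OF assms(1,3,4) _ moderate_smooth[OF assms(2) e]]) (use assms(5) e in blast)
    then show ?case unfolding smooth_on_def by blast
  qed
  obtain b where b: "b \<in> moderate_weights" "\<forall>\<^sub>0\<epsilon>. \<forall>x\<in>K. norm (iter_partial \<alpha> (w \<epsilon>) x) \<le> b \<epsilon>"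
    using moderate_symbol[OF assms(2-4)] unfolding symbol_def by blast
  have "\<forall>\<^sub>0\<epsilon>. \<forall>x\<in>UNIV. norm (iter_partial \<alpha> (extend_zero \<Omega> (w \<epsilon>)) x) \<le> b \<epsilon>"
    using b(2) eventually_in_unit
  proof eventually_elim
    case (elim \<epsilon>)
    then have e: "\<epsilon> \<in> {0<..1}" by simp
    have z: "w \<epsilon> x = 0" if "x \<in> \<Omega> - K" for x using assms(5) e that by blast
    show ?case
    proof
      fix x
      show "norm (iter_partial \<alpha> (extend_zero \<Omega> (w \<epsilon>)) x) \<le> b \<epsilon>"
      proof (cases "x \<in> K")
        case True
        then have "iter_partial \<alpha> (extend_zero \<Omega> (w \<epsilon>)) x = iter_partial \<alpha> (w \<epsilon>) x"
          using assms(4) by (intro iter_partial_extend_zero(1)[OF assms(1,3,4) z]) auto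
        then show ?thesis using elim(1) True by simp
      next
        case False
        then have "iter_partial \<alpha> (extend_zero \<Omega> (w \<epsilon>)) x = 0"
          by (intro iter_partial_extend_zero(2)[OF assms(1,3,4) z])
        then show ?thesis using weights_nonneg[OF weights_moderate_weights b(1)] by simp
      qed
    qed
  qed
  then show "\<exists>b\<in>moderate_weights. \<forall>\<^sub>0\<epsilon>. \<forall>x\<in>UNIV. norm (iter_partial \<alpha> (extend_zero \<Omega> (w \<epsilon>)) x) \<le> b \<epsilon>"
    using b(1) by blast
qed

lemma rapid_boundE:
  assumes "rapid_bound N p \<Gamma> w" "N \<le> M"
  obtains C where "0 \<le> C" "\<forall>\<^sub>0\<epsilon>. \<forall>r>0. \<forall>\<xi>\<in>\<Gamma>. (1 + r) ^ p * norm (w \<epsilon> (r *\<^sub>R \<xi>)) \<le> C * inverse \<epsilon> ^ M"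
proof -
  obtain C where C: "\<forall>\<^sub>0\<epsilon>. \<forall>r>0. \<forall>\<xi>\<in>\<Gamma>. (1 + r) ^ p * norm (w \<epsilon> (r *\<^sub>R \<xi>)) \<le> C * inverse \<epsilon> ^ N"
    using assms(1) unfolding rapid_bound_def by blast
  have "\<forall>\<^sub>0\<epsilon>. \<forall>r>0. \<forall>\<xi>\<in>\<Gamma>. (1 + r) ^ p * norm (w \<epsilon> (r *\<^sub>R \<xi>)) \<le> max C 0 * inverse \<epsilon> ^ M"
    using C eventually_in_unit
  proof eventually_elim
    case (elim \<epsilon>)
    then have "1 \<le> inverse \<epsilon>" by (simp add: one_le_inverse)
    then have "C * inverse \<epsilon> ^ N \<le> max C 0 * inverse \<epsilon> ^ M"
      using assms(2) elim(2) by (intro mult_mono power_increasing) auto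
    then show ?case using elim(1) order_trans by blast
  qed
  then show thesis using that[of "max C 0"] by simp
qed

lemma rapid_diff:
  assumes "rapid \<Gamma> v" "rapid \<Gamma> w"
  shows "rapid \<Gamma> (\<lambda>\<epsilon> \<xi>. v \<epsilon> \<xi> - w \<epsilon> \<xi>)"
proof -
  obtain M N where M: "\<And>p. rapid_bound M p \<Gamma> v" and N: "\<And>p. rapid_bound N p \<Gamma> w"
    using assms unfolding rapid_def by blast
  show ?thesis
  proof (rule rapidI[where N="M + N"])
    fix p
    obtain C where C: "\<forall>\<^sub>0\<epsilon>. \<forall>r>0. \<forall>\<xi>\<in>\<Gamma>. (1 + r) ^ p * norm (v \<epsilon> (r *\<^sub>R \<xi>)) \<le> C * inverse \<epsilon> ^ (M + N)"
      by (rule rapid_boundE[OF M le_add1])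
    obtain D where D: "\<forall>\<^sub>0\<epsilon>. \<forall>r>0. \<forall>\<xi>\<in>\<Gamma>. (1 + r) ^ p * norm (w \<epsilon> (r *\<^sub>R \<xi>)) \<le> D * inverse \<epsilon> ^ (M + N)"
      by (rule rapid_boundE[OF N le_add2])
    have "\<forall>\<^sub>0\<epsilon>. \<forall>r>0. \<forall>\<xi>\<in>\<Gamma>. (1 + r) ^ p * norm (v \<epsilon> (r *\<^sub>R \<xi>) - w \<epsilon> (r *\<^sub>R \<xi>)) \<le> (C + D) * inverse \<epsilon> ^ (M + N)"
      using C D
    proof eventually_elim
      case (elim \<epsilon>)
      show ?case
      proof (intro allI impI ballI)
        fix r :: real and \<xi> assume r: "0 < r" "\<xi> \<in> \<Gamma>"
        have "(1 + r) ^ p * norm (v \<epsilon> (r *\<^sub>R \<xi>) - w \<epsilon> (r *\<^sub>R \<xi>)) \<le> (1 + r) ^ p * (norm (v \<epsilon> (r *\<^sub>R \<xi>)) + norm (w \<epsilon> (r *\<^sub>R \<xi>)))"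
          using r by (intro mult_left_mono norm_triangle_ineq4) auto
        also have "\<dots> \<le> (C + D) * inverse \<epsilon> ^ (M + N)"
          unfolding distrib_left distrib_right using elim r by (intro add_mono) auto
        finally show "(1 + r) ^ p * norm (v \<epsilon> (r *\<^sub>R \<xi>) - w \<epsilon> (r *\<^sub>R \<xi>)) \<le> (C + D) * inverse \<epsilon> ^ (M + N)" .
      qed
    qed
    then show "rapid_bound (M + N) p \<Gamma> (\<lambda>\<epsilon> \<xi>. v \<epsilon> \<xi> - w \<epsilon> \<xi>)" unfolding rapid_bound_def by blast
  qed
qed

lemma rapid_cong:
  assumes "\<forall>\<^sub>0\<epsilon>. \<forall>\<xi>. v \<epsilon> \<xi> = w \<epsilon> \<xi>" "rapid \<Gamma> v"
  shows "rapid \<Gamma> w"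
proof -
  obtain N where N: "\<And>p. rapid_bound N p \<Gamma> v" using assms(2) unfolding rapid_def by blast
  show ?thesis
  proof (rule rapidI[where N=N])
    fix p
    obtain C where C: "\<forall>\<^sub>0\<epsilon>. \<forall>r>0. \<forall>\<xi>\<in>\<Gamma>. (1 + r) ^ p * norm (v \<epsilon> (r *\<^sub>R \<xi>)) \<le> C * inverse \<epsilon> ^ N"
      by (rule rapid_boundE[OF N order_refl])
    have "\<forall>\<^sub>0\<epsilon>. \<forall>r>0. \<forall>\<xi>\<in>\<Gamma>. (1 + r) ^ p * norm (w \<epsilon> (r *\<^sub>R \<xi>)) \<le> C * inverse \<epsilon> ^ N"
      using C assms(1) by eventually_elim simp
    then show "rapid_bound N p \<Gamma> w" unfolding rapid_bound_def by blast
  qed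
qed

lemma rapid_zero: "rapid \<Gamma> (\<lambda>_ _. 0)"
  by (rule rapidI[where N=0]) (auto simp: rapid_bound_def intro!: exI[of _ 0])

lemma rapid_add:
  assumes "rapid \<Gamma> v" "rapid \<Gamma> w"
  shows "rapid \<Gamma> (\<lambda>\<epsilon> \<xi>. v \<epsilon> \<xi> + w \<epsilon> \<xi>)"
  using rapid_diff[OF assms(1) rapid_diff[OF rapid_zero assms(2)]] by simp

lemma rapid_sum:
  assumes "finite J" "\<And>j. j \<in> J \<Longrightarrow> rapid \<Gamma> (w j)"
  shows "rapid \<Gamma> (\<lambda>\<epsilon> \<xi>. \<Sum>j\<in>J. w j \<epsilon> \<xi>)"
  using assms by (induction J rule: finite_induct) (auto intro: rapid_zero rapid_add)

lemma rapid_Un: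
  assumes "rapid \<Gamma> w" "rapid \<Gamma>' w"
  shows "rapid (\<Gamma> \<union> \<Gamma>') w"
proof -
  obtain M N where M: "\<And>p. rapid_bound M p \<Gamma> w" and N: "\<And>p. rapid_bound N p \<Gamma>' w"
    using assms unfolding rapid_def by blast
  show ?thesis
  proof (rule rapidI[where N="M + N"])
    fix p
    obtain C where C: "0 \<le> C" "\<forall>\<^sub>0\<epsilon>. \<forall>r>0. \<forall>\<xi>\<in>\<Gamma>. (1 + r) ^ p * norm (w \<epsilon> (r *\<^sub>R \<xi>)) \<le> C * inverse \<epsilon> ^ (M + N)"
      by (rule rapid_boundE[OF M le_add1])
    obtain D where D: "0 \<le> D" "\<forall>\<^sub>0\<epsilon>. \<forall>r>0. \<forall>\<xi>\<in>\<Gamma>'. (1 + r) ^ p * norm (w \<epsilon> (r *\<^sub>R \<xi>)) \<le> D * inverse \<epsilon> ^ (M + N)"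
      by (rule rapid_boundE[OF N le_add2])
    have "\<forall>\<^sub>0\<epsilon>. \<forall>r>0. \<forall>\<xi>\<in>\<Gamma> \<union> \<Gamma>'. (1 + r) ^ p * norm (w \<epsilon> (r *\<^sub>R \<xi>)) \<le> (C + D) * inverse \<epsilon> ^ (M + N)"
      using C(2) D(2) eventually_in_unit
    proof eventually_elim
      case (elim \<epsilon>)
      then have "C * inverse \<epsilon> ^ (M + N) \<le> (C + D) * inverse \<epsilon> ^ (M + N)"
        "D * inverse \<epsilon> ^ (M + N) \<le> (C + D) * inverse \<epsilon> ^ (M + N)"
        using C(1) D(1) by (auto intro!: mult_right_mono)
      then show ?case using elim(1,2) order_trans by blast
    qed
    then show "rapid_bound (M + N) p (\<Gamma> \<union> \<Gamma>') w" unfolding rapid_bound_def by blast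
  qed
qed

lemma rapid_subset: "rapid \<Gamma> w \<Longrightarrow> \<Gamma>' \<subseteq> \<Gamma> \<Longrightarrow> rapid \<Gamma>' w"
proof -
  assume "rapid \<Gamma> w" and sub: "\<Gamma>' \<subseteq> \<Gamma>"
  then obtain N where N: "\<And>p. rapid_bound N p \<Gamma> w" unfolding rapid_def by blast
  show ?thesis
  proof (rule rapidI[where N=N])
    fix p
    obtain C where C: "\<forall>\<^sub>0\<epsilon>. \<forall>r>0. \<forall>\<xi>\<in>\<Gamma>. (1 + r) ^ p * norm (w \<epsilon> (r *\<^sub>R \<xi>)) \<le> C * inverse \<epsilon> ^ N"
      by (rule rapid_boundE[OF N order_refl])
    have "\<forall>\<^sub>0\<epsilon>. \<forall>r>0. \<forall>\<xi>\<in>\<Gamma>'. (1 + r) ^ p * norm (w \<epsilon> (r *\<^sub>R \<xi>)) \<le> C * inverse \<epsilon> ^ N"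
      using C by eventually_elim (use sub in blast)
    then show "rapid_bound N p \<Gamma>' w" unfolding rapid_bound_def by blast
  qed
qed

lemma rapid_Union:
  assumes "finite \<S>" "\<And>\<Gamma>. \<Gamma> \<in> \<S> \<Longrightarrow> rapid \<Gamma> w"
  shows "rapid (\<Union>\<S>) w"
  using assms
proof (induction \<S> rule: finite_induct)
  case empty
  show ?case unfolding rapid_def rapid_bound_def by simp
next
  case (insert \<Gamma> \<S>)
  then show ?case using rapid_Un[of \<Gamma> w "\<Union>\<S>"] by simp
qed

lemma weights_reparam:
  assumes B: "weights B"
  shows "weights {\<lambda>\<theta>. w (\<pi> \<theta>) |w. w \<in> B}" (is "weights ?B")
  unfolding weights_def
proof (intro conjI ballI allI impI)
  show "0 \<le> w \<theta>" if "w \<in> ?B" for w \<theta>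
    using that weights_nonneg[OF B] by auto
  show "(\<lambda>_. c) \<in> ?B" if "0 \<le> c" for c
    using weights_const[OF B that] by (intro CollectI exI[of _ "\<lambda>_. c"]) simp
  fix v w assume "v \<in> ?B" "w \<in> ?B"
  then obtain v' w' where vw: "v = (\<lambda>\<theta>. v' (\<pi> \<theta>))" "w = (\<lambda>\<theta>. w' (\<pi> \<theta>))" "v' \<in> B" "w' \<in> B" by auto
  show "(\<lambda>\<theta>. v \<theta> + w \<theta>) \<in> ?B"
    using weights_add[OF B vw(3,4)] unfolding vw(1,2) by (intro CollectI exI[of _ "\<lambda>\<theta>. v' \<theta> + w' \<theta>"]) simp
  show "(\<lambda>\<theta>. v \<theta> * w \<theta>) \<in> ?B"
    using weights_mult[OF B vw(3,4)] unfolding vw(1,2) by (intro CollectI exI[of _ "\<lambda>\<theta>. v' \<theta> * w' \<theta>"]) simp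
qed

text \<open>
  Negligibility gives smallness of the transform without decay, moderateness gives decay without smallness.
  The square of \<open>(1 + r)\<^sup>p |fourier v|\<close> is the product of \<open>(1 + r)\<^sup>2\<^sup>p |fourier v|\<close>, which is \<open>O(\<epsilon>\<^sup>-\<^sup>N)\<close> for some
  \<open>N\<close> depending on \<open>p\<close>, and of \<open>|fourier v|\<close>, which is \<open>O(\<epsilon>\<^sup>N)\<close> for that \<open>N\<close>.
\<close>

lemma fourier_null_rapid:
  fixes v :: "real \<Rightarrow> real^'n::finite \<Rightarrow> complex"
  assumes sym: "symbol UNIV UNIV (at_right 0) moderate_weights v"
    and L: "compact L" "\<forall>\<^sub>0\<epsilon>. \<forall>x. x \<notin> L \<longrightarrow> v \<epsilon> x = 0"
    and null: "\<And>N. \<exists>C\<ge>0. \<forall>\<^sub>0\<epsilon>. \<forall>x. norm (v \<epsilon> x) \<le> C * \<epsilon> ^ N"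
    and \<Gamma>: "\<Gamma> \<subseteq> sphere 0 1"
  shows "rapid \<Gamma> (\<lambda>\<epsilon>. fourier (v \<epsilon>))"
proof (rule rapidI[where N=0])
  fix p :: nat
  define B where "B = {\<lambda>\<theta> :: real \<times> (real^'n). w (fst \<theta>) |w. w \<in> moderate_weights}"
  have B: "weights B"
    unfolding B_def by (rule weights_reparam[OF weights_moderate_weights])
  have s: "symbol UNIV UNIV (param_filter UNIV) B (\<lambda>\<theta>. v (fst \<theta>))"
    by (rule symbol_reparam[OF sym filterlim_fst_param_filter]) (auto simp: B_def)
  have z: "\<forall>\<^sub>F \<theta> in param_filter UNIV. \<forall>x\<in>UNIV-L. v (fst \<theta>) x = 0"
    unfolding eventually_param_filter using L(2) by eventually_elim auto
  have "\<exists>w\<in>B. \<forall>\<^sub>F \<theta> in param_filter UNIV. (1 + norm (snd \<theta>)) ^ (2 * p) *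
      norm (LINT x:UNIV|lborel. v (fst \<theta>) x * exp (- (\<i> * of_real (x \<bullet> snd \<theta>)))) \<le> w \<theta>"
    by (rule decay_one_plus[OF B fourier_decay[OF B open_UNIV L(1) subset_UNIV s z]]) simp
  then obtain w where w: "w \<in> moderate_weights" "\<forall>\<^sub>0\<epsilon>. \<forall>\<xi>. (1 + norm \<xi>) ^ (2 * p) * norm (fourier (v \<epsilon>) \<xi>) \<le> w \<epsilon>"
    unfolding B_def eventually_param_filter by (auto simp: set_lebesgue_integral_def fourier_def)
  obtain C N where C: "0 \<le> C" "\<forall>\<^sub>0\<epsilon>. w \<epsilon> \<le> C * inverse \<epsilon> ^ N" using moderate_weightsE[OF w(1)] .
  obtain D where D: "0 \<le> D" "\<forall>\<^sub>0\<epsilon>. \<forall>x. norm (v \<epsilon> x) \<le> D * \<epsilon> ^ N" using null[of N] by blast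
  \<comment> \<open>At least 1, so that a bound of the square by \<open>E\<close> bounds the base by \<open>E\<close>.\<close>
  define E where "E = max 1 (C * (measure lborel L * D))"
  have "\<forall>\<^sub>0\<epsilon>. \<forall>r>0. \<forall>\<xi>\<in>\<Gamma>. (1 + r) ^ p * norm (fourier (v \<epsilon>) (r *\<^sub>R \<xi>)) \<le> E * inverse \<epsilon> ^ 0"
    using w(2) C(2) D(2) L(2) symbol_differentiable[OF sym] eventually_in_unit
  proof eventually_elim
    case (elim \<epsilon>)
    show ?case
    proof (intro allI impI ballI)
      fix r :: real and \<xi> assume r: "0 < r" "\<xi> \<in> \<Gamma>"
      then have n: "norm (r *\<^sub>R \<xi>) = r" using \<Gamma> by auto
      let ?F = "norm (fourier (v \<epsilon>) (r *\<^sub>R \<xi>))"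
      have cont: "continuous_on UNIV (v \<epsilon>)"
        using elim(5) by (simp add: continuous_on_of_differentiable)
      have 1: "?F \<le> measure lborel L * (D * \<epsilon> ^ N)"
        by (rule fourier_norm_le[OF cont L(1)]) (use elim in auto)
      have 2: "(1 + r) ^ (2 * p) * ?F \<le> C * inverse \<epsilon> ^ N"
        using elim(1)[rule_format, of "r *\<^sub>R \<xi>"] elim(2) unfolding n by linarith
      have "((1 + r) ^ p * ?F)\<^sup>2 = ((1 + r) ^ (2 * p) * ?F) * ?F"
        by (simp add: power2_eq_square power_mult_distrib mult_2 power_add)
      also have "\<dots> \<le> (C * inverse \<epsilon> ^ N) * (measure lborel L * (D * \<epsilon> ^ N))"
        using C(1) elim(6) by (intro mult_mono 1 2) auto
      also have "\<dots> = C * (measure lborel L * D)"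
        using elim(6) by (simp add: power_inverse field_simps)
      also have "\<dots> \<le> E" by (simp add: E_def)
      finally have sq: "((1 + r) ^ p * ?F)\<^sup>2 \<le> E" .
      have E1: "1 \<le> E" by (simp add: E_def)
      have "(1 + r) ^ p * ?F \<le> E"
      proof (rule ccontr)
        assume "\<not> (1 + r) ^ p * ?F \<le> E"
        then have "E < (1 + r) ^ p * ?F" by simp
        then have "E * E < ((1 + r) ^ p * ?F)\<^sup>2"
          unfolding power2_eq_square using E1 by (intro mult_strict_mono) auto
        moreover have "E \<le> E * E" using E1 by simp
        ultimately show False using sq by linarith
      qed
      then show "(1 + r) ^ p * ?F \<le> E * inverse \<epsilon> ^ 0" by simp
    qed
  qed
  then show "rapid_bound 0 p \<Gamma> (\<lambda>\<epsilon>. fourier (v \<epsilon>))"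
    unfolding rapid_bound_def by blast
qed

lemma rapid_representative:
  fixes v w :: "real \<Rightarrow> real^'n::finite \<Rightarrow> complex"
  assumes \<Omega>: "open \<Omega>" and v: "v \<in> moderate_nets \<Omega>" and w: "w \<in> moderate_nets \<Omega>"
    and K: "compact K" "K \<subseteq> \<Omega>" "\<forall>\<epsilon>\<in>{0<..1}. \<forall>x\<in>\<Omega>-K. v \<epsilon> x = 0" "\<forall>\<epsilon>\<in>{0<..1}. \<forall>x\<in>\<Omega>-K. w \<epsilon> x = 0"
    and null: "(\<lambda>\<epsilon> x. v \<epsilon> x - w \<epsilon> x) \<in> null_nets \<Omega>" and \<Gamma>: "\<Gamma> \<subseteq> sphere 0 1"
    and r: "rapid \<Gamma> (\<lambda>\<epsilon>. fourier (extend_zero \<Omega> (v \<epsilon>)))"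
  shows "rapid \<Gamma> (\<lambda>\<epsilon>. fourier (extend_zero \<Omega> (w \<epsilon>)))"
proof -
  define d where "d \<epsilon> x = v \<epsilon> x - w \<epsilon> x" for \<epsilon> x
  have d: "d \<in> null_nets \<Omega>" using null by (simp add: d_def[abs_def])
  have dK: "\<forall>\<epsilon>\<in>{0<..1}. \<forall>x\<in>\<Omega>-K. d \<epsilon> x = 0" using K(3,4) by (simp add: d_def)
  have outside: "extend_zero \<Omega> (d \<epsilon>) x = 0" if "\<epsilon> \<in> {0<..1}" "x \<notin> K" for \<epsilon> x
    using dK that by (simp add: extend_zero_def)
  have "rapid \<Gamma> (\<lambda>\<epsilon>. fourier (extend_zero \<Omega> (d \<epsilon>)))"
  proof (rule fourier_null_rapid[OF symbol_extend_zero[OF \<Omega> null_moderate[OF d] K(1,2) dK] K(1) _ _ \<Gamma>])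
    show "\<forall>\<^sub>0\<epsilon>. \<forall>x. x \<notin> K \<longrightarrow> extend_zero \<Omega> (d \<epsilon>) x = 0"
      using eventually_in_unit by eventually_elim (auto intro: outside)
    fix N
    obtain C where C: "C \<ge> 0" "\<forall>\<^sub>0\<epsilon>. \<forall>x\<in>K. norm (d \<epsilon> x) \<le> C * \<epsilon> ^ N"
      using null_bound[OF d K(1,2)] .
    have "\<forall>\<^sub>0\<epsilon>. \<forall>x. norm (extend_zero \<Omega> (d \<epsilon>) x) \<le> C * \<epsilon> ^ N"
      using C(2) eventually_in_unit
    proof eventually_elim
      case (elim \<epsilon>)
      show ?case
      proof
        fix x
        show "norm (extend_zero \<Omega> (d \<epsilon>) x) \<le> C * \<epsilon> ^ N"
        proof (cases "x \<in> K")
          case True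
          then show ?thesis using elim(1) K(2) by (auto simp: extend_zero_def)
        next
          case False
          then show ?thesis using outside[of \<epsilon> x] elim(2) C(1) by simp
        qed
      qed
    qed
    then show "\<exists>C\<ge>0. \<forall>\<^sub>0\<epsilon>. \<forall>x. norm (extend_zero \<Omega> (d \<epsilon>) x) \<le> C * \<epsilon> ^ N" using C(1) by blast
  qed
  from rapid_diff[OF r this] show ?thesis
  proof (rule rapid_cong[rotated])
    show "\<forall>\<^sub>0\<epsilon>. \<forall>\<xi>. fourier (extend_zero \<Omega> (v \<epsilon>)) \<xi> - fourier (extend_zero \<Omega> (d \<epsilon>)) \<xi> = fourier (extend_zero \<Omega> (w \<epsilon>)) \<xi>"
      using eventually_in_unit
    proof eventually_elim
      case (elim \<epsilon>)
      then have e: "\<epsilon> \<in> {0<..1}" by simp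
      have c: "continuous_on \<Omega> (v \<epsilon>)" "continuous_on \<Omega> (w \<epsilon>)"
        using smooth_on_continuous_on[OF moderate_smooth] v w e by blast+
      show ?case
      proof
        fix \<xi>
        let ?e = "\<lambda>x :: real^'n. exp (- (\<i> * complex_of_real (x \<bullet> \<xi>)))"
        have i: "set_integrable lborel \<Omega> (\<lambda>x. v \<epsilon> x * ?e x)" "set_integrable lborel \<Omega> (\<lambda>x. w \<epsilon> x * ?e x)"
          by (rule set_integrable_compact_support[OF \<Omega> K(1,2)], use K(3,4) e in \<open>auto intro!: continuous_intros c\<close>)+
        have "(LINT x:\<Omega>|lborel. d \<epsilon> x * ?e x) = (LINT x:\<Omega>|lborel. v \<epsilon> x * ?e x - w \<epsilon> x * ?e x)"
          unfolding d_def left_diff_distrib by (rule refl)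
        also have "\<dots> = (LINT x:\<Omega>|lborel. v \<epsilon> x * ?e x) - (LINT x:\<Omega>|lborel. w \<epsilon> x * ?e x)"
          by (rule set_integral_diff(2)[OF i])
        finally show "fourier (extend_zero \<Omega> (v \<epsilon>)) \<xi> - fourier (extend_zero \<Omega> (d \<epsilon>)) \<xi> = fourier (extend_zero \<Omega> (w \<epsilon>)) \<xi>"
          unfolding fourier_extend_zero by simp
      qed
    qed
  qed
qed

lemma test_functionE:
  assumes "\<phi> \<in> test_functions \<Omega>"
  obtains K where "compact K" "K \<subseteq> \<Omega>" "\<And>x. x \<in> \<Omega> - K \<Longrightarrow> \<phi> x = 0"
  using assms unfolding test_functions_def by blast

lemma test_function_smooth: "\<phi> \<in> test_functions \<Omega> \<Longrightarrow> smooth_on \<Omega> \<phi>"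
  unfolding test_functions_def by blast

text \<open>
  Any two compactly supported representatives of \<open>\<phi> U\<close> differ by a negligible net with compact support, so
  one particular representative may be tested.
\<close>

lemma rapidly_decreasing_gmult_iff:
  fixes u :: "real \<Rightarrow> real^'n::finite \<Rightarrow> complex"
  assumes \<Omega>: "open \<Omega>" and U: "U \<in> colombeau \<Omega>" "u \<in> U" and \<phi>: "\<phi> \<in> test_functions \<Omega>"
    and \<Gamma>: "\<Gamma> \<subseteq> sphere 0 1"
  shows "rapidly_decreasing \<Gamma> (fourier_nets \<Omega> (gmult \<Omega> \<phi> U)) \<longleftrightarrow>
     rapid \<Gamma> (\<lambda>\<epsilon>. fourier (extend_zero \<Omega> (\<lambda>x. \<phi> x * u \<epsilon> x)))"
proof -
  obtain K where K: "compact K" "K \<subseteq> \<Omega>" "\<And>x. x \<in> \<Omega> - K \<Longrightarrow> \<phi> x = 0" using test_functionE[OF \<phi>] by blast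
  note sm = test_function_smooth[OF \<phi>]
  have um: "u \<in> moderate_nets \<Omega>" using colombeau_moderate[OF U] .
  have pu: "(\<lambda>\<epsilon> x. \<phi> x * u \<epsilon> x) \<in> moderate_nets \<Omega>"
    by (rule moderate_mult[OF \<Omega> moderate_smooth_function[OF sm] um])
  show ?thesis
  proof
    assume "rapidly_decreasing \<Gamma> (fourier_nets \<Omega> (gmult \<Omega> \<phi> U))"
    then obtain w where w: "w \<in> fourier_nets \<Omega> (gmult \<Omega> \<phi> U)" "rapid \<Gamma> w"
      unfolding rapidly_decreasing_iff_rapid by blast
    then obtain v L where v: "w = (\<lambda>\<epsilon> \<xi>. LINT x:\<Omega>|lborel. v \<epsilon> x * exp (- (\<i> * complex_of_real (x \<bullet> \<xi>))))"
        "v \<in> gmult \<Omega> \<phi> U" "compact L" "L \<subseteq> \<Omega>" "\<forall>\<epsilon>\<in>{0<..1}. \<forall>x\<in>\<Omega> - L. v \<epsilon> x = 0"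
      unfolding fourier_nets_def by blast
    obtain u' where u': "u' \<in> U" "v \<in> gclass \<Omega> (\<lambda>\<epsilon> x. \<phi> x * u' \<epsilon> x)"
      using v(2) unfolding gmult_def by blast
    note v' = gclassD[OF u'(2)]
    have "(\<lambda>\<epsilon> x. v \<epsilon> x - \<phi> x * u \<epsilon> x) \<in> null_nets \<Omega>"
    proof -
      have "(\<lambda>\<epsilon> x. \<phi> x * (u' \<epsilon> x - u \<epsilon> x)) \<in> null_nets \<Omega>"
        by (rule null_mult[OF \<Omega> sm colombeau_diff_null[OF \<Omega> U(1) u'(1) U(2)]])
      from null_add[OF \<Omega> null_minus[OF \<Omega> v'(3)] this] show ?thesis by (simp add: algebra_simps)
    qed
    moreover have "rapid \<Gamma> (\<lambda>\<epsilon>. fourier (extend_zero \<Omega> (v \<epsilon>)))"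
      using w(2) unfolding v(1) fourier_extend_zero[symmetric] by simp
    ultimately show "rapid \<Gamma> (\<lambda>\<epsilon>. fourier (extend_zero \<Omega> (\<lambda>x. \<phi> x * u \<epsilon> x)))"
      using K v(3-5) by (intro rapid_representative[OF \<Omega> v'(2) pu, where K="K \<union> L" and \<Gamma>=\<Gamma>] \<Gamma>) auto
  next
    assume r: "rapid \<Gamma> (\<lambda>\<epsilon>. fourier (extend_zero \<Omega> (\<lambda>x. \<phi> x * u \<epsilon> x)))"
    have "(\<lambda>\<epsilon> x. \<phi> x * u \<epsilon> x) \<in> gmult \<Omega> \<phi> U"
      unfolding gmult_def using U(2) gclass_self[OF pu] by blast
    then have "(\<lambda>\<epsilon> \<xi>. LINT x:\<Omega>|lborel. \<phi> x * u \<epsilon> x * exp (- (\<i> * complex_of_real (x \<bullet> \<xi>)))) \<in> fourier_nets \<Omega> (gmult \<Omega> \<phi> U)"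
      unfolding fourier_nets_def using K
      by (intro CollectI exI[of _ "\<lambda>\<epsilon> x. \<phi> x * u \<epsilon> x"] conjI refl exI[of _ K]) auto
    moreover have "rapid \<Gamma> (\<lambda>\<epsilon> \<xi>. LINT x:\<Omega>|lborel. \<phi> x * u \<epsilon> x * exp (- (\<i> * complex_of_real (x \<bullet> \<xi>))))"
      using r unfolding fourier_extend_zero[symmetric] .
    ultimately show "rapidly_decreasing \<Gamma> (fourier_nets \<Omega> (gmult \<Omega> \<phi> U))"
      unfolding rapidly_decreasing_iff_rapid by blast
  qed
qed

lemma symbol_ident:
  fixes X :: "(real^'n::finite) set"
  assumes B: "weights B" and X: "open X" "bounded X"
  shows "symbol X X F B (\<lambda>_ x. x)"
proof -
  obtain b where b: "\<forall>x\<in>X. norm x \<le> b" using X(2) unfolding bounded_iff by blast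
  have z: "symbol_upto 0 X X F B (\<lambda>_ x. x)"
    by (rule symbol_upto_0I[OF _ weights_const[OF B, of "max b 0"]]) (use b in \<open>auto intro!: always_eventually\<close>)
  have "symbol_upto (Suc k) X X F B (\<lambda>_ x. x)" for k
    by (rule symbol_upto_SucI[OF X(1) subset_refl z, where h="\<lambda>i _ _. axis i 1"])
      (auto simp: partial_deriv_ident intro: symbol_upto_const[OF B weights_const[OF B, of 1]])
  then show ?thesis unfolding symbol_iff_upto using symbol_upto_mono by (metis le_add2 plus_1_eq_Suc)
qed

text \<open>
  Positive multiples of two distinct unit vectors cannot cancel: the difference controls both
  coefficients.
\<close>

lemma unit_separation:
  fixes a b :: "'a::real_normed_vector"
  assumes "norm a = 1" "norm b = 1" "\<delta> \<le> norm (a - b)" "0 \<le> s" "0 \<le> t"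
  shows "\<delta> * s \<le> 2 * norm (s *\<^sub>R a - t *\<^sub>R b)" "\<delta> * t \<le> 2 * norm (s *\<^sub>R a - t *\<^sub>R b)"
proof -
  have st: "\<bar>s - t\<bar> \<le> norm (s *\<^sub>R a - t *\<^sub>R b)"
    using norm_triangle_ineq3[of "s *\<^sub>R a" "t *\<^sub>R b"] assms by simp
  have "s * norm (a - b) = norm ((s *\<^sub>R a - t *\<^sub>R b) - (s - t) *\<^sub>R b)"
    using assms(4) by (simp add: algebra_simps flip: norm_scaleR[of s, unfolded abs_of_nonneg[OF assms(4)]] )
  also have "\<dots> \<le> norm (s *\<^sub>R a - t *\<^sub>R b) + \<bar>s - t\<bar>"
    using norm_triangle_ineq4[of "s *\<^sub>R a - t *\<^sub>R b" "(s - t) *\<^sub>R b"] assms(2) by simp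
  finally have 1: "s * norm (a - b) \<le> 2 * norm (s *\<^sub>R a - t *\<^sub>R b)" using st by simp
  have "t * norm (a - b) = norm ((s *\<^sub>R a - t *\<^sub>R b) - (s - t) *\<^sub>R a)"
    using assms(5) by (simp add: algebra_simps flip: norm_scaleR[of t, unfolded abs_of_nonneg[OF assms(5)]] )
  also have "\<dots> \<le> norm (s *\<^sub>R a - t *\<^sub>R b) + \<bar>s - t\<bar>"
    using norm_triangle_ineq4[of "s *\<^sub>R a - t *\<^sub>R b" "(s - t) *\<^sub>R a"] assms(1) by simp
  finally have 2: "t * norm (a - b) \<le> 2 * norm (s *\<^sub>R a - t *\<^sub>R b)" using st by simp
  show "\<delta> * s \<le> 2 * norm (s *\<^sub>R a - t *\<^sub>R b)"
    using mult_right_mono[OF assms(3,4)] 1 by (simp add: mult.commute)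
  show "\<delta> * t \<le> 2 * norm (s *\<^sub>R a - t *\<^sub>R b)"
    using mult_right_mono[OF assms(3,5)] 2 by (simp add: mult.commute)
qed

section \<open>Wave front set, generalized graph and the set D\<close>

text \<open>
  The properties of a cutoff of a moderate net that the pullback estimate requires of \<open>v\<close>.
\<close>

lemma cutoff_net:
  fixes u :: "real \<Rightarrow> real^'n::finite \<Rightarrow> complex"
  assumes \<Omega>: "open \<Omega>" and u: "u \<in> moderate_nets \<Omega>" and \<phi>: "\<phi> \<in> test_functions \<Omega>"
  obtains L C N where "\<forall>\<^sub>0\<epsilon>. smooth_on UNIV (extend_zero \<Omega> (\<lambda>x. \<phi> x * u \<epsilon> x))"
    "compact L" "\<forall>\<^sub>0\<epsilon>. \<forall>y. y \<notin> L \<longrightarrow> extend_zero \<Omega> (\<lambda>x. \<phi> x * u \<epsilon> x) y = 0"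
    "\<forall>\<^sub>0\<epsilon>. \<forall>y. norm (extend_zero \<Omega> (\<lambda>x. \<phi> x * u \<epsilon> x) y) \<le> C * inverse \<epsilon> ^ N"
proof -
  obtain K where K: "compact K" "K \<subseteq> \<Omega>" "\<And>x. x \<in> \<Omega> - K \<Longrightarrow> \<phi> x = 0" using test_functionE[OF \<phi>] by blast
  note sm = test_function_smooth[OF \<phi>]
  have m: "(\<lambda>\<epsilon> x. \<phi> x * u \<epsilon> x) \<in> moderate_nets \<Omega>"
    by (rule moderate_mult[OF \<Omega> moderate_smooth_function[OF sm] u])
  have s: "symbol UNIV UNIV (at_right 0) moderate_weights (\<lambda>\<epsilon>. extend_zero \<Omega> (\<lambda>x. \<phi> x * u \<epsilon> x))"
    by (rule symbol_extend_zero[OF \<Omega> m K(1,2)]) (use K(3) in auto)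
  obtain w where w: "w \<in> moderate_weights" "\<forall>\<^sub>0\<epsilon>. \<forall>x\<in>UNIV. norm (extend_zero \<Omega> (\<lambda>x. \<phi> x * u \<epsilon> x) x) \<le> w \<epsilon>"
    using symbol_bound[OF s] .
  obtain C N where C: "\<forall>\<^sub>0\<epsilon>. w \<epsilon> \<le> C * inverse \<epsilon> ^ N" using moderate_weightsE[OF w(1)] by blast
  show thesis
  proof (rule that[of K C N])
    show "\<forall>\<^sub>0\<epsilon>. smooth_on UNIV (extend_zero \<Omega> (\<lambda>x. \<phi> x * u \<epsilon> x))"
      using eventually_in_unit
    proof eventually_elim
      case (elim \<epsilon>)
      then have "smooth_on \<Omega> (\<lambda>x. \<phi> x * u \<epsilon> x)" using moderate_smooth[OF m, of \<epsilon>] by simp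
      then show ?case using smooth_on_extend_zero[OF \<Omega> K(1,2), of "\<lambda>x. \<phi> x * u \<epsilon> x"] K(3) by simp
    qed
    show "\<forall>\<^sub>0\<epsilon>. \<forall>y. y \<notin> K \<longrightarrow> extend_zero \<Omega> (\<lambda>x. \<phi> x * u \<epsilon> x) y = 0"
      using K(3) by (auto simp: extend_zero_def intro!: always_eventually)
    show "\<forall>\<^sub>0\<epsilon>. \<forall>y. norm (extend_zero \<Omega> (\<lambda>x. \<phi> x * u \<epsilon> x) y) \<le> C * inverse \<epsilon> ^ N"
      using C w(2) by eventually_elim (meson UNIV_I order_trans)
  qed (rule K(1))
qed

lemma test_functionI:
  assumes "smooth_on UNIV \<phi>" "compact K" "K \<subseteq> \<Omega>" "\<And>x. x \<notin> K \<Longrightarrow> \<phi> x = 0"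
  shows "\<phi> \<in> test_functions \<Omega>"
  using assms smooth_on_subset[OF assms(1) subset_UNIV] unfolding test_functions_def by auto

lemma codifferential_ident: "codifferential (\<lambda>x. x) x \<eta> = \<eta>"
  by (simp add: codifferential_def partial_deriv_ident vec_eq_iff inner_axis')

text \<open>
  Multiplication by a test function does not enlarge the set of irregular directions. This is the
  pullback estimate for the identity map: for \<open>\<eta>\<close> outside \<open>\<Gamma>\<close> and \<open>\<xi>\<close> in the smaller set \<open>\<Gamma>'\<close> the phase
  \<open>x \<bullet> (\<eta> - \<lambda>\<xi>)\<close> is nonstationary. The set \<open>\<Gamma>'\<close> serves all test functions, which allows products of cutoffs
  later.
\<close>

lemma rapid_times_test_function:
  fixes u :: "real \<Rightarrow> real^'n::finite \<Rightarrow> complex"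
  assumes \<Omega>: "open \<Omega>" and u: "u \<in> moderate_nets \<Omega>" and \<psi>: "\<psi> \<in> test_functions \<Omega>"
    and \<Gamma>: "openin (top_of_set (sphere 0 1)) \<Gamma>" "\<zeta> \<in> \<Gamma>"
    and r: "rapid \<Gamma> (\<lambda>\<epsilon>. fourier (extend_zero \<Omega> (\<lambda>x. \<psi> x * u \<epsilon> x)))"
  obtains \<Gamma>' where "openin (top_of_set (sphere 0 1)) \<Gamma>'" "\<zeta> \<in> \<Gamma>'"
    "\<And>\<phi>. \<phi> \<in> test_functions \<Omega> \<Longrightarrow> rapid \<Gamma>' (\<lambda>\<epsilon>. fourier (extend_zero \<Omega> (\<lambda>x. \<phi> x * \<psi> x * u \<epsilon> x)))"
proof -
  have sub: "\<Gamma> \<subseteq> sphere 0 1" using openin_imp_subset[OF \<Gamma>(1)] .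
  obtain d where d: "d > 0" "ball \<zeta> d \<inter> sphere 0 1 \<subseteq> \<Gamma>"
    using \<Gamma> unfolding openin_contains_ball by blast
  \<comment> \<open>Points of \<open>\<Gamma>'\<close> and of the complement of \<open>\<Gamma>\<close> have distance at least \<open>d / 2\<close>, whence the gradient
    bound \<open>8 / d\<close>: \<open>unit_separation\<close> bounds \<open>s\<close> and \<open>t\<close> by \<open>4 / d\<close> times the gradient each.\<close>
  define \<Gamma>' where "\<Gamma>' = sphere 0 1 \<inter> ball \<zeta> (d / 2)"
  define V where "V = sphere 0 1 - \<Gamma>"
  have far: "d / 2 \<le> norm (\<eta> - \<xi>)" if "\<eta> \<in> V" "\<xi> \<in> \<Gamma>'" for \<eta> \<xi>
  proof -
    have "\<eta> \<notin> ball \<zeta> d" using that(1) d(2) unfolding V_def by blast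
    then have "d \<le> dist \<zeta> \<eta>" by simp
    also have "\<dots> \<le> dist \<zeta> \<xi> + dist \<xi> \<eta>" by (rule dist_triangle)
    finally show ?thesis using that(2) unfolding \<Gamma>'_def by (simp add: dist_norm norm_minus_commute)
  qed
  obtain L C N where L: "\<forall>\<^sub>0\<epsilon>. smooth_on UNIV (extend_zero \<Omega> (\<lambda>x. \<psi> x * u \<epsilon> x))"
    "compact L" "\<forall>\<^sub>0\<epsilon>. \<forall>y. y \<notin> L \<longrightarrow> extend_zero \<Omega> (\<lambda>x. \<psi> x * u \<epsilon> x) y = 0"
    "\<forall>\<^sub>0\<epsilon>. \<forall>y. norm (extend_zero \<Omega> (\<lambda>x. \<psi> x * u \<epsilon> x) y) \<le> C * inverse \<epsilon> ^ N"
    using cutoff_net[OF \<Omega> u \<psi>] by blast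
  have VV: "sphere 0 1 - V \<subseteq> \<Gamma>" unfolding V_def by blast
  show thesis
  proof (rule that[of \<Gamma>'])
    show "openin (top_of_set (sphere 0 1)) \<Gamma>'" unfolding \<Gamma>'_def by (intro openin_open_Int) simp
    show "\<zeta> \<in> \<Gamma>'" using \<Gamma> sub d(1) by (auto simp: \<Gamma>'_def)
    fix \<phi> assume \<phi>: "\<phi> \<in> test_functions \<Omega>"
    obtain K where K: "compact K" "K \<subseteq> \<Omega>" "\<And>x. x \<in> \<Omega> - K \<Longrightarrow> \<phi> x = 0" using test_functionE[OF \<phi>] by blast
    define a where "a = extend_zero \<Omega> \<phi>"
    have a0: "a x = 0" if "x \<notin> K" for x using K(3) that by (auto simp: a_def extend_zero_def)
    have as: "smooth_on UNIV a"
      unfolding a_def by (rule smooth_on_extend_zero[OF \<Omega> K(1,2) _ test_function_smooth[OF \<phi>]]) (use K(3) in blast)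
    obtain R where R: "K \<subseteq> ball 0 R"
      using compact_imp_bounded[OF K(1)] bounded_subset_ballD by blast
    let ?X = "ball (0 :: real^'n) R"
    have "rapid \<Gamma>' (\<lambda>\<epsilon> \<zeta>. LINT x:?X|lborel. a x * extend_zero \<Omega> (\<lambda>x. \<psi> x * u \<epsilon> x) x * exp (- (\<i> * of_real (x \<bullet> \<zeta>))))"
    proof (rule rapid_pullback[where f="\<lambda>_ x. x" and a="\<lambda>_. a" and \<rho>="\<lambda>_. 8 / d", OF open_ball K(1) R _ _ _ L rapid_subset[OF r VV]])
      show "symbol ?X ?X (at_right 0) slow_weights (\<lambda>_ x. x)"
        by (rule symbol_ident[OF weights_slow_weights]) auto
      show "symbol ?X ?X (at_right 0) slow_weights (\<lambda>_. a)"
        by (rule symbol_mono[OF symbol_test_function[OF weights_slow_weights as K(1) a0]]) auto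
      show "\<forall>\<^sub>0\<epsilon>. \<forall>x\<in>?X - K. a x = 0" using a0 by simp
      show "(\<lambda>_. 8 / d) \<in> slow_weights" using d(1) by (intro slow_weights_const) simp
      show "\<Gamma>' \<subseteq> sphere 0 1" by (auto simp: \<Gamma>'_def)
      show "\<forall>\<^sub>0\<epsilon>. \<forall>x\<in>?X. \<forall>\<eta>\<in>V. \<forall>\<xi>\<in>\<Gamma>'. \<forall>s\<ge>0. \<forall>t\<ge>0. s + t = 1 \<longrightarrow>
         1 \<le> 8 / d * norm (s *\<^sub>R codifferential (\<lambda>x. x) x \<eta> - t *\<^sub>R \<xi>)"
      proof (intro always_eventually allI ballI impI)
        fix \<eta> \<xi> :: "real^'n" and s t :: real
        assume h: "\<eta> \<in> V" "\<xi> \<in> \<Gamma>'" "0 \<le> s" "0 \<le> t" "s + t = 1"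
        have n: "norm \<eta> = 1" "norm \<xi> = 1" using h by (auto simp: V_def \<Gamma>'_def)
        have "d / 2 * s + d / 2 * t \<le> 4 * norm (s *\<^sub>R \<eta> - t *\<^sub>R \<xi>)"
          using unit_separation[OF n far[OF h(1,2)] h(3,4)] by simp
        moreover have "d / 2 * s + d / 2 * t = d / 2"
          using h(5) by (simp add: field_simps flip: distrib_left)
        ultimately show "1 \<le> 8 / d * norm (s *\<^sub>R codifferential (\<lambda>x. x) x \<eta> - t *\<^sub>R \<xi>)" for x
          using d(1) unfolding codifferential_ident by (simp add: field_simps)
      qed
    qed
    moreover have "(LINT x:?X|lborel. a x * extend_zero \<Omega> (\<lambda>x. \<psi> x * u \<epsilon> x) x * exp (- (\<i> * of_real (x \<bullet> \<zeta>)))) =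
        fourier (extend_zero \<Omega> (\<lambda>x. \<phi> x * \<psi> x * u \<epsilon> x)) \<zeta>" for \<epsilon> \<zeta>
      unfolding fourier_def set_lebesgue_integral_def
    proof (rule Bochner_Integration.integral_cong[OF refl])
      fix x
      show "indicator ?X x *\<^sub>R (a x * extend_zero \<Omega> (\<lambda>x. \<psi> x * u \<epsilon> x) x * exp (- (\<i> * of_real (x \<bullet> \<zeta>)))) =
         extend_zero \<Omega> (\<lambda>x. \<phi> x * \<psi> x * u \<epsilon> x) x * exp (- (\<i> * of_real (x \<bullet> \<zeta>)))"
      proof (cases "x \<in> K")
        case True
        then show ?thesis using R K(2) by (auto simp: a_def extend_zero_def)
      next
        case False
        then show ?thesis using a0[of x] K(3) by (auto simp: extend_zero_def)
      qed
    qed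
    ultimately show "rapid \<Gamma>' (\<lambda>\<epsilon>. fourier (extend_zero \<Omega> (\<lambda>x. \<phi> x * \<psi> x * u \<epsilon> x)))" by simp
  qed
qed

text \<open>
  The regular direction comes with a cutoff \<open>\<psi>\<close> that may be shrunk by any further test function.
\<close>

lemma not_WF_E:
  fixes u :: "real \<Rightarrow> real^'n::finite \<Rightarrow> complex"
  assumes \<Omega>: "open \<Omega>" and U: "U \<in> colombeau \<Omega>" "u \<in> U" and y: "y \<in> \<Omega>" "\<eta> \<in> sphere 0 1" "(y, \<eta>) \<notin> WF \<Omega> U"
  obtains \<psi> \<Gamma> where "\<psi> \<in> test_functions \<Omega>" "\<psi> y \<noteq> 0" "openin (top_of_set (sphere 0 1)) \<Gamma>" "\<eta> \<in> \<Gamma>"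
    "\<And>\<phi>. \<phi> \<in> test_functions \<Omega> \<Longrightarrow> rapid \<Gamma> (\<lambda>\<epsilon>. fourier (extend_zero \<Omega> (\<lambda>x. \<phi> x * \<psi> x * u \<epsilon> x)))"
proof -
  have "\<eta> \<notin> irregular_directions_at \<Omega> U y" using y unfolding WF_def by simp
  then obtain \<psi> where \<psi>: "\<psi> \<in> test_functions \<Omega>" "\<psi> y \<noteq> 0" "\<eta> \<notin> irregular_directions \<Omega> (gmult \<Omega> \<psi> U)"
    unfolding irregular_directions_at_def by blast
  then obtain \<Gamma> where \<Gamma>: "openin (top_of_set (sphere 0 1)) \<Gamma>" "\<eta> \<in> \<Gamma>" "rapidly_decreasing \<Gamma> (fourier_nets \<Omega> (gmult \<Omega> \<psi> U))"
    using y(2) unfolding irregular_directions_def by blast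
  have "rapid \<Gamma> (\<lambda>\<epsilon>. fourier (extend_zero \<Omega> (\<lambda>x. \<psi> x * u \<epsilon> x)))"
    using rapidly_decreasing_gmult_iff[OF \<Omega> U \<psi>(1) openin_imp_subset[OF \<Gamma>(1)]] \<Gamma>(3) by simp
  then show thesis
  proof (rule rapid_times_test_function[OF \<Omega> colombeau_moderate[OF U] \<psi>(1) \<Gamma>(1,2)])
    fix \<Gamma>'
    assume "openin (top_of_set (sphere 0 1)) \<Gamma>'" "\<eta> \<in> \<Gamma>'"
      "\<And>\<phi>. \<phi> \<in> test_functions \<Omega> \<Longrightarrow> rapid \<Gamma>' (\<lambda>\<epsilon>. fourier (extend_zero \<Omega> (\<lambda>x. \<phi> x * \<psi> x * u \<epsilon> x)))"
    then show thesis by (rule that[OF \<psi>(1,2)])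
  qed
qed

lemma not_WF_I:
  fixes u :: "real \<Rightarrow> real^'n::finite \<Rightarrow> complex"
  assumes \<Omega>: "open \<Omega>" and U: "U \<in> colombeau \<Omega>" "u \<in> U" and \<phi>: "\<phi> \<in> test_functions \<Omega>" "\<phi> x \<noteq> 0"
    and \<Gamma>: "openin (top_of_set (sphere 0 1)) \<Gamma>" "\<xi> \<in> \<Gamma>"
    and r: "rapid \<Gamma> (\<lambda>\<epsilon>. fourier (extend_zero \<Omega> (\<lambda>x. \<phi> x * u \<epsilon> x)))"
  shows "(x, \<xi>) \<notin> WF \<Omega> U"
proof -
  have "rapidly_decreasing \<Gamma> (fourier_nets \<Omega> (gmult \<Omega> \<phi> U))"
    using rapidly_decreasing_gmult_iff[OF \<Omega> U \<phi>(1) openin_imp_subset[OF \<Gamma>(1)]] r by simp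
  then have "\<xi> \<notin> irregular_directions \<Omega> (gmult \<Omega> \<phi> U)"
    using \<Gamma> unfolding irregular_directions_def by blast
  then have "\<xi> \<notin> irregular_directions_at \<Omega> U x"
    unfolding irregular_directions_at_def using \<phi> by blast
  then show ?thesis unfolding WF_def by simp
qed

lemma filterlim_nat_floor_inverse: "filterlim (\<lambda>\<epsilon>::real. nat \<lfloor>inverse \<epsilon>\<rfloor>) sequentially (at_right 0)"
  by (rule filterlim_compose[OF filterlim_nat_sequentially filterlim_compose[OF filterlim_floor_sequentially filterlim_inverse_at_top_right]])

text \<open>
  Nets, reparametrizations and cluster points condense to a statement about single points. In the
  converse direction, the points found for \<open>\<delta> = 1/(n+1)\<close> are arranged into a net by \<open>n = \<lfloor>1/\<epsilon>\<rfloor>\<close>.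
\<close>

lemma cluster_net_iff:
  fixes g :: "real \<Rightarrow> 'z::metric_space \<Rightarrow> 'y::metric_space"
  shows "(\<exists>z. \<exists>\<tau>\<in>reparam. (\<forall>\<epsilon>\<in>{0<..1}. z \<epsilon> \<in> A) \<and> (z \<longlongrightarrow> p) (at_right 0) \<and> cluster_point (\<lambda>\<epsilon>. g (\<tau> \<epsilon>) (z \<epsilon>)) y)
    \<longleftrightarrow> (\<forall>\<delta>>0. \<exists>\<epsilon>. 0 < \<epsilon> \<and> \<epsilon> < \<delta> \<and> \<epsilon> \<le> 1 \<and> (\<exists>a\<in>A. dist a p < \<delta> \<and> dist (g \<epsilon> a) y < \<delta>))" (is "?L \<longleftrightarrow> ?R")
proof
  assume ?L
  then obtain z \<tau> \<sigma> where \<tau>: "\<tau> \<in> reparam" and z: "\<forall>\<epsilon>\<in>{0<..1}. z \<epsilon> \<in> A" "(z \<longlongrightarrow> p) (at_right 0)"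
    and \<sigma>: "\<sigma> \<in> reparam" "((\<lambda>\<epsilon>. g (\<tau> (\<sigma> \<epsilon>)) (z (\<sigma> \<epsilon>))) \<longlongrightarrow> y) (at_right 0)"
    unfolding cluster_point_def by blast
  have \<sigma>_lim: "filterlim \<sigma> (at_right 0) (at_right 0)"
    unfolding filterlim_at
  proof
    show "\<forall>\<^sub>0\<epsilon>. \<sigma> \<epsilon> \<in> {0<..} \<and> \<sigma> \<epsilon> \<noteq> 0"
      using eventually_in_unit by eventually_elim (use \<sigma>(1) in \<open>force simp: reparam_def\<close>)
    show "(\<sigma> \<longlongrightarrow> 0) (at_right 0)" using \<sigma>(1) by (simp add: reparam_def)
  qed
  have \<tau>\<sigma>: "((\<lambda>\<epsilon>. \<tau> (\<sigma> \<epsilon>)) \<longlongrightarrow> 0) (at_right 0)"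
    using \<tau> filterlim_compose[OF _ \<sigma>_lim] by (auto simp: reparam_def)
  have z\<sigma>: "((\<lambda>\<epsilon>. z (\<sigma> \<epsilon>)) \<longlongrightarrow> p) (at_right 0)" by (rule filterlim_compose[OF z(2) \<sigma>_lim])
  show ?R
  proof (intro allI impI)
    fix \<delta> :: real assume \<delta>: "0 < \<delta>"
    have "\<forall>\<^sub>0\<epsilon>. dist (\<tau> (\<sigma> \<epsilon>)) 0 < \<delta> \<and> dist (z (\<sigma> \<epsilon>)) p < \<delta> \<and> dist (g (\<tau> (\<sigma> \<epsilon>)) (z (\<sigma> \<epsilon>))) y < \<delta> \<and> (0 < \<epsilon> \<and> \<epsilon> < 1)"
      by (intro eventually_conj tendstoD[OF \<tau>\<sigma> \<delta>] tendstoD[OF z\<sigma> \<delta>] tendstoD[OF \<sigma>(2) \<delta>]) (use eventually_in_unit in \<open>auto simp: eventually_conj_iff\<close>)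
    then obtain \<epsilon> where \<epsilon>: "dist (\<tau> (\<sigma> \<epsilon>)) 0 < \<delta>" "dist (z (\<sigma> \<epsilon>)) p < \<delta>" "dist (g (\<tau> (\<sigma> \<epsilon>)) (z (\<sigma> \<epsilon>))) y < \<delta>" "0 < \<epsilon>" "\<epsilon> < 1"
      using eventually_happens[of _ "at_right (0::real)"] trivial_limit_at_right_real by blast
    have s: "\<sigma> \<epsilon> \<in> {0<..1}" using \<sigma>(1) \<epsilon>(4,5) unfolding reparam_def by simp
    then have t: "\<tau> (\<sigma> \<epsilon>) \<in> {0<..1}" using \<tau> unfolding reparam_def by simp
    show "\<exists>\<epsilon>. 0 < \<epsilon> \<and> \<epsilon> < \<delta> \<and> \<epsilon> \<le> 1 \<and> (\<exists>a\<in>A. dist a p < \<delta> \<and> dist (g \<epsilon> a) y < \<delta>)"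
      using \<epsilon> s t z(1) by (intro exI[of _ "\<tau> (\<sigma> \<epsilon>)"] conjI bexI[of _ "z (\<sigma> \<epsilon>)"]) auto
  qed
next
  assume R: ?R
  have "\<exists>\<epsilon> a. 0 < \<epsilon> \<and> \<epsilon> < inverse (real (Suc n)) \<and> \<epsilon> \<le> 1 \<and> a \<in> A \<and> dist a p < inverse (real (Suc n)) \<and> dist (g \<epsilon> a) y < inverse (real (Suc n))" for n
    using R[rule_format, of "inverse (real (Suc n))"] by auto
  then obtain e a where ea: "\<And>n. 0 < e n" "\<And>n. e n < inverse (real (Suc n))" "\<And>n. e n \<le> 1" "\<And>n. a n \<in> A"
      "\<And>n. dist (a n) p < inverse (real (Suc n))" "\<And>n. dist (g (e n) (a n)) y < inverse (real (Suc n))"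
    by metis
  have e0: "e \<longlonglongrightarrow> 0"
    by (rule tendsto_sandwich[OF _ _ tendsto_const LIMSEQ_inverse_real_of_nat]) (use ea(1,2) less_imp_le in \<open>auto intro!: always_eventually\<close>)
  have a_lim: "a \<longlonglongrightarrow> p"
    by (rule metric_tendsto_imp_tendsto[OF LIMSEQ_inverse_real_of_nat]) (use ea(5) less_imp_le in \<open>auto intro!: always_eventually simp: abs_of_pos\<close>)
  have g_lim: "(\<lambda>n. g (e n) (a n)) \<longlonglongrightarrow> y"
    by (rule metric_tendsto_imp_tendsto[OF LIMSEQ_inverse_real_of_nat]) (use ea(6) less_imp_le in \<open>auto intro!: always_eventually simp: abs_of_pos\<close>)
  define \<nu> where "\<nu> \<epsilon> = nat \<lfloor>inverse \<epsilon>\<rfloor>" for \<epsilon> :: real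
  have \<nu>: "filterlim \<nu> sequentially (at_right 0)" unfolding \<nu>_def by (rule filterlim_nat_floor_inverse)
  have id: "(\<lambda>\<epsilon>. \<epsilon>) \<in> reparam" unfolding reparam_def by (auto intro: tendsto_ident_at)
  have "(\<lambda>\<epsilon>. e (\<nu> \<epsilon>)) \<in> reparam"
    unfolding reparam_def using ea(1,3) filterlim_compose[OF e0 \<nu>] by simp
  moreover have "((\<lambda>\<epsilon>. a (\<nu> \<epsilon>)) \<longlongrightarrow> p) (at_right 0)" by (rule filterlim_compose[OF a_lim \<nu>])
  moreover have "cluster_point (\<lambda>\<epsilon>. g (e (\<nu> \<epsilon>)) (a (\<nu> \<epsilon>))) y"
    unfolding cluster_point_def using filterlim_compose[OF g_lim \<nu>] id by (intro bexI[of _ "\<lambda>\<epsilon>. \<epsilon>"]) auto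
  ultimately show ?L using ea(4) by (intro exI[of _ "\<lambda>\<epsilon>. a (\<nu> \<epsilon>)"] bexI[of _ "\<lambda>\<epsilon>. e (\<nu> \<epsilon>)"]) auto
qed

lemma ggraph_iff:
  "(x, y) \<in> ggraph \<Omega>1 \<Omega>2 f \<longleftrightarrow> x \<in> \<Omega>1 \<and> y \<in> \<Omega>2 \<and>
    (\<forall>\<delta>>0. \<exists>\<epsilon>. 0 < \<epsilon> \<and> \<epsilon> < \<delta> \<and> \<epsilon> \<le> 1 \<and> (\<exists>a\<in>\<Omega>1. dist a x < \<delta> \<and> dist (f \<epsilon> a) y < \<delta>))"
  unfolding ggraph_def using cluster_net_iff[of \<Omega>1 x f y] by simp

text \<open>
  C-boundedness keeps the values of \<open>f\<close> near \<open>x\<close> in a compact \<open>K \<subseteq> \<Omega>2\<close>. The fibre is closed in \<open>K\<close>.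
  A point of \<open>K - W\<close> is not in the fibre and hence has a neighbourhood that \<open>f\<^sub>\<epsilon>\<close> avoids near \<open>x\<close> for small
  \<open>\<epsilon>\<close>; finitely many of these neighbourhoods cover \<open>K - W\<close>.
\<close>

lemma
  fixes f :: "real \<Rightarrow> real^'n::finite \<Rightarrow> real^'m::finite"
  assumes \<Omega>1: "open \<Omega>1" "x \<in> \<Omega>1" and cb: "cbounded_rep \<Omega>1 \<Omega>2 f"
  shows compact_ggraph_fibre: "compact (ggraph \<Omega>1 \<Omega>2 f `` {x})"
    and ggraph_neighbourhood: "open W \<Longrightarrow> ggraph \<Omega>1 \<Omega>2 f `` {x} \<subseteq> W \<Longrightarrow>
      \<exists>X. open X \<and> x \<in> X \<and> X \<subseteq> \<Omega>1 \<and> (\<forall>\<^sub>0\<epsilon>. \<forall>a\<in>X. f \<epsilon> a \<in> W)"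
proof -
  let ?G = "ggraph \<Omega>1 \<Omega>2 f `` {x}"
  obtain r where r: "r > 0" "cball x r \<subseteq> \<Omega>1" using \<Omega>1 open_contains_cball by blast
  obtain K where K: "compact K" "K \<subseteq> \<Omega>2" "\<And>\<epsilon> a. \<epsilon> \<in> {0<..1} \<Longrightarrow> a \<in> cball x r \<Longrightarrow> f \<epsilon> a \<in> K"
    using cbounded_rep_compact[OF cb compact_cball r(2)] by metis
  have closed: "y \<in> ?G" if lim: "\<And>\<delta>. \<delta> > 0 \<Longrightarrow> \<exists>\<epsilon>. 0 < \<epsilon> \<and> \<epsilon> < \<delta> \<and> \<epsilon> \<le> 1 \<and> (\<exists>a\<in>\<Omega>1. dist a x < \<delta> \<and> dist (f \<epsilon> a) y < \<delta>)" for y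
  proof -
    have "y \<in> closure K"
      unfolding closure_approachable
    proof (intro allI impI)
      fix e :: real assume "e > 0"
      then obtain \<epsilon> a where h: "0 < \<epsilon>" "\<epsilon> \<le> 1" "dist a x < min e r" "dist (f \<epsilon> a) y < min e r"
        using lim[of "min e r"] r(1) by auto
      then have "f \<epsilon> a \<in> K" by (intro K(3)) (auto simp: dist_commute)
      then show "\<exists>y'\<in>K. dist y' y < e" using h(4) by auto
    qed
    then have "y \<in> \<Omega>2" using K(1,2) compact_imp_closed closure_closed by blast
    then show ?thesis using lim \<Omega>1(2) by (simp add: ggraph_iff)
  qed
  have "closed ?G"
    unfolding closure_subset_eq[symmetric]
  proof
    fix y assume "y \<in> closure ?G"
    then have y: "\<forall>e>0. \<exists>y'\<in>?G. dist y' y < e" unfolding closure_approachable .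
    show "y \<in> ?G"
    proof (rule closed)
      fix \<delta> :: real assume "\<delta> > 0"
      then obtain y' where y': "y' \<in> ?G" "dist y' y < \<delta> / 2" using y half_gt_zero by blast
      obtain \<epsilon> a where h: "0 < \<epsilon>" "\<epsilon> < \<delta> / 2" "\<epsilon> \<le> 1" "a \<in> \<Omega>1" "dist a x < \<delta> / 2" "dist (f \<epsilon> a) y' < \<delta> / 2"
        using y'(1) \<open>\<delta> > 0\<close> half_gt_zero[of \<delta>] unfolding Image_singleton_iff ggraph_iff by blast
      have "dist (f \<epsilon> a) y < \<delta>" using h(6) y'(2) dist_triangle[of "f \<epsilon> a" y y'] by linarith
      then show "\<exists>\<epsilon>. 0 < \<epsilon> \<and> \<epsilon> < \<delta> \<and> \<epsilon> \<le> 1 \<and> (\<exists>a\<in>\<Omega>1. dist a x < \<delta> \<and> dist (f \<epsilon> a) y < \<delta>)"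
        using h \<open>\<delta> > 0\<close> by (intro exI[of _ \<epsilon>] conjI bexI[of _ a]) auto
    qed
  qed
  moreover have "?G \<subseteq> K"
  proof
    fix y assume y: "y \<in> ?G"
    have "y \<in> closure K"
      unfolding closure_approachable
    proof (intro allI impI)
      fix e :: real assume "e > 0"
      then have "min e r > 0" using r(1) by simp
      then obtain \<epsilon> a where h: "0 < \<epsilon>" "\<epsilon> \<le> 1" "dist a x < min e r" "dist (f \<epsilon> a) y < min e r"
        using y unfolding Image_singleton_iff ggraph_iff by blast
      then have "f \<epsilon> a \<in> K" by (intro K(3)) (auto simp: dist_commute)
      then show "\<exists>y'\<in>K. dist y' y < e" using h(4) by auto
    qed
    then show "y \<in> K" using K(1) compact_imp_closed closure_closed by blast
  qed
  ultimately show "compact ?G" using K(1) compact_Int_closed[of K ?G] by (simp add: Int_absorb1)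
  assume W: "open W" "?G \<subseteq> W"
  have cK: "compact (K - W)" using K(1) W(1) by (rule compact_diff)
  have "\<exists>\<delta>>0. \<forall>\<epsilon> a. 0 < \<epsilon> \<and> \<epsilon> < \<delta> \<and> \<epsilon> \<le> 1 \<and> a \<in> \<Omega>1 \<and> dist a x < \<delta> \<longrightarrow> \<delta> \<le> dist (f \<epsilon> a) y" if "y \<in> K - W" for y
  proof (rule ccontr)
    assume n: "\<not> ?thesis"
    have "\<exists>\<epsilon>. 0 < \<epsilon> \<and> \<epsilon> < \<delta> \<and> \<epsilon> \<le> 1 \<and> (\<exists>a\<in>\<Omega>1. dist a x < \<delta> \<and> dist (f \<epsilon> a) y < \<delta>)" if "\<delta> > 0" for \<delta>
    proof (rule ccontr)
      assume none: "\<not> ?thesis"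
      have "\<forall>\<epsilon> a. 0 < \<epsilon> \<and> \<epsilon> < \<delta> \<and> \<epsilon> \<le> 1 \<and> a \<in> \<Omega>1 \<and> dist a x < \<delta> \<longrightarrow> \<delta> \<le> dist (f \<epsilon> a) y"
      proof (intro allI impI, rule ccontr)
        fix \<epsilon> a assume "0 < \<epsilon> \<and> \<epsilon> < \<delta> \<and> \<epsilon> \<le> 1 \<and> a \<in> \<Omega>1 \<and> dist a x < \<delta>" "\<not> \<delta> \<le> dist (f \<epsilon> a) y"
        then show False by - (rule notE[OF none], intro exI[of _ \<epsilon>] conjI bexI[of _ a], auto)
      qed
      then show False using that by - (rule notE[OF n], intro exI[of _ \<delta>] conjI)
    qed
    then have "y \<in> ?G" by (rule closed)
    then have "y \<in> W" using W(2) by (rule rev_subsetD)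
    then show False using that by simp
  qed
  then obtain d where d: "\<And>y. y \<in> K - W \<Longrightarrow> 0 < d y"
      "\<And>y \<epsilon> a. y \<in> K - W \<Longrightarrow> 0 < \<epsilon> \<Longrightarrow> \<epsilon> < d y \<Longrightarrow> \<epsilon> \<le> 1 \<Longrightarrow> a \<in> \<Omega>1 \<Longrightarrow> dist a x < d y \<Longrightarrow> d y \<le> dist (f \<epsilon> a) y"
    by metis
  obtain T where T: "T \<subseteq> K - W" "finite T" "K - W \<subseteq> (\<Union>y\<in>T. ball y (d y))"
    by (rule compactE_image[OF cK, of "K - W" "\<lambda>y. ball y (d y)"]) (use d(1) in auto)
  define \<delta> where "\<delta> = Min (insert r (d ` T))"
  have \<delta>: "\<delta> > 0" "\<delta> \<le> r" "\<And>y. y \<in> T \<Longrightarrow> \<delta> \<le> d y"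
    unfolding \<delta>_def using T d(1) r(1) by auto
  have "\<forall>\<^sub>0\<epsilon>. \<epsilon> \<in> {0<..<\<delta>}" using eventually_at_right_real[OF \<delta>(1)] .
  then have "\<forall>\<^sub>0\<epsilon>. \<forall>a\<in>ball x \<delta>. f \<epsilon> a \<in> W"
    using eventually_in_unit
  proof eventually_elim
    case (elim \<epsilon>)
    show ?case
    proof (rule ballI, rule ccontr)
      fix a assume a: "a \<in> ball x \<delta>" "f \<epsilon> a \<notin> W"
      have "f \<epsilon> a \<in> K" by (rule K(3)) (use elim a \<delta>(2) in auto)
      then obtain y where y: "y \<in> T" "dist y (f \<epsilon> a) < d y" using T(3) a(2) by auto
      have "d y \<le> dist (f \<epsilon> a) y"
      proof (rule d(2))
        show "y \<in> K - W" using y T(1) by blast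
        show "a \<in> \<Omega>1" using a \<delta>(2) r(2) by auto
        show "\<epsilon> < d y" "dist a x < d y" using elim \<delta>(3)[OF y(1)] a(1) by (auto simp: dist_commute)
      qed (use elim in auto)
      then show False using y(2) by (simp add: dist_commute)
    qed
  qed
  then show "\<exists>X. open X \<and> x \<in> X \<and> X \<subseteq> \<Omega>1 \<and> (\<forall>\<^sub>0\<epsilon>. \<forall>a\<in>X. f \<epsilon> a \<in> W)"
    using \<delta> r(2) by (intro exI[of _ "ball x \<delta>"]) auto
qed

lemma transp_diff_eq: "transp_diff f \<epsilon> x \<eta> = codifferential (f \<epsilon>) x \<eta>"
proof -
  have "(transpose (jacobian (f \<epsilon>) (at x)) *v \<eta>) $ j = partial_deriv j (f \<epsilon>) x \<bullet> \<eta>" for j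
    unfolding jacobian_def
    by (simp add: matrix_vector_mult_def transpose_def matrix_def partial_deriv_def inner_vec_def)
  then show ?thesis by (simp add: transp_diff_def codifferential_def vec_eq_iff)
qed

text \<open>
  In \<open>D\<^sup>f\<close> the codifferential \<open>T\<close> applied to \<open>\<eta>\<close> has norm at least \<open>\<alpha>/\<sigma>\<close>, and its direction stays at
  distance \<open>\<delta>\<close> from \<open>\<xi>\<close> since \<open>\<xi>\<close> is not a cluster point of the directions. So \<open>s T\<close> and \<open>t \<xi>\<close> cannot cancel.
  The slow scale of \<open>\<sigma>\<close> makes the resulting bound \<open>\<rho>\<close> slow scale.
\<close>

lemma nonstationary_at_D_set:
  fixes f :: "real \<Rightarrow> real^'n::finite \<Rightarrow> real^'m::finite"
  assumes D: "(x, \<eta>) \<in> D_set \<Omega>1 f" and \<xi>: "\<xi> \<in> sphere 0 1" "\<xi> \<notin> M_graph_at \<Omega>1 f x \<eta>"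
  obtains X V \<Gamma> \<rho> where "open X" "x \<in> X" "X \<subseteq> \<Omega>1" "openin (top_of_set (sphere 0 1)) V" "\<eta> \<in> V"
    "openin (top_of_set (sphere 0 1)) \<Gamma>" "\<xi> \<in> \<Gamma>" "\<rho> \<in> slow_weights"
    "\<forall>\<^sub>0\<epsilon>. \<forall>x\<in>X. \<forall>\<eta>\<in>V. \<forall>\<xi>\<in>\<Gamma>. \<forall>s\<ge>0. \<forall>t\<ge>0. s + t = 1 \<longrightarrow>
         1 \<le> \<rho> \<epsilon> * norm (s *\<^sub>R codifferential (f \<epsilon>) x \<eta> - t *\<^sub>R \<xi>)"
proof -
  let ?Q = "\<lambda>X V. \<exists>\<sigma>. (\<forall>\<epsilon>\<in>{0<..1}. 0 < \<sigma> \<epsilon>) \<and> slow_scale \<sigma> \<and>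
       (\<exists>\<alpha>>0. \<exists>\<beta>>0. \<exists>\<epsilon>'\<in>{0<..1}. \<forall>\<epsilon>\<in>{0<..<\<epsilon>'}.
          (\<forall>x\<in>X. \<forall>\<eta>\<in>V. \<alpha> \<le> norm (\<sigma> \<epsilon> *\<^sub>R transp_diff f \<epsilon> x \<eta>)) \<and>
          (\<forall>x\<in>X. \<forall>\<eta>\<in>sphere_perp V. norm (\<sigma> \<epsilon> *\<^sub>R transp_diff f \<epsilon> x \<eta>) \<le> \<beta>))"
  from D have "\<exists>X V. open X \<and> X \<subseteq> \<Omega>1 \<and> x \<in> X \<and> openin (top_of_set (sphere 0 1)) V \<and> \<eta> \<in> V \<and> ?Q X V"
    unfolding D_set_def mem_Collect_eq prod.case .
  then obtain X V where *: "open X \<and> X \<subseteq> \<Omega>1 \<and> x \<in> X \<and> openin (top_of_set (sphere 0 1)) V \<and> \<eta> \<in> V \<and> ?Q X V"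
    by (elim exE)
  have X: "open X" "X \<subseteq> \<Omega>1" "x \<in> X" and V: "openin (top_of_set (sphere 0 1)) V" "\<eta> \<in> V" and ex: "?Q X V"
    using * by - (elim conjE, assumption)+
  have sub: "(x', \<eta>') \<in> D_set \<Omega>1 f" if "x' \<in> X" "\<eta>' \<in> V" for x' \<eta>'
    unfolding D_set_def mem_Collect_eq prod.case
    by (intro exI[of _ X] exI[of _ V] conjI X(1,2) V(1) that ex)
  obtain \<sigma> \<alpha> \<epsilon>' where \<sigma>: "\<forall>\<epsilon>\<in>{0<..1}. 0 < \<sigma> \<epsilon>" "slow_scale \<sigma>" and \<alpha>: "\<alpha> > 0" and \<epsilon>': "\<epsilon>' \<in> {0<..1}"
    and low: "\<And>\<epsilon> x \<eta>. \<epsilon> \<in> {0<..<\<epsilon>'} \<Longrightarrow> x \<in> X \<Longrightarrow> \<eta> \<in> V \<Longrightarrow> \<alpha> \<le> norm (\<sigma> \<epsilon> *\<^sub>R transp_diff f \<epsilon> x \<eta>)"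
    using ex by (elim exE conjE bexE) (rule that, auto)
  have "\<not> (\<forall>\<delta>>0. \<exists>\<epsilon>. 0 < \<epsilon> \<and> \<epsilon> < \<delta> \<and> \<epsilon> \<le> 1 \<and> (\<exists>a\<in>D_set \<Omega>1 f. dist a (x, \<eta>) < \<delta> \<and> dist (M_net f \<epsilon> a) \<xi> < \<delta>))"
    using \<xi> D unfolding M_graph_at_def cluster_net_iff[symmetric] by simp
  then obtain \<delta> where "\<delta> > 0" and
    nc: "\<not> (\<exists>\<epsilon>. 0 < \<epsilon> \<and> \<epsilon> < \<delta> \<and> \<epsilon> \<le> 1 \<and> (\<exists>a\<in>D_set \<Omega>1 f. dist a (x, \<eta>) < \<delta> \<and> dist (M_net f \<epsilon> a) \<xi> < \<delta>))"
    unfolding not_all not_imp by (elim exE conjE)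
  have \<delta>: "\<delta> > 0" "\<And>\<epsilon> a. 0 < \<epsilon> \<Longrightarrow> \<epsilon> < \<delta> \<Longrightarrow> \<epsilon> \<le> 1 \<Longrightarrow> a \<in> D_set \<Omega>1 f \<Longrightarrow> dist a (x, \<eta>) < \<delta> \<Longrightarrow> \<delta> \<le> dist (M_net f \<epsilon> a) \<xi>"
    using \<open>\<delta> > 0\<close> nc by (simp_all add: not_less[symmetric]) blast
  define X' where "X' = X \<inter> ball x (\<delta> / 2)"
  define V' where "V' = V \<inter> ball \<eta> (\<delta> / 2)"
  define \<Gamma> where "\<Gamma> = sphere 0 1 \<inter> ball \<xi> (\<delta> / 2)"
  \<comment> \<open>The separation \<open>\<delta>/2\<close> bounds \<open>t\<close> and \<open>s |T|\<close> by \<open>4/\<delta>\<close> times the gradient, and \<open>s\<close> is at most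
    \<open>s |T| \<sigma>/\<alpha>\<close>; the two bounds are added because \<open>s + t = 1\<close>.\<close>
  define \<rho> where "\<rho> \<epsilon> = 4 / \<delta> * (1 + \<bar>\<sigma> \<epsilon>\<bar> * (1 / \<alpha>))" for \<epsilon>
  show thesis
  proof (rule that[of X' V' \<Gamma> \<rho>])
    show "open X'" "x \<in> X'" "X' \<subseteq> \<Omega>1" using X \<delta>(1) by (auto simp: X'_def)
    show "openin (top_of_set (sphere 0 1)) V'" unfolding V'_def by (rule openin_Int_open[OF V(1) open_ball])
    show "\<eta> \<in> V'" "\<xi> \<in> \<Gamma>" using V \<xi>(1) \<delta>(1) by (auto simp: V'_def \<Gamma>_def)
    show "openin (top_of_set (sphere 0 1)) \<Gamma>" unfolding \<Gamma>_def by (intro openin_open_Int) simp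
    have "(\<lambda>\<epsilon>. 1 + \<bar>\<sigma> \<epsilon>\<bar> * (1 / \<alpha>)) \<in> slow_weights"
      using \<alpha> by (intro slow_weights_add_mult slow_weights_const slow_scale_imp_slow_weights[OF \<sigma>(2)]) auto
    moreover have "0 \<le> 4 / \<delta>" using \<delta>(1) by simp
    ultimately show "\<rho> \<in> slow_weights"
      unfolding \<rho>_def[abs_def] by (intro slow_weights_add_mult(2)[OF slow_weights_const])
    have "\<forall>\<^sub>0\<epsilon>. \<epsilon> \<in> {0<..<min \<delta> \<epsilon>'}" using \<delta>(1) \<epsilon>' by (intro eventually_at_right_real) auto
    then show "\<forall>\<^sub>0\<epsilon>. \<forall>x\<in>X'. \<forall>\<eta>\<in>V'. \<forall>\<xi>\<in>\<Gamma>. \<forall>s\<ge>0. \<forall>t\<ge>0. s + t = 1 \<longrightarrow>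
         1 \<le> \<rho> \<epsilon> * norm (s *\<^sub>R codifferential (f \<epsilon>) x \<eta> - t *\<^sub>R \<xi>)"
    proof eventually_elim
      case (elim \<epsilon>)
      then have e: "0 < \<epsilon>" "\<epsilon> < \<delta>" "\<epsilon> < \<epsilon>'" "\<epsilon> \<le> 1" using \<epsilon>' by auto
      have s0: "0 < \<sigma> \<epsilon>" using \<sigma>(1) e by simp
      show ?case
      proof (intro ballI allI impI)
        fix x' \<eta>' \<xi>' and s t :: real
        assume h: "x' \<in> X'" "\<eta>' \<in> V'" "\<xi>' \<in> \<Gamma>" "0 \<le> s" "0 \<le> t" "s + t = 1"
        define T where "T = codifferential (f \<epsilon>) x' \<eta>'"
        have xv: "x' \<in> X" "\<eta>' \<in> V" using h by (auto simp: X'_def V'_def)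
        have "\<alpha> \<le> norm (\<sigma> \<epsilon> *\<^sub>R T)"
          using low e xv unfolding T_def transp_diff_eq by simp
        then have T\<alpha>: "\<alpha> \<le> \<sigma> \<epsilon> * norm T" using s0 by simp
        then have T0: "T \<noteq> 0" using \<alpha> by auto
        have "dist (x', \<eta>') (x, \<eta>) < \<delta>"
        proof -
          have "dist (x', \<eta>') (x, \<eta>) \<le> dist x' x + dist \<eta>' \<eta>"
            unfolding dist_Pair_Pair by (rule sqrt_sum_squares_le_sum) auto
          then show ?thesis using h by (simp add: X'_def V'_def dist_commute)
        qed
        from \<delta>(2)[OF e(1,2,4) sub[OF xv] this] have "\<delta> \<le> dist (sgn T) \<xi>"
          by (simp add: M_net_def transp_diff_eq T_def)
        moreover have "dist \<xi> \<xi>' < \<delta> / 2" "norm \<xi>' = 1" using h(3) by (auto simp: \<Gamma>_def)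
        ultimately have far: "\<delta> / 2 \<le> norm (sgn T - \<xi>')"
          using dist_triangle2[of "sgn T" \<xi> \<xi>'] unfolding dist_norm[symmetric] by simp
        define I where "I = norm (s *\<^sub>R T - t *\<^sub>R \<xi>')"
        have eq: "(s * norm T) *\<^sub>R sgn T = s *\<^sub>R T" using T0 by (simp add: sgn_div_norm)
        have n1: "norm (sgn T) = 1" using T0 by (simp add: norm_sgn)
        have 1: "\<delta> / 2 * (s * norm T) \<le> 2 * I" "\<delta> / 2 * t \<le> 2 * I"
          using unit_separation[OF n1 \<open>norm \<xi>' = 1\<close> far, of "s * norm T" t] h(4,5) unfolding eq I_def by auto
        have "s * 1 \<le> s * (\<sigma> \<epsilon> * (1 / \<alpha>) * norm T)"
          using T\<alpha> \<alpha> h(4) by (intro mult_left_mono) (auto simp: field_simps)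
        also have "\<dots> = \<sigma> \<epsilon> * (1 / \<alpha>) * (s * norm T)" by simp
        also have "\<dots> \<le> \<sigma> \<epsilon> * (1 / \<alpha>) * (4 / \<delta> * I)"
          using 1(1) \<delta>(1) s0 \<alpha> by (intro mult_left_mono) (auto simp: field_simps)
        finally have 2: "s \<le> 4 / \<delta> * (\<sigma> \<epsilon> * (1 / \<alpha>) * I)" by (simp add: mult_ac)
        have 3: "t \<le> 4 / \<delta> * I" using 1(2) \<delta>(1) by (simp add: field_simps)
        have "1 \<le> 4 / \<delta> * (\<sigma> \<epsilon> * (1 / \<alpha>) * I) + 4 / \<delta> * I" using 2 3 h(6) by linarith
        also have "\<dots> = \<rho> \<epsilon> * I" using s0 by (simp add: \<rho>_def algebra_simps add_divide_distrib)
        finally show "1 \<le> \<rho> \<epsilon> * norm (s *\<^sub>R codifferential (f \<epsilon>) x' \<eta>' - t *\<^sub>R \<xi>')"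
          by (simp add: I_def T_def)
      qed
    qed
  qed
qed

section \<open>Microlocal cutoffs\<close>

text \<open>
  The gradient hypothesis of the pullback estimate, for \<open>\<eta>\<close> in the cone over \<open>V\<close> and frequencies in the
  directions \<open>\<Gamma>\<close>.
\<close>

definition nonstationary ::
    "(real \<Rightarrow> real^'n::finite \<Rightarrow> real^'m::finite) \<Rightarrow> (real^'n) set \<Rightarrow> (real^'m) set \<Rightarrow> (real^'n) set \<Rightarrow> (real \<Rightarrow> real) \<Rightarrow> bool" where
  "nonstationary f X V \<Gamma> \<rho> \<longleftrightarrow> (\<forall>\<^sub>0\<epsilon>. \<forall>x\<in>X. \<forall>\<eta>\<in>V. \<forall>\<xi>\<in>\<Gamma>. \<forall>s\<ge>0. \<forall>t\<ge>0. s + t = 1 \<longrightarrow>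
     1 \<le> \<rho> \<epsilon> * norm (s *\<^sub>R codifferential (f \<epsilon>) x \<eta> - t *\<^sub>R \<xi>))"

lemma nonstationary_mono:
  assumes "nonstationary f X V \<Gamma> \<rho>" "X' \<subseteq> X" "\<Gamma>' \<subseteq> \<Gamma>"
  shows "nonstationary f X' V \<Gamma>' \<rho>"
  using assms(1) unfolding nonstationary_def
proof eventually_elim
  case (elim \<epsilon>)
  show ?case
  proof (intro ballI allI impI)
    fix x \<eta> \<xi> and s t :: real
    assume "x \<in> X'" "\<eta> \<in> V" "\<xi> \<in> \<Gamma>'" "0 \<le> s" "0 \<le> t" "s + t = 1"
    then show "1 \<le> \<rho> \<epsilon> * norm (s *\<^sub>R codifferential (f \<epsilon>) x \<eta> - t *\<^sub>R \<xi>)"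
      using elim[rule_format, OF subsetD[OF assms(2)] _ subsetD[OF assms(3)]] by simp
  qed
qed

lemma nonstationary_UN:
  assumes "finite T" "\<And>j. j \<in> T \<Longrightarrow> \<rho> j \<in> slow_weights" "\<And>j. j \<in> T \<Longrightarrow> nonstationary f X (V j) \<Gamma> (\<rho> j)"
  shows "nonstationary f X (\<Union>j\<in>T. V j) \<Gamma> (\<lambda>\<epsilon>. \<Sum>j\<in>T. \<rho> j \<epsilon>)"
proof -
  have "\<forall>\<^sub>0\<epsilon>. \<forall>j\<in>T. \<forall>x\<in>X. \<forall>\<eta>\<in>V j. \<forall>\<xi>\<in>\<Gamma>. \<forall>s\<ge>0. \<forall>t\<ge>0. s + t = 1 \<longrightarrow>
     1 \<le> \<rho> j \<epsilon> * norm (s *\<^sub>R codifferential (f \<epsilon>) x \<eta> - t *\<^sub>R \<xi>)"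
    using assms(3) unfolding nonstationary_def by (intro eventually_ball_finite[OF assms(1)] ballI)
  then show ?thesis
    unfolding nonstationary_def
  proof eventually_elim
    case (elim \<epsilon>)
    show ?case
    proof (intro ballI allI impI)
      fix x \<eta> \<xi> and s t :: real
      assume h: "x \<in> X" "\<eta> \<in> (\<Union>j\<in>T. V j)" "\<xi> \<in> \<Gamma>" "0 \<le> s" "0 \<le> t" "s + t = 1"
      then obtain j where j: "j \<in> T" "\<eta> \<in> V j" by blast
      have "1 \<le> \<rho> j \<epsilon> * norm (s *\<^sub>R codifferential (f \<epsilon>) x \<eta> - t *\<^sub>R \<xi>)"
        using elim[rule_format, OF j(1) h(1) j(2) h(3-6)] .
      also have "\<dots> \<le> (\<Sum>j\<in>T. \<rho> j \<epsilon>) * norm (s *\<^sub>R codifferential (f \<epsilon>) x \<eta> - t *\<^sub>R \<xi>)"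
        using assms(2) weights_nonneg[OF weights_slow_weights]
        by (intro mult_right_mono member_le_sum[OF j(1) _ assms(1)]) auto
      finally show "1 \<le> (\<Sum>j\<in>T. \<rho> j \<epsilon>) * norm (s *\<^sub>R codifferential (f \<epsilon>) x \<eta> - t *\<^sub>R \<xi>)" .
    qed
  qed
qed

lemma slow_weights_sum:
  assumes "finite T" "\<And>j. j \<in> T \<Longrightarrow> \<rho> j \<in> slow_weights"
  shows "(\<lambda>\<epsilon>. \<Sum>j\<in>T. \<rho> j \<epsilon>) \<in> slow_weights"
  using assms by (induction T rule: finite_induct) (auto intro: slow_weights_const slow_weights_add_mult)

lemma test_function_mult:
  assumes "open \<Omega>" "\<phi> \<in> test_functions \<Omega>" "smooth_on \<Omega> \<psi>"
  shows "(\<lambda>x. \<phi> x * \<psi> x) \<in> test_functions \<Omega>"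
proof -
  obtain K where "compact K" "K \<subseteq> \<Omega>" "\<And>x. x \<in> \<Omega> - K \<Longrightarrow> \<phi> x = 0" using test_functionE[OF assms(2)] by blast
  then show ?thesis
    using smooth_on_mult[OF assms(1) test_function_smooth[OF assms(2)] assms(3)]
    unfolding test_functions_def by (intro CollectI conjI exI[of _ K]) auto
qed

text \<open>
  Every unit covector \<open>\<eta>\<close> at \<open>y\<close> has a neighbourhood of one of two kinds: on it the phase is nonstationary
  (if \<open>(y, \<eta>)\<close> is in the wave front set), or the transform of \<open>\<psi>\<^sub>\<eta> u\<close> decreases rapidly. Finitely many of
  them cover the sphere. The cutoff is the product of the finitely many \<open>\<psi>\<^sub>\<eta>\<close> of the second kind, and \<open>V\<close> is
  the union of the neighbourhoods of the first kind.
\<close>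

lemma microlocal_cutoff:
  fixes f :: "real \<Rightarrow> real^'n::finite \<Rightarrow> real^'m::finite" and u :: "real \<Rightarrow> real^'m \<Rightarrow> complex"
  assumes \<Omega>1: "open \<Omega>1" "x \<in> \<Omega>1" and \<Omega>2: "open \<Omega>2" "y \<in> \<Omega>2" and \<xi>: "\<xi> \<in> sphere 0 1"
    and U: "U \<in> colombeau \<Omega>2" "u \<in> U"
    and good: "\<And>\<eta>. (y, \<eta>) \<in> WF \<Omega>2 U \<Longrightarrow> (x, \<eta>) \<in> D_set \<Omega>1 f \<and> \<xi> \<notin> M_graph_at \<Omega>1 f x \<eta>"
  obtains \<Phi> X V \<Gamma> \<rho> where "\<Phi> \<in> test_functions \<Omega>2" "\<Phi> y \<noteq> 0"
    "rapid (sphere 0 1 - V) (\<lambda>\<epsilon>. fourier (extend_zero \<Omega>2 (\<lambda>z. \<Phi> z * u \<epsilon> z)))"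
    "open X" "x \<in> X" "X \<subseteq> \<Omega>1" "openin (top_of_set (sphere 0 1)) \<Gamma>" "\<xi> \<in> \<Gamma>" "\<rho> \<in> slow_weights" "nonstationary f X V \<Gamma> \<rho>"
proof -
  let ?S = "sphere (0 :: real^'m) 1" and ?S' = "sphere (0 :: real^'n) 1"
  define A where "A = {\<eta>. (y, \<eta>) \<in> WF \<Omega>2 U}"
  define P where "P \<eta> X V \<Gamma> \<rho> \<longleftrightarrow> open X \<and> x \<in> X \<and> openin (top_of_set ?S) V \<and> \<eta> \<in> V \<and>
    openin (top_of_set ?S') \<Gamma> \<and> \<xi> \<in> \<Gamma> \<and> \<rho> \<in> slow_weights \<and> nonstationary f X V \<Gamma> \<rho>" for \<eta> X V \<Gamma> \<rho>
  define Q where "Q \<eta> \<psi> \<Gamma> \<longleftrightarrow> \<psi> \<in> test_functions \<Omega>2 \<and> \<psi> y \<noteq> 0 \<and> openin (top_of_set ?S) \<Gamma> \<and> \<eta> \<in> \<Gamma> \<and>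
    (\<forall>\<phi>\<in>test_functions \<Omega>2. rapid \<Gamma> (\<lambda>\<epsilon>. fourier (extend_zero \<Omega>2 (\<lambda>z. \<phi> z * \<psi> z * u \<epsilon> z))))" for \<eta> \<psi> \<Gamma>
  have "\<exists>X V \<Gamma> \<rho>. P \<eta> X V \<Gamma> \<rho>" if "\<eta> \<in> A" for \<eta>
  proof -
    have "(x, \<eta>) \<in> D_set \<Omega>1 f" "\<xi> \<notin> M_graph_at \<Omega>1 f x \<eta>" using good that unfolding A_def by blast+
    then show ?thesis
    proof (rule nonstationary_at_D_set[OF _ \<xi>])
      fix X V \<Gamma> \<rho>
      assume "open X" "x \<in> X" "X \<subseteq> \<Omega>1" "openin (top_of_set ?S) V" "\<eta> \<in> V"
        "openin (top_of_set ?S') \<Gamma>" "\<xi> \<in> \<Gamma>" "\<rho> \<in> slow_weights"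
        "\<forall>\<^sub>0\<epsilon>. \<forall>x\<in>X. \<forall>\<eta>\<in>V. \<forall>\<xi>\<in>\<Gamma>. \<forall>s\<ge>0. \<forall>t\<ge>0. s + t = 1 \<longrightarrow>
             1 \<le> \<rho> \<epsilon> * norm (s *\<^sub>R codifferential (f \<epsilon>) x \<eta> - t *\<^sub>R \<xi>)"
      then show ?thesis
        unfolding P_def nonstationary_def by (intro exI[of _ X] exI[of _ V] exI[of _ \<Gamma>] exI[of _ \<rho>] conjI)
    qed
  qed
  then obtain X V \<Gamma> \<rho> where P: "\<And>\<eta>. \<eta> \<in> A \<Longrightarrow> P \<eta> (X \<eta>) (V \<eta>) (\<Gamma> \<eta>) (\<rho> \<eta>)" by metis
  have "\<exists>\<psi> \<Gamma>. Q \<eta> \<psi> \<Gamma>" if "\<eta> \<in> ?S - A" for \<eta>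
  proof (rule not_WF_E[OF \<Omega>2(1) U \<Omega>2(2), of \<eta>])
    show "\<eta> \<in> ?S" "(y, \<eta>) \<notin> WF \<Omega>2 U" using that unfolding A_def by auto
    fix \<psi> \<Gamma>
    assume "\<psi> \<in> test_functions \<Omega>2" "\<psi> y \<noteq> 0" "openin (top_of_set ?S) \<Gamma>" "\<eta> \<in> \<Gamma>"
      "\<And>\<phi>. \<phi> \<in> test_functions \<Omega>2 \<Longrightarrow> rapid \<Gamma> (\<lambda>\<epsilon>. fourier (extend_zero \<Omega>2 (\<lambda>z. \<phi> z * \<psi> z * u \<epsilon> z)))"
    then show ?thesis unfolding Q_def by (intro exI[of _ \<psi>] exI[of _ \<Gamma>] conjI ballI)
  qed
  then obtain \<psi> \<Lambda> where Q: "\<And>\<eta>. \<eta> \<in> ?S - A \<Longrightarrow> Q \<eta> (\<psi> \<eta>) (\<Lambda> \<eta>)" by metis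
  define N where "N \<eta> = (if \<eta> \<in> A then V \<eta> else \<Lambda> \<eta>)" for \<eta>
  have N: "openin (top_of_set ?S) (N \<eta>) \<and> \<eta> \<in> N \<eta>" if "\<eta> \<in> ?S" for \<eta>
  proof (cases "\<eta> \<in> A")
    case True
    then show ?thesis using P[OF True] by (simp add: P_def N_def)
  next
    case False
    then have "\<eta> \<in> ?S - A" using that by simp
    from Q[OF this] False show ?thesis by (simp add: Q_def N_def)
  qed
  have "\<exists>O'. open O' \<and> N \<eta> = ?S \<inter> O'" if "\<eta> \<in> ?S" for \<eta>
    using N[OF that] unfolding openin_open by blast
  then obtain O' where O': "\<And>\<eta>. \<eta> \<in> ?S \<Longrightarrow> open (O' \<eta>) \<and> N \<eta> = ?S \<inter> O' \<eta>" by metis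
  obtain T where T: "T \<subseteq> ?S" "finite T" "?S \<subseteq> (\<Union>\<eta>\<in>T. O' \<eta>)"
  proof (rule compactE_image[OF compact_sphere, of ?S O'])
    show "open (O' \<eta>)" if "\<eta> \<in> ?S" for \<eta> using O'[OF that] by simp
    show "?S \<subseteq> (\<Union>\<eta>\<in>?S. O' \<eta>)" using N O' by blast
  qed
  have cover: "?S \<subseteq> (\<Union>\<eta>\<in>T. N \<eta>)"
  proof
    fix \<eta> assume "\<eta> \<in> ?S"
    then obtain \<eta>' where "\<eta>' \<in> T" "\<eta> \<in> O' \<eta>'" using T(3) by blast
    then show "\<eta> \<in> (\<Union>\<eta>\<in>T. N \<eta>)" using O'[of \<eta>'] T(1) \<open>\<eta> \<in> ?S\<close> by blast
  qed
  define T1 where "T1 = T \<inter> A"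
  define T2 where "T2 = T - A"
  have fin: "finite T1" "finite T2" using T(2) by (simp_all add: T1_def T2_def)
  have P1: "P \<eta> (X \<eta>) (V \<eta>) (\<Gamma> \<eta>) (\<rho> \<eta>)" if "\<eta> \<in> T1" for \<eta> using P that by (simp add: T1_def)
  have Q2: "Q \<eta> (\<psi> \<eta>) (\<Lambda> \<eta>)" if "\<eta> \<in> T2" for \<eta> using Q that T(1) by (auto simp: T2_def)
  obtain b Kb where b: "smooth_on UNIV b" "compact Kb" "Kb \<subseteq> \<Omega>2" "\<And>z. z \<notin> Kb \<Longrightarrow> b z = (0::complex)" "b y \<noteq> 0"
    using bump_exists[OF \<Omega>2] by blast
  have bt: "b \<in> test_functions \<Omega>2" by (rule test_functionI[OF b(1-4)])
  \<comment> \<open>The bump \<open>b\<close> provides compact support even if the product is empty.\<close>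
  define \<Phi> where "\<Phi> z = b z * (\<Prod>\<eta>\<in>T2. \<psi> \<eta> z)" for z
  have sm: "smooth_on \<Omega>2 (\<lambda>z. \<Prod>\<eta>\<in>T'. \<psi> \<eta> z)" if "T' \<subseteq> T2" for T'
    using that finite_subset[OF that fin(2)] Q2
    by (intro smooth_on_prod[OF \<Omega>2(1)] test_function_smooth) (auto simp: Q_def)
  define X' where "X' = \<Omega>1 \<inter> (\<Inter>\<eta>\<in>T1. X \<eta>)"
  define V' where "V' = (\<Union>\<eta>\<in>T1. V \<eta>)"
  define \<Gamma>' where "\<Gamma>' = ?S' \<inter> (\<Inter>\<eta>\<in>T1. \<Gamma> \<eta>)"
  show thesis
  proof (rule that[of \<Phi> V' X' \<Gamma>' "\<lambda>\<epsilon>. \<Sum>\<eta>\<in>T1. \<rho> \<eta> \<epsilon>"])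
    show "\<Phi> \<in> test_functions \<Omega>2"
      unfolding \<Phi>_def by (rule test_function_mult[OF \<Omega>2(1) bt sm]) simp
    show "\<Phi> y \<noteq> 0" using b(5) Q2 fin(2) by (auto simp: \<Phi>_def Q_def)
    show "rapid (?S - V') (\<lambda>\<epsilon>. fourier (extend_zero \<Omega>2 (\<lambda>z. \<Phi> z * u \<epsilon> z)))"
    proof (rule rapid_subset)
      show "rapid (\<Union>(\<Lambda> ` T2)) (\<lambda>\<epsilon>. fourier (extend_zero \<Omega>2 (\<lambda>z. \<Phi> z * u \<epsilon> z)))"
      proof (rule rapid_Union)
        fix G assume "G \<in> \<Lambda> ` T2"
        then obtain \<eta> where \<eta>: "\<eta> \<in> T2" "G = \<Lambda> \<eta>" by blast
        have "(\<lambda>z. b z * (\<Prod>\<eta>\<in>T2 - {\<eta>}. \<psi> \<eta> z)) \<in> test_functions \<Omega>2"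
          by (rule test_function_mult[OF \<Omega>2(1) bt sm]) blast
        moreover have "\<forall>\<phi>\<in>test_functions \<Omega>2. rapid (\<Lambda> \<eta>) (\<lambda>\<epsilon>. fourier (extend_zero \<Omega>2 (\<lambda>z. \<phi> z * \<psi> \<eta> z * u \<epsilon> z)))"
          using Q2[OF \<eta>(1)] unfolding Q_def by (elim conjE)
        ultimately have "rapid (\<Lambda> \<eta>) (\<lambda>\<epsilon>. fourier (extend_zero \<Omega>2 (\<lambda>z. b z * (\<Prod>\<eta>\<in>T2 - {\<eta>}. \<psi> \<eta> z) * \<psi> \<eta> z * u \<epsilon> z)))"
          by (rule bspec[rotated])
        moreover have "\<Phi> z = b z * (\<Prod>\<eta>\<in>T2 - {\<eta>}. \<psi> \<eta> z) * \<psi> \<eta> z" for z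
          using prod.remove[OF fin(2) \<eta>(1), of "\<lambda>\<eta>. \<psi> \<eta> z"] by (simp add: \<Phi>_def mult_ac)
        ultimately show "rapid G (\<lambda>\<epsilon>. fourier (extend_zero \<Omega>2 (\<lambda>z. \<Phi> z * u \<epsilon> z)))" by (simp add: \<eta>(2))
      qed (use fin in simp)
      show "?S - V' \<subseteq> \<Union>(\<Lambda> ` T2)"
      proof
        fix \<eta> assume h: "\<eta> \<in> ?S - V'"
        then obtain \<eta>' where \<eta>': "\<eta>' \<in> T" "\<eta> \<in> N \<eta>'" using cover by blast
        show "\<eta> \<in> \<Union>(\<Lambda> ` T2)"
        proof (cases "\<eta>' \<in> A")
          case True
          then have "\<eta> \<in> V'" using \<eta>' by (auto simp: V'_def T1_def N_def)
          then show ?thesis using h by blast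
        next
          case False
          then show ?thesis using \<eta>' by (auto simp: T2_def N_def)
        qed
      qed
    qed
    have "open (\<Inter>\<eta>\<in>T1. X \<eta>)" using P1 fin(1) by (intro open_INT) (auto simp: P_def)
    then show "open X'" unfolding X'_def using \<Omega>1(1) by (rule open_Int[rotated])
    show "x \<in> X'" using \<Omega>1(2) P1 by (auto simp: X'_def P_def)
    show "X' \<subseteq> \<Omega>1" by (auto simp: X'_def)
    show "openin (top_of_set ?S') \<Gamma>'"
    proof (cases "T1 = {}")
      case True
      then show ?thesis by (simp add: \<Gamma>'_def)
    next
      case False
      have "openin (top_of_set ?S') (\<Inter>\<eta>\<in>T1. \<Gamma> \<eta>)"
        by (rule openin_INT2[OF fin(1) False]) (use P1 in \<open>auto simp: P_def\<close>)
      then show ?thesis using openin_imp_subset by (fastforce simp: \<Gamma>'_def Int_absorb1)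
    qed
    show "\<xi> \<in> \<Gamma>'" using \<xi> P1 by (auto simp: \<Gamma>'_def P_def)
    show "(\<lambda>\<epsilon>. \<Sum>\<eta>\<in>T1. \<rho> \<eta> \<epsilon>) \<in> slow_weights"
      by (rule slow_weights_sum[OF fin(1)]) (use P1 in \<open>auto simp: P_def\<close>)
    show "nonstationary f X' V' \<Gamma>' (\<lambda>\<epsilon>. \<Sum>\<eta>\<in>T1. \<rho> \<eta> \<epsilon>)"
      unfolding V'_def
    proof (rule nonstationary_UN[OF fin(1)])
      fix \<eta> assume \<eta>: "\<eta> \<in> T1"
      show "\<rho> \<eta> \<in> slow_weights" using P1[OF \<eta>] by (simp add: P_def)
      have "nonstationary f (X \<eta>) (V \<eta>) (\<Gamma> \<eta>) (\<rho> \<eta>)" using P1[OF \<eta>] by (simp add: P_def)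
      then show "nonstationary f X' (V \<eta>) \<Gamma>' (\<rho> \<eta>)"
        by (rule nonstationary_mono) (use \<eta> in \<open>auto simp: X'_def \<Gamma>'_def\<close>)
    qed
  qed
qed

lemma slow_scaled_symbol:
  fixes f :: "real \<Rightarrow> real^'n::finite \<Rightarrow> real^'m::finite"
  assumes f: "f \<in> moderate_nets \<Omega>1" and x: "x \<in> slow_scaled_points \<Omega>1 f"
  obtains X where "open X" "x \<in> X" "X \<subseteq> \<Omega>1" "symbol X X (at_right 0) slow_weights f"
proof -
  have "\<exists>X0. open X0 \<and> X0 \<subseteq> \<Omega>1 \<and> x \<in> X0 \<and>
        (\<forall>\<alpha>. \<exists>r C. slow_scale r \<and>
           (\<forall>\<^sub>0\<epsilon>. \<forall>x\<in>X0. norm (iter_partial \<alpha> (f \<epsilon>) x) \<le> C * r \<epsilon>))"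
    using x unfolding slow_scaled_points_def mem_Collect_eq .
  then obtain X where X: "open X \<and> X \<subseteq> \<Omega>1 \<and> x \<in> X \<and>
        (\<forall>\<alpha>. \<exists>r C. slow_scale r \<and>
           (\<forall>\<^sub>0\<epsilon>. \<forall>x\<in>X. norm (iter_partial \<alpha> (f \<epsilon>) x) \<le> C * r \<epsilon>))" by (elim exE)
  have X1: "open X" "X \<subseteq> \<Omega>1" "x \<in> X" using X by - (elim conjE, assumption)+
  have X2: "\<exists>r C. slow_scale r \<and> (\<forall>\<^sub>0\<epsilon>. \<forall>x\<in>X. norm (iter_partial \<alpha> (f \<epsilon>) x) \<le> C * r \<epsilon>)" for \<alpha>
    using X by (elim conjE allE)
  have "symbol X X (at_right 0) slow_weights f"
    unfolding symbol_def
  proof (intro allI conjI)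
    fix \<alpha> :: "'n list"
    show "\<forall>\<^sub>0\<epsilon>. \<forall>x\<in>X. iter_partial \<alpha> (f \<epsilon>) differentiable (at x)"
      using eventually_in_unit
    proof eventually_elim
      case (elim \<epsilon>)
      then have "smooth_on \<Omega>1 (f \<epsilon>)" using moderate_smooth[OF f, of \<epsilon>] by simp
      then have "smooth_on X (f \<epsilon>)" using X1(2) by (rule smooth_on_subset)
      then show ?case unfolding smooth_on_def by simp
    qed
    obtain r C where r: "slow_scale r" "\<forall>\<^sub>0\<epsilon>. \<forall>x\<in>X. norm (iter_partial \<alpha> (f \<epsilon>) x) \<le> C * r \<epsilon>"
      using X2[of \<alpha>] by (elim exE conjE)
    have "(\<lambda>\<epsilon>. \<bar>C\<bar> * \<bar>r \<epsilon>\<bar>) \<in> slow_weights"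
      by (rule slow_weights_add_mult(2)[OF slow_weights_const slow_scale_imp_slow_weights[OF r(1)]]) simp
    moreover have "\<forall>\<^sub>0\<epsilon>. \<forall>x\<in>X. norm (iter_partial \<alpha> (f \<epsilon>) x) \<le> \<bar>C\<bar> * \<bar>r \<epsilon>\<bar>"
      using r(2)
    proof eventually_elim
      case (elim \<epsilon>)
      have "C * r \<epsilon> \<le> \<bar>C\<bar> * \<bar>r \<epsilon>\<bar>" using abs_ge_self[of "C * r \<epsilon>"] by (simp add: abs_mult)
      then show ?case using elim order_trans by blast
    qed
    ultimately show "\<exists>w\<in>slow_weights. \<forall>\<^sub>0\<epsilon>. \<forall>x\<in>X. norm (iter_partial \<alpha> (f \<epsilon>) x) \<le> w \<epsilon>"
      by (intro bexI[where x="\<lambda>\<epsilon>. \<bar>C\<bar> * \<bar>r \<epsilon>\<bar>"])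
  qed
  then show thesis by (rule that[OF X1(1,3,2)])
qed

section \<open>The pullback theorem\<close>

text \<open>
  The cutoffs \<open>\<Phi>\<^sub>y\<close> belonging to finitely many \<open>y\<close> have no common zero near the fibre. With
  \<open>S = \<Sum>\<^sub>y |\<Phi>\<^sub>y|\<^sup>2\<close>, the amplitudes \<open>\<phi> (cnj \<Phi>\<^sub>y / S) \<circ> f\<close> are slow scale symbols and satisfy
  \<open>\<Sum>\<^sub>y a\<^sub>y \<cdot> (\<Phi>\<^sub>y u \<circ> f) = \<phi> \<cdot> (u \<circ> f)\<close>, so that the pullback estimate applies to every summand.
\<close>

lemma pullback_regular_slow:
  fixes f :: "real \<Rightarrow> real^'n::finite \<Rightarrow> real^'m::finite" and u :: "real \<Rightarrow> real^'m \<Rightarrow> complex"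
  assumes \<Omega>1: "open \<Omega>1" "x \<in> \<Omega>1" and \<Omega>2: "open \<Omega>2" and f: "f \<in> moderate_nets \<Omega>1" and cb: "cbounded_rep \<Omega>1 \<Omega>2 f"
    and U: "U \<in> colombeau \<Omega>2" "u \<in> U" and slow: "x \<in> slow_scaled_points \<Omega>1 f" and \<xi>: "\<xi> \<in> sphere 0 1"
    and good: "\<And>y \<eta>. (x, y) \<in> ggraph \<Omega>1 \<Omega>2 f \<Longrightarrow> (y, \<eta>) \<in> WF \<Omega>2 U \<Longrightarrow> (x, \<eta>) \<in> D_set \<Omega>1 f \<and> \<xi> \<notin> M_graph_at \<Omega>1 f x \<eta>"
  shows "(x, \<xi>) \<notin> WF \<Omega>1 (gpullback \<Omega>1 f u)"
proof -
  let ?G = "ggraph \<Omega>1 \<Omega>2 f `` {x}" and ?S' = "sphere (0 :: real^'n) 1"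
  have um: "u \<in> moderate_nets \<Omega>2" by (rule colombeau_moderate[OF U])
  obtain X0 where X0: "open X0" "x \<in> X0" "X0 \<subseteq> \<Omega>1" "symbol X0 X0 (at_right 0) slow_weights f"
    using slow_scaled_symbol[OF f slow] by metis
  define Q where "Q y \<Phi> X V \<Gamma> \<rho> \<longleftrightarrow> \<Phi> \<in> test_functions \<Omega>2 \<and> \<Phi> y \<noteq> 0 \<and>
    rapid (sphere 0 1 - V) (\<lambda>\<epsilon>. fourier (extend_zero \<Omega>2 (\<lambda>z. \<Phi> z * u \<epsilon> z))) \<and>
    open X \<and> x \<in> X \<and> X \<subseteq> \<Omega>1 \<and> openin (top_of_set ?S') \<Gamma> \<and> \<xi> \<in> \<Gamma> \<and> \<rho> \<in> slow_weights \<and> nonstationary f X V \<Gamma> \<rho>"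
    for y \<Phi> X V \<Gamma> \<rho>
  have "\<exists>\<Phi> X V \<Gamma> \<rho>. Q y \<Phi> X V \<Gamma> \<rho>" if y: "y \<in> ?G" for y
  proof -
    have g: "(x, y) \<in> ggraph \<Omega>1 \<Omega>2 f" using y by simp
    then have "y \<in> \<Omega>2" by (simp add: ggraph_iff)
    show ?thesis
    proof (rule microlocal_cutoff[OF \<Omega>1 \<Omega>2 \<open>y \<in> \<Omega>2\<close> \<xi> U good[OF g]])
      fix \<Phi> X V \<Gamma> \<rho>
      assume "\<Phi> \<in> test_functions \<Omega>2" "\<Phi> y \<noteq> 0"
        "rapid (sphere 0 1 - V) (\<lambda>\<epsilon>. fourier (extend_zero \<Omega>2 (\<lambda>z. \<Phi> z * u \<epsilon> z)))"
        "open X" "x \<in> X" "X \<subseteq> \<Omega>1" "openin (top_of_set ?S') \<Gamma>" "\<xi> \<in> \<Gamma>" "\<rho> \<in> slow_weights" "nonstationary f X V \<Gamma> \<rho>"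
      then show ?thesis
        unfolding Q_def by (intro exI[of _ \<Phi>] exI[of _ X] exI[of _ V] exI[of _ \<Gamma>] exI[of _ \<rho>] conjI)
    qed
  qed
  then obtain \<Phi> X V \<Gamma> \<rho> where Q: "\<And>y. y \<in> ?G \<Longrightarrow> Q y (\<Phi> y) (X y) (V y) (\<Gamma> y) (\<rho> y)" by metis
  have \<Phi>t: "\<Phi> y \<in> test_functions \<Omega>2" "\<Phi> y y \<noteq> 0" if "y \<in> ?G" for y using Q[OF that] by (simp_all add: Q_def)
  define E where "E y = extend_zero \<Omega>2 (\<Phi> y)" for y
  have E_smooth: "\<exists>L. smooth_on UNIV (E y) \<and> compact L \<and> (\<forall>z. z \<notin> L \<longrightarrow> E y z = 0)" if y: "y \<in> ?G" for y
  proof -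
    obtain L where L: "compact L" "L \<subseteq> \<Omega>2" "\<And>z. z \<in> \<Omega>2 - L \<Longrightarrow> \<Phi> y z = 0"
      using test_functionE[OF \<Phi>t(1)[OF y]] by blast
    have "smooth_on UNIV (E y)"
      unfolding E_def by (rule smooth_on_extend_zero[OF \<Omega>2 L test_function_smooth[OF \<Phi>t(1)[OF y]]])
    then show ?thesis using L by (intro exI[of _ L]) (auto simp: E_def extend_zero_def)
  qed
  have E_cont: "continuous_on UNIV (E y)" if "y \<in> ?G" for y
    using E_smooth[OF that] smooth_on_continuous_on by blast
  have E_symbol: "symbol UNIV UNIV F slow_weights (\<lambda>_. E y)" if "y \<in> ?G" for y F
    using E_smooth[OF that] symbol_test_function[OF weights_slow_weights] by blast
  have G2: "?G \<subseteq> \<Omega>2" by (auto simp: ggraph_iff)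
  have Gc: "compact ?G" by (rule compact_ggraph_fibre[OF \<Omega>1 cb])
  obtain T where T: "T \<subseteq> ?G" "finite T" "?G \<subseteq> (\<Union>y\<in>T. {z. E y z \<noteq> 0})"
  proof (rule compactE_image[OF Gc, of ?G "\<lambda>y. {z. E y z \<noteq> 0}"])
    show "open {z. E y z \<noteq> 0}" if "y \<in> ?G" for y
      using E_cont[OF that] by (intro open_Collect_neq continuous_intros) auto
    show "?G \<subseteq> (\<Union>y\<in>?G. {z. E y z \<noteq> 0})"
      using \<Phi>t(2) G2 by (auto simp: E_def extend_zero_def)
  qed
  have TG: "y \<in> ?G" if "y \<in> T" for y using that T(1) by blast
  define s where "s z = (\<Sum>y\<in>T. (norm (E y z))\<^sup>2)" for z
  define S where "S z = (\<Sum>y\<in>T. cnj (E y z) * E y z)" for z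
  have S_s: "S z = of_real (s z)" for z
    unfolding S_def s_def of_real_sum complex_norm_square by (simp add: mult.commute)
  have s_cont: "continuous_on UNIV s"
    unfolding s_def by (intro continuous_intros E_cont TG)
  \<comment> \<open>A positive lower bound of \<open>S\<close> near the fibre is what bounds \<open>1/S\<close> along \<open>f\<close>.\<close>
  have "\<exists>c>0. \<forall>y\<in>?G. c < s y"
  proof (cases "?G = {}")
    case True
    then show ?thesis by (intro exI[of _ 1]) auto
  next
    case False
    obtain y0 where y0: "y0 \<in> ?G" "\<forall>y\<in>?G. s y0 \<le> s y"
      using continuous_attains_inf[OF Gc False continuous_on_subset[OF s_cont]] by blast
    obtain t where t: "t \<in> T" "E t y0 \<noteq> 0" using T(3) y0(1) by blast
    have "0 < (norm (E t y0))\<^sup>2" using t(2) by simp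
    also have "\<dots> \<le> s y0" unfolding s_def by (rule member_le_sum[OF t(1) _ T(2)]) simp
    finally have "0 < s y0" .
    then show ?thesis using y0(2) by (intro exI[of _ "s y0 / 2"]) force
  qed
  then obtain c where c: "c > 0" "\<And>y. y \<in> ?G \<Longrightarrow> c < s y" by blast
  define W where "W = \<Omega>2 \<inter> {z. c < s z}"
  have Wo: "open W" unfolding W_def using \<Omega>2 s_cont by (intro open_Int open_Collect_less continuous_intros) auto
  have GW: "?G \<subseteq> W" using G2 c(2) by (auto simp: W_def)
  obtain X1 where X1: "open X1" "x \<in> X1" "X1 \<subseteq> \<Omega>1" "\<forall>\<^sub>0\<epsilon>. \<forall>a\<in>X1. f \<epsilon> a \<in> W"
    using ggraph_neighbourhood[OF \<Omega>1 cb Wo GW] by (elim exE conjE)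
  define X' where "X' = X0 \<inter> X1 \<inter> (\<Inter>y\<in>T. X y)"
  define \<Gamma>' where "\<Gamma>' = ?S' \<inter> (\<Inter>y\<in>T. \<Gamma> y)"
  have "open (\<Inter>y\<in>T. X y)" using Q TG T(2) by (intro open_INT) (auto simp: Q_def)
  then have X'o: "open X'" using X0(1) X1(1) by (simp add: X'_def open_Int)
  have xX': "x \<in> X'" using X0 X1 Q TG by (auto simp: X'_def Q_def)
  obtain \<phi> K where \<phi>: "smooth_on UNIV \<phi>" "compact K" "K \<subseteq> X'" "\<And>z. z \<notin> K \<Longrightarrow> \<phi> z = (0::complex)" "\<phi> x \<noteq> 0"
    using bump_exists[OF X'o xX'] by blast
  have X'1: "X' \<subseteq> \<Omega>1" using X0(3) by (auto simp: X'_def)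
  have \<phi>t: "\<phi> \<in> test_functions \<Omega>1" by (rule test_functionI[OF \<phi>(1,2) order_trans[OF \<phi>(3) X'1] \<phi>(4)])
  note XX = X'o subset_refl[of X']
  note SW = weights_slow_weights
  have f': "symbol X' X' (at_right 0) slow_weights f"
    by (rule symbol_mono[OF X0(4)]) (auto simp: X'_def)
  have inW: "\<forall>\<^sub>0\<epsilon>. \<forall>a\<in>X'. f \<epsilon> a \<in> W"
    using X1(4) by eventually_elim (auto simp: X'_def)
  have Ef: "symbol X' X' (at_right 0) slow_weights (\<lambda>\<epsilon> a. E y (f \<epsilon> a))" if "y \<in> T" for y
    by (rule symbol_compose[OF SW XX E_symbol[OF TG[OF that]] f']) simp
  have cEf: "symbol X' X' (at_right 0) slow_weights (\<lambda>\<epsilon> a. cnj (E y (f \<epsilon> a)))" if "y \<in> T" for y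
    by (rule symbol_bounded_linear[OF SW XX bounded_linear_cnj Ef[OF that]])
  have Sf: "symbol X' X' (at_right 0) slow_weights (\<lambda>\<epsilon> a. S (f \<epsilon> a))"
    unfolding S_def by (rule symbol_sum[OF SW XX T(2)]) (rule symbol_mult[OF SW XX cEf Ef])
  have S_low: "\<forall>\<^sub>0\<epsilon>. \<forall>a\<in>X'. S (f \<epsilon> a) \<noteq> 0 \<and> norm (inverse (S (f \<epsilon> a))) \<le> 1 / c"
    using inW
  proof eventually_elim
    case (elim \<epsilon>)
    show ?case
    proof
      fix a assume "a \<in> X'"
      then have "c < s (f \<epsilon> a)" using elim by (simp add: W_def)
      then show "S (f \<epsilon> a) \<noteq> 0 \<and> norm (inverse (S (f \<epsilon> a))) \<le> 1 / c"
        using c(1) unfolding S_s norm_inverse norm_of_real by (auto simp: field_simps)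
    qed
  qed
  have iS: "symbol X' X' (at_right 0) slow_weights (\<lambda>\<epsilon> a. inverse (S (f \<epsilon> a)))"
  proof (rule symbol_inverse[OF SW XX Sf _ slow_weights_const])
    show "\<forall>\<^sub>0\<epsilon>. \<forall>a\<in>X'. S (f \<epsilon> a) \<noteq> 0" using S_low by eventually_elim blast
    show "\<forall>\<^sub>0\<epsilon>. \<forall>a\<in>X'. norm (inverse (S (f \<epsilon> a))) \<le> 1 / c" using S_low by eventually_elim blast
  qed (use c(1) in simp)
  have \<phi>s: "symbol X' X' (at_right 0) slow_weights (\<lambda>_. \<phi>)"
    by (rule symbol_mono[OF symbol_test_function[OF SW \<phi>(1,2,4)]]) auto
  define a where "a y \<epsilon> z = \<phi> z * (cnj (E y (f \<epsilon> z)) * inverse (S (f \<epsilon> z)))" for y \<epsilon> z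
  have a: "symbol X' X' (at_right 0) slow_weights (a y)" if "y \<in> T" for y
    unfolding a_def by (rule symbol_mult[OF SW XX \<phi>s symbol_mult[OF SW XX cEf[OF that] iS]])
  define v where "v y \<epsilon> = extend_zero \<Omega>2 (\<lambda>z. \<Phi> y z * u \<epsilon> z)" for y \<epsilon>
  define I where "I y \<epsilon> \<zeta> = (LINT z:X'|lborel. a y \<epsilon> z * v y \<epsilon> (f \<epsilon> z) * exp (- (\<i> * of_real (z \<bullet> \<zeta>))))" for y \<epsilon> \<zeta>
  have rI: "rapid \<Gamma>' (I y)" if y: "y \<in> T" for y
  proof -
    have q: "Q y (\<Phi> y) (X y) (V y) (\<Gamma> y) (\<rho> y)" by (rule Q[OF TG[OF y]])
    obtain L C N where v: "\<forall>\<^sub>0\<epsilon>. smooth_on UNIV (v y \<epsilon>)" "compact L"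
        "\<forall>\<^sub>0\<epsilon>. \<forall>z. z \<notin> L \<longrightarrow> v y \<epsilon> z = 0" "\<forall>\<^sub>0\<epsilon>. \<forall>z. norm (v y \<epsilon> z) \<le> C * inverse \<epsilon> ^ N"
      using cutoff_net[OF \<Omega>2 um \<Phi>t(1)[OF TG[OF y]]] unfolding v_def .
    have "nonstationary f X' (V y) \<Gamma>' (\<rho> y)"
      by (rule nonstationary_mono[of f "X y" _ "\<Gamma> y"]) (use q y in \<open>auto simp: Q_def X'_def \<Gamma>'_def\<close>)
    note ns = this[unfolded nonstationary_def]
    have a0: "\<forall>\<^sub>0\<epsilon>. \<forall>z\<in>X' - K. a y \<epsilon> z = 0" using \<phi>(4) by (simp add: a_def)
    have r: "rapid (sphere 0 1 - V y) (\<lambda>\<epsilon>. fourier (v y \<epsilon>))" using q by (simp add: Q_def v_def)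
    have \<rho>: "\<rho> y \<in> slow_weights" using q by (simp add: Q_def)
    show ?thesis
      unfolding I_def by (rule rapid_pullback[OF X'o \<phi>(2,3) f' a[OF y] a0 v r \<rho> ns]) (simp add: \<Gamma>'_def)
  qed
  have "rapid \<Gamma>' (\<lambda>\<epsilon>. fourier (extend_zero \<Omega>1 (\<lambda>z. \<phi> z * u \<epsilon> (f \<epsilon> z))))"
  proof (rule rapid_cong[OF _ rapid_sum[OF T(2) rI]])
    have cont_v: "\<forall>\<^sub>0\<epsilon>. \<forall>y\<in>T. continuous_on UNIV (v y \<epsilon>)"
    proof (rule eventually_ball_finite[OF T(2)], rule ballI)
      fix y assume y: "y \<in> T"
      have "\<forall>\<^sub>0\<epsilon>. smooth_on UNIV (v y \<epsilon>)"
        by (rule cutoff_net[OF \<Omega>2 um \<Phi>t(1)[OF TG[OF y]]]) (simp only: v_def)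
      then show "\<forall>\<^sub>0\<epsilon>. continuous_on UNIV (v y \<epsilon>)"
        by eventually_elim (rule smooth_on_continuous_on)
    qed
    have cont_a: "\<forall>\<^sub>0\<epsilon>. \<forall>y\<in>T. \<forall>z\<in>X'. a y \<epsilon> differentiable (at z)"
      by (rule eventually_ball_finite[OF T(2)]) (use symbol_differentiable[OF a] in blast)
    show "\<forall>\<^sub>0\<epsilon>. \<forall>\<zeta>. (\<Sum>y\<in>T. I y \<epsilon> \<zeta>) = fourier (extend_zero \<Omega>1 (\<lambda>z. \<phi> z * u \<epsilon> (f \<epsilon> z))) \<zeta>"
      using inW S_low cont_v cont_a symbol_differentiable[OF f']
    proof eventually_elim
      case (elim \<epsilon>)
      have fc: "continuous_on X' (f \<epsilon>)"
        using elim(5) by (auto intro!: continuous_on_of_differentiable)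
      show ?case
      proof
        fix \<zeta>
        let ?e = "\<lambda>z :: real^'n. exp (- (\<i> * complex_of_real (z \<bullet> \<zeta>)))"
        have int: "set_integrable lborel X' (\<lambda>z. a y \<epsilon> z * v y \<epsilon> (f \<epsilon> z) * ?e z)" if y: "y \<in> T" for y
        proof (rule set_integrable_compact_support[OF X'o \<phi>(2,3)])
          show "a y \<epsilon> z * v y \<epsilon> (f \<epsilon> z) * ?e z = 0" if "z \<in> X' - K" for z
            using \<phi>(4) that by (simp add: a_def)
          have "continuous_on X' (a y \<epsilon>)"
            using elim(4) y by (auto intro!: continuous_on_of_differentiable)
          moreover have "continuous_on X' (\<lambda>z. v y \<epsilon> (f \<epsilon> z))"
            using elim(3) y by (intro continuous_on_compose2[OF _ fc, of UNIV "v y \<epsilon>"]) auto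
          ultimately show "continuous_on X' (\<lambda>z. a y \<epsilon> z * v y \<epsilon> (f \<epsilon> z) * ?e z)" by (intro continuous_intros)
        qed
        have pointwise: "(\<Sum>y\<in>T. a y \<epsilon> z * v y \<epsilon> (f \<epsilon> z) * ?e z) = \<phi> z * u \<epsilon> (f \<epsilon> z) * ?e z" if z: "z \<in> X'" for z
        proof -
          have f2: "f \<epsilon> z \<in> \<Omega>2" using elim(1) z by (simp add: W_def)
          have S0: "S (f \<epsilon> z) \<noteq> 0" using elim(2) z by blast
          have "a y \<epsilon> z * v y \<epsilon> (f \<epsilon> z) * ?e z =
              (\<phi> z * inverse (S (f \<epsilon> z)) * u \<epsilon> (f \<epsilon> z) * ?e z) * (cnj (E y (f \<epsilon> z)) * E y (f \<epsilon> z))" for y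
            using f2 by (simp add: a_def v_def E_def extend_zero_def mult_ac)
          then have "(\<Sum>y\<in>T. a y \<epsilon> z * v y \<epsilon> (f \<epsilon> z) * ?e z) =
              (\<phi> z * inverse (S (f \<epsilon> z)) * u \<epsilon> (f \<epsilon> z) * ?e z) * S (f \<epsilon> z)"
            by (simp only: S_def sum_distrib_left)
          then show ?thesis using S0 by simp
        qed
        have "(\<Sum>y\<in>T. I y \<epsilon> \<zeta>) = (LINT z:X'|lborel. (\<Sum>y\<in>T. a y \<epsilon> z * v y \<epsilon> (f \<epsilon> z) * ?e z))"
          using int unfolding I_def set_lebesgue_integral_def set_integrable_def scaleR_sum_right
          by (subst Bochner_Integration.integral_sum) auto
        also have "\<dots> = (LINT z:X'|lborel. \<phi> z * u \<epsilon> (f \<epsilon> z) * ?e z)"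
          by (rule set_lebesgue_integral_cong) (use pointwise X'o in auto)
        also have "\<dots> = fourier (extend_zero \<Omega>1 (\<lambda>z. \<phi> z * u \<epsilon> (f \<epsilon> z))) \<zeta>"
          unfolding fourier_extend_zero set_lebesgue_integral_def
        proof (rule Bochner_Integration.integral_cong[OF refl])
          fix z
          show "indicator X' z *\<^sub>R (\<phi> z * u \<epsilon> (f \<epsilon> z) * ?e z) = indicator \<Omega>1 z *\<^sub>R (\<phi> z * u \<epsilon> (f \<epsilon> z) * ?e z)"
          proof (cases "z \<in> K")
            case True
            then have "z \<in> X'" "z \<in> \<Omega>1" using \<phi>(3) X'1 by auto
            then show ?thesis by simp
          next
            case False
            then show ?thesis using \<phi>(4) by simp
          qed
        qed
        finally show "(\<Sum>y\<in>T. I y \<epsilon> \<zeta>) = fourier (extend_zero \<Omega>1 (\<lambda>z. \<phi> z * u \<epsilon> (f \<epsilon> z))) \<zeta>" .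
      qed
    qed
  qed
  moreover have "(\<lambda>\<epsilon> z. u \<epsilon> (f \<epsilon> z)) \<in> moderate_nets \<Omega>1" by (rule moderate_compose[OF \<Omega>1(1) um f cb])
  then have "gpullback \<Omega>1 f u \<in> colombeau \<Omega>1" "(\<lambda>\<epsilon> z. u \<epsilon> (f \<epsilon> z)) \<in> gpullback \<Omega>1 f u"
    unfolding gpullback_def by (rule gclass_colombeau, rule gclass_self)
  moreover have "openin (top_of_set ?S') \<Gamma>'"
  proof (cases "T = {}")
    case True
    then show ?thesis by (simp add: \<Gamma>'_def)
  next
    case False
    have "openin (top_of_set ?S') (\<Inter>y\<in>T. \<Gamma> y)"
      by (rule openin_INT2[OF T(2) False]) (use Q TG in \<open>auto simp: Q_def\<close>)
    then show ?thesis using openin_imp_subset by (fastforce simp: \<Gamma>'_def Int_absorb1)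
  qed
  moreover have "\<xi> \<in> \<Gamma>'" using \<xi> Q TG by (auto simp: \<Gamma>'_def Q_def)
  ultimately show ?thesis
    using not_WF_I[OF \<Omega>1(1) _ _ \<phi>t \<phi>(5), of "gpullback \<Omega>1 f u" "\<lambda>\<epsilon> z. u \<epsilon> (f \<epsilon> z)" \<Gamma>' \<xi>] by blast
qed

lemma gen_real_net:
  assumes "k \<in> moderate_numbers"
  shows "(\<lambda>\<epsilon> _. complex_of_real (k \<epsilon>)) \<in> moderate_nets \<Omega>"
    and "\<exists>w\<in>moderate_weights. \<forall>\<^sub>0\<epsilon>. \<bar>k \<epsilon>\<bar> \<le> w \<epsilon>"
proof -
  obtain p :: real where "k \<in> O[at_right 0](\<lambda>\<epsilon>. \<epsilon> powr (- p))" using assms unfolding moderate_numbers_def by blast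
  then obtain C where C: "\<forall>\<^sub>0\<epsilon>. norm (k \<epsilon>) \<le> C * norm (\<epsilon> powr (- p))"
    by (elim landau_o.bigE)
  have "\<exists>p::real. \<exists>C. \<forall>\<^sub>0\<epsilon>. \<bar>k \<epsilon>\<bar> \<le> C * \<epsilon> powr (- p)"
    using C by (intro exI[of _ p] exI[of _ C]) simp
  then show ex: "\<exists>w\<in>moderate_weights. \<forall>\<^sub>0\<epsilon>. \<bar>k \<epsilon>\<bar> \<le> w \<epsilon>"
    by (rule bigo_moderate[THEN iffD1, rotated]) (rule order_trans)
  then obtain w where w: "w \<in> moderate_weights" "\<forall>\<^sub>0\<epsilon>. \<bar>k \<epsilon>\<bar> \<le> w \<epsilon>" by blast
  show "(\<lambda>\<epsilon> _. complex_of_real (k \<epsilon>)) \<in> moderate_nets \<Omega>"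
    unfolding moderate_nets_iff_symbol
    by (intro conjI ballI allI impI smooth_on_const symbol_const[OF weights_moderate_weights w(1)]) (use w(2) in simp)
qed

text \<open>
  For some generalized constant \<open>k\<close> the difference \<open>u - k\<close> is negligible near every point of the fibre,
  hence on finitely many balls covering \<open>f\<^sub>\<epsilon>(X)\<close>. Negligibility of a moderate net is tested on the values
  alone, so \<open>\<phi> f\<^sup>*u\<close> may be represented by \<open>\<phi> k\<close>.
\<close>

lemma pullback_regular_const:
  fixes f :: "real \<Rightarrow> real^'n::finite \<Rightarrow> real^'m::finite" and u :: "real \<Rightarrow> real^'m \<Rightarrow> complex"
  assumes \<Omega>1: "open \<Omega>1" "x \<in> \<Omega>1" and \<Omega>2: "open \<Omega>2" and f: "f \<in> moderate_nets \<Omega>1" and cb: "cbounded_rep \<Omega>1 \<Omega>2 f"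
    and U: "U \<in> colombeau \<Omega>2" "u \<in> U" and x: "x \<notin> K_set \<Omega>1 \<Omega>2 f U" and \<xi>: "\<xi> \<in> sphere 0 1"
  shows "(x, \<xi>) \<notin> WF \<Omega>1 (gpullback \<Omega>1 f u)"
proof -
  let ?G = "ggraph \<Omega>1 \<Omega>2 f `` {x}"
  have um: "u \<in> moderate_nets \<Omega>2" by (rule colombeau_moderate[OF U])
  obtain \<kappa> where \<kappa>: "\<kappa> \<in> gen_reals" "x \<notin> fst ` (ggraph \<Omega>1 \<Omega>2 f \<inter> (\<Omega>1 \<times> gsupp \<Omega>2 (gdiff_const \<Omega>2 U \<kappa>)))"
    using x unfolding K_set_def by blast
  obtain k where k: "k \<in> \<kappa>" "k \<in> moderate_numbers"
  proof -
    obtain k where "k \<in> moderate_numbers" "\<kappa> = {(k, l). k \<in> moderate_numbers \<and> l \<in> moderate_numbers \<and> (\<lambda>\<epsilon>. k \<epsilon> - l \<epsilon>) \<in> null_numbers} `` {k}"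
      using \<kappa>(1) unfolding gen_reals_def by (rule quotientE)
    moreover have "(\<lambda>_. 0) \<in> null_numbers" unfolding null_numbers_def by simp
    ultimately show thesis using that[of k] by simp
  qed
  note kn = gen_real_net[OF k(2)]
  define w where "w \<epsilon> y = u \<epsilon> y - complex_of_real (k \<epsilon>)" for \<epsilon> y
  have wm: "w \<in> moderate_nets \<Omega>2" unfolding w_def[abs_def] by (rule moderate_diff[OF \<Omega>2 um kn(1)])
  have wU: "w \<in> gdiff_const \<Omega>2 U \<kappa>"
    unfolding gdiff_const_def using gclass_self[OF wm] U(2) k(1) by (auto simp: w_def[abs_def])
  have "\<exists>r>0. cball y r \<subseteq> \<Omega>2 \<and> (\<exists>V. cball y r \<subseteq> V \<and> w \<in> null_nets V)" if y: "y \<in> ?G" for y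
  proof -
    have g: "(x, y) \<in> ggraph \<Omega>1 \<Omega>2 f" using y by simp
    then have y2: "y \<in> \<Omega>2" by (simp add: ggraph_iff)
    have "y \<notin> gsupp \<Omega>2 (gdiff_const \<Omega>2 U \<kappa>)"
    proof
      assume "y \<in> gsupp \<Omega>2 (gdiff_const \<Omega>2 U \<kappa>)"
      then have "(x, y) \<in> ggraph \<Omega>1 \<Omega>2 f \<inter> (\<Omega>1 \<times> gsupp \<Omega>2 (gdiff_const \<Omega>2 U \<kappa>))" using g \<Omega>1(2) by blast
      then show False using \<kappa>(2) by (metis fst_conv image_eqI)
    qed
    then obtain V where V: "open V" "V \<subseteq> \<Omega>2" "y \<in> V" "grestrict V (gdiff_const \<Omega>2 U \<kappa>) = gclass V (\<lambda>_ _. 0)"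
      using y2 unfolding gsupp_def by blast
    have "w \<in> grestrict V (gdiff_const \<Omega>2 U \<kappa>)"
      unfolding grestrict_def using wU gclass_self[OF moderate_subset[OF wm V(2)]] by blast
    then have "(\<lambda>\<epsilon> z. 0 - w \<epsilon> z) \<in> null_nets V" using gclassD(3) unfolding V(4) by blast
    from null_minus[OF V(1) this] have wn: "w \<in> null_nets V" by simp
    obtain r where "r > 0" "cball y r \<subseteq> V" using V(1,3) open_contains_cball by blast
    then show ?thesis using wn V(2) by blast
  qed
  then obtain r where r: "\<And>y. y \<in> ?G \<Longrightarrow> r y > 0" "\<And>y. y \<in> ?G \<Longrightarrow> cball y (r y) \<subseteq> \<Omega>2"
      "\<And>y. y \<in> ?G \<Longrightarrow> \<exists>V. cball y (r y) \<subseteq> V \<and> w \<in> null_nets V" by metis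
  obtain T where T: "T \<subseteq> ?G" "finite T" "?G \<subseteq> (\<Union>y\<in>T. ball y (r y))"
    by (rule compactE_image[OF compact_ggraph_fibre[OF \<Omega>1 cb], of ?G "\<lambda>y. ball y (r y)"]) (use r(1) in auto)
  obtain X where X: "open X" "x \<in> X" "X \<subseteq> \<Omega>1" "\<forall>\<^sub>0\<epsilon>. \<forall>a\<in>X. f \<epsilon> a \<in> (\<Union>y\<in>T. ball y (r y))"
    using ggraph_neighbourhood[OF \<Omega>1 cb open_UN[OF ballI[OF open_ball]] T(3)] by (elim exE conjE)
  obtain \<phi> K where \<phi>: "smooth_on UNIV \<phi>" "compact K" "K \<subseteq> X" "\<And>z. z \<notin> K \<Longrightarrow> \<phi> z = (0::complex)" "\<phi> x \<noteq> 0"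
    using bump_exists[OF X(1,2)] by blast
  have K1: "K \<subseteq> \<Omega>1" using \<phi>(3) X(3) by blast
  have \<phi>t: "\<phi> \<in> test_functions \<Omega>1" by (rule test_functionI[OF \<phi>(1,2) K1 \<phi>(4)])
  note \<phi>1 = test_function_smooth[OF \<phi>t]
  have uf: "(\<lambda>\<epsilon> z. u \<epsilon> (f \<epsilon> z)) \<in> moderate_nets \<Omega>1" by (rule moderate_compose[OF \<Omega>1(1) um f cb])
  have pf: "(\<lambda>\<epsilon> z. \<phi> z * u \<epsilon> (f \<epsilon> z)) \<in> moderate_nets \<Omega>1" and pk: "(\<lambda>\<epsilon> z. \<phi> z * complex_of_real (k \<epsilon>)) \<in> moderate_nets \<Omega>1"
    by (rule moderate_mult[OF \<Omega>1(1) moderate_smooth_function[OF \<phi>1] uf], rule moderate_mult[OF \<Omega>1(1) moderate_smooth_function[OF \<phi>1] kn(1)])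
  obtain b where b: "\<And>z. norm (\<phi> z) \<le> b" "0 \<le> b"
  proof -
    obtain b where "\<forall>z\<in>K. norm (\<phi> z) \<le> b"
      using compact_imp_bounded[OF compact_continuous_image[OF continuous_on_subset[OF smooth_on_continuous_on[OF \<phi>(1)]] \<phi>(2)]]
      by (auto simp: bounded_iff)
    then have "norm (\<phi> z) \<le> max b 0" for z using \<phi>(4)[of z] by (cases "z \<in> K") auto
    then show thesis using that[of "max b 0"] by simp
  qed
  have null: "(\<lambda>\<epsilon> z. \<phi> z * complex_of_real (k \<epsilon>) - \<phi> z * u \<epsilon> (f \<epsilon> z)) \<in> null_nets \<Omega>1"
    unfolding null_nets_iff
  proof (intro conjI allI impI)
    show "(\<lambda>\<epsilon> z. \<phi> z * complex_of_real (k \<epsilon>) - \<phi> z * u \<epsilon> (f \<epsilon> z)) \<in> moderate_nets \<Omega>1"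
      by (rule moderate_diff[OF \<Omega>1(1) pk pf])
    fix K' and N :: nat
    have "\<exists>C\<ge>0. \<forall>\<^sub>0\<epsilon>. \<forall>z\<in>cball y (r y). norm (w \<epsilon> z) \<le> C * \<epsilon> ^ N" if "y \<in> T" for y
    proof -
      have "y \<in> ?G" using that T(1) by blast
      from r(3)[OF this] obtain V where V: "cball y (r y) \<subseteq> V" "w \<in> null_nets V" by (elim exE conjE)
      show ?thesis by (rule null_bound[OF V(2) compact_cball V(1), of N]) (intro exI conjI)
    qed
    then have "\<forall>y\<in>T. \<exists>C\<ge>0. \<forall>\<^sub>0\<epsilon>. \<forall>z\<in>cball y (r y). norm (w \<epsilon> z) \<le> C * \<epsilon> ^ N"
      by (rule ballI)
    from bchoice[OF this] obtain C where "\<forall>y\<in>T. 0 \<le> C y \<and> (\<forall>\<^sub>0\<epsilon>. \<forall>z\<in>cball y (r y). norm (w \<epsilon> z) \<le> C y * \<epsilon> ^ N)"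
      by (elim exE)
    then have C: "\<And>y. y \<in> T \<Longrightarrow> 0 \<le> C y"
       "\<And>y. y \<in> T \<Longrightarrow> \<forall>\<^sub>0\<epsilon>. \<forall>z\<in>cball y (r y). norm (w \<epsilon> z) \<le> C y * \<epsilon> ^ N" by simp_all
    have "\<forall>\<^sub>0\<epsilon>. \<forall>y\<in>T. \<forall>z\<in>cball y (r y). norm (w \<epsilon> z) \<le> C y * \<epsilon> ^ N"
      using C(2) by (intro eventually_ball_finite[OF T(2)] ballI)
    then have "\<forall>\<^sub>0\<epsilon>. \<forall>z\<in>K'. norm (\<phi> z * complex_of_real (k \<epsilon>) - \<phi> z * u \<epsilon> (f \<epsilon> z)) \<le> (b * sum C T) * \<epsilon> ^ N"
      using X(4) eventually_in_unit
    proof eventually_elim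
      case (elim \<epsilon>)
      have CT: "0 \<le> sum C T" using C(1) by (rule sum_nonneg)
      show ?case
      proof
        fix z
        show "norm (\<phi> z * complex_of_real (k \<epsilon>) - \<phi> z * u \<epsilon> (f \<epsilon> z)) \<le> (b * sum C T) * \<epsilon> ^ N"
        proof (cases "z \<in> K")
          case True
          then obtain y where y: "y \<in> T" "f \<epsilon> z \<in> ball y (r y)" using elim(2) \<phi>(3) by blast
          have "norm (\<phi> z * complex_of_real (k \<epsilon>) - \<phi> z * u \<epsilon> (f \<epsilon> z)) = norm (\<phi> z) * norm (w \<epsilon> (f \<epsilon> z))"
            by (simp add: w_def norm_minus_commute flip: norm_mult right_diff_distrib)
          also have "\<dots> \<le> b * (C y * \<epsilon> ^ N)"
            using elim(1) y by (intro mult_mono b) auto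
          also have "\<dots> \<le> b * (sum C T * \<epsilon> ^ N)"
            using b(2) elim(3) C(1) by (intro mult_left_mono mult_right_mono member_le_sum[OF y(1) _ T(2)]) auto
          finally show ?thesis by (simp add: mult.assoc)
        next
          case False
          then show ?thesis using \<phi>(4) b(2) CT elim(3) by simp
        qed
      qed
    qed
    then show "\<exists>C\<ge>0. \<forall>\<^sub>0\<epsilon>. \<forall>z\<in>K'. norm (\<phi> z * complex_of_real (k \<epsilon>) - \<phi> z * u \<epsilon> (f \<epsilon> z)) \<le> C * \<epsilon> ^ N"
      using b(2) C(1) by (intro exI[of _ "b * sum C T"] conjI mult_nonneg_nonneg sum_nonneg)
  qed
  obtain wk Ck Nk where wk: "\<forall>\<^sub>0\<epsilon>. \<bar>k \<epsilon>\<bar> \<le> wk \<epsilon>" "0 \<le> Ck" "\<forall>\<^sub>0\<epsilon>. wk \<epsilon> \<le> Ck * inverse \<epsilon> ^ Nk"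
    using kn(2) moderate_weightsE by metis
  have rk: "rapid (sphere 0 1) (\<lambda>\<epsilon>. fourier (extend_zero \<Omega>1 (\<lambda>z. \<phi> z * complex_of_real (k \<epsilon>))))"
  proof (rule rapidI[where N=Nk])
    fix p :: nat
    have "\<exists>c\<in>const_weights. \<forall>\<^sub>F \<zeta> in principal UNIV. (1 + norm \<zeta>) ^ p *
        norm (LINT z:UNIV|lborel. \<phi> z * exp (- (\<i> * complex_of_real (z \<bullet> \<zeta>)))) \<le> c \<zeta>"
      by (rule decay_one_plus[OF weights_const_weights fourier_decay[OF weights_const_weights open_UNIV \<phi>(2) subset_UNIV
          symbol_test_function[OF weights_const_weights \<phi>(1,2,4)]]]) (use \<phi>(4) in auto)
    then obtain c where c: "0 \<le> c" "\<And>\<zeta>. (1 + norm \<zeta>) ^ p * norm (fourier \<phi> \<zeta>) \<le> c"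
      unfolding const_weights_def by (auto simp: eventually_principal fourier_def set_lebesgue_integral_def)
    have eq: "fourier (extend_zero \<Omega>1 (\<lambda>z. \<phi> z * complex_of_real (k \<epsilon>))) \<zeta> = complex_of_real (k \<epsilon>) * fourier \<phi> \<zeta>" for \<epsilon> \<zeta>
      unfolding fourier_def integral_mult_right_zero[symmetric]
      by (rule Bochner_Integration.integral_cong[OF refl]) (use \<phi>(4) K1 in \<open>auto simp: extend_zero_def\<close>)
    have "\<forall>\<^sub>0\<epsilon>. \<forall>t>0. \<forall>\<xi>\<in>sphere 0 1. (1 + t) ^ p *
        norm (fourier (extend_zero \<Omega>1 (\<lambda>z. \<phi> z * complex_of_real (k \<epsilon>))) (t *\<^sub>R \<xi>)) \<le> (Ck * c) * inverse \<epsilon> ^ Nk"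
      using wk(1,3) eventually_in_unit
    proof eventually_elim
      case (elim \<epsilon>)
      show ?case
      proof (intro allI impI ballI)
        fix t :: real and \<xi> :: "real^'n" assume t: "0 < t" "\<xi> \<in> sphere 0 1"
        have "(1 + t) ^ p * norm (fourier \<phi> (t *\<^sub>R \<xi>)) \<le> c" using c(2)[of "t *\<^sub>R \<xi>"] t by simp
        then have "\<bar>k \<epsilon>\<bar> * ((1 + t) ^ p * norm (fourier \<phi> (t *\<^sub>R \<xi>))) \<le> (Ck * inverse \<epsilon> ^ Nk) * c"
          using elim wk(2) t by (intro mult_mono) auto
        then show "(1 + t) ^ p * norm (fourier (extend_zero \<Omega>1 (\<lambda>z. \<phi> z * complex_of_real (k \<epsilon>))) (t *\<^sub>R \<xi>)) \<le> (Ck * c) * inverse \<epsilon> ^ Nk"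
          unfolding eq norm_mult norm_of_real by (simp only: mult_ac)
      qed
    qed
    then show "rapid_bound Nk p (sphere 0 1) (\<lambda>\<epsilon>. fourier (extend_zero \<Omega>1 (\<lambda>z. \<phi> z * complex_of_real (k \<epsilon>))))"
      unfolding rapid_bound_def by blast
  qed
  have "rapid (sphere 0 1) (\<lambda>\<epsilon>. fourier (extend_zero \<Omega>1 (\<lambda>z. \<phi> z * u \<epsilon> (f \<epsilon> z))))"
    by (rule rapid_representative[OF \<Omega>1(1) pk pf \<phi>(2) K1 _ _ null subset_refl rk]) (use \<phi>(4) in auto)
  moreover have "gpullback \<Omega>1 f u \<in> colombeau \<Omega>1" "(\<lambda>\<epsilon> z. u \<epsilon> (f \<epsilon> z)) \<in> gpullback \<Omega>1 f u"
    unfolding gpullback_def using uf by (rule gclass_colombeau, rule gclass_self)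
  ultimately show ?thesis
    using not_WF_I[OF \<Omega>1(1) _ _ \<phi>t \<phi>(5) openin_subtopology_self \<xi>, of "gpullback \<Omega>1 f u" "\<lambda>\<epsilon> z. u \<epsilon> (f \<epsilon> z)"] by blast
qed

theorem theorem5p2p5:
  fixes \<Omega>1 :: "(real^'n::finite) set" and \<Omega>2 :: "(real^'m::finite) set"
    and F :: "(real \<Rightarrow> real^'n \<Rightarrow> real^'m) set" and f :: "real \<Rightarrow> real^'n \<Rightarrow> real^'m"
    and U :: "(real \<Rightarrow> real^'m \<Rightarrow> complex) set" and u :: "real \<Rightarrow> real^'m \<Rightarrow> complex"
  assumes "open \<Omega>1" and "open \<Omega>2"
    and "F \<in> cbounded_maps \<Omega>1 \<Omega>2" and "f \<in> F" and "cbounded_rep \<Omega>1 \<Omega>2 f"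
    and "U \<in> colombeau \<Omega>2" and "u \<in> U"
  shows "gpullback \<Omega>1 f u \<in> colombeau \<Omega>1 \<and>
    WF \<Omega>1 (gpullback \<Omega>1 f u) \<subseteq>
      wf_pullback \<Omega>1 \<Omega>2 f (WF \<Omega>2 U)
      \<union> unfavorable_support \<Omega>1 \<Omega>2 f (WF \<Omega>2 U) \<times> sphere 0 1
      \<union> (K_set \<Omega>1 \<Omega>2 f U \<inter> (\<Omega>1 - slow_scaled_points \<Omega>1 f)) \<times> sphere 0 1"
proof
  have f: "f \<in> moderate_nets \<Omega>1"
    using assms(3,4) colombeau_moderate unfolding cbounded_maps_def by blast
  show "gpullback \<Omega>1 f u \<in> colombeau \<Omega>1"
    unfolding gpullback_def
    by (rule gclass_colombeau[OF moderate_compose[OF assms(1) colombeau_moderate[OF assms(6,7)] f assms(5)]])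
  show "WF \<Omega>1 (gpullback \<Omega>1 f u) \<subseteq>
      wf_pullback \<Omega>1 \<Omega>2 f (WF \<Omega>2 U)
      \<union> unfavorable_support \<Omega>1 \<Omega>2 f (WF \<Omega>2 U) \<times> sphere 0 1
      \<union> (K_set \<Omega>1 \<Omega>2 f U \<inter> (\<Omega>1 - slow_scaled_points \<Omega>1 f)) \<times> sphere 0 1" (is "_ \<subseteq> ?A \<union> ?B \<union> ?C")
  proof (rule subsetI, rule ccontr)
    fix p assume p: "p \<in> WF \<Omega>1 (gpullback \<Omega>1 f u)" "p \<notin> ?A \<union> ?B \<union> ?C"
    obtain x \<xi> where "p = (x, \<xi>)" by (rule prod.exhaust)
    with p have W: "(x, \<xi>) \<in> WF \<Omega>1 (gpullback \<Omega>1 f u)"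
      and A: "(x, \<xi>) \<notin> ?A" and B: "(x, \<xi>) \<notin> ?B" and C: "(x, \<xi>) \<notin> ?C"
      by simp_all
    have x: "x \<in> \<Omega>1" and \<xi>: "\<xi> \<in> sphere 0 1" using W unfolding WF_def by auto
    have K: "x \<in> K_set \<Omega>1 \<Omega>2 f U"
      using W pullback_regular_const[OF assms(1) x assms(2) f assms(5-7) _ \<xi>] by blast
    then have slow: "x \<in> slow_scaled_points \<Omega>1 f" using C x \<xi> by blast
    have A': "\<xi> \<notin> wf_pullback_at \<Omega>1 \<Omega>2 f (WF \<Omega>2 U) x" using A x unfolding wf_pullback_def by blast
    \<comment> \<open>For empty \<open>D\<^sup>f\<close> the pullback of the wave front set contains every direction.\<close>
    then have D: "D_set \<Omega>1 f \<noteq> {}" using \<xi> unfolding wf_pullback_at_def by auto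
    have good: "(x, \<eta>) \<in> D_set \<Omega>1 f \<and> \<xi> \<notin> M_graph_at \<Omega>1 f x \<eta>"
      if "(x, y) \<in> ggraph \<Omega>1 \<Omega>2 f" "(y, \<eta>) \<in> WF \<Omega>2 U" for y \<eta>
    proof
      show "(x, \<eta>) \<in> D_set \<Omega>1 f"
      proof (rule ccontr)
        assume "(x, \<eta>) \<notin> D_set \<Omega>1 f"
        then have "x \<in> unfavorable_support \<Omega>1 \<Omega>2 f (WF \<Omega>2 U)"
          unfolding unfavorable_support_def using that x by blast
        then show False using B \<xi> by blast
      qed
      have "\<eta> \<in> (\<Union>y\<in>ggraph \<Omega>1 \<Omega>2 f `` {x}. WF \<Omega>2 U `` {y})" using that by blast
      then show "\<xi> \<notin> M_graph_at \<Omega>1 f x \<eta>" using A' D unfolding wf_pullback_at_def by auto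
    qed
    have "(x, \<xi>) \<notin> WF \<Omega>1 (gpullback \<Omega>1 f u)"
      by (rule pullback_regular_slow[OF assms(1) x assms(2) f assms(5-7) slow \<xi>]) (rule good)
    then show False using W by simp
  qed
qed

end
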